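(* Let $R$ be a ring with unit, let $n \geq 1$, and let $R_n = R[x_1, x_1^{-1}, \ldots, x_n, x_n^{-1}]$ be the Laurent polynomial ring in $n$ indeterminates, with $R_0 = R$ and $R_k = R_{k-1}[x_k, x_k^{-1}]$. Let $C$ be a bounded below chain complex of projective (right) $R_n$-modules, not necessarily finitely generated. The following four conditions are equivalent: (a) $C$ is $R$-finitely dominated. (b) $C$ is $R$-finitely dominated, and for every one of the $n!$ re-numberings of the variables $x_1, \ldots, x_n$ (with $R_j$ then denoting the Laurent polynomial ring over $R$ in the first $j$ variables of the re-numbering), $C$ is homotopy $R_j$-finite for $j = 1, 2, \ldots, n$. (c) $C$ is $R_n$-finitely dominated, and for every one of the $n!$ re-numberings of the variables $x_1, \ldots, x_n$ the chain complexes \[ C \otimes_{R_j} R_{j-1}((x_j)) \quad \text{and} \quad C \otimes_{R_j} R_{j-1}((x_j^{-1})), \qquad 1 \leq j \leq n, \] are acyclic. (d) $C$ is $R_n$-finitely dominated, and for some re-numbering of the variables $x_1, \ldots, x_n$ the chain complexes \[ C \otimes_{R_j} R_{j-1}((x_j)) \quad \text{and} \quad C \otimes_{R_j} R_{j-1}((x_j^{-1})), \qquad 1 \leq j \leq n, \] are acyclic.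
   Context: All modules are right modules; chain complexes of $A$-modules over a unital ring $A$. If $S$ is a subring of $A$, every chain complex of $A$-modules is by restriction a chain complex of $S$-modules, and "homotopy equivalent over $S$" means $S$-linear chain homotopy equivalence. A complex $C$ of $A$-modules is called: $S$-finite if it is bounded and consists of finitely generated free $S$-modules; homotopy $S$-finite if it is homotopy equivalent (over $S$) to an $S$-finite complex; strict $S$-perfect if it is bounded and consists of finitely generated projective $S$-modules; $S$-finitely dominated if it is homotopy equivalent (over $S$) to a strict $S$-perfect complex of $S$-modules. For a ring $K$ and indeterminate $x$, $K((x)) = K[[x]][x^{-1}]$ is the ring of formal Laurent series $\sum_{j \geq k} a_j x^j$ ($k \in \mathbb{Z}$), and $K((x^{-1})) = K[[x^{-1}]][x]$ is the ring of formal Laurent series $\sum_{j \leq k} a_j x^j$; these are $K[x,x^{-1}]$-modules via the natural inclusions, so with $K = R_{j-1}$ they are $R_j$-modules. A complex is acyclic if all its homology modules vanish. *)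

theory Defs
  imports Main "HOL-Library.Poly_Mapping" "HOL-Library.Function_Algebras"
begin

text \<open>Laurent polynomials over a unital ring 'r in the variables x_i (i :: nat):
  finitely supported maps from exponent vectors (nat to int, finitely supported) to 'r.
  The variables are central, multiplication is convolution.\<close>
type_synonym 'r laurent = "(nat \<Rightarrow>\<^sub>0 int) \<Rightarrow>\<^sub>0 'r"

type_synonym 'r series = "(nat \<Rightarrow>\<^sub>0 int) \<Rightarrow> 'r"

text \<open>The Laurent polynomial ring over R in the variables x_v, v in V (a subring of 'r laurent).
  laurent_ring {} is (the copy of) R itself, laurent_ring {1..j} is R_j.\<close>
definition laurent_ring :: "nat set \<Rightarrow> ('r::ring_1) laurent set" where
  "laurent_ring V = {p::('r::ring_1) laurent. \<forall>e \<in> Poly_Mapping.keys p. Poly_Mapping.keys e \<subseteq> V}"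

text \<open>K((x_v)) with K = laurent_ring V (v not in V): series in x_v bounded below in x_v,
  each x_v-coefficient being a Laurent polynomial in the variables of V.\<close>
definition novikov_pos :: "nat set \<Rightarrow> nat \<Rightarrow> ('r::ring_1) series set" where
  "novikov_pos V v = {f. (\<forall>e. f e \<noteq> 0 \<longrightarrow> Poly_Mapping.keys e \<subseteq> insert v V)
      \<and> (\<exists>m. \<forall>e. f e \<noteq> 0 \<longrightarrow> m \<le> Poly_Mapping.lookup e v)
      \<and> (\<forall>t. finite {e. f e \<noteq> 0 \<and> Poly_Mapping.lookup e v = t})}"

definition novikov_neg :: "nat set \<Rightarrow> nat \<Rightarrow> ('r::ring_1) series set" where
  "novikov_neg V v = {f. (\<forall>e. f e \<noteq> 0 \<longrightarrow> Poly_Mapping.keys e \<subseteq> insert v V)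
      \<and> (\<exists>m. \<forall>e. f e \<noteq> 0 \<longrightarrow> Poly_Mapping.lookup e v \<le> m)
      \<and> (\<forall>t. finite {e. f e \<noteq> 0 \<and> Poly_Mapping.lookup e v = t})}"

definition series_lmult :: "('r::ring_1) laurent \<Rightarrow> 'r series \<Rightarrow> 'r series" where
  "series_lmult p f = (\<lambda>e. \<Sum>k\<in>Poly_Mapping.keys p. Poly_Mapping.lookup p k * f (e - k))"

section \<open>Right modules over a subring S of a ring 'a, living in an abelian group type 'm\<close>

definition right_module :: "('a::ring_1) set \<Rightarrow> ('m::ab_group_add) set \<Rightarrow> ('m \<Rightarrow> 'a \<Rightarrow> 'm) \<Rightarrow> bool" where
  "right_module S M act \<longleftrightarrow>
     0 \<in> M \<and> (\<forall>x\<in>M. \<forall>y\<in>M. x + y \<in> M) \<and> (\<forall>x\<in>M. - x \<in> M)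
     \<and> (\<forall>x\<in>M. \<forall>a\<in>S. act x a \<in> M)
     \<and> (\<forall>x\<in>M. \<forall>y\<in>M. \<forall>a\<in>S. act (x + y) a = act x a + act y a)
     \<and> (\<forall>x\<in>M. \<forall>a\<in>S. \<forall>b\<in>S. act x (a + b) = act x a + act x b)
     \<and> (\<forall>x\<in>M. \<forall>a\<in>S. \<forall>b\<in>S. act x (a * b) = act (act x a) b)
     \<and> (\<forall>x\<in>M. act x 1 = x)"

definition linear_map :: "('a::ring_1) set \<Rightarrow> ('m::ab_group_add) set \<Rightarrow> ('m \<Rightarrow> 'a \<Rightarrow> 'm)
    \<Rightarrow> ('n::ab_group_add) set \<Rightarrow> ('n \<Rightarrow> 'a \<Rightarrow> 'n) \<Rightarrow> ('m \<Rightarrow> 'n) \<Rightarrow> bool" where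
  "linear_map S M act N act' f \<longleftrightarrow>
     (\<forall>x\<in>M. f x \<in> N) \<and> (\<forall>x\<in>M. \<forall>y\<in>M. f (x + y) = f x + f y)
     \<and> (\<forall>x\<in>M. \<forall>a\<in>S. f (act x a) = act' (f x) a)"

definition fin_generated :: "('a::ring_1) set \<Rightarrow> ('m::ab_group_add) set \<Rightarrow> ('m \<Rightarrow> 'a \<Rightarrow> 'm) \<Rightarrow> bool" where
  "fin_generated S M act \<longleftrightarrow>
     (\<exists>G. finite G \<and> G \<subseteq> M \<and>
        (\<forall>x\<in>M. \<exists>c. (\<forall>g\<in>G. c g \<in> S) \<and> x = (\<Sum>g\<in>G. act g (c g))))"

definition fg_free :: "('a::ring_1) set \<Rightarrow> ('m::ab_group_add) set \<Rightarrow> ('m \<Rightarrow> 'a \<Rightarrow> 'm) \<Rightarrow> bool" where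
  "fg_free S M act \<longleftrightarrow>
     (\<exists>B. finite B \<and> B \<subseteq> M \<and>
        (\<forall>x\<in>M. \<exists>c. (\<forall>b\<in>B. c b \<in> S) \<and> x = (\<Sum>b\<in>B. act b (c b)))
      \<and> (\<forall>c. (\<forall>b\<in>B. c b \<in> S) \<and> (\<Sum>b\<in>B. act b (c b)) = 0 \<longrightarrow> (\<forall>b\<in>B. c b = 0)))"

definition free_mod :: "('a::ring_1) set \<Rightarrow> 'i set \<Rightarrow> ('i \<Rightarrow> 'a) set" where
  "free_mod S I = {\<phi>. {i. \<phi> i \<noteq> 0} \<subseteq> I \<and> finite {i. \<phi> i \<noteq> 0} \<and> (\<forall>i. \<phi> i \<in> S)}"

definition free_act :: "('i \<Rightarrow> 'a::ring_1) \<Rightarrow> 'a \<Rightarrow> ('i \<Rightarrow> 'a)" where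
  "free_act \<phi> a = (\<lambda>i. \<phi> i * a)"

definition projective_module :: "('a::ring_1) set \<Rightarrow> ('m::ab_group_add) set \<Rightarrow> ('m \<Rightarrow> 'a \<Rightarrow> 'm) \<Rightarrow> bool" where
  "projective_module S P act \<longleftrightarrow> right_module S P act \<and>
     (\<exists>(I::'m set) (i::'m \<Rightarrow> ('m \<Rightarrow> 'a)) p.
        linear_map S P act (free_mod S I) free_act i
      \<and> linear_map S (free_mod S I) free_act P act p
      \<and> (\<forall>x\<in>P. p (i x) = x))"

definition chain_complex :: "('a::ring_1) set \<Rightarrow> (int \<Rightarrow> ('m::ab_group_add) set) \<Rightarrow> (int \<Rightarrow> 'm \<Rightarrow> 'm)
    \<Rightarrow> ('m \<Rightarrow> 'a \<Rightarrow> 'm) \<Rightarrow> bool" where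
  "chain_complex S C d act \<longleftrightarrow>
     (\<forall>k. right_module S (C k) act)
   \<and> (\<forall>k. linear_map S (C k) act (C (k - 1)) act (d k))
   \<and> (\<forall>k. \<forall>x\<in>C k. d (k - 1) (d k x) = 0)"

definition bounded_below :: "(int \<Rightarrow> ('m::zero) set) \<Rightarrow> bool" where
  "bounded_below C \<longleftrightarrow> (\<exists>N. \<forall>k. k < N \<longrightarrow> C k = {0})"

definition bounded_complex :: "(int \<Rightarrow> ('m::zero) set) \<Rightarrow> bool" where
  "bounded_complex C \<longleftrightarrow> (\<exists>N. \<forall>k. N < \<bar>k\<bar> \<longrightarrow> C k = {0})"

definition chain_map :: "('a::ring_1) set \<Rightarrow> (int \<Rightarrow> ('m::ab_group_add) set) \<Rightarrow> (int \<Rightarrow> 'm \<Rightarrow> 'm)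
    \<Rightarrow> ('m \<Rightarrow> 'a \<Rightarrow> 'm) \<Rightarrow> (int \<Rightarrow> ('n::ab_group_add) set) \<Rightarrow> (int \<Rightarrow> 'n \<Rightarrow> 'n) \<Rightarrow> ('n \<Rightarrow> 'a \<Rightarrow> 'n)
    \<Rightarrow> (int \<Rightarrow> 'm \<Rightarrow> 'n) \<Rightarrow> bool" where
  "chain_map S C d act D e act' f \<longleftrightarrow>
     (\<forall>k. linear_map S (C k) act (D k) act' (f k))
   \<and> (\<forall>k. \<forall>x\<in>C k. e k (f k x) = f (k - 1) (d k x))"

definition chain_homotopic :: "('a::ring_1) set \<Rightarrow> (int \<Rightarrow> ('m::ab_group_add) set) \<Rightarrow> (int \<Rightarrow> 'm \<Rightarrow> 'm)
    \<Rightarrow> ('m \<Rightarrow> 'a \<Rightarrow> 'm) \<Rightarrow> (int \<Rightarrow> ('n::ab_group_add) set) \<Rightarrow> (int \<Rightarrow> 'n \<Rightarrow> 'n) \<Rightarrow> ('n \<Rightarrow> 'a \<Rightarrow> 'n)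
    \<Rightarrow> (int \<Rightarrow> 'm \<Rightarrow> 'n) \<Rightarrow> (int \<Rightarrow> 'm \<Rightarrow> 'n) \<Rightarrow> bool" where
  "chain_homotopic S C d act D e act' f g \<longleftrightarrow>
     (\<exists>h. (\<forall>k. linear_map S (C k) act (D (k + 1)) act' (h k))
        \<and> (\<forall>k. \<forall>x\<in>C k. f k x - g k x = e (k + 1) (h k x) + h (k - 1) (d k x)))"

definition homotopy_equiv :: "('a::ring_1) set \<Rightarrow> (int \<Rightarrow> ('m::ab_group_add) set) \<Rightarrow> (int \<Rightarrow> 'm \<Rightarrow> 'm)
    \<Rightarrow> ('m \<Rightarrow> 'a \<Rightarrow> 'm) \<Rightarrow> (int \<Rightarrow> ('n::ab_group_add) set) \<Rightarrow> (int \<Rightarrow> 'n \<Rightarrow> 'n) \<Rightarrow> ('n \<Rightarrow> 'a \<Rightarrow> 'n)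
    \<Rightarrow> bool" where
  "homotopy_equiv S C d act D e act' \<longleftrightarrow>
     (\<exists>f g. chain_map S C d act D e act' f \<and> chain_map S D e act' C d act g
        \<and> chain_homotopic S C d act C d act (\<lambda>k x. g k (f k x)) (\<lambda>k x. x)
        \<and> chain_homotopic S D e act' D e act' (\<lambda>k y. f k (g k y)) (\<lambda>k y. y))"

text \<open>S-finitely dominated: S-homotopy equivalent to a strict S-perfect complex of S-modules.
  The witness complex is taken in the carrier type nat \<Rightarrow> 'a, which is large enough to hold
  (an isomorphic copy of) every bounded complex of finitely generated S-modules.\<close>
definition fin_dominated :: "('a::ring_1) set \<Rightarrow> (int \<Rightarrow> ('m::ab_group_add) set) \<Rightarrow> (int \<Rightarrow> 'm \<Rightarrow> 'm)
    \<Rightarrow> ('m \<Rightarrow> 'a \<Rightarrow> 'm) \<Rightarrow> bool" where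
  "fin_dominated S C d act \<longleftrightarrow>
     (\<exists>(D :: int \<Rightarrow> (nat \<Rightarrow> 'a) set) e act'.
        chain_complex S D e act' \<and> bounded_complex D
      \<and> (\<forall>k. fin_generated S (D k) act' \<and> projective_module S (D k) act')
      \<and> homotopy_equiv S C d act D e act')"

definition homotopy_finite :: "('a::ring_1) set \<Rightarrow> (int \<Rightarrow> ('m::ab_group_add) set) \<Rightarrow> (int \<Rightarrow> 'm \<Rightarrow> 'm)
    \<Rightarrow> ('m \<Rightarrow> 'a \<Rightarrow> 'm) \<Rightarrow> bool" where
  "homotopy_finite S C d act \<longleftrightarrow>
     (\<exists>(D :: int \<Rightarrow> (nat \<Rightarrow> 'a) set) e act'.
        chain_complex S D e act' \<and> bounded_complex D
      \<and> (\<forall>k. right_module S (D k) act' \<and> fg_free S (D k) act')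
      \<and> homotopy_equiv S C d act D e act')"

text \<open>For a right S-module M (action act) and a left S-module N (action lact), M \<otimes>_S N is the
  free abelian group on M \<times> N modulo the subgroup tensor_rel of bilinearity and balancing
  relations.\<close>
definition gen :: "'m \<times> 'n \<Rightarrow> ('m \<times> 'n) \<Rightarrow>\<^sub>0 int" where
  "gen p = Poly_Mapping.single p 1"

inductive_set tensor_rel :: "('a::ring_1) set \<Rightarrow> ('m::ab_group_add) set \<Rightarrow> ('m \<Rightarrow> 'a \<Rightarrow> 'm)
    \<Rightarrow> ('n::ab_group_add) set \<Rightarrow> ('a \<Rightarrow> 'n \<Rightarrow> 'n) \<Rightarrow> (('m \<times> 'n) \<Rightarrow>\<^sub>0 int) set"
  for S M act N lact where
  zero: "0 \<in> tensor_rel S M act N lact"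
| add: "\<Phi> \<in> tensor_rel S M act N lact \<Longrightarrow> \<Psi> \<in> tensor_rel S M act N lact
          \<Longrightarrow> \<Phi> + \<Psi> \<in> tensor_rel S M act N lact"
| neg: "\<Phi> \<in> tensor_rel S M act N lact \<Longrightarrow> - \<Phi> \<in> tensor_rel S M act N lact"
| addl: "x \<in> M \<Longrightarrow> x' \<in> M \<Longrightarrow> y \<in> N
          \<Longrightarrow> gen (x + x', y) - gen (x, y) - gen (x', y) \<in> tensor_rel S M act N lact"
| addr: "x \<in> M \<Longrightarrow> y \<in> N \<Longrightarrow> y' \<in> N
          \<Longrightarrow> gen (x, y + y') - gen (x, y) - gen (x, y') \<in> tensor_rel S M act N lact"
| bal: "x \<in> M \<Longrightarrow> y \<in> N \<Longrightarrow> a \<in> S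
          \<Longrightarrow> gen (act x a, y) - gen (x, lact a y) \<in> tensor_rel S M act N lact"

definition free_ab :: "'m set \<Rightarrow> 'n set \<Rightarrow> (('m \<times> 'n) \<Rightarrow>\<^sub>0 int) set" where
  "free_ab M N = {\<Phi>. Poly_Mapping.keys \<Phi> \<subseteq> M \<times> N}"

definition tensor_map :: "('m \<Rightarrow> 'm) \<Rightarrow> (('m \<times> 'n) \<Rightarrow>\<^sub>0 int) \<Rightarrow> (('m \<times> 'n) \<Rightarrow>\<^sub>0 int)" where
  "tensor_map f \<Phi> = (\<Sum>p\<in>Poly_Mapping.keys \<Phi>. Poly_Mapping.single (f (fst p), snd p) (Poly_Mapping.lookup \<Phi> p))"

definition tensor_acyclic :: "('a::ring_1) set \<Rightarrow> (int \<Rightarrow> ('m::ab_group_add) set) \<Rightarrow> (int \<Rightarrow> 'm \<Rightarrow> 'm)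
    \<Rightarrow> ('m \<Rightarrow> 'a \<Rightarrow> 'm) \<Rightarrow> ('n::ab_group_add) set \<Rightarrow> ('a \<Rightarrow> 'n \<Rightarrow> 'n) \<Rightarrow> bool" where
  "tensor_acyclic S C d act N lact \<longleftrightarrow>
     (\<forall>k. \<forall>\<Phi>\<in>free_ab (C k) N.
        tensor_map (d k) \<Phi> \<in> tensor_rel S (C (k - 1)) act N lact \<longrightarrow>
        (\<exists>\<Psi>\<in>free_ab (C (k + 1)) N.
           \<Phi> - tensor_map (d (k + 1)) \<Psi> \<in> tensor_rel S (C k) act N lact))"

end

theory Submission
  imports Defs "HOL-Library.Product_Plus" "HOL-Library.Nat_Bijection"
begin

text \<open>One variable is treated at a time: let \<open>L = K[x, x\<^sup>-\<^sup>1]\<close> and let \<open>C\<close> be a bounded below complex of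
  projective \<open>L\<close>-modules.

  If \<open>C\<close> is \<open>L\<close>-finitely dominated, it is the image, up to homotopy, of an idempotent \<open>q\<close> on a finite
  free \<open>L\<close>-complex \<open>F\<close>.  Acyclicity over \<open>K((x))\<close> and over \<open>K((x\<^sup>-\<^sup>1))\<close> gives \<open>K\<close>-linear null homotopies
  of \<open>q\<close> as a map into the two completions of \<open>F\<close>.  Keeping the negative powers of \<open>x\<close> of the first and the
  nonnegative powers of the second, both finite in number, and adding the results yields a homotopy \<open>h\<close> on \<open>F\<close> itself.
  Truncation commutes with the differential up to terms of bounded degree, so \<open>q\<close> is homotopic to a map
  into a subcomplex of \<open>F\<close> of bounded degree in \<open>x\<close>, which is finite free over \<open>K\<close>; hence \<open>C\<close> is
  dominated over \<open>K\<close>.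

  Conversely, let \<open>C\<close> be, up to \<open>K\<close>-homotopy, the image of an idempotent \<open>q\<close> on a finite free
  \<open>K\<close>-complex \<open>F\<close>.  Multiplication by \<open>x\<close> on \<open>C\<close> becomes a chain map \<open>U\<close> of \<open>F\<close>, and the mapping cone of
  \<open>xq - U + (1 - q)\<close> on \<open>F \<otimes>\<^sub>K L\<close> is a finite free \<open>L\<close>-complex homotopy equivalent to \<open>C\<close> (the mapping
  torus of \<open>U\<close>).  Over \<open>K((x))\<close> this map is a quasi-isomorphism because \<open>U\<close> is invertible up to homotopy
  on the image of \<open>q\<close>; exchanging \<open>x\<close> and \<open>x\<^sup>-\<^sup>1\<close> settles \<open>K((x\<^sup>-\<^sup>1))\<close>.\<close>

section \<open>Modules and linear maps\<close>

text \<open>The rings are sets of scalars inside one type, so \<open>C\<close> stays fixed while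
  variables are added or removed, and it remains projective because each larger Laurent ring is free
  over the smaller ones. Condition (a) knows nothing of the order of the variables: climbing from it
  along every renumbering gives (b) and (c), and descending along a single one gives (a) from (d).
  Truncation of series is linear over \<open>K\<close> but not over \<open>L\<close>. Hence the null
  homotopies are used as \<open>K\<close>-linear maps, and the defect is a commutator of truncation
  with the matrix of the differential, confined to bounded degrees. The descent produces only a
  homotopy retract of a finite free complex, while finite domination asks for an equivalence with a
  perfect complex; closing this gap is a separate algebraic construction. In the ascent the image of
  \<open>q\<close> is only projective over \<open>K\<close>. On the complementary image of
  \<open>1 - q\<close> the map of the cone is the identity, so this part of the cone is contractible
  and the torus of the projective part acquires finite free modules, as in Mather's trick. This is
  why homotopy finiteness, and not just finite domination, holds over \<open>L\<close>.\<close>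

definition subring :: "('a::ring_1) set \<Rightarrow> bool" where
  "subring S \<longleftrightarrow> 0 \<in> S \<and> 1 \<in> S \<and> (\<forall>a\<in>S. \<forall>b\<in>S. a + b \<in> S \<and> a * b \<in> S) \<and> (\<forall>a\<in>S. - a \<in> S)"

lemma subringD:
  assumes "subring S"
  shows subring_0: "0 \<in> S" and subring_1: "1 \<in> S"
    and subring_add: "a \<in> S \<Longrightarrow> b \<in> S \<Longrightarrow> a + b \<in> S"
    and subring_mult: "a \<in> S \<Longrightarrow> b \<in> S \<Longrightarrow> a * b \<in> S"
    and subring_uminus: "a \<in> S \<Longrightarrow> - a \<in> S"
    and subring_diff: "a \<in> S \<Longrightarrow> b \<in> S \<Longrightarrow> a - b \<in> S"
  using assms unfolding subring_def by (auto simp: diff_conv_add_uminus simp del: add_uminus_conv_diff)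

lemma subring_sum: "subring S \<Longrightarrow> (\<And>i. i \<in> A \<Longrightarrow> f i \<in> S) \<Longrightarrow> sum f A \<in> S"
  by (induction A rule: infinite_finite_induct) (auto intro: subring_0 subring_add)

lemma right_moduleD:
  assumes "right_module S M act"
  shows module_0: "0 \<in> M"
    and module_add: "x \<in> M \<Longrightarrow> y \<in> M \<Longrightarrow> x + y \<in> M"
    and module_uminus: "x \<in> M \<Longrightarrow> - x \<in> M"
    and module_act: "x \<in> M \<Longrightarrow> a \<in> S \<Longrightarrow> act x a \<in> M"
    and act_add: "x \<in> M \<Longrightarrow> y \<in> M \<Longrightarrow> a \<in> S \<Longrightarrow> act (x + y) a = act x a + act y a"
    and act_add_right: "x \<in> M \<Longrightarrow> a \<in> S \<Longrightarrow> b \<in> S \<Longrightarrow> act x (a + b) = act x a + act x b"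
    and act_mult: "x \<in> M \<Longrightarrow> a \<in> S \<Longrightarrow> b \<in> S \<Longrightarrow> act x (a * b) = act (act x a) b"
    and act_1: "x \<in> M \<Longrightarrow> act x 1 = x"
  using assms unfolding right_module_def by auto

lemma module_diff: "right_module S M act \<Longrightarrow> x \<in> M \<Longrightarrow> y \<in> M \<Longrightarrow> x - y \<in> M"
  using module_add[of S M act x "- y"] module_uminus[of S M act y] by simp

lemma module_sum: "right_module S M act \<Longrightarrow> (\<And>i. i \<in> A \<Longrightarrow> f i \<in> M) \<Longrightarrow> sum f A \<in> M"
  by (induction A rule: infinite_finite_induct) (auto intro: module_0 module_add)

lemma act_0: "right_module S M act \<Longrightarrow> a \<in> S \<Longrightarrow> act 0 a = 0"
  using act_add[of S M act 0 0 a] module_0[of S M act] by simp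

lemma act_0_right: "right_module S M act \<Longrightarrow> 0 \<in> S \<Longrightarrow> x \<in> M \<Longrightarrow> act x 0 = 0"
  using act_add_right[of S M act x 0 0] by simp

lemma act_uminus: "right_module S M act \<Longrightarrow> x \<in> M \<Longrightarrow> a \<in> S \<Longrightarrow> act (- x) a = - act x a"
  using act_add[of S M act x "- x" a] act_0[of S M act a] module_uminus[of S M act x]
  by (simp add: eq_neg_iff_add_eq_0 add.commute)

lemma act_diff:
  "right_module S M act \<Longrightarrow> x \<in> M \<Longrightarrow> y \<in> M \<Longrightarrow> a \<in> S \<Longrightarrow> act (x - y) a = act x a - act y a"
  using act_add[of S M act x "- y" a] act_uminus[of S M act y a] module_uminus[of S M act y] by simp

lemma act_sum:
  assumes "right_module S M act" "a \<in> S"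
  shows "(\<And>i. i \<in> A \<Longrightarrow> f i \<in> M) \<Longrightarrow> act (sum f A) a = (\<Sum>i\<in>A. act (f i) a)"
proof (induction A rule: infinite_finite_induct)
  case (insert i A)
  then show ?case
    using assms by (simp add: act_add module_sum)
qed (use assms in \<open>auto simp: act_0\<close>)

lemma act_sum_right:
  assumes "right_module S M act" "subring S" "x \<in> M"
  shows "(\<And>i. i \<in> A \<Longrightarrow> f i \<in> S) \<Longrightarrow> act x (sum f A) = (\<Sum>i\<in>A. act x (f i))"
proof (induction A rule: infinite_finite_induct)
  case (insert i A)
  then show ?case
    using assms by (simp add: act_add_right subring_sum)
qed (use assms in \<open>auto simp: act_0_right subring_0\<close>)

text \<open>Restriction of scalars is literally a smaller scalar set: carrier and action stay the
  same, so one and the same complex serves for every \<open>laurent_ring V\<close>. The analogues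
  for maps, complexes and homotopies are used in the same way.\<close>

lemma right_module_mono: "right_module S M act \<Longrightarrow> S' \<subseteq> S \<Longrightarrow> right_module S' M act"
  unfolding right_module_def by blast

lemma right_module_zero:
  assumes "right_module S M act" "subring S"
  shows "right_module S {0} act"
  using act_0[OF assms(1)] assms(2) unfolding right_module_def by (auto simp: subringD)

lemma linear_mapD:
  assumes "linear_map S M act N act' f"
  shows linear_in: "x \<in> M \<Longrightarrow> f x \<in> N"
    and linear_add: "x \<in> M \<Longrightarrow> y \<in> M \<Longrightarrow> f (x + y) = f x + f y"
    and linear_act: "x \<in> M \<Longrightarrow> a \<in> S \<Longrightarrow> f (act x a) = act' (f x) a"
  using assms unfolding linear_map_def by auto

lemma linear_mapI:
  assumes "\<And>x. x \<in> M \<Longrightarrow> f x \<in> N"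
    and "\<And>x y. x \<in> M \<Longrightarrow> y \<in> M \<Longrightarrow> f (x + y) = f x + f y"
    and "\<And>x a. x \<in> M \<Longrightarrow> a \<in> S \<Longrightarrow> f (act x a) = act' (f x) a"
  shows "linear_map S M act N act' f"
  using assms unfolding linear_map_def by auto

lemma linear_map_mono: "linear_map S M act N act' f \<Longrightarrow> S' \<subseteq> S \<Longrightarrow> linear_map S' M act N act' f"
  unfolding linear_map_def by blast

lemma linear_map_cong:
  assumes "linear_map S M act N act' f" "\<And>x. x \<in> M \<Longrightarrow> f x = g x" "right_module S M act"
  shows "linear_map S M act N act' g"
  using assms(1,2) module_act[OF assms(3)] module_add[OF assms(3)] unfolding linear_map_def by simp

lemma linear_map_codomain:
  "linear_map S M act N act' f \<Longrightarrow> (\<And>x. x \<in> M \<Longrightarrow> f x \<in> N') \<Longrightarrow> linear_map S M act N' act' f"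
  unfolding linear_map_def by blast

lemma linear_map_domain:
  "linear_map S M act N act' f \<Longrightarrow> M' \<subseteq> M \<Longrightarrow> linear_map S M' act N act' f"
  unfolding linear_map_def by blast

lemma linear_0: "linear_map S M act N act' f \<Longrightarrow> 0 \<in> M \<Longrightarrow> f 0 = 0"
  using linear_add[of S M act N act' f 0 0] by simp

lemma linear_uminus:
  "linear_map S M act N act' f \<Longrightarrow> right_module S M act \<Longrightarrow> x \<in> M \<Longrightarrow> f (- x) = - f x"
  using linear_add[of S M act N act' f x "- x"] linear_0[of S M act N act' f]
    module_0[of S M act] module_uminus[of S M act x]
  by (simp add: eq_neg_iff_add_eq_0 add.commute)

lemma linear_diff:
  "linear_map S M act N act' f \<Longrightarrow> right_module S M act \<Longrightarrow> x \<in> M \<Longrightarrow> y \<in> M \<Longrightarrow> f (x - y) = f x - f y"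
  using linear_add[of S M act N act' f x "- y"] linear_uminus[of S M act N act' f y]
    module_uminus[of S M act y] by simp

lemma linear_sum:
  assumes "linear_map S M act N act' f" "right_module S M act"
  shows "(\<And>i. i \<in> A \<Longrightarrow> g i \<in> M) \<Longrightarrow> f (sum g A) = (\<Sum>i\<in>A. f (g i))"
proof (induction A rule: infinite_finite_induct)
  case (insert i A)
  then show ?case
    using assms by (simp add: linear_add[OF assms(1)] module_sum[OF assms(2)])
qed (use assms in \<open>auto simp: linear_0 module_0\<close>)

lemma linear_id: "linear_map S M act M act (\<lambda>x. x)"
  unfolding linear_map_def by auto

lemma linear_comp:
  "linear_map S M act N act' f \<Longrightarrow> linear_map S N act' P act'' g \<Longrightarrow> linear_map S M act P act'' (\<lambda>x. g (f x))"
  unfolding linear_map_def by auto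

lemma linear_zero: "right_module S N act' \<Longrightarrow> linear_map S M act N act' (\<lambda>x. 0)"
  unfolding linear_map_def by (auto simp: act_0 module_0)

lemma linear_plus:
  "linear_map S M act N act' f \<Longrightarrow> linear_map S M act N act' g \<Longrightarrow> right_module S N act'
   \<Longrightarrow> linear_map S M act N act' (\<lambda>x. f x + g x)"
  unfolding linear_map_def by (auto simp: act_add module_add algebra_simps)

lemma linear_neg:
  "linear_map S M act N act' f \<Longrightarrow> right_module S N act' \<Longrightarrow> linear_map S M act N act' (\<lambda>x. - f x)"
  unfolding linear_map_def by (auto simp: act_uminus module_uminus)

lemma linear_minus:
  "linear_map S M act N act' f \<Longrightarrow> linear_map S M act N act' g \<Longrightarrow> right_module S N act'
   \<Longrightarrow> linear_map S M act N act' (\<lambda>x. f x - g x)"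
  using linear_plus[of S M act N act' f "\<lambda>x. - g x"] linear_neg[of S M act N act' g] by simp

lemma linear_sum_maps:
  assumes N: "right_module S N act'"
  shows "(\<And>i. i \<in> A \<Longrightarrow> linear_map S M act N act' (f i)) \<Longrightarrow> linear_map S M act N act' (\<lambda>x. \<Sum>i\<in>A. f i x)"
  by (induction A rule: infinite_finite_induct) (auto simp: N intro!: linear_zero linear_plus)

lemma linear_act_const:
  "right_module S M act \<Longrightarrow> subring S \<Longrightarrow> x \<in> M \<Longrightarrow> linear_map S S (*) M act (\<lambda>a. act x a)"
  unfolding linear_map_def by (auto simp: module_act act_add_right act_mult)

definition pair_act :: "('m \<Rightarrow> 'a \<Rightarrow> 'm) \<Rightarrow> ('n \<Rightarrow> 'a \<Rightarrow> 'n) \<Rightarrow> 'm \<times> 'n \<Rightarrow> 'a \<Rightarrow> 'm \<times> 'n" where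
  "pair_act act act' z a = (act (fst z) a, act' (snd z) a)"

lemma pair_module:
  "right_module S M act \<Longrightarrow> right_module S N act' \<Longrightarrow> right_module S (M \<times> N) (pair_act act act')"
  unfolding right_module_def pair_act_def zero_prod_def by auto

subsection \<open>Modules of finitely supported functions\<close>

definition unit_vec :: "'i \<Rightarrow> 'i \<Rightarrow> 'a::ring_1" where
  "unit_vec j = (\<lambda>i. if i = j then 1 else 0)"

lemma unit_vec_same [simp]: "unit_vec j j = 1"
  by (simp add: unit_vec_def)

lemma unit_vec_other: "i \<noteq> j \<Longrightarrow> unit_vec j i = 0"
  by (simp add: unit_vec_def)

lemma free_mod_module:
  assumes "subring S"
  shows "right_module S (free_mod S J) free_act"
proof -
  have "finite {i. x i + y i \<noteq> 0}" if "finite {i. x i \<noteq> 0}" "finite {i. y i \<noteq> 0}"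
    for x y :: "'b \<Rightarrow> 'a"
    by (rule finite_subset[OF _ finite_UnI[OF that]]) auto
  moreover have "finite {i. x i * a \<noteq> 0}" if "finite {i. x i \<noteq> 0}" for x :: "'b \<Rightarrow> 'a" and a
    by (rule finite_subset[OF _ that]) auto
  ultimately show ?thesis
    unfolding right_module_def free_mod_def free_act_def
    using assms by (auto simp: subringD fun_eq_iff algebra_simps subset_iff)
      (metis add_0 mult_zero_left)+
qed

lemma free_mod_iff:
  "finite J \<Longrightarrow> x \<in> free_mod S J \<longleftrightarrow> (\<forall>i. x i \<in> S) \<and> (\<forall>i. i \<notin> J \<longrightarrow> x i = 0)"
  unfolding free_mod_def by (auto intro: finite_subset)

lemma free_mod_mono: "J \<subseteq> J' \<Longrightarrow> free_mod S J \<subseteq> free_mod S J'"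
  unfolding free_mod_def by blast

lemma free_mod_empty: "0 \<in> S \<Longrightarrow> free_mod S {} = {0}"
  unfolding free_mod_def by (auto simp: fun_eq_iff)

lemma unit_vec_in: "subring S \<Longrightarrow> j \<in> J \<Longrightarrow> unit_vec j \<in> free_mod S J"
  unfolding free_mod_def unit_vec_def by (auto simp: subringD)

lemma sum_fun_apply: "(\<Sum>i\<in>A. f i) x = (\<Sum>i\<in>A. f i x)"
  for f :: "'i \<Rightarrow> 'b \<Rightarrow> 'c::comm_monoid_add"
  by (induction A rule: infinite_finite_induct) auto

lemma sum_unit_vec:
  assumes "finite A" "\<And>i. i \<notin> A \<Longrightarrow> x i = 0"
  shows "(\<Sum>j\<in>A. free_act (unit_vec j) (x j)) = x"
proof
  fix i
  have "(\<Sum>j\<in>A. free_act (unit_vec j) (x j)) i = (\<Sum>j\<in>A. if i = j then x j else 0)"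
    unfolding sum_fun_apply free_act_def unit_vec_def by (rule sum.cong) auto
  then show "(\<Sum>j\<in>A. free_act (unit_vec j) (x j)) i = x i"
    using assms by simp
qed

lemma linear_on_free:
  assumes "linear_map S (free_mod S J) free_act M act f" "subring S" "finite J" "x \<in> free_mod S J"
  shows "f x = (\<Sum>j\<in>J. act (f (unit_vec j)) (x j))"
proof -
  have x: "\<And>j. x j \<in> S" "\<And>j. j \<notin> J \<Longrightarrow> x j = 0"
    using assms by (auto simp: free_mod_iff)
  note FM = free_mod_module[OF assms(2), of J]
  have "f x = f (\<Sum>j\<in>J. free_act (unit_vec j) (x j))"
    using sum_unit_vec[of J x] assms(3) x by simp
  also have "\<dots> = (\<Sum>j\<in>J. f (free_act (unit_vec j) (x j)))"
    by (rule linear_sum[OF assms(1) FM]) (use x in \<open>auto intro!: module_act[OF FM] unit_vec_in assms\<close>)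
  also have "\<dots> = (\<Sum>j\<in>J. act (f (unit_vec j)) (x j))"
    by (rule sum.cong) (auto intro!: linear_act[OF assms(1)] unit_vec_in assms x)
  finally show ?thesis .
qed

lemma linear_free_eqI:
  assumes "linear_map S (free_mod S J) free_act M act f" "linear_map S (free_mod S J) free_act M' act g"
    and "subring S" "finite J" "x \<in> free_mod S J"
    and "\<And>j. j \<in> J \<Longrightarrow> f (unit_vec j) = g (unit_vec j)"
  shows "f x = g x"
  using linear_on_free[OF assms(1,3-5)] linear_on_free[OF assms(2,3-5)] assms(6) by simp

lemma linear_proj: "linear_map S (free_mod S J) free_act S (*) (\<lambda>x. x j)"
  unfolding linear_map_def free_mod_def free_act_def by auto

lemma linear_into_free:
  assumes "finite J" "right_module S M act" "0 \<in> S"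
    and "\<And>j. j \<in> J \<Longrightarrow> linear_map S M act S (*) (c j)"
  shows "linear_map S M act (free_mod S J) free_act (\<lambda>x j. if j \<in> J then c j x else 0)"
  unfolding linear_map_def free_mod_iff[OF assms(1)]
  using assms(3) linear_in[OF assms(4)] linear_add[OF assms(4)] linear_act[OF assms(4)]
  by (auto simp: fun_eq_iff free_act_def)

subsection \<open>Dual bases\<close>

text \<open>The dual basis criterion for projectivity. The index type is independent of the module,
  unlike in \<open>projective_module\<close>, so that index sets can become products under
  restriction of scalars and disjoint sums under direct sums. The \<open>b i\<close> may satisfy
  relations, and \<open>B\<close> may be infinite, whence the sum over the support of
  \<open>x\<close>.\<close>

definition dual_basis :: "('a::ring_1) set \<Rightarrow> ('m::ab_group_add) set \<Rightarrow> ('m \<Rightarrow> 'a \<Rightarrow> 'm) \<Rightarrow> 'i set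
    \<Rightarrow> ('i \<Rightarrow> 'm) \<Rightarrow> ('i \<Rightarrow> 'm \<Rightarrow> 'a) \<Rightarrow> bool" where
  "dual_basis S M act B b c \<longleftrightarrow> (\<forall>i\<in>B. b i \<in> M) \<and> (\<forall>i\<in>B. linear_map S M act S (*) (c i))
     \<and> (\<forall>x\<in>M. finite {i\<in>B. c i x \<noteq> 0} \<and> x = (\<Sum>i\<in>{i\<in>B. c i x \<noteq> 0}. act (b i) (c i x)))"

lemma dual_basisD:
  assumes "dual_basis S M act B b c"
  shows dual_basis_in: "i \<in> B \<Longrightarrow> b i \<in> M"
    and dual_basis_linear: "i \<in> B \<Longrightarrow> linear_map S M act S (*) (c i)"
    and dual_basis_finite: "x \<in> M \<Longrightarrow> finite {i\<in>B. c i x \<noteq> 0}"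
    and dual_basis_expand: "x \<in> M \<Longrightarrow> x = (\<Sum>i\<in>{i\<in>B. c i x \<noteq> 0}. act (b i) (c i x))"
  using assms unfolding dual_basis_def by blast+

lemma dual_basis_coord: "dual_basis S M act B b c \<Longrightarrow> i \<in> B \<Longrightarrow> x \<in> M \<Longrightarrow> c i x \<in> S"
  using linear_in[OF dual_basis_linear] .

lemma dual_basis_expand_superset:
  assumes "dual_basis S M act B b c" "right_module S M act" "0 \<in> S" "x \<in> M"
    and "finite A" "A \<subseteq> B" "{i\<in>B. c i x \<noteq> 0} \<subseteq> A"
  shows "x = (\<Sum>i\<in>A. act (b i) (c i x))"
proof -
  have "(\<Sum>i\<in>{i\<in>B. c i x \<noteq> 0}. act (b i) (c i x)) = (\<Sum>i\<in>A. act (b i) (c i x))"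
    using assms by (intro sum.mono_neutral_left) (auto simp: act_0_right dual_basis_in)
  then show ?thesis
    using dual_basis_expand[OF assms(1,4)] by simp
qed

lemma dual_basis_free:
  assumes "subring S"
  shows "dual_basis S (free_mod S J) free_act J unit_vec (\<lambda>j x. x j)"
  unfolding dual_basis_def
proof (intro conjI ballI)
  fix x :: "'b \<Rightarrow> 'a"
  assume x: "x \<in> free_mod S J"
  then have eq: "{i\<in>J. x i \<noteq> 0} = {i. x i \<noteq> 0}"
    by (auto simp: free_mod_def)
  show "finite {i\<in>J. x i \<noteq> 0}"
    using x by (auto simp: eq free_mod_def)
  then show "x = (\<Sum>i\<in>{i\<in>J. x i \<noteq> 0}. free_act (unit_vec i) (x i))"
    by (subst sum_unit_vec) (auto simp: eq)
qed (use assms in \<open>auto intro: unit_vec_in linear_proj\<close>)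

text \<open>Take the images of the unit vectors under \<open>p\<close> and the coordinates of
  \<open>i\<close>; the expansion of \<open>x\<close> is \<open>p\<close> applied to the expansion
  of \<open>i x\<close> in the free module.\<close>

lemma dual_basis_projective:
  fixes P :: "('m::ab_group_add) set"
  assumes "projective_module S P act" "subring S"
  shows "\<exists>(B::'m set) b c. dual_basis S P act B b c"
proof -
  obtain I :: "'m set" and i p where
    i: "linear_map S P act (free_mod S I) free_act i"
    and p: "linear_map S (free_mod S I) free_act P act p" and pi: "\<And>x. x \<in> P \<Longrightarrow> p (i x) = x"
    using assms(1) unfolding projective_module_def by blast
  note db = dual_basis_free[OF assms(2), of I]
  note FM = free_mod_module[OF assms(2), of I]
  have "dual_basis S P act I (\<lambda>j. p (unit_vec j)) (\<lambda>j x. i x j)"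
    unfolding dual_basis_def
  proof (intro conjI ballI)
    fix x assume x: "x \<in> P"
    then have ix: "i x \<in> free_mod S I"
      using i by (auto dest: linear_in)
    show "finite {j\<in>I. i x j \<noteq> 0}"
      using dual_basis_finite[OF db ix] .
    have "x = p (i x)"
      using pi x by simp
    also have "\<dots> = p (\<Sum>j\<in>{j\<in>I. i x j \<noteq> 0}. free_act (unit_vec j) (i x j))"
      using dual_basis_expand[OF db ix] by simp
    also have "\<dots> = (\<Sum>j\<in>{j\<in>I. i x j \<noteq> 0}. p (free_act (unit_vec j) (i x j)))"
      by (rule linear_sum[OF p FM])
        (use dual_basis_coord[OF db _ ix] in \<open>auto intro!: module_act[OF FM] unit_vec_in assms\<close>)
    also have "\<dots> = (\<Sum>j\<in>{j\<in>I. i x j \<noteq> 0}. act (p (unit_vec j)) (i x j))"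
      using dual_basis_coord[OF db _ ix]
      by (intro sum.cong) (auto intro!: linear_act[OF p] unit_vec_in assms)
    finally show "x = (\<Sum>j\<in>{j\<in>I. i x j \<noteq> 0}. act (p (unit_vec j)) (i x j))" .
  qed (auto intro!: linear_in[OF p] unit_vec_in assms linear_comp[OF i linear_proj])
  then show ?thesis by blast
qed

text \<open>The lifting property of projectives: choose preimages of the \<open>f (b i)\<close> and
  combine them with the coordinates \<open>c i\<close>. Relations among the \<open>b i\<close> do no
  harm, because the lift is built from the linear functionals \<open>c i\<close>.\<close>

lemma dual_basis_lift:
  assumes db: "dual_basis S M act B b c" and S: "subring S" and M: "right_module S M act"
    and N: "right_module S N act'" and P: "right_module S P act''"
    and g: "linear_map S N act' P act'' g" and f: "linear_map S M act P act'' f"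
    and im: "\<And>x. x \<in> M \<Longrightarrow> f x \<in> g ` N"
  shows "\<exists>f'. linear_map S M act N act' f' \<and> (\<forall>x\<in>M. g (f' x) = f x)"
proof -
  have "\<forall>i\<in>B. \<exists>y\<in>N. g y = f (b i)"
    using im dual_basis_in[OF db] by fastforce
  then obtain y where y: "\<And>i. i \<in> B \<Longrightarrow> y i \<in> N" "\<And>i. i \<in> B \<Longrightarrow> g (y i) = f (b i)"
    by metis
  define supp where "supp x = {i\<in>B. c i x \<noteq> 0}" for x
  define f' where "f' x = (\<Sum>i\<in>supp x. act' (y i) (c i x))" for x
  have supp: "finite (supp x)" "supp x \<subseteq> B" if "x \<in> M" for x
    using dual_basis_finite[OF db that] by (auto simp: supp_def)
  have coord: "c i x \<in> S" if "x \<in> M" "i \<in> B" for i x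
    using dual_basis_coord[OF db that(2,1)] .
  have f'_eq: "f' x = (\<Sum>i\<in>A. act' (y i) (c i x))"
    if "x \<in> M" "finite A" "A \<subseteq> B" "supp x \<subseteq> A" for x A
    unfolding f'_def using that supp[OF that(1)]
    by (intro sum.mono_neutral_left) (auto simp: supp_def act_0_right[OF N subring_0[OF S]] y)
  have "linear_map S M act N act' f'"
  proof (rule linear_mapI)
    fix x assume x: "x \<in> M"
    show "f' x \<in> N"
      unfolding f'_def using x supp(2)[OF x] y coord
      by (auto intro!: module_sum[OF N] module_act[OF N])
  next
    fix x z assume xz: "x \<in> M" "z \<in> M"
    \<comment> \<open>The supports of \<open>x\<close>, \<open>z\<close> and \<open>x + z\<close>
      differ, so all three sums are extended by zeros to a common finite index set.\<close>
    let ?A = "supp x \<union> supp z \<union> supp (x + z)"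
    have xz': "x + z \<in> M"
      using module_add[OF M xz] .
    have A: "finite ?A" "?A \<subseteq> B"
      using supp[OF xz(1)] supp[OF xz(2)] supp[OF xz'] by auto
    have "act' (y i) (c i (x + z)) = act' (y i) (c i x) + act' (y i) (c i z)" if "i \<in> ?A" for i
      using that A xz y coord linear_add[OF dual_basis_linear[OF db] xz]
      by (metis act_add_right[OF N] subsetD)
    then have "(\<Sum>i\<in>?A. act' (y i) (c i (x + z)))
        = (\<Sum>i\<in>?A. act' (y i) (c i x)) + (\<Sum>i\<in>?A. act' (y i) (c i z))"
      by (simp add: sum.distrib)
    moreover have "supp x \<subseteq> ?A" "supp z \<subseteq> ?A" "supp (x + z) \<subseteq> ?A"
      by auto
    ultimately show "f' (x + z) = f' x + f' z"
      using f'_eq[OF xz(1) A] f'_eq[OF xz(2) A] f'_eq[OF xz' A] by (simp del: Un_subset_iff)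
  next
    fix x a assume x: "x \<in> M" and a: "a \<in> S"
    let ?A = "supp x \<union> supp (act x a)"
    have xa: "act x a \<in> M"
      using module_act[OF M x a] .
    have A: "finite ?A" "?A \<subseteq> B"
      using supp[OF x] supp[OF xa] by auto
    have "act' (y i) (c i (act x a)) = act' (act' (y i) (c i x)) a" if "i \<in> ?A" for i
      using that A x y coord linear_act[OF dual_basis_linear[OF db] x a] a
      by (metis act_mult[OF N] subsetD)
    moreover have "act' (f' x) a = (\<Sum>i\<in>?A. act' (act' (y i) (c i x)) a)"
      unfolding f'_eq[OF x A, simplified]
      by (rule act_sum[OF N a]) (use A x y coord in \<open>auto intro!: module_act[OF N]\<close>)
    ultimately show "f' (act x a) = act' (f' x) a"
      using f'_eq[OF xa A] by simp
  qed
  moreover have "g (f' x) = f x" if x: "x \<in> M" for x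
  proof -
    have "g (f' x) = (\<Sum>i\<in>supp x. g (act' (y i) (c i x)))"
      unfolding f'_def
      by (rule linear_sum[OF g N]) (use supp(2)[OF x] x y coord in \<open>auto intro!: module_act[OF N]\<close>)
    also have "\<dots> = (\<Sum>i\<in>supp x. f (act (b i) (c i x)))"
      using supp(2)[OF x] x y coord dual_basis_in[OF db]
      by (intro sum.cong) (auto simp: linear_act[OF g] linear_act[OF f] subset_iff)
    also have "\<dots> = f (\<Sum>i\<in>supp x. act (b i) (c i x))"
      by (rule linear_sum[OF f M, symmetric])
        (use supp(2)[OF x] x coord dual_basis_in[OF db] in \<open>auto intro!: module_act[OF M]\<close>)
    also have "\<dots> = f x"
      using dual_basis_expand[OF db x] by (simp add: supp_def)
    finally show ?thesis .
  qed
  ultimately show ?thesis by blast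
qed

text \<open>Expand over \<open>S\<close>, then expand each coordinate over \<open>S'\<close>. This
  is what keeps \<open>C\<close> projective over all the smaller Laurent rings.\<close>

lemma dual_basis_restrict_scalars:
  assumes db: "dual_basis S M act B b c" and S: "subring S" and M: "right_module S M act"
    and db': "dual_basis S' S (*) B' b' c'" and S': "subring S'" "S' \<subseteq> S"
  shows "dual_basis S' M act (B \<times> B') (\<lambda>(i, j). act (b i) (b' j)) (\<lambda>(i, j) x. c' j (c i x))"
  unfolding dual_basis_def
proof (intro conjI ballI)
  fix ij assume "ij \<in> B \<times> B'"
  then obtain i j where ij: "ij = (i, j)" "i \<in> B" "j \<in> B'"
    by auto
  show "(case ij of (i, j) \<Rightarrow> act (b i) (b' j)) \<in> M"
    using ij by (auto intro!: module_act[OF M] dual_basis_in[OF db] dual_basis_in[OF db'])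
  have "linear_map S' M act S' (*) (\<lambda>x. c' j (c i x))"
    by (rule linear_comp[OF linear_map_mono[OF dual_basis_linear[OF db ij(2)] S'(2)]
          dual_basis_linear[OF db' ij(3)]])
  then show "linear_map S' M act S' (*) (case ij of (i, j) \<Rightarrow> \<lambda>x. c' j (c i x))"
    using ij by simp
next
  fix x assume x: "x \<in> M"
  let ?A = "{i\<in>B. c i x \<noteq> 0}"
  let ?A' = "\<lambda>i. {j\<in>B'. c' j (c i x) \<noteq> 0}"
  have ci: "c i x \<in> S" if "i \<in> B" for i
    using dual_basis_coord[OF db that x] .
  have eq: "{ij\<in>B \<times> B'. (case ij of (i, j) \<Rightarrow> \<lambda>x. c' j (c i x)) x \<noteq> 0} = Sigma ?A ?A'"
    using linear_0[OF dual_basis_linear[OF db']] S by (auto simp: subring_0)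
  have fin: "finite ?A" "\<And>i. i \<in> ?A \<Longrightarrow> finite (?A' i)"
    using dual_basis_finite[OF db x] dual_basis_finite[OF db' ci] by auto
  then show "finite {ij\<in>B \<times> B'. (case ij of (i, j) \<Rightarrow> \<lambda>x. c' j (c i x)) x \<noteq> 0}"
    unfolding eq by blast
  have "x = (\<Sum>i\<in>?A. act (b i) (c i x))"
    using dual_basis_expand[OF db x] .
  also have "\<dots> = (\<Sum>i\<in>?A. \<Sum>j\<in>?A' i. act (act (b i) (b' j)) (c' j (c i x)))"
  proof (rule sum.cong[OF refl])
    fix i assume "i \<in> ?A"
    then have i: "i \<in> B" by simp
    have "act (b i) (c i x) = act (b i) (\<Sum>j\<in>?A' i. b' j * c' j (c i x))"
      using dual_basis_expand[OF db' ci[OF i]] by simp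
    also have "\<dots> = (\<Sum>j\<in>?A' i. act (b i) (b' j * c' j (c i x)))"
      by (rule act_sum_right[OF M S dual_basis_in[OF db i]])
        (use S S' dual_basis_in[OF db'] dual_basis_coord[OF db' _ ci[OF i]] in \<open>auto intro!: subring_mult\<close>)
    also have "\<dots> = (\<Sum>j\<in>?A' i. act (act (b i) (b' j)) (c' j (c i x)))"
      using S' dual_basis_in[OF db'] dual_basis_coord[OF db' _ ci[OF i]] dual_basis_in[OF db i]
      by (intro sum.cong) (auto intro!: act_mult[OF M])
    finally show "act (b i) (c i x) = (\<Sum>j\<in>?A' i. act (act (b i) (b' j)) (c' j (c i x)))" .
  qed
  also have "\<dots> = (\<Sum>(i, j)\<in>Sigma ?A ?A'. act (act (b i) (b' j)) (c' j (c i x)))"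
    by (rule sum.Sigma) (use fin in auto)
  also have "\<dots> = (\<Sum>ij\<in>Sigma ?A ?A'. act (case ij of (i, j) \<Rightarrow> act (b i) (b' j)) ((case ij of (i, j) \<Rightarrow> \<lambda>x. c' j (c i x)) x))"
    by (rule sum.cong) auto
  finally show "x = (\<Sum>ij\<in>{ij\<in>B \<times> B'. (case ij of (i, j) \<Rightarrow> \<lambda>x. c' j (c i x)) x \<noteq> 0}.
      act (case ij of (i, j) \<Rightarrow> act (b i) (b' j)) ((case ij of (i, j) \<Rightarrow> \<lambda>x. c' j (c i x)) x))"
    unfolding eq .
qed

text \<open>Meant for submodules spanned by part of the dual basis, such as the vectors of bounded
  degree in one variable.\<close>

lemma dual_basis_submodule:
  assumes "dual_basis S M act B b c" "M' \<subseteq> M" "B' \<subseteq> B"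
    and "\<And>i. i \<in> B' \<Longrightarrow> b i \<in> M'" "\<And>i x. i \<in> B - B' \<Longrightarrow> x \<in> M' \<Longrightarrow> c i x = 0"
  shows "dual_basis S M' act B' b c"
proof -
  have eq: "{i\<in>B'. c i x \<noteq> 0} = {i\<in>B. c i x \<noteq> 0}" if "x \<in> M'" for x
    using assms(3,5) that by auto
  show ?thesis
    unfolding dual_basis_def
  proof (intro conjI ballI)
    fix i assume "i \<in> B'"
    then show "linear_map S M' act S (*) (c i)"
      using assms(2,3) dual_basis_linear[OF assms(1)] linear_map_domain by blast
  next
    fix x assume x: "x \<in> M'"
    then have "x \<in> M"
      using assms(2) by blast
    then show "finite {i\<in>B'. c i x \<noteq> 0}" "x = (\<Sum>i\<in>{i\<in>B'. c i x \<noteq> 0}. act (b i) (c i x))"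
      unfolding eq[OF x] using dual_basis_finite[OF assms(1)] dual_basis_expand[OF assms(1)] by blast+
  qed (use assms(4) in auto)
qed

lemma dual_basis_pair:
  assumes db: "dual_basis S M act B b c" and db': "dual_basis S N act' B' b' c'"
    and M: "right_module S M act" and N: "right_module S N act'"
  shows "dual_basis S (M \<times> N) (pair_act act act') (B <+> B')
    (case_sum (\<lambda>i. (b i, 0)) (\<lambda>j. (0, b' j))) (case_sum (\<lambda>i z. c i (fst z)) (\<lambda>j z. c' j (snd z)))"
  unfolding dual_basis_def
proof (intro conjI ballI)
  fix i assume i: "i \<in> B <+> B'"
  then show "case_sum (\<lambda>i. (b i, 0)) (\<lambda>j. (0, b' j)) i \<in> M \<times> N"
    using module_0[OF M] module_0[OF N] dual_basis_in[OF db] dual_basis_in[OF db'] by auto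
  show "linear_map S (M \<times> N) (pair_act act act') S (*)
      (case_sum (\<lambda>i z. c i (fst z)) (\<lambda>j z. c' j (snd z)) i)"
    using i dual_basis_linear[OF db] dual_basis_linear[OF db']
    by (auto simp: linear_map_def pair_act_def)
next
  fix z assume z: "z \<in> M \<times> N"
  let ?A = "{i\<in>B. c i (fst z) \<noteq> 0}" and ?A' = "{j\<in>B'. c' j (snd z) \<noteq> 0}"
  have eq: "{i\<in>B <+> B'. case_sum (\<lambda>i z. c i (fst z)) (\<lambda>j z. c' j (snd z)) i z \<noteq> 0} = ?A <+> ?A'"
    by auto
  have zz: "fst z \<in> M" "snd z \<in> N"
    using z by auto
  have fin: "finite ?A" "finite ?A'"
    using dual_basis_finite[OF db zz(1)] dual_basis_finite[OF db' zz(2)] .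
  then have fin': "finite (?A <+> ?A')"
    by (rule finite_Plus)
  then show "finite {i\<in>B <+> B'. case_sum (\<lambda>i z. c i (fst z)) (\<lambda>j z. c' j (snd z)) i z \<noteq> 0}"
    unfolding eq .
  have "(\<Sum>i\<in>?A <+> ?A'. pair_act act act' (case_sum (\<lambda>i. (b i, 0)) (\<lambda>j. (0, b' j)) i)
      (case_sum (\<lambda>i z. c i (fst z)) (\<lambda>j z. c' j (snd z)) i z))
    = (\<Sum>i\<in>?A. (act (b i) (c i (fst z)), 0)) + (\<Sum>j\<in>?A'. (0, act' (b' j) (c' j (snd z))))"
    using fin dual_basis_coord[OF db _ zz(1)] dual_basis_coord[OF db' _ zz(2)]
    by (subst sum.Plus) (auto simp: pair_act_def act_0[OF M] act_0[OF N] intro!: arg_cong2[where f="(+)"] sum.cong)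
  also have "\<dots> = z"
    using dual_basis_expand[OF db zz(1)] dual_basis_expand[OF db' zz(2)]
    by (simp add: prod_eq_iff fst_sum snd_sum)
  finally show "z = (\<Sum>i\<in>{i\<in>B <+> B'. case_sum (\<lambda>i z. c i (fst z)) (\<lambda>j z. c' j (snd z)) i z \<noteq> 0}.
     pair_act act act' (case_sum (\<lambda>i. (b i, 0)) (\<lambda>j. (0, b' j)) i)
      (case_sum (\<lambda>i z. c i (fst z)) (\<lambda>j z. c' j (snd z)) i z))"
    unfolding eq by simp
qed

text \<open>The surjection onto \<open>P\<close> from the free module on a finite generating set
  splits by projectivity, and the splitting supplies the coordinates.\<close>

lemma dual_basis_fin_generated:
  fixes P :: "('m::ab_group_add) set"
  assumes "fin_generated S P act" "projective_module S P act" "subring S"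
  shows "\<exists>(G::'m set) c. finite G \<and> dual_basis S P act G (\<lambda>g. g) c"
proof -
  obtain G where G: "finite G" "G \<subseteq> P"
    "\<And>x. x \<in> P \<Longrightarrow> \<exists>c. (\<forall>g\<in>G. c g \<in> S) \<and> x = (\<Sum>g\<in>G. act g (c g))"
    using assms(1) unfolding fin_generated_def by blast
  have P: "right_module S P act"
    using assms(2) by (simp add: projective_module_def)
  obtain B :: "'m set" and b c where db: "dual_basis S P act B b c"
    using dual_basis_projective[OF assms(2,3)] by blast
  define g where "g \<phi> = (\<Sum>j\<in>G. act j (\<phi> j))" for \<phi>
  have g: "linear_map S (free_mod S G) free_act P act g"
    unfolding g_def by (intro linear_sum_maps[OF P] linear_comp[OF linear_proj] linear_act_const[OF P assms(3)])
      (use G in auto)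
  have "\<exists>f. linear_map S P act (free_mod S G) free_act f \<and> (\<forall>x\<in>P. g (f x) = x)"
  proof (rule dual_basis_lift[OF db assms(3) P free_mod_module[OF assms(3)] P g linear_id])
    fix x assume "x \<in> P"
    then obtain a where a: "\<forall>g\<in>G. a g \<in> S" "x = (\<Sum>g\<in>G. act g (a g))"
      using G by blast
    let ?\<phi> = "\<lambda>j. if j \<in> G then a j else 0"
    have "?\<phi> \<in> free_mod S G" "g ?\<phi> = x"
      using a G(1) assms(3) by (auto simp: free_mod_iff subring_0 g_def)
    then show "x \<in> g ` free_mod S G"
      by force
  qed
  then obtain f where f: "linear_map S P act (free_mod S G) free_act f" "\<And>x. x \<in> P \<Longrightarrow> g (f x) = x"
    by blast
  have "dual_basis S P act G (\<lambda>g. g) (\<lambda>j x. f x j)"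
    unfolding dual_basis_def
  proof (intro conjI ballI)
    fix x assume x: "x \<in> P"
    have "(\<Sum>i\<in>{i \<in> G. f x i \<noteq> 0}. act i (f x i)) = g (f x)"
      unfolding g_def using G(1,2) act_0_right[OF P subring_0[OF assms(3)]]
      by (intro sum.mono_neutral_left) auto
    then show "x = (\<Sum>i\<in>{i \<in> G. f x i \<noteq> 0}. act i (f x i))"
      using f(2)[OF x] by simp
  qed (use G in \<open>auto intro: linear_comp[OF f(1) linear_proj]\<close>)
  then show ?thesis
    using G(1) by blast
qed

text \<open>\<open>projective_module\<close> asks for a free module indexed by elements of the
  module's own type, here \<open>nat \<Rightarrow> 'a\<close>, so each index \<open>j\<close> is
  represented by its unit vector.\<close>

lemma retract_of_free:
  fixes J :: "nat set"
  assumes S: "subring S" and J: "finite J" and M: "right_module S M free_act" "M \<subseteq> free_mod S J"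
    and p: "linear_map S (free_mod S J) free_act M free_act p" "\<And>x. x \<in> M \<Longrightarrow> p x = x"
  shows "fin_generated S M free_act" "projective_module S M free_act"
proof -
  let ?u = "unit_vec :: nat \<Rightarrow> nat \<Rightarrow> 'a"
  have inj: "inj ?u"
    by (metis injI unit_vec_other unit_vec_same zero_neq_one)
  have expand: "x = (\<Sum>j\<in>J. free_act (p (?u j)) (x j))" if "x \<in> M" for x
    using linear_on_free[OF p(1) S J] that M(2) p(2)[OF that] by (metis subsetD)
  show "fin_generated S M free_act"
    unfolding fin_generated_def
  proof (intro exI[of _ "p ` ?u ` J"] conjI ballI)
    show "p ` ?u ` J \<subseteq> M"
      by (auto intro!: linear_in[OF p(1)] unit_vec_in[OF S])
    fix x assume x: "x \<in> M"
    then have xS: "x j \<in> S" for j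
      using M(2) J by (auto simp: free_mod_iff)
    \<comment> \<open>Different \<open>j\<close> may have the same image under \<open>p\<close>, so
      the coefficients are collected along the fibres.\<close>
    let ?c = "\<lambda>g. \<Sum>j\<in>{j\<in>J. p (?u j) = g}. x j"
    have "x = (\<Sum>g\<in>(\<lambda>j. p (?u j)) ` J. \<Sum>j\<in>{j\<in>J. p (?u j) = g}. free_act (p (?u j)) (x j))"
      using expand[OF x] sum.image_gen[OF J, of "\<lambda>j. free_act (p (?u j)) (x j)" "\<lambda>j. p (?u j)"] by simp
    also have "\<dots> = (\<Sum>g\<in>(\<lambda>j. p (?u j)) ` J. free_act g (?c g))"
      by (intro sum.cong) (auto simp: fun_eq_iff free_act_def sum_fun_apply sum_distrib_left)
    finally show "\<exists>c. (\<forall>g\<in>p ` ?u ` J. c g \<in> S) \<and> x = (\<Sum>g\<in>p ` ?u ` J. free_act g (c g))"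
      using S xS by (intro exI[of _ ?c]) (auto simp: image_image intro!: subring_sum)
  qed (use J in auto)
  show "projective_module S M free_act"
    unfolding projective_module_def
  proof (intro conjI exI)
    define i :: "(nat \<Rightarrow> 'a) \<Rightarrow> (nat \<Rightarrow> 'a) \<Rightarrow> 'a"
      where "i x = (\<lambda>g. if g \<in> ?u ` J then x (inv ?u g) else 0)" for x
    have inv: "inv ?u (?u j) = j" for j
      using inj by simp
    have I: "finite (?u ` J)"
      using J by simp
    show "right_module S M free_act" by (rule M)
    show "linear_map S M free_act (free_mod S (?u ` J)) free_act i"
      unfolding i_def linear_map_def free_mod_iff[OF I]
      using M(2) J S by (auto simp: free_mod_iff free_act_def fun_eq_iff subring_0 inv subset_iff)
    have r: "linear_map S (free_mod S (?u ` J)) free_act (free_mod S J) free_act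
         (\<lambda>\<phi> j. if j \<in> J then \<phi> (?u j) else 0)"
      unfolding linear_map_def free_mod_iff[OF I] free_mod_iff[OF J]
      using S by (auto simp: free_act_def fun_eq_iff subring_0 free_mod_def)
    show "linear_map S (free_mod S (?u ` J)) free_act M free_act
         (\<lambda>\<phi>. p (\<lambda>j. if j \<in> J then \<phi> (?u j) else 0))"
      by (rule linear_comp[OF r p(1)])
    show "\<forall>x\<in>M. p (\<lambda>j. if j \<in> J then i x (?u j) else 0) = x"
    proof
      fix x assume x: "x \<in> M"
      then have "\<And>j. j \<notin> J \<Longrightarrow> x j = 0"
        using M(2) J by (auto simp: free_mod_iff)
      then have "(\<lambda>j. if j \<in> J then i x (?u j) else 0) = x"
        by (auto simp: i_def fun_eq_iff inv)
      then show "p (\<lambda>j. if j \<in> J then i x (?u j) else 0) = x"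
        using p(2)[OF x] by simp
    qed
  qed
qed


section \<open>Chain complexes\<close>

lemma chain_complexD:
  assumes "chain_complex S C d act"
  shows complex_module: "right_module S (C k) act"
    and complex_linear: "linear_map S (C k) act (C (k - 1)) act (d k)"
    and complex_d: "x \<in> C k \<Longrightarrow> d k x \<in> C (k - 1)"
    and complex_dd: "x \<in> C k \<Longrightarrow> d (k - 1) (d k x) = 0"
  using assms unfolding chain_complex_def linear_map_def by blast+

lemma chain_complex_Suc:
  assumes "chain_complex S C d act"
  shows complex_linear_Suc: "linear_map S (C (k + 1)) act (C k) act (d (k + 1))"
    and complex_d_Suc: "x \<in> C (k + 1) \<Longrightarrow> d (k + 1) x \<in> C k"
    and complex_dd_Suc: "x \<in> C (k + 1) \<Longrightarrow> d k (d (k + 1) x) = 0"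
  using complex_linear[OF assms, of "k + 1"] complex_d[OF assms, of x "k + 1"]
    complex_dd[OF assms, of x "k + 1"] by auto

lemma chain_complex_mono: "chain_complex S C d act \<Longrightarrow> S' \<subseteq> S \<Longrightarrow> chain_complex S' C d act"
  unfolding chain_complex_def by (meson linear_map_mono right_module_mono)

lemma chain_mapD:
  assumes "chain_map S C d act D e act' f"
  shows chain_map_linear: "linear_map S (C k) act (D k) act' (f k)"
    and chain_map_in: "x \<in> C k \<Longrightarrow> f k x \<in> D k"
    and chain_map_comm: "x \<in> C k \<Longrightarrow> e k (f k x) = f (k - 1) (d k x)"
  using assms unfolding chain_map_def linear_map_def by blast+

lemma chain_mapI:
  assumes "\<And>k. linear_map S (C k) act (D k) act' (f k)"
    and "\<And>k x. x \<in> C k \<Longrightarrow> e k (f k x) = f (k - 1) (d k x)"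
  shows "chain_map S C d act D e act' f"
  using assms unfolding chain_map_def by blast

lemma chain_map_mono: "chain_map S C d act D e act' f \<Longrightarrow> S' \<subseteq> S \<Longrightarrow> chain_map S' C d act D e act' f"
  unfolding chain_map_def by (meson linear_map_mono)

lemma chain_map_comp:
  assumes "chain_map S C d act D e act' f" "chain_map S D e act' E r act'' g"
  shows "chain_map S C d act E r act'' (\<lambda>k x. g k (f k x))"
proof (rule chain_mapI)
  fix k
  show "linear_map S (C k) act (E k) act'' (\<lambda>x. g k (f k x))"
    by (rule linear_comp[OF chain_map_linear[OF assms(1)] chain_map_linear[OF assms(2)]])
  fix x assume x: "x \<in> C k"
  then show "r k (g k (f k x)) = g (k - 1) (f (k - 1) (d k x))"
    using chain_map_comm[OF assms(2) chain_map_in[OF assms(1) x]] chain_map_comm[OF assms(1) x]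
    by simp
qed

lemma chain_homotopic_comp:
  assumes u: "chain_map S B b actb C c actc u" and v: "chain_map S D e actd E r acte v"
    and h: "chain_homotopic S C c actc D e actd f g"
    and D: "chain_complex S D e actd"
    and f: "chain_map S C c actc D e actd f" and g: "chain_map S C c actc D e actd g"
  shows "chain_homotopic S B b actb E r acte (\<lambda>k x. v k (f k (u k x))) (\<lambda>k x. v k (g k (u k x)))"
proof -
  obtain h where h: "\<And>k. linear_map S (C k) actc (D (k + 1)) actd (h k)"
    "\<And>k x. x \<in> C k \<Longrightarrow> f k x - g k x = e (k + 1) (h k x) + h (k - 1) (c k x)"
    using h unfolding chain_homotopic_def by blast
  show ?thesis
    unfolding chain_homotopic_def
  proof (intro exI[of _ "\<lambda>k x. v (k + 1) (h k (u k x))"] conjI allI ballI)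
    fix k
    show "linear_map S (B k) actb (E (k + 1)) acte (\<lambda>x. v (k + 1) (h k (u k x)))"
      by (rule linear_comp[OF linear_comp[OF chain_map_linear[OF u] h(1)] chain_map_linear[OF v]])
    fix x assume x: "x \<in> B k"
    have ux: "u k x \<in> C k"
      using chain_map_in[OF u x] .
    have hx: "h k (u k x) \<in> D (k + 1)"
      using linear_in[OF h(1) ux] .
    have bx: "u (k - 1) (b k x) = c k (u k x)" "c k (u k x) \<in> C (k - 1) \<Longrightarrow> h (k - 1) (c k (u k x)) \<in> D k"
      using chain_map_comm[OF u x] linear_in[OF h(1), of _ "k - 1"] by auto
    have hd: "h (k - 1) (c k (u k x)) \<in> D k"
    proof -
      have "h (k - 1) (c k (u k x)) = f k (u k x) - g k (u k x) - e (k + 1) (h k (u k x))"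
        using h(2)[OF ux] by simp
      then show ?thesis
        using module_diff[OF complex_module[OF D]] chain_map_in[OF f ux] chain_map_in[OF g ux]
          complex_d_Suc[OF D hx] by simp
    qed
    have "v k (f k (u k x)) - v k (g k (u k x)) = v k (e (k + 1) (h k (u k x)) + h (k - 1) (c k (u k x)))"
      using linear_diff[OF chain_map_linear[OF v] complex_module[OF D] chain_map_in[OF f ux] chain_map_in[OF g ux]]
        h(2)[OF ux] by simp
    also have "\<dots> = v k (e (k + 1) (h k (u k x))) + v k (h (k - 1) (c k (u k x)))"
      by (rule linear_add[OF chain_map_linear[OF v] complex_d_Suc[OF D hx] hd])
    also have "\<dots> = r (k + 1) (v (k + 1) (h k (u k x))) + v (k - 1 + 1) (h (k - 1) (u (k - 1) (b k x)))"
      using chain_map_comm[OF v hx] bx by simp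
    finally show "v k (f k (u k x)) - v k (g k (u k x))
      = r (k + 1) (v (k + 1) (h k (u k x))) + v (k - 1 + 1) (h (k - 1) (u (k - 1) (b k x)))" .
  qed
qed

lemma chain_map_id: "chain_map S C d act C d act (\<lambda>k x. x)"
  unfolding chain_map_def by (auto intro: linear_id)

lemma chain_homotopic_trans:
  assumes "chain_homotopic S C d act D e act' f g" "chain_homotopic S C d act D e act' g u"
    and C: "chain_complex S C d act" and D: "chain_complex S D e act'"
  shows "chain_homotopic S C d act D e act' f u"
proof -
  obtain h where h: "\<And>k. linear_map S (C k) act (D (k + 1)) act' (h k)"
    "\<And>k x. x \<in> C k \<Longrightarrow> f k x - g k x = e (k + 1) (h k x) + h (k - 1) (d k x)"
    using assms(1) unfolding chain_homotopic_def by blast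
  obtain h' where h': "\<And>k. linear_map S (C k) act (D (k + 1)) act' (h' k)"
    "\<And>k x. x \<in> C k \<Longrightarrow> g k x - u k x = e (k + 1) (h' k x) + h' (k - 1) (d k x)"
    using assms(2) unfolding chain_homotopic_def by blast
  show ?thesis
    unfolding chain_homotopic_def
  proof (intro exI[of _ "\<lambda>k x. h k x + h' k x"] conjI allI ballI)
    fix k
    show "linear_map S (C k) act (D (k + 1)) act' (\<lambda>x. h k x + h' k x)"
      by (rule linear_plus[OF h(1) h'(1) complex_module[OF D]])
    fix x assume x: "x \<in> C k"
    have "e (k + 1) (h k x + h' k x) = e (k + 1) (h k x) + e (k + 1) (h' k x)"
      by (rule linear_add[OF complex_linear[OF D] linear_in[OF h(1) x] linear_in[OF h'(1) x]])
    then show "f k x - u k x = e (k + 1) (h k x + h' k x) + (h (k - 1) (d k x) + h' (k - 1) (d k x))"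
      using h(2)[OF x] h'(2)[OF x] by (simp add: algebra_simps)
  qed
qed

lemma chain_homotopic_cong:
  assumes "chain_homotopic S C d act D e act' f g"
    and "\<And>k x. x \<in> C k \<Longrightarrow> f k x = f' k x" "\<And>k x. x \<in> C k \<Longrightarrow> g k x = g' k x"
  shows "chain_homotopic S C d act D e act' f' g'"
  using assms unfolding chain_homotopic_def by auto

lemma chain_homotopic_mono:
  "chain_homotopic S C d act D e act' f g \<Longrightarrow> S' \<subseteq> S \<Longrightarrow> chain_homotopic S' C d act D e act' f g"
  unfolding chain_homotopic_def by (meson linear_map_mono)

lemma chain_homotopic_refl:
  assumes "chain_complex S D e act'"
  shows "chain_homotopic S C d act D e act' f f"
proof -
  have "e (k + 1) 0 = 0" for k
    by (rule linear_0[OF complex_linear[OF assms] module_0[OF complex_module[OF assms]]])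
  then show ?thesis
    unfolding chain_homotopic_def
    by (intro exI[of _ "\<lambda>k x. 0"]) (auto intro!: linear_zero complex_module[OF assms])
qed

text \<open>Half of a homotopy equivalence: \<open>C\<close> is a retract of \<open>D\<close> up to
  homotopy. Truncation delivers only this much; for finite free \<open>D\<close> it is upgraded to
  \<open>fin_dominated\<close> in \<open>fin_dominated_of_dominated\<close>.\<close>

definition dominated :: "('a::ring_1) set \<Rightarrow> (int \<Rightarrow> ('m::ab_group_add) set) \<Rightarrow> (int \<Rightarrow> 'm \<Rightarrow> 'm)
    \<Rightarrow> ('m \<Rightarrow> 'a \<Rightarrow> 'm) \<Rightarrow> (int \<Rightarrow> ('n::ab_group_add) set) \<Rightarrow> (int \<Rightarrow> 'n \<Rightarrow> 'n) \<Rightarrow> ('n \<Rightarrow> 'a \<Rightarrow> 'n)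
    \<Rightarrow> bool" where
  "dominated S C d act D e act' \<longleftrightarrow> (\<exists>f g. chain_map S C d act D e act' f
     \<and> chain_map S D e act' C d act g
     \<and> chain_homotopic S C d act C d act (\<lambda>k x. g k (f k x)) (\<lambda>k x. x))"

lemma homotopy_equiv_dominated:
  "homotopy_equiv S C d act D e act' \<Longrightarrow> dominated S C d act D e act'"
  unfolding homotopy_equiv_def dominated_def by blast

lemma homotopy_equiv_sym:
  "homotopy_equiv S C d act D e act' \<Longrightarrow> homotopy_equiv S D e act' C d act"
  unfolding homotopy_equiv_def by blast

lemma dominated_mono:
  "dominated S C d act D e act' \<Longrightarrow> S' \<subseteq> S \<Longrightarrow> dominated S' C d act D e act'"
  unfolding dominated_def by (meson chain_map_mono chain_homotopic_mono)

lemma homotopic_id_comp: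
  assumes f: "chain_map S C d act D e act' f" and g: "chain_map S D e act' C d act g"
    and gf: "chain_homotopic S C d act C d act (\<lambda>k x. g k (f k x)) (\<lambda>k x. x)"
    and f': "chain_map S D e act' E r act'' f'" and g': "chain_map S E r act'' D e act' g'"
    and gf': "chain_homotopic S D e act' D e act' (\<lambda>k x. g' k (f' k x)) (\<lambda>k x. x)"
    and C: "chain_complex S C d act" and D: "chain_complex S D e act'"
  shows "chain_homotopic S C d act C d act (\<lambda>k x. g k (g' k (f' k (f k x)))) (\<lambda>k x. x)"
  by (rule chain_homotopic_trans[OF chain_homotopic_comp[OF f g gf' D] gf C C])
    (intro chain_map_comp[OF f' g'] chain_map_id)+

lemma dominated_trans:
  assumes "dominated S C d act D e act'" "dominated S D e act' E r act''"
    and C: "chain_complex S C d act" and D: "chain_complex S D e act'"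
  shows "dominated S C d act E r act''"
proof -
  obtain f g where fg: "chain_map S C d act D e act' f" "chain_map S D e act' C d act g"
    "chain_homotopic S C d act C d act (\<lambda>k x. g k (f k x)) (\<lambda>k x. x)"
    using assms(1) unfolding dominated_def by blast
  obtain f' g' where fg': "chain_map S D e act' E r act'' f'" "chain_map S E r act'' D e act' g'"
    "chain_homotopic S D e act' D e act' (\<lambda>k x. g' k (f' k x)) (\<lambda>k x. x)"
    using assms(2) unfolding dominated_def by blast
  show ?thesis
    unfolding dominated_def
    using chain_map_comp[OF fg(1) fg'(1)] chain_map_comp[OF fg'(2) fg(2)]
      homotopic_id_comp[OF fg fg' C D] by blast
qed

lemma homotopy_equiv_trans:
  assumes "homotopy_equiv S C d act D e act'" "homotopy_equiv S D e act' E r act''"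
    and C: "chain_complex S C d act" and D: "chain_complex S D e act'" and E: "chain_complex S E r act''"
  shows "homotopy_equiv S C d act E r act''"
proof -
  obtain f g where fg: "chain_map S C d act D e act' f" "chain_map S D e act' C d act g"
    "chain_homotopic S C d act C d act (\<lambda>k x. g k (f k x)) (\<lambda>k x. x)"
    "chain_homotopic S D e act' D e act' (\<lambda>k x. f k (g k x)) (\<lambda>k x. x)"
    using assms(1) unfolding homotopy_equiv_def by blast
  obtain f' g' where fg': "chain_map S D e act' E r act'' f'" "chain_map S E r act'' D e act' g'"
    "chain_homotopic S D e act' D e act' (\<lambda>k x. g' k (f' k x)) (\<lambda>k x. x)"
    "chain_homotopic S E r act'' E r act'' (\<lambda>k x. f' k (g' k x)) (\<lambda>k x. x)"
    using assms(2) unfolding homotopy_equiv_def by blast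
  show ?thesis
    unfolding homotopy_equiv_def
    using chain_map_comp[OF fg(1) fg'(1)] chain_map_comp[OF fg'(2) fg(2)]
      homotopic_id_comp[OF fg(1-3) fg'(1-3) C D] homotopic_id_comp[OF fg'(2,1,4) fg(2,1,4) E D] by blast
qed

subsection \<open>Replacing a complex by one of standard free modules\<close>

text \<open>Transport of structure to standard free modules. The index sets are disjoint subsets of
  \<open>nat\<close> because the witnesses of \<open>fin_dominated\<close> live in
  \<open>nat \<Rightarrow> 'a\<close>, and because a direct sum of several degrees can then be
  written as functions on a union. The new differential \<open>i d p\<close> squares to zero since
  \<open>p i\<close> is the identity; for an honest basis \<open>i p\<close> is the identity as
  well.\<close>

lemma coordinatize:
  fixes D :: "int \<Rightarrow> ('m::ab_group_add) set" and S :: "('a::ring_1) set"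
    and B :: "int \<Rightarrow> 'i set" and I :: "int set"
  assumes D: "chain_complex S D d act" and S: "subring S"
    and fin: "\<And>k. finite (B k)" and bd: "\<And>k. k \<notin> I \<Longrightarrow> B k = {}"
    and db: "\<And>k. dual_basis S (D k) act (B k) (b k) (c k)"
  obtains J :: "int \<Rightarrow> nat set" and e i p where "\<And>k. finite (J k)"
    "\<And>k l. k \<noteq> l \<Longrightarrow> J k \<inter> J l = {}" "\<And>k. k \<notin> I \<Longrightarrow> J k = {}"
    "chain_complex S (\<lambda>k. free_mod S (J k)) e free_act"
    "chain_map S D d act (\<lambda>k. free_mod S (J k)) e free_act i"
    "chain_map S (\<lambda>k. free_mod S (J k)) e free_act D d act p"
    "\<And>k x. x \<in> D k \<Longrightarrow> p k (i k x) = x"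
    "(\<And>k u v. u \<in> B k \<Longrightarrow> v \<in> B k \<Longrightarrow> c k u (b k v) = (if u = v then 1 else 0))
      \<Longrightarrow> (\<And>k y. y \<in> free_mod S (J k) \<Longrightarrow> i k (p k y) = y)"
proof -
  \<comment> \<open>The degree serves as a tag that separates the index sets; of \<open>B k\<close>
    only its cardinality matters.\<close>
  define J where "J k = (\<lambda>m. prod_encode (int_encode k, m)) ` {..<card (B k)}" for k
  have J: "finite (J k)" for k
    by (simp add: J_def)
  have disj: "J k \<inter> J l = {}" if "k \<noteq> l" for k l
    using that by (auto simp: J_def int_encode_eq)
  have "card (J k) = card (B k)" for k
    unfolding J_def by (subst card_image) (auto simp: inj_on_def)
  then have "\<forall>k. \<exists>\<beta>. bij_betw \<beta> (J k) (B k)"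
    using J fin finite_same_card_bij by blast
  then obtain \<beta> where \<beta>: "\<And>k. bij_betw (\<beta> k) (J k) (B k)"
    by metis
  have \<beta>B: "\<beta> k j \<in> B k" if "j \<in> J k" for k j
    using \<beta> that by (meson bij_betwE)
  define i where "i k x = (\<lambda>j. if j \<in> J k then c k (\<beta> k j) x else 0)" for k x
  define p where "p k y = (\<Sum>j\<in>J k. act (b k (\<beta> k j)) (y j))" for k y
  define e where "e k y = i (k - 1) (d k (p k y))" for k y
  note M = complex_module[OF D]
  have i: "linear_map S (D k) act (free_mod S (J k)) free_act (i k)" for k
    unfolding i_def by (rule linear_into_free[OF J M subring_0[OF S] dual_basis_linear[OF db \<beta>B]])
  have p: "linear_map S (free_mod S (J k)) free_act (D k) act (p k)" for k
    unfolding p_def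
    by (intro linear_sum_maps[OF M] linear_comp[OF linear_proj] linear_act_const[OF M S] dual_basis_in[OF db] \<beta>B)
  have pi: "p k (i k x) = x" if x: "x \<in> D k" for k x
  proof -
    have "p k (i k x) = (\<Sum>j\<in>J k. act (b k (\<beta> k j)) (c k (\<beta> k j) x))"
      unfolding p_def i_def by simp
    also have "\<dots> = (\<Sum>j\<in>B k. act (b k j) (c k j x))"
      by (rule sum.reindex_bij_betw[OF \<beta>])
    also have "\<dots> = x"
      by (rule dual_basis_expand_superset[OF db M subring_0[OF S] x fin, symmetric]) auto
    finally show ?thesis .
  qed
  have e: "linear_map S (free_mod S (J k)) free_act (free_mod S (J (k - 1))) free_act (e k)" for k
    unfolding e_def by (rule linear_comp[OF linear_comp[OF p complex_linear[OF D]] i])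
  have cm_p: "chain_map S (\<lambda>k. free_mod S (J k)) e free_act D d act p"
    by (rule chain_mapI[OF p]) (simp add: e_def pi complex_d[OF D linear_in[OF p]])
  have cm_i: "chain_map S D d act (\<lambda>k. free_mod S (J k)) e free_act i"
    by (rule chain_mapI[OF i]) (simp add: e_def pi)
  have cc: "chain_complex S (\<lambda>k. free_mod S (J k)) e free_act"
    unfolding chain_complex_def
  proof (intro conjI allI ballI)
    fix k y assume y: "y \<in> free_mod S (J k)"
    then have "d (k - 1) (d k (p k y)) = 0"
      by (intro complex_dd[OF D] linear_in[OF p])
    moreover have "i (k - 1 - 1) 0 = 0"
      by (rule linear_0[OF i module_0[OF M]])
    ultimately show "e (k - 1) (e k y) = 0"
      unfolding e_def using pi[OF complex_d[OF D linear_in[OF p y]]] by simp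
  qed (use e free_mod_module[OF S] in auto)
  have ip: "i k (p k y) = y" if base: "\<And>k u v. u \<in> B k \<Longrightarrow> v \<in> B k \<Longrightarrow> c k u (b k v) = (if u = v then 1 else 0)"
    and y: "y \<in> free_mod S (J k)" for k y
  proof -
    have "i k (p k (unit_vec j)) = unit_vec j" if j: "j \<in> J k" for j
    proof -
      have "p k (unit_vec j) = (\<Sum>l\<in>J k. if l = j then b k (\<beta> k j) else 0)"
        unfolding p_def using dual_basis_in[OF db \<beta>B]
        by (intro sum.cong) (auto simp: unit_vec_def act_1[OF M[of k]] act_0_right[OF M[of k] subring_0[OF S]])
      then have pj: "p k (unit_vec j) = b k (\<beta> k j)"
        using J j by simp
      have "\<beta> k l = \<beta> k j \<longleftrightarrow> l = j" if "l \<in> J k" for l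
        using \<beta>[of k] that j by (auto simp: bij_betw_def inj_on_def)
      then show ?thesis
        unfolding pj using base[OF \<beta>B \<beta>B] j by (auto simp: fun_eq_iff i_def unit_vec_def)
    qed
    then show ?thesis
      using linear_free_eqI[OF linear_comp[OF p i] linear_id S J y] by blast
  qed
  show ?thesis
    by (rule that[of J e i p]) (use J disj bd cc cm_i cm_p pi ip in \<open>auto simp: J_def\<close>)
qed

subsection \<open>Null homotopies\<close>

text \<open>The comparison argument for a bounded below complex of projectives and an exact target:
  degree by degree \<open>f - h d\<close> is a cycle, exactness puts it into the image of
  \<open>e\<close>, and projectivity lifts it.\<close>

lemma null_homotopy:
  fixes f :: "int \<Rightarrow> 'm::ab_group_add \<Rightarrow> 'n::ab_group_add"
  assumes S: "subring S" and X: "chain_complex S X d act" and Y: "chain_complex S Y e act'"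
    and lo: "\<And>k. k < lo \<Longrightarrow> X k = {0}"
    and db: "\<And>k. \<exists>(B::'i set) b c. dual_basis S (X k) act B b c"
    and exact: "\<And>k y. y \<in> Y k \<Longrightarrow> e k y = 0 \<Longrightarrow> \<exists>w\<in>Y (k + 1). e (k + 1) w = y"
    and f: "chain_map S X d act Y e act' f"
  obtains h where "\<And>k. linear_map S (X k) act (Y (k + 1)) act' (h k)"
    "\<And>k x. x \<in> X k \<Longrightarrow> f k x = e (k + 1) (h k x) + h (k - 1) (d k x)"
proof -
  \<comment> \<open>\<open>?P n h\<close> says that \<open>h\<close> is a candidate on degree
    \<open>lo - 1 + n\<close> and that \<open>f - h d\<close> is a cycle one degree higher, which is
    what the next choice needs; \<open>?Q\<close> is the homotopy equation linking consecutive
    choices. At \<open>n = 0\<close> the source is zero.\<close>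
  let ?P = "\<lambda>n h. linear_map S (X (lo - 1 + int n)) act (Y (lo + int n)) act' h
     \<and> (\<forall>x\<in>X (lo + int n). e (lo + int n) (f (lo + int n) x - h (d (lo + int n) x)) = 0)"
  let ?Q = "\<lambda>n h h'. \<forall>x\<in>X (lo + int n). e (lo + int n + 1) (h' x) = f (lo + int n) x - h (d (lo + int n) x)"
  note MX = complex_module[OF X] and MY = complex_module[OF Y]
  have f0: "f k 0 = 0" for k
    by (rule linear_0[OF chain_map_linear[OF f] module_0[OF MX]])
  have e0: "e k 0 = 0" for k
    by (rule linear_0[OF complex_linear[OF Y] module_0[OF MY]])
  have "\<exists>H. \<forall>n. ?P n (H n) \<and> ?Q n (H n) (H (Suc n))"
  proof (rule dependent_nat_choice)
    have "e lo (f lo x - 0) = 0" if "x \<in> X lo" for x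
      using chain_map_comm[OF f that] complex_d[OF X that] lo[of "lo - 1"] f0 by simp
    then have "?P 0 (\<lambda>x. 0)"
      by (simp add: linear_zero[OF MY])
    then show "\<exists>h. ?P 0 h" by blast
  next
    fix h n assume P: "?P n h"
    let ?k = "lo + int n"
    have h: "linear_map S (X (?k - 1)) act (Y ?k) act' h"
      using P by (simp add: algebra_simps)
    let ?g = "\<lambda>x. f ?k x - h (d ?k x)"
    have g: "linear_map S (X ?k) act (Y ?k) act' ?g"
      by (rule linear_minus[OF chain_map_linear[OF f] linear_comp[OF complex_linear[OF X] h] MY])
    obtain B :: "'i set" and b c where db': "dual_basis S (X ?k) act B b c"
      using db by blast
    have "\<exists>h'. linear_map S (X ?k) act (Y (?k + 1)) act' h' \<and> (\<forall>x\<in>X ?k. e (?k + 1) (h' x) = ?g x)"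
    proof (rule dual_basis_lift[OF db' S MX MY MY complex_linear_Suc[OF Y] g])
      fix x assume x: "x \<in> X ?k"
      show "?g x \<in> e (?k + 1) ` Y (?k + 1)"
        using exact[OF linear_in[OF g x]] P x by (metis imageI)
    qed
    then obtain h' where h': "linear_map S (X ?k) act (Y (?k + 1)) act' h'"
      "\<And>x. x \<in> X ?k \<Longrightarrow> e (?k + 1) (h' x) = ?g x"
      by blast
    have "e (?k + 1) (f (?k + 1) x - h' (d (?k + 1) x)) = 0" if x: "x \<in> X (?k + 1)" for x
    proof -
      have dx: "d (?k + 1) x \<in> X ?k"
        by (rule complex_d_Suc[OF X x])
      have "e (?k + 1) (f (?k + 1) x - h' (d (?k + 1) x)) = e (?k + 1) (f (?k + 1) x) - e (?k + 1) (h' (d (?k + 1) x))"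
        by (rule linear_diff[OF complex_linear[OF Y] MY chain_map_in[OF f x] linear_in[OF h'(1) dx]])
      also have "\<dots> = h (d ?k (d (?k + 1) x))"
        using chain_map_comm[OF f x] h'(2)[OF dx] by simp
      also have "\<dots> = 0"
        using complex_dd_Suc[OF X x] linear_0[OF h module_0[OF MX]] by simp
      finally show ?thesis .
    qed
    then have "?P (Suc n) h'"
      using h'(1) by (simp add: algebra_simps)
    moreover have "?Q n h h'"
      using h'(2) by blast
    ultimately show "\<exists>h'. ?P (Suc n) h' \<and> ?Q n h h'" by blast
  qed
  then obtain H where H: "\<And>n. linear_map S (X (lo - 1 + int n)) act (Y (lo + int n)) act' (H n)"
    "\<And>n x. x \<in> X (lo + int n) \<Longrightarrow> e (lo + int n + 1) (H (Suc n) x) = f (lo + int n) x - H n (d (lo + int n) x)"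
    by blast
  define h where "h k = (if k \<ge> lo - 1 then H (nat (k - lo + 1)) else (\<lambda>x. 0))" for k
  show ?thesis
  proof (rule that[of h])
    fix k
    show lin: "linear_map S (X k) act (Y (k + 1)) act' (h k)" for k
    proof (cases "k \<ge> lo - 1")
      case True
      then have "lo - 1 + int (nat (k - lo + 1)) = k" "lo + int (nat (k - lo + 1)) = k + 1"
        by auto
      then show ?thesis
        using H(1)[of "nat (k - lo + 1)"] True by (simp add: h_def)
    qed (simp add: h_def linear_zero[OF MY])
    fix x assume x: "x \<in> X k"
    show "f k x = e (k + 1) (h k x) + h (k - 1) (d k x)"
    proof (cases "k \<ge> lo")
      case True
      define n where "n = nat (k - lo)"
      have k: "k = lo + int n"
        using True by (simp add: n_def)
      have "h k = H (Suc n)" "h (k - 1) = H n"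
        by (simp_all add: h_def k nat_add_distrib)
      then show ?thesis
        using H(2)[of x n] x k by simp
    next
      case False
      then have "X k = {0}" "X (k - 1) = {0}"
        using lo by auto
      moreover have "h k 0 = 0" "h (k - 1) 0 = 0"
        using linear_0[OF lin module_0[OF MX]] by auto
      ultimately show ?thesis
        using x complex_d[OF X x] by (simp add: f0 e0)
    qed
  qed
qed

text \<open>An exact, bounded below complex of projectives is contractible. For the cone of
  \<open>\<psi>\<close>, with modules \<open>C k \<times> T (k - 1)\<close>, the entries of a
  contraction contain a homotopy inverse of \<open>\<psi>\<close> and both homotopies. The
  hypothesis \<open>exact\<close> is exactness of this cone, written out in components.\<close>

lemma homotopy_equiv_of_exact_cone:
  fixes C :: "int \<Rightarrow> ('m::ab_group_add) set" and T :: "int \<Rightarrow> ('n::ab_group_add) set"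
  assumes S: "subring S" and C: "chain_complex S C d act" and T: "chain_complex S T e act'"
    and lo: "\<And>k. k < lo \<Longrightarrow> C k = {0}" "\<And>k. k < lo \<Longrightarrow> T k = {0}"
    and dbC: "\<And>k. \<exists>(B::'i set) b c. dual_basis S (C k) act B b c"
    and dbT: "\<And>k. \<exists>(B::'j set) b c. dual_basis S (T k) act' B b c"
    and \<psi>: "chain_map S T e act' C d act \<psi>"
    and exact: "\<And>k c t. c \<in> C k \<Longrightarrow> t \<in> T (k - 1) \<Longrightarrow> e (k - 1) t = 0 \<Longrightarrow> d k c + \<psi> (k - 1) t = 0
      \<Longrightarrow> \<exists>c'\<in>C (k + 1). \<exists>t'\<in>T k. d (k + 1) c' + \<psi> k t' = c \<and> - e k t' = t"
  shows "homotopy_equiv S C d act T e act'"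
proof -
  define X where "X k = C k \<times> T (k - 1)" for k
  define D where "D k z = (d k (fst z) + \<psi> (k - 1) (snd z), - e (k - 1) (snd z))" for k z
  note MC = complex_module[OF C] and MT = complex_module[OF T]
  note C0 = module_0[OF MC] and T0 = module_0[OF MT]
  have d0: "d k 0 = 0" for k
    by (rule linear_0[OF complex_linear[OF C] C0])
  have e0: "e k 0 = 0" for k
    by (rule linear_0[OF complex_linear[OF T] T0])
  have \<psi>0: "\<psi> k 0 = 0" for k
    by (rule linear_0[OF chain_map_linear[OF \<psi>] T0])
  have X: "chain_complex S X D (pair_act act act')"
    unfolding chain_complex_def
  proof (intro conjI allI ballI)
    fix k
    show "right_module S (X k) (pair_act act act')"
      unfolding X_def by (rule pair_module[OF MC MT])
    have 1: "linear_map S (X k) (pair_act act act') (C k) act fst" "linear_map S (X k) (pair_act act act') (T (k - 1)) act' snd" for k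
      unfolding X_def linear_map_def pair_act_def by auto
    have "linear_map S (X k) (pair_act act act') (C (k - 1)) act (\<lambda>z. d k (fst z) + \<psi> (k - 1) (snd z))"
      by (rule linear_plus[OF linear_comp[OF 1(1) complex_linear[OF C]] linear_comp[OF 1(2) chain_map_linear[OF \<psi>]] MC])
    moreover have "linear_map S (X k) (pair_act act act') (T (k - 1 - 1)) act' (\<lambda>z. - e (k - 1) (snd z))"
      by (rule linear_neg[OF linear_comp[OF 1(2) complex_linear[OF T]] MT])
    ultimately show "linear_map S (X k) (pair_act act act') (X (k - 1)) (pair_act act act') (D k)"
      unfolding linear_map_def X_def D_def by (auto simp: pair_act_def)
    fix z assume "z \<in> X k"
    then have z: "fst z \<in> C k" "snd z \<in> T (k - 1)"
      by (auto simp: X_def)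
    have ez: "e (k - 1) (snd z) \<in> T (k - 1 - 1)"
      by (rule complex_d[OF T z(2)])
    have "d (k - 1) (d k (fst z) + \<psi> (k - 1) (snd z)) = d (k - 1) (\<psi> (k - 1) (snd z))"
      using linear_add[OF complex_linear[OF C] complex_d[OF C z(1)] chain_map_in[OF \<psi> z(2)]]
        complex_dd[OF C z(1)] by simp
    also have "\<dots> = \<psi> (k - 1 - 1) (e (k - 1) (snd z))"
      by (rule chain_map_comm[OF \<psi> z(2)])
    finally show "D (k - 1) (D k z) = 0"
      unfolding D_def zero_prod_def
      using linear_uminus[OF chain_map_linear[OF \<psi>] MT ez] linear_uminus[OF complex_linear[OF T] MT ez]
        complex_dd[OF T z(2)] by simp
  qed
  have dbX: "\<exists>(B::('i + 'j) set) b c. dual_basis S (X k) (pair_act act act') B b c" for k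
  proof -
    obtain B :: "'i set" and b c where 1: "dual_basis S (C k) act B b c"
      using dbC by blast
    obtain B' :: "'j set" and b' c' where 2: "dual_basis S (T (k - 1)) act' B' b' c'"
      using dbT by blast
    show ?thesis
      unfolding X_def using dual_basis_pair[OF 1 2 MC MT] by blast
  qed
  have loX: "X k = {0}" if "k < lo" for k
    using lo(1)[of k] lo(2)[of "k - 1"] that by (auto simp: X_def zero_prod_def)
  have exX: "\<exists>w\<in>X (k + 1). D (k + 1) w = z" if z: "z \<in> X k" "D k z = 0" for k z
  proof -
    have z1: "fst z \<in> C k" "snd z \<in> T (k - 1)" "e (k - 1) (snd z) = 0"
      "d k (fst z) + \<psi> (k - 1) (snd z) = 0"
      using z by (auto simp: X_def D_def zero_prod_def)
    obtain c' t' where "c' \<in> C (k + 1)" "t' \<in> T k" "d (k + 1) c' + \<psi> k t' = fst z" "- e k t' = snd z"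
      using exact[OF z1] by blast
    then show ?thesis
      by (intro bexI[of _ "(c', t')"]) (auto simp: D_def X_def prod_eq_iff)
  qed
  \<comment> \<open>A contraction of the cone, as a null homotopy of its identity. The entry from
    \<open>C\<close> to \<open>T\<close> becomes the inverse of \<open>\<psi>\<close>, the two
    diagonal entries become the homotopies.\<close>
  obtain h where h: "\<And>k. linear_map S (X k) (pair_act act act') (X (k + 1)) (pair_act act act') (h k)"
    "\<And>k x. x \<in> X k \<Longrightarrow> x = D (k + 1) (h k x) + h (k - 1) (D k x)"
    using null_homotopy[OF S X X loX dbX exX chain_map_id] by blast
  define h1 where "h1 k c = fst (h k (c, 0))" for k c
  define f where "f k c = snd (h k (c, 0))" for k c
  define h2 where "h2 k t = snd (h (k + 1) (0, t))" for k t
  have inl: "linear_map S (C k) act (X k) (pair_act act act') (\<lambda>c. (c, 0))" for k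
    unfolding linear_map_def X_def pair_act_def by (auto simp: T0 act_0[OF MT])
  have inr: "linear_map S (T k) act' (X (k + 1)) (pair_act act act') (\<lambda>t. (0, t))" for k
    unfolding linear_map_def X_def pair_act_def by (auto simp: C0 act_0[OF MC])
  have pr: "linear_map S (X (k + 1)) (pair_act act act') (C (k + 1)) act fst"
    "linear_map S (X (k + 1)) (pair_act act act') (T k) act' snd" for k
    unfolding linear_map_def X_def pair_act_def by auto
  have h1: "linear_map S (C k) act (C (k + 1)) act (h1 k)" for k
    unfolding h1_def by (rule linear_comp[OF linear_comp[OF inl h(1)] pr(1)])
  have f: "linear_map S (C k) act (T k) act' (f k)" for k
    unfolding f_def by (rule linear_comp[OF linear_comp[OF inl h(1)] pr(2)])
  have h2: "linear_map S (T k) act' (T (k + 1)) act' (h2 k)" for k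
    unfolding h2_def by (rule linear_comp[OF linear_comp[OF inr h(1)] pr(2)])
  have c1: "c = d (k + 1) (h1 k c) + \<psi> k (f k c) + h1 (k - 1) (d k c)"
    and c2: "e k (f k c) = f (k - 1) (d k c)" if "c \<in> C k" for k c
  proof -
    have "(c, 0) \<in> X k"
      using that T0 by (simp add: X_def)
    from h(2)[OF this] have "(c, 0) = D (k + 1) (h k (c, 0)) + h (k - 1) (d k c, 0)"
      by (simp add: D_def \<psi>0 e0)
    then show "c = d (k + 1) (h1 k c) + \<psi> k (f k c) + h1 (k - 1) (d k c)" "e k (f k c) = f (k - 1) (d k c)"
      by (auto simp: D_def prod_eq_iff h1_def f_def)
  qed
  have t2: "f k (\<psi> k t) - t = e (k + 1) (h2 k t) + h2 (k - 1) (e k t)" if t: "t \<in> T k" for k t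
  proof -
    have "(0, t) \<in> X (k + 1)"
      using t C0 by (simp add: X_def)
    note h(2)[OF this]
    moreover have "D (k + 1) (0, t) = (\<psi> k t, 0) + (- (0, e k t))"
      by (simp add: D_def d0)
    moreover have "h k ((\<psi> k t, 0) + (- (0, e k t))) = h k (\<psi> k t, 0) - h k (0, e k t)"
    proof -
      have 1: "(\<psi> k t, 0) \<in> X k"
        using chain_map_in[OF \<psi> t] T0 by (simp add: X_def)
      have 2: "(0, e k t) \<in> X k"
        using complex_d[OF T t] C0 by (simp add: X_def)
      show ?thesis
        using linear_diff[OF h(1) complex_module[OF X] 1 2] by simp
    qed
    ultimately have "(0, t) = D (k + 1 + 1) (h (k + 1) (0, t)) + (h k (\<psi> k t, 0) - h k (0, e k t))"
      by simp
    then have "t = - e (k + 1) (snd (h (k + 1) (0, t))) + (f k (\<psi> k t) - snd (h k (0, e k t)))"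
      by (simp add: D_def prod_eq_iff f_def add.commute)
    then show ?thesis
      by (simp add: h2_def algebra_simps)
  qed
  have cf: "chain_map S C d act T e act' f"
    by (rule chain_mapI) (use f c2 in auto)
  show ?thesis
    unfolding homotopy_equiv_def
  proof (intro exI conjI)
    show "chain_map S C d act T e act' f" by (rule cf)
    show "chain_map S T e act' C d act \<psi>" by (rule \<psi>)
    show "chain_homotopic S C d act C d act (\<lambda>k x. \<psi> k (f k x)) (\<lambda>k x. x)"
      unfolding chain_homotopic_def
    proof (intro exI[of _ "\<lambda>k c. - h1 k c"] conjI allI ballI)
      show "linear_map S (C k) act (C (k + 1)) act (\<lambda>c. - h1 k c)" for k
        by (rule linear_neg[OF h1 MC])
      fix k c assume c: "c \<in> C k"
      have "d (k + 1) (- h1 k c) = - d (k + 1) (h1 k c)"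
        by (rule linear_uminus[OF complex_linear[OF C] MC linear_in[OF h1 c]])
      moreover have "\<psi> k (f k c) - (d (k + 1) (h1 k c) + \<psi> k (f k c) + h1 (k - 1) (d k c))
          = - d (k + 1) (h1 k c) + - h1 (k - 1) (d k c)"
        by simp
      ultimately show "\<psi> k (f k c) - c = d (k + 1) (- h1 k c) + - h1 (k - 1) (d k c)"
        using c1[OF c] by simp
    qed
    show "chain_homotopic S T e act' T e act' (\<lambda>k x. f k (\<psi> k x)) (\<lambda>k x. x)"
      unfolding chain_homotopic_def using h2 t2 by blast
  qed
qed


section \<open>Complexes dominated by finite free complexes\<close>

definition restrict_to :: "'i set \<Rightarrow> ('i \<Rightarrow> 'a::zero) \<Rightarrow> 'i \<Rightarrow> 'a" where
  "restrict_to A x = (\<lambda>i. if i \<in> A then x i else 0)"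

lemma linear_restrict_to:
  assumes "0 \<in> S"
  shows "linear_map S (free_mod S A) free_act (free_mod S B) free_act (restrict_to B)"
proof -
  have "finite {i. (i \<in> B \<longrightarrow> x i \<noteq> 0) \<and> i \<in> B}" if "finite {i. x i \<noteq> 0}" for x :: "'b \<Rightarrow> 'a"
    by (rule finite_subset[OF _ that]) auto
  then show ?thesis
    unfolding linear_map_def free_mod_def restrict_to_def
    using assms by (auto simp: free_act_def fun_eq_iff)
qed

lemma restrict_to_id: "x \<in> free_mod S A \<Longrightarrow> A \<subseteq> B \<Longrightarrow> restrict_to B x = x"
  unfolding free_mod_def restrict_to_def by (auto simp: fun_eq_iff)

lemma restrict_to_disjoint: "x \<in> free_mod S A \<Longrightarrow> A \<inter> B = {} \<Longrightarrow> restrict_to B x = 0"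
  unfolding free_mod_def restrict_to_def by (auto simp: fun_eq_iff)

text \<open>Let \<open>f\<close>, \<open>g\<close> and a homotopy \<open>h\<close> from \<open>gf\<close> to the identity exhibit \<open>C\<close> as dominated by \<open>F\<close>.
  The modules \<open>P\<^sub>k = \<Oplus>j\<le>k. F\<^sub>j\<close> carry a differential \<open>\<Delta>\<close> for which \<open>P\<close> is homotopy equivalent to \<open>C\<close>
  via \<open>f\<close> and \<open>\<Phi> = (h\<^sup>k\<^sup>-\<^sup>jg)\<^sub>j\<close>; it is determined by requiring that the inclusions
  \<open>P\<^sub>k \<subseteq> P\<^sub>k\<^sub>+\<^sub>1\<close> form a homotopy from \<open>f\<Phi>\<close> to the identity.  Above the top degree of \<open>F\<close> the differential of \<open>P\<close>
  alternates between an idempotent \<open>q\<close> and \<open>1 - q\<close>, so that \<open>P\<close> may be cut off there (the instant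
  finiteness obstruction of Ranicki).\<close>

lemma fin_dominated_of_dominated:
  fixes J :: "int \<Rightarrow> nat set" and S :: "('a::ring_1) set" and C :: "int \<Rightarrow> ('m::ab_group_add) set"
  assumes S: "subring S" and C: "chain_complex S C d act"
    and fin: "\<And>k. finite (J k)" and disj: "\<And>k l. k \<noteq> l \<Longrightarrow> J k \<inter> J l = {}"
    and bd: "\<And>k. k \<notin> {lo..hi} \<Longrightarrow> J k = {}" and lohi: "lo \<le> hi"
    and F: "chain_complex S (\<lambda>k. free_mod S (J k)) e free_act"
    and dom: "dominated S C d act (\<lambda>k. free_mod S (J k)) e free_act"
  shows "fin_dominated S C d act"
proof -
  let ?F = "\<lambda>k. free_mod S (J k)"
  obtain f g where f: "chain_map S C d act ?F e free_act f" and g: "chain_map S ?F e free_act C d act g"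
    and "chain_homotopic S C d act C d act (\<lambda>k x. g k (f k x)) (\<lambda>k x. x)"
    using dom unfolding dominated_def by blast
  then obtain h0 where h0: "\<And>k. linear_map S (C k) act (C (k + 1)) act (h0 k)"
    "\<And>k x. x \<in> C k \<Longrightarrow> g k (f k x) - x = d (k + 1) (h0 k x) + h0 (k - 1) (d k x)"
    unfolding chain_homotopic_def by blast
  note MC = complex_module[OF C] and FM = free_mod_module[OF S]
  note C0 = module_0[OF MC] and F0 = module_0[OF FM]
  have S0: "0 \<in> S"
    using S by (rule subring_0)
  \<comment> \<open>With this sign \<open>d h + h d = 1 - g f\<close>, the form used by the
    recursions below.\<close>
  define h where "h k x = - h0 k x" for k x
  have h: "linear_map S (C k) act (C (k + 1)) act (h k)" for k
    unfolding h_def by (rule linear_neg[OF h0(1) MC])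
  have hh: "d (k + 1) (h k x) = x - g k (f k x) - h (k - 1) (d k x)" if x: "x \<in> C k" for k x
  proof -
    have "d (k + 1) (h k x) = - d (k + 1) (h0 k x)"
      unfolding h_def by (rule linear_uminus[OF complex_linear[OF C] MC linear_in[OF h0(1) x]])
    then show ?thesis
      using h0(2)[OF x] by (simp add: h_def algebra_simps)
  qed
  have f0: "f k 0 = 0" for k by (rule linear_0[OF chain_map_linear[OF f] C0])
  have g0: "g k 0 = 0" for k by (rule linear_0[OF chain_map_linear[OF g] F0])
  have h00: "h k 0 = 0" for k by (rule linear_0[OF h C0])
  have d0: "d k 0 = 0" for k by (rule linear_0[OF complex_linear[OF C] C0])
  have e0: "e k 0 = 0" for k by (rule linear_0[OF complex_linear[OF F] F0])

  \<comment> \<open>Degrees are counted by stages: stage \<open>n\<close> is degree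
    \<open>lo - 1 + n\<close>, so stage 0 carries the zero module and the recursions start
    trivially.\<close>
  define \<kappa> where "\<kappa> n = lo - 1 + int n" for n
  have \<kappa>Suc: "\<kappa> (Suc n) = \<kappa> n + 1" "lo + int n = \<kappa> n + 1" "\<kappa> n + 1 - 1 = \<kappa> n" for n
    by (simp_all add: \<kappa>_def)
  define U where "U n = (\<Union>j\<in>{lo..<lo + int n}. J j)" for n
  have U0: "U 0 = {}"
    by (simp add: U_def)
  have USuc: "U (Suc n) = U n \<union> J (\<kappa> n + 1)" for n
  proof -
    have "{lo..<lo + int (Suc n)} = insert (lo + int n) {lo..<lo + int n}"
      by auto
    then show ?thesis
      by (auto simp: U_def \<kappa>_def)
  qed
  have Ufin: "finite (U n)" for n
    by (simp add: U_def fin)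
  have JU: "J (\<kappa> n + 1) \<inter> U n = {}" for n
  proof -
    have "J (\<kappa> n + 1) \<inter> J j = {}" if "j \<in> {lo..<lo + int n}" for j
      by (rule disj) (use that in \<open>simp add: \<kappa>_def\<close>)
    then show ?thesis
      unfolding U_def by blast
  qed
  have Jlo: "J (\<kappa> 0) = {}"
    by (rule bd) (simp add: \<kappa>_def)
  have JkU: "J (\<kappa> n) \<subseteq> U n" for n
    using Jlo USuc by (cases n) (auto simp: \<kappa>Suc)
  let ?P = "\<lambda>n. free_mod S (U n)"
  have Pmono: "?P n \<subseteq> ?P (Suc n)" for n
    by (rule free_mod_mono) (simp add: USuc)
  have Pmono': "?P (n - 1) \<subseteq> ?P n" for n
    by (cases n) (use Pmono in auto)
  have FP: "?F (\<kappa> n) \<subseteq> ?P n" for n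
    by (rule free_mod_mono[OF JkU])

  \<comment> \<open>Continued by \<open>h\<close> on the old summands and by \<open>g\<close> on the
    new one, which unfolds to powers of \<open>h\<close> applied to \<open>g\<close>.\<close>
  define \<Phi> where "\<Phi> = rec_nat (\<lambda>x. 0)
    (\<lambda>n \<phi> x. h (\<kappa> n) (\<phi> (restrict_to (U n) x)) + g (\<kappa> n + 1) (restrict_to (J (\<kappa> n + 1)) x))"
  have \<Phi>0: "\<Phi> 0 = (\<lambda>x. 0)"
    and \<Phi>Suc: "\<Phi> (Suc n) = (\<lambda>x. h (\<kappa> n) (\<Phi> n (restrict_to (U n) x)) + g (\<kappa> n + 1) (restrict_to (J (\<kappa> n + 1)) x))"
    for n by (simp_all add: \<Phi>_def)
  \<comment> \<open>On the old summands the value is forced by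
    \<open>\<Delta> (Suc n) v + \<Delta> n v = v - f (\<Phi> n v)\<close>, in which the inclusion of
    stages acts as the homotopy; on the new summand it is the differential of
    \<open>F\<close>.\<close>
  define \<Delta> where "\<Delta> = rec_nat (\<lambda>x. 0)
    (\<lambda>n \<delta> x. restrict_to (U n) x - f (\<kappa> n) (\<Phi> n (restrict_to (U n) x)) - \<delta> (restrict_to (U n) x)
       + e (\<kappa> n + 1) (restrict_to (J (\<kappa> n + 1)) x))"
  have \<Delta>0: "\<Delta> 0 = (\<lambda>x. 0)"
    and \<Delta>Suc: "\<Delta> (Suc n) = (\<lambda>x. restrict_to (U n) x - f (\<kappa> n) (\<Phi> n (restrict_to (U n) x)) - \<Delta> n (restrict_to (U n) x)
       + e (\<kappa> n + 1) (restrict_to (J (\<kappa> n + 1)) x))"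
    for n by (simp_all add: \<Delta>_def)
  note rU = linear_restrict_to[OF S0, of "U _" "U _"]
  note rJ = linear_restrict_to[OF S0, of "U _" "J _"]
  have eF: "linear_map S (?F (\<kappa> n + 1)) free_act (?F (\<kappa> n)) free_act (e (\<kappa> n + 1))" for n
    by (rule complex_linear_Suc[OF F])
  have lin\<Phi>: "linear_map S (?P n) free_act (C (\<kappa> n)) act (\<Phi> n)" for n
  proof (induction n)
    case 0
    show ?case unfolding \<Phi>0 by (rule linear_zero[OF MC])
  next
    case (Suc n)
    show ?case
      unfolding \<Phi>Suc \<kappa>Suc
      by (rule linear_plus[OF linear_comp[OF linear_comp[OF rU Suc] h] linear_comp[OF rJ chain_map_linear[OF g]] MC])
  qed
  have lin\<Delta>: "linear_map S (?P n) free_act (?P (n - 1)) free_act (\<Delta> n)" for n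
  proof (induction n)
    case 0
    show ?case unfolding \<Delta>0 by (rule linear_zero[OF FM])
  next
    case (Suc n)
    have 1: "linear_map S (?P (Suc n)) free_act (?P n) free_act (\<lambda>x. f (\<kappa> n) (\<Phi> n (restrict_to (U n) x)))"
      by (rule linear_map_codomain[OF linear_comp[OF linear_comp[OF rU lin\<Phi>] chain_map_linear[OF f]]])
        (use FP linear_in[OF linear_comp[OF linear_comp[OF rU lin\<Phi>] chain_map_linear[OF f]]] in blast)
    have 2: "linear_map S (?P (Suc n)) free_act (?P n) free_act (\<lambda>x. \<Delta> n (restrict_to (U n) x))"
      by (rule linear_map_codomain[OF linear_comp[OF rU Suc]])
        (use Pmono' linear_in[OF linear_comp[OF rU Suc]] in blast)
    have 3: "linear_map S (?P (Suc n)) free_act (?P n) free_act (\<lambda>x. e (\<kappa> n + 1) (restrict_to (J (\<kappa> n + 1)) x))"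
      by (rule linear_map_codomain[OF linear_comp[OF rJ eF]])
        (use FP linear_in[OF linear_comp[OF rJ eF]] in blast)
    show ?case
      unfolding \<Delta>Suc diff_Suc_1 by (intro linear_plus linear_minus rU 1 2 3 FM)
  qed
  have \<Phi>z: "\<Phi> n 0 = 0" for n by (rule linear_0[OF lin\<Phi> F0])
  have \<Delta>z: "\<Delta> n 0 = 0" for n by (rule linear_0[OF lin\<Delta> F0])
  \<comment> \<open>On the newest summand alone only the last term of each recursion
    survives.\<close>
  have onF: "\<Phi> n w = g (\<kappa> n) w" "\<Delta> n w = e (\<kappa> n) w" if w: "w \<in> ?F (\<kappa> n)" for n w
  proof -
    have "\<Phi> n w = g (\<kappa> n) w \<and> \<Delta> n w = e (\<kappa> n) w"
    proof (cases n)
      case 0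
      then have "w = 0"
        using w Jlo free_mod_empty[OF S0] by auto
      then show ?thesis
        using 0 by (simp add: \<Phi>0 \<Delta>0 g0 e0)
    next
      case (Suc m)
      then have w': "w \<in> ?F (\<kappa> m + 1)"
        using w by (simp add: \<kappa>Suc)
      have "restrict_to (U m) w = 0" "restrict_to (J (\<kappa> m + 1)) w = w"
        by (rule restrict_to_disjoint[OF w' JU], rule restrict_to_id[OF w']) simp
      then show ?thesis
        by (simp add: Suc \<Phi>Suc \<Delta>Suc \<Phi>z \<Delta>z h00 f0 \<kappa>Suc)
    qed
    then show "\<Phi> n w = g (\<kappa> n) w" "\<Delta> n w = e (\<kappa> n) w" by auto
  qed
  have onP: "\<Phi> (Suc n) v = h (\<kappa> n) (\<Phi> n v)" "\<Delta> (Suc n) v = v - f (\<kappa> n) (\<Phi> n v) - \<Delta> n v"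
    if v: "v \<in> ?P n" for n v
  proof -
    have "restrict_to (U n) v = v" "restrict_to (J (\<kappa> n + 1)) v = 0"
      by (rule restrict_to_id[OF v order_refl], rule restrict_to_disjoint[OF v]) (use JU in blast)
    then show "\<Phi> (Suc n) v = h (\<kappa> n) (\<Phi> n v)" "\<Delta> (Suc n) v = v - f (\<kappa> n) (\<Phi> n v) - \<Delta> n v"
      by (simp_all add: \<Phi>Suc \<Delta>Suc g0 e0)
  qed
  have \<Phi>in: "v \<in> ?P n \<Longrightarrow> \<Phi> n v \<in> C (\<kappa> n)" for n v by (rule linear_in[OF lin\<Phi>])
  have \<Delta>in: "v \<in> ?P n \<Longrightarrow> \<Delta> n v \<in> ?P (n - 1)" for n v by (rule linear_in[OF lin\<Delta>])
  have fP: "c \<in> C (\<kappa> n) \<Longrightarrow> f (\<kappa> n) c \<in> ?P n" for n c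
    using chain_map_in[OF f] FP by blast
  \<comment> \<open>Both identities go through one induction: expanding
    \<open>\<Delta> (\<Delta> x)\<close> uses the chain map property of \<open>\<Phi>\<close> at the
    preceding stage. At stage 0 the predecessor \<open>n - 1\<close> is 0 again and everything
    vanishes.\<close>
  have comm: "d (\<kappa> n) (\<Phi> n x) = \<Phi> (n - 1) (\<Delta> n x)" "\<Delta> (n - 1) (\<Delta> n x) = 0" if "x \<in> ?P n" for n x
  proof -
    have "d (\<kappa> n) (\<Phi> n x) = \<Phi> (n - 1) (\<Delta> n x) \<and> \<Delta> (n - 1) (\<Delta> n x) = 0"
      using that
    proof (induction n arbitrary: x)
      case 0
      then show ?case by (simp add: \<Phi>0 \<Delta>0 d0)
    next
      case (Suc n x)
      define y z where "y = restrict_to (U n) x" and "z = restrict_to (J (\<kappa> n + 1)) x"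
      have y: "y \<in> ?P n" and z: "z \<in> ?F (\<kappa> n + 1)"
        unfolding y_def z_def using linear_in[OF rU Suc.prems] linear_in[OF rJ Suc.prems] by auto
      have ez: "e (\<kappa> n + 1) z \<in> ?F (\<kappa> n)"
        by (rule complex_d_Suc[OF F z])
      have ezP: "e (\<kappa> n + 1) z \<in> ?P n"
        using ez FP by blast
      have fy: "f (\<kappa> n) (\<Phi> n y) \<in> ?F (\<kappa> n)"
        by (rule chain_map_in[OF f \<Phi>in[OF y]])
      have fyP: "f (\<kappa> n) (\<Phi> n y) \<in> ?P n"
        using fy FP by blast
      have \<Delta>y: "\<Delta> n y \<in> ?P n"
        using \<Delta>in[OF y] Pmono' by blast
      have \<Phi>\<Delta>: "\<Phi> n (\<Delta> n y) = h (\<kappa> n - 1) (d (\<kappa> n) (\<Phi> n y))"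
      proof (cases n)
        case 0
        then show ?thesis by (simp add: \<Phi>0 d0 h00)
      next
        case (Suc m)
        then show ?thesis
          using onP(1)[of "\<Delta> n y" m] \<Delta>in[OF y] Suc.IH[OF y] by (simp add: \<kappa>Suc)
      qed
      have \<Delta>\<Delta>: "\<Delta> n (\<Delta> n y) = \<Delta> n y - f (\<kappa> n - 1) (d (\<kappa> n) (\<Phi> n y))"
      proof (cases n)
        case 0
        then show ?thesis by (simp add: \<Delta>0 \<Phi>0 d0 f0)
      next
        case (Suc m)
        then show ?thesis
          using onP(2)[of "\<Delta> n y" m] \<Delta>in[OF y] Suc.IH[OF y] by (simp add: \<kappa>Suc zero_fun_def)
      qed
      have \<Delta>x: "\<Delta> (Suc n) x = y - f (\<kappa> n) (\<Phi> n y) - \<Delta> n y + e (\<kappa> n + 1) z"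
        and \<Phi>x: "\<Phi> (Suc n) x = h (\<kappa> n) (\<Phi> n y) + g (\<kappa> n + 1) z"
        by (simp_all add: \<Delta>Suc \<Phi>Suc y_def z_def)
      have split: "L (y - f (\<kappa> n) (\<Phi> n y) - \<Delta> n y + e (\<kappa> n + 1) z)
         = L y - L (f (\<kappa> n) (\<Phi> n y)) - L (\<Delta> n y) + L (e (\<kappa> n + 1) z)"
        if "linear_map S (?P n) free_act M a L" for M a and L :: "(nat \<Rightarrow> 'a) \<Rightarrow> 'q::ab_group_add"
        using that y fyP \<Delta>y ezP
        by (simp add: linear_add[OF that] linear_diff[OF that FM] module_diff[OF FM])
      have "d (\<kappa> n + 1) (\<Phi> (Suc n) x) = d (\<kappa> n + 1) (h (\<kappa> n) (\<Phi> n y)) + d (\<kappa> n + 1) (g (\<kappa> n + 1) z)"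
        unfolding \<Phi>x
        by (rule linear_add[OF complex_linear[OF C] linear_in[OF h \<Phi>in[OF y]] chain_map_in[OF g z]])
      also have "\<dots> = \<Phi> n y - g (\<kappa> n) (f (\<kappa> n) (\<Phi> n y)) - h (\<kappa> n - 1) (d (\<kappa> n) (\<Phi> n y)) + g (\<kappa> n) (e (\<kappa> n + 1) z)"
        using hh[OF \<Phi>in[OF y]] chain_map_comm[OF g z] by simp
      also have "\<dots> = \<Phi> n (\<Delta> (Suc n) x)"
        unfolding \<Delta>x split[OF lin\<Phi>] by (simp add: onF(1)[OF fy] onF(1)[OF ez] \<Phi>\<Delta>)
      finally have 1: "d (\<kappa> n + 1) (\<Phi> (Suc n) x) = \<Phi> n (\<Delta> (Suc n) x)" .
      have "\<Delta> n (\<Delta> (Suc n) x) = \<Delta> n y - e (\<kappa> n) (f (\<kappa> n) (\<Phi> n y)) - \<Delta> n (\<Delta> n y) + e (\<kappa> n) (e (\<kappa> n + 1) z)"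
        unfolding \<Delta>x split[OF lin\<Delta>] by (simp add: onF(2)[OF fy] onF(2)[OF ez])
      also have "\<dots> = 0"
        using chain_map_comm[OF f \<Phi>in[OF y]] complex_dd_Suc[OF F z] by (simp add: \<Delta>\<Delta>)
      finally show ?case
        using 1 by (simp add: \<kappa>Suc)
    qed
    then show "d (\<kappa> n) (\<Phi> n x) = \<Phi> (n - 1) (\<Delta> n x)" "\<Delta> (n - 1) (\<Delta> n x) = 0" by auto
  qed

  define N where "N k = nat (k - lo + 1)" for k
  define t where "t = N hi"
  have \<kappa>N: "\<kappa> (N k) = k" if "k \<ge> lo - 1" for k
    using that by (simp add: \<kappa>_def N_def)
  have N1: "N (k - 1) = N k - 1" for k
    by (simp add: N_def nat_diff_distrib')
  have NSuc: "N (k + 1) = Suc (N k)" if "k \<ge> lo - 1" for k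
    using that by (simp add: N_def Suc_nat_eq_nat_zadd1)
  have \<kappa>t: "\<kappa> t = hi"
    unfolding t_def using lohi by (simp add: \<kappa>N)
  have Fhi: "?F k = {0}" if "k > hi" for k
    using bd[of k] that by (simp add: free_mod_empty[OF S0])
  have Flo: "?F k = {0}" if "k < lo" for k
    using bd[of k] that by (simp add: free_mod_empty[OF S0])
  have fhi: "f k c = 0" if "k > hi" "c \<in> C k" for k c
    using chain_map_in[OF f that(2)] Fhi[OF that(1)] by simp
  have flo: "f k c = 0" if "k < lo" "c \<in> C k" for k c
    using chain_map_in[OF f that(2)] Flo[OF that(1)] by simp
  have Plo: "?P (N k) = {0}" if "k < lo" for k
    using that U0 by (simp add: N_def free_mod_empty[OF S0])
  have NU: "U (N k) \<subseteq> U t" if "k \<le> hi" for k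
    unfolding U_def t_def N_def using that by (intro UN_mono) auto
  have UJ: "U (Suc t) = U t"
    using bd[of "hi + 1"] by (simp add: USuc \<kappa>t)
  \<comment> \<open>No summand is added above degree \<open>hi\<close>, so
    \<open>U (Suc t) = U t\<close> and the differential out of stage \<open>Suc t\<close> is an
    endomorphism of the top module. One stage later \<open>f\<close> vanishes, the differential is
    \<open>1 - q\<close>, and the vanishing of its square makes \<open>q\<close> idempotent.\<close>
  define q where "q = \<Delta> (Suc t)"
  have q: "linear_map S (?P t) free_act (?P t) free_act q"
    using lin\<Delta>[of "Suc t"] by (simp add: q_def UJ)
  have qin: "v \<in> ?P t \<Longrightarrow> q v \<in> ?P t" for v by (rule linear_in[OF q])
  have qv: "q v = v - f hi (\<Phi> t v) - \<Delta> t v" if "v \<in> ?P t" for v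
    using onP(2)[OF that] by (simp add: q_def \<kappa>t)
  have \<Delta>q: "\<Delta> t (q v) = 0" if "v \<in> ?P t" for v
    using comm(2)[of v "Suc t"] that by (simp add: q_def UJ)
  have \<Phi>q: "\<Phi> t (q v) = d (hi + 1) (h hi (\<Phi> t v))" if "v \<in> ?P t" for v
    using comm(1)[of v "Suc t"] onP(1)[OF that] that by (simp add: q_def UJ \<kappa>Suc \<kappa>t)
  have qq: "q (q v) = q v" if v: "v \<in> ?P t" for v
  proof -
    have v': "v \<in> ?P (Suc t)" "v \<in> ?P (Suc (Suc t))"
      using v Pmono by blast+
    have "\<Delta> (Suc (Suc t)) v = v - q v"
      unfolding onP(2)[OF v'(1)] using fhi[OF _ \<Phi>in[OF v'(1)]] by (simp add: q_def \<kappa>Suc \<kappa>t)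
    then have "q (v - q v) = 0"
      using comm(2)[OF v'(2)] by (simp add: q_def)
    then show ?thesis
      using linear_diff[OF q FM v qin[OF v]] by simp
  qed

  \<comment> \<open>In degree \<open>hi\<close> the kernel of \<open>q\<close>, which is the image
    of \<open>1 - q\<close>, represents the cokernel of the incoming differential \<open>q\<close>;
    it replaces the exact alternating tail.\<close>
  define Q where "Q k = (if k < hi then ?P (N k) else if k = hi then {x \<in> ?P t. q x = 0} else {0})" for k
  define r where "r k x = (if k \<le> hi then \<Delta> (N k) x else 0)" for k x
  define a where "a k x = (if k < hi then f k x else if k = hi then f k x - q (f k x) else 0)" for k x
  define b where "b k x = (if k \<le> hi then \<Phi> (N k) x else 0)" for k x
  define \<pi> where "\<pi> k x = (if k < hi then restrict_to (U (N k)) x else if k = hi then x - q x else 0)" for k x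
  have kerq: "v - q v \<in> Q hi" if "v \<in> ?P t" for v
    using that linear_diff[OF q FM that qin[OF that]] qq[OF that]
    by (simp add: Q_def module_diff[OF FM] qin)
  have Qhi: "x \<in> ?P t" "q x = 0" if "x \<in> Q hi" for x
    using that by (auto simp: Q_def)
  have QP: "Q k \<subseteq> ?P (N k)" if "k \<le> hi" for k
    using that by (auto simp: Q_def t_def)
  have QPt: "Q k \<subseteq> ?P t" for k
  proof (cases "k \<le> hi")
    case True
    then show ?thesis using QP[OF True] free_mod_mono[OF NU[OF True]] by blast
  next
    case False
    then show ?thesis using F0 by (auto simp: Q_def)
  qed
  have Q0: "0 \<in> Q k" for k
    using F0 linear_0[OF q F0] by (auto simp: Q_def)
  have MQ: "right_module S (Q k) free_act" for k
  proof (cases "k = hi")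
    case True
    have "q (v + w) = 0" if "v \<in> ?P t" "w \<in> ?P t" "q v = 0" "q w = 0" for v w
      using linear_add[OF q that(1,2)] that by simp
    moreover have "q (- v) = 0" if "v \<in> ?P t" "q v = 0" for v
      using linear_uminus[OF q FM that(1)] that by simp
    moreover have "q (free_act v s) = 0" if "v \<in> ?P t" "q v = 0" "s \<in> S" for v s
      using linear_act[OF q that(1,3)] that act_0[OF FM that(3)] by simp
    ultimately show ?thesis
      using FM[of "U t"] True unfolding right_module_def Q_def by (simp add: linear_0[OF q F0])
  next
    case False
    then show ?thesis
      using FM[of "U (N k)"] right_module_zero[OF FM[of "U t"] S] by (simp add: Q_def)
  qed
  have \<pi>: "linear_map S (?P t) free_act (Q k) free_act (\<pi> k)" for k
  proof -
    consider "k < hi" | "k = hi" | "k > hi" by linarith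
    then show ?thesis
    proof cases
      case 1
      then show ?thesis
        unfolding \<pi>_def Q_def using linear_restrict_to[OF S0, of "U t" "U (N k)"] by simp
    next
      case 2
      have "linear_map S (?P t) free_act (?P t) free_act (\<lambda>x. x - q x)"
        by (rule linear_minus[OF linear_id q FM])
      then show ?thesis
        unfolding \<pi>_def using 2 kerq linear_map_codomain[of S "?P t" free_act "?P t" free_act _ "Q hi"]
        by simp
    next
      case 3
      then show ?thesis
        unfolding \<pi>_def using linear_zero[OF MQ] by simp
    qed
  qed
  have \<pi>id: "\<pi> k x = x" if "x \<in> Q k" for k x
    using that restrict_to_id[of x S "U (N k)" "U (N k)"] by (auto simp: \<pi>_def Q_def split: if_splits)
  have rlin: "linear_map S (Q k) free_act (Q (k - 1)) free_act (r k)" for k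
  proof (cases "k \<le> hi")
    case True
    have "linear_map S (Q k) free_act (?P (N k - 1)) free_act (\<Delta> (N k))"
      by (rule linear_map_domain[OF lin\<Delta> QP[OF True]])
    then show ?thesis
      using True unfolding r_def by (simp add: Q_def N1)
  next
    case False
    then show ?thesis
      unfolding r_def using linear_zero[OF MQ] by simp
  qed
  have Qc: "chain_complex S Q r free_act"
    unfolding chain_complex_def
  proof (intro conjI allI ballI)
    fix k x assume x: "x \<in> Q k"
    show "r (k - 1) (r k x) = 0"
    proof (cases "k \<le> hi")
      case True
      then show ?thesis
        using comm(2)[of x "N k"] QP[OF True] x by (auto simp: r_def N1)
    next
      case False
      then show ?thesis
        by (simp add: r_def \<Delta>z)
    qed
  qed (use MQ rlin in auto)
  have alin: "linear_map S (C k) act (Q k) free_act (a k)" for k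
  proof -
    consider "k < lo" | "lo \<le> k" "k < hi" | "k = hi" | "k > hi" by linarith
    then show ?thesis
    proof cases
      case 1
      then have "a k c = 0" if "c \<in> C k" for c
        using lohi flo[OF 1 that] by (simp add: a_def)
      then show ?thesis
        using linear_map_cong[OF linear_zero[OF MQ] _ MC, of k "a k"] by simp
    next
      case 2
      then have "linear_map S (C k) act (?P (N k)) free_act (f k)"
        using linear_map_codomain[OF chain_map_linear[OF f], of k "?P (N k)"] fP[of _ "N k"] \<kappa>N[of k] by simp
      then show ?thesis
        using 2 unfolding a_def by (simp add: Q_def)
    next
      case 3
      have 1: "linear_map S (C hi) act (?P t) free_act (f hi)"
        using linear_map_codomain[OF chain_map_linear[OF f], of hi "?P t"] fP[of _ t] \<kappa>t by simp
      have 2: "linear_map S (?P t) free_act (Q hi) free_act (\<lambda>x. x - q x)"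
        using \<pi>[of hi] by (simp add: \<pi>_def[abs_def])
      show ?thesis
        using linear_comp[OF 1 2] 3 unfolding a_def by simp
    next
      case 4
      then show ?thesis
        unfolding a_def using linear_zero[OF MQ] by simp
    qed
  qed
  have fPk: "f k c \<in> ?P (N k)" if "c \<in> C k" for k c
  proof (cases "k < lo")
    case True
    then show ?thesis using flo[OF True that] F0 by simp
  next
    case False
    then show ?thesis using fP[of c "N k"] that \<kappa>N[of k] by simp
  qed
  have onf: "\<Phi> (N k) (f k c) = g k (f k c)" "\<Delta> (N k) (f k c) = e k (f k c)" if "c \<in> C k" for k c
  proof -
    have "\<Phi> (N k) (f k c) = g k (f k c) \<and> \<Delta> (N k) (f k c) = e k (f k c)"
    proof (cases "k < lo")
      case True
      then show ?thesis using flo[OF True that] by (simp add: \<Phi>z g0 e0 \<Delta>z)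
    next
      case False
      then show ?thesis
        using onF[of "f k c" "N k"] chain_map_in[OF f that] \<kappa>N[of k] by simp
    qed
    then show "\<Phi> (N k) (f k c) = g k (f k c)" "\<Delta> (N k) (f k c) = e k (f k c)" by auto
  qed
  have acm: "chain_map S C d act Q r free_act a"
  proof (rule chain_mapI[OF alin])
    fix k c assume c: "c \<in> C k"
    have ec: "e k (f k c) = f (k - 1) (d k c)"
      by (rule chain_map_comm[OF f c])
    consider "k < hi" | "k = hi" | "k = hi + 1" | "k > hi + 1" by linarith
    then show "r k (a k c) = a (k - 1) (d k c)"
    proof cases
      case 1
      then show ?thesis using onf[OF c] ec by (simp add: a_def r_def)
    next
      case 2
      have fc: "f hi c \<in> ?P t"
        using fPk[OF c] 2 by (simp add: t_def)
      have "\<Delta> t (f hi c - q (f hi c)) = \<Delta> t (f hi c)"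
        using linear_diff[OF lin\<Delta> FM fc qin[OF fc]] \<Delta>q[OF fc] by simp
      then show ?thesis using 2 onf[OF c] ec by (simp add: a_def r_def t_def)
    next
      case 3
      then have "f hi (d k c) = 0"
        using ec fhi[OF _ c] e0 by simp
      then show ?thesis using 3 linear_0[OF q F0] by (simp add: a_def r_def)
    next
      case 4
      then show ?thesis by (simp add: a_def r_def)
    qed
  qed
  have blin: "linear_map S (Q k) free_act (C k) act (b k)" for k
  proof -
    consider "k < lo" | "lo \<le> k" "k \<le> hi" | "k > hi" by linarith
    then show ?thesis
    proof cases
      case 1
      then have "b k = (\<lambda>x. 0)"
        using lohi by (auto simp: b_def N_def \<Phi>0)
      then show ?thesis using linear_zero[OF MC] by simp
    next
      case 2
      then have "linear_map S (Q k) free_act (C k) act (\<Phi> (N k))"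
        using linear_map_domain[OF lin\<Phi> QP] \<kappa>N[of k] by fastforce
      then show ?thesis using 2 unfolding b_def by simp
    next
      case 3
      then show ?thesis
        unfolding b_def using linear_zero[OF MC] by simp
    qed
  qed
  have bcm: "chain_map S Q r free_act C d act b"
  proof (rule chain_mapI[OF blin])
    fix k x assume x: "x \<in> Q k"
    consider "k < lo" | "lo \<le> k" "k \<le> hi" | "k > hi" by linarith
    then show "d k (b k x) = b (k - 1) (r k x)"
    proof cases
      case 1
      then show ?thesis by (simp add: b_def N_def \<Phi>0 d0)
    next
      case 2
      then have "x \<in> ?P (N k)"
        using QP x by blast
      then show ?thesis
        using comm(1)[of x "N k"] 2 \<kappa>N[of k] by (simp add: b_def r_def N1)
    next
      case 3
      then show ?thesis by (simp add: b_def r_def d0 \<Phi>z)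
    qed
  qed
  have hom1: "chain_homotopic S C d act C d act (\<lambda>k x. b k (a k x)) (\<lambda>k x. x)"
  proof -
    \<comment> \<open>In degree \<open>hi\<close> the map \<open>a\<close> carries the factor
      \<open>1 - q\<close>. Since \<open>\<Phi> q = d h \<Phi>\<close>, this costs the extra term
      \<open>h g f\<close>.\<close>
    define H where "H k x = (if k = hi then - (h k x + h k (g k (f k x))) else - h k x)" for k x
    have H: "linear_map S (C k) act (C (k + 1)) act (H k)" for k
    proof (cases "k = hi")
      case True
      have "linear_map S (C k) act (C (k + 1)) act (\<lambda>x. - (h k x + h k (g k (f k x))))"
        by (intro linear_neg linear_plus linear_comp[OF _ h] linear_comp[OF chain_map_linear[OF f] chain_map_linear[OF g]] h MC)
      then show ?thesis using True unfolding H_def by simp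
    next
      case False
      then show ?thesis using linear_neg[OF h MC] unfolding H_def by simp
    qed
    have "b k (a k x) - x = d (k + 1) (H k x) + H (k - 1) (d k x)" if x: "x \<in> C k" for k x
    proof -
      have gf: "g k (f k x) \<in> C k"
        by (rule chain_map_in[OF g chain_map_in[OF f x]])
      have hx: "h k x \<in> C (k + 1)" and hgf: "h k (g k (f k x)) \<in> C (k + 1)"
        using linear_in[OF h] x gf by auto
      have neg: "d (k + 1) (- h k x) = - d (k + 1) (h k x)"
        by (rule linear_uminus[OF complex_linear[OF C] MC hx])
      consider "k < hi" | "k = hi" | "k = hi + 1" | "k > hi + 1" by linarith
      then show ?thesis
      proof cases
        case 1
        then show ?thesis
          using onf[OF x] hh[OF x] neg by (simp add: a_def b_def H_def)
      next
        case 2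
        have fx: "f hi x \<in> ?P t"
          using fPk[OF x] 2 by (simp add: t_def)
        have "b k (a k x) = g hi (f hi x) - d (hi + 1) (h hi (g hi (f hi x)))"
          using linear_diff[OF lin\<Phi> FM fx qin[OF fx]] \<Phi>q[OF fx] onf(1)[OF x] 2
          by (simp add: a_def b_def t_def)
        moreover have "d (k + 1) (- (h k x + h k (g k (f k x)))) = - (d (k + 1) (h k x) + d (k + 1) (h k (g k (f k x))))"
          using linear_uminus[OF complex_linear[OF C] MC module_add[OF MC hx hgf]]
            linear_add[OF complex_linear[OF C] hx hgf] by simp
        ultimately show ?thesis
          using hh[OF x] 2 by (simp add: H_def)
      next
        case 3
        have fx: "f k x = 0"
          using fhi[OF _ x] 3 by simp
        then have "f hi (d k x) = 0"
          using chain_map_comm[OF f x] e0 3 by simp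
        then show ?thesis
          using 3 hh[OF x] neg fx by (simp add: a_def b_def H_def g0 h00)
      next
        case 4
        then have fx: "f k x = 0"
          using fhi[OF _ x] by simp
        then show ?thesis
          using 4 hh[OF x] neg by (simp add: a_def b_def H_def g0)
      qed
    qed
    then show ?thesis
      unfolding chain_homotopic_def using H by blast
  qed
  have hom2: "chain_homotopic S Q r free_act Q r free_act (\<lambda>k x. a k (b k x)) (\<lambda>k x. x)"
  proof -
    \<comment> \<open>The inclusions of consecutive stages with a sign, followed by
      \<open>1 - q\<close> where the target is the kernel of \<open>q\<close>.\<close>
    define H where "H k x = (if k < hi - 1 then - x else if k = hi - 1 then - (x - q x) else 0)" for k x
    have NhiSuc: "t = Suc (N (hi - 1))"
      using NSuc[of "hi - 1"] lohi by (simp add: t_def)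
    have H: "linear_map S (Q k) free_act (Q (k + 1)) free_act (H k)" for k
    proof -
      consider "k < hi - 1" | "k = hi - 1" | "k > hi - 1" by linarith
      then show ?thesis
      proof cases
        case 1
        have "Q k \<subseteq> Q (k + 1)"
        proof (cases "k \<ge> lo - 1")
          case True
          then show ?thesis using 1 Pmono by (simp add: Q_def NSuc)
        next
          case False
          then show ?thesis using 1 Plo[of k] F0 by (simp add: Q_def)
        qed
        then have "linear_map S (Q k) free_act (Q (k + 1)) free_act (\<lambda>x. - x)"
          by (intro linear_neg MQ linear_map_codomain[OF linear_id]) blast
        then show ?thesis using 1 unfolding H_def by simp
      next
        case 2
        have "linear_map S (Q k) free_act (Q hi) free_act (\<pi> hi)"
          by (rule linear_map_domain[OF \<pi> QPt])
        from linear_neg[OF this MQ] have "linear_map S (Q k) free_act (Q hi) free_act (\<lambda>x. - (x - q x))"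
          by (simp add: \<pi>_def)
        then show ?thesis using 2 unfolding H_def by simp
      next
        case 3
        then show ?thesis unfolding H_def using linear_zero[OF MQ] by simp
      qed
    qed
    have "a k (b k x) - x = r (k + 1) (H k x) + H (k - 1) (r k x)" if x: "x \<in> Q k" for k x
    proof -
      consider "k < lo - 1" | "lo - 1 \<le> k" "k < hi - 1" | "k = hi - 1" "lo \<le> hi" | "k = hi" | "k > hi"
        using lohi by linarith
      then show ?thesis
      proof cases
        case 1
        then have "x = 0"
          using x Plo[of k] lohi by (simp add: Q_def)
        then show ?thesis
          using linear_0[OF alin C0] linear_0[OF blin Q0] linear_0[OF rlin Q0] linear_0[OF H Q0] by simp
      next
        case 2
        then have xP: "x \<in> ?P (N k)"
          using x by (simp add: Q_def)
        have xP': "x \<in> ?P (N (k + 1))"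
          using xP Pmono NSuc 2 by auto
        have "\<Delta> (N (k + 1)) (- x) = - \<Delta> (Suc (N k)) x"
          using linear_uminus[OF lin\<Delta> FM xP'] NSuc 2 by simp
        then show ?thesis
          using onP(2)[OF xP] 2 \<kappa>N[of k] by (simp add: a_def b_def r_def H_def)
      next
        case 3
        then have xP: "x \<in> ?P (N k)"
          using x by (simp add: Q_def)
        then have xt: "x \<in> ?P t"
          using Pmono NhiSuc 3 by auto
        have "\<Delta> t (- (x - q x)) = - \<Delta> t x"
          using linear_uminus[OF lin\<Delta> FM module_diff[OF FM xt qin[OF xt]]]
            linear_diff[OF lin\<Delta> FM xt qin[OF xt]] \<Delta>q[OF xt] by simp
        then show ?thesis
          using onP(2)[OF xP] 3 \<kappa>N[of k] NhiSuc by (simp add: a_def b_def r_def H_def t_def)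
      next
        case 4
        have xt: "x \<in> ?P t" and qx: "q x = 0"
          using Qhi x 4 by auto
        have \<Delta>x: "\<Delta> t x \<in> ?P t"
          using \<Delta>in[OF xt] Pmono' by blast
        have fx: "f hi (\<Phi> t x) = x - \<Delta> t x"
          using qv[OF xt] qx by (simp add: algebra_simps)
        have "q (x - \<Delta> t x) = - q (\<Delta> t x)"
          using linear_diff[OF q FM xt \<Delta>x] qx by simp
        then show ?thesis
          using 4 fx by (simp add: a_def b_def r_def H_def t_def)
      next
        case 5
        then have "x = 0"
          using x by (simp add: Q_def)
        then show ?thesis
          using linear_0[OF alin C0] linear_0[OF blin Q0] linear_0[OF rlin Q0] linear_0[OF H Q0] by simp
      qed
    qed
    then show ?thesis
      unfolding chain_homotopic_def using H by blast
  qed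
  have "homotopy_equiv S C d act Q r free_act"
    unfolding homotopy_equiv_def using acm bcm hom1 hom2 by blast
  moreover have "fin_generated S (Q k) free_act \<and> projective_module S (Q k) free_act" for k
    using retract_of_free[OF S Ufin MQ QPt \<pi> \<pi>id] by blast
  moreover have "bounded_complex Q"
    unfolding bounded_complex_def
  proof (intro exI allI impI)
    fix k assume "\<bar>lo\<bar> + \<bar>hi\<bar> < \<bar>k\<bar>"
    then have "k > hi \<or> k < lo \<and> k < hi"
      using lohi by linarith
    then show "Q k = {0}"
      using Plo[of k] by (auto simp: Q_def)
  qed
  ultimately show ?thesis
    unfolding fin_dominated_def using Qc by blast
qed


section \<open>Tensor products\<close>

definition left_module :: "('a::ring_1) set \<Rightarrow> ('n::ab_group_add) set \<Rightarrow> ('a \<Rightarrow> 'n \<Rightarrow> 'n) \<Rightarrow> bool" where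
  "left_module S N lact \<longleftrightarrow> 0 \<in> N \<and> (\<forall>x\<in>N. \<forall>y\<in>N. x + y \<in> N) \<and> (\<forall>x\<in>N. - x \<in> N)
     \<and> (\<forall>a\<in>S. \<forall>x\<in>N. lact a x \<in> N)
     \<and> (\<forall>a\<in>S. \<forall>x\<in>N. \<forall>y\<in>N. lact a (x + y) = lact a x + lact a y)
     \<and> (\<forall>a\<in>S. \<forall>b\<in>S. \<forall>x\<in>N. lact (a + b) x = lact a x + lact b x)
     \<and> (\<forall>a\<in>S. \<forall>b\<in>S. \<forall>x\<in>N. lact (a * b) x = lact a (lact b x))
     \<and> (\<forall>x\<in>N. lact 1 x = x)"

lemma left_moduleD:
  assumes "left_module S N lact"
  shows left_0: "0 \<in> N"
    and left_add: "x \<in> N \<Longrightarrow> y \<in> N \<Longrightarrow> x + y \<in> N"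
    and left_uminus: "x \<in> N \<Longrightarrow> - x \<in> N"
    and left_act: "a \<in> S \<Longrightarrow> x \<in> N \<Longrightarrow> lact a x \<in> N"
    and lact_add: "a \<in> S \<Longrightarrow> x \<in> N \<Longrightarrow> y \<in> N \<Longrightarrow> lact a (x + y) = lact a x + lact a y"
    and lact_add_left: "a \<in> S \<Longrightarrow> b \<in> S \<Longrightarrow> x \<in> N \<Longrightarrow> lact (a + b) x = lact a x + lact b x"
    and lact_mult: "a \<in> S \<Longrightarrow> b \<in> S \<Longrightarrow> x \<in> N \<Longrightarrow> lact (a * b) x = lact a (lact b x)"
    and lact_1: "x \<in> N \<Longrightarrow> lact 1 x = x"
  using assms unfolding left_module_def by auto

lemma left_sum: "left_module S N lact \<Longrightarrow> (\<And>i. i \<in> A \<Longrightarrow> f i \<in> N) \<Longrightarrow> sum f A \<in> N"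
  by (induction A rule: infinite_finite_induct) (auto intro: left_0 left_add)

lemma lact_0: "left_module S N lact \<Longrightarrow> a \<in> S \<Longrightarrow> lact a 0 = 0"
  using lact_add[of S N lact a 0 0] left_0[of S N lact] by simp

lemma lact_0_left: "left_module S N lact \<Longrightarrow> 0 \<in> S \<Longrightarrow> x \<in> N \<Longrightarrow> lact 0 x = 0"
  using lact_add_left[of S N lact 0 0 x] by simp

lemma lact_uminus: "left_module S N lact \<Longrightarrow> a \<in> S \<Longrightarrow> x \<in> N \<Longrightarrow> lact a (- x) = - lact a x"
  using lact_add[of S N lact a x "- x"] lact_0[of S N lact a] left_uminus[of S N lact x]
  by (simp add: eq_neg_iff_add_eq_0 add.commute)

lemma lact_uminus_left:
  "left_module S N lact \<Longrightarrow> subring S \<Longrightarrow> a \<in> S \<Longrightarrow> x \<in> N \<Longrightarrow> lact (- a) x = - lact a x"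
  using lact_add_left[of S N lact a "- a" x] lact_0_left[of S N lact x]
    subring_uminus[of S a] subring_0[of S]
  by (simp add: eq_neg_iff_add_eq_0 add.commute)

lemma lact_sum:
  assumes "left_module S N lact" "a \<in> S"
  shows "(\<And>i. i \<in> A \<Longrightarrow> f i \<in> N) \<Longrightarrow> lact a (sum f A) = (\<Sum>i\<in>A. lact a (f i))"
proof (induction A rule: infinite_finite_induct)
  case (insert i A)
  then show ?case
    using lact_add[OF assms, of "f i" "sum f A"] left_sum[OF assms(1), of A f] by simp
qed (use assms in \<open>auto simp: lact_0\<close>)

lemma lact_sum_left:
  assumes "left_module S N lact" "subring S" "x \<in> N"
  shows "(\<And>i. i \<in> A \<Longrightarrow> f i \<in> S) \<Longrightarrow> lact (sum f A) x = (\<Sum>i\<in>A. lact (f i) x)"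
proof (induction A rule: infinite_finite_induct)
  case (insert i A)
  then show ?case
    using lact_add_left[OF assms(1), of "f i" "sum f A" x] subring_sum[OF assms(2), of A f] assms(3) by simp
qed (use assms in \<open>auto simp: lact_0_left subring_0\<close>)

subsection \<open>Formal sums of pairs\<close>

lemma poly_mapping_sum_single:
  "finite A \<Longrightarrow> Poly_Mapping.keys \<Phi> \<subseteq> A \<Longrightarrow> (\<Sum>p\<in>A. Poly_Mapping.single p (Poly_Mapping.lookup \<Phi> p)) = \<Phi>"
  by (rule poly_mapping_eqI)
    (auto simp: lookup_sum lookup_single when_def in_keys_iff subset_iff)

lemma single_int_induct:
  fixes P :: "('p \<Rightarrow>\<^sub>0 int) \<Rightarrow> bool"
  assumes "P 0" "\<And>\<Phi> \<Psi>. P \<Phi> \<Longrightarrow> P \<Psi> \<Longrightarrow> P (\<Phi> + \<Psi>)" "\<And>\<Phi>. P \<Phi> \<Longrightarrow> P (- \<Phi>)"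
    and "P (Poly_Mapping.single p 1)"
  shows "P (Poly_Mapping.single p m)"
proof -
  have n: "P (Poly_Mapping.single p (int n))" for n
  proof (induction n)
    case (Suc n)
    then have "P (Poly_Mapping.single p (int n) + Poly_Mapping.single p 1)"
      using assms(2,4) by blast
    then show ?case
      by (simp add: single_add[symmetric] add.commute)
  qed (use assms(1) in simp)
  show ?thesis
  proof (cases "m \<ge> 0")
    case True
    then show ?thesis using n[of "nat m"] by simp
  next
    case False
    then have "Poly_Mapping.single p m = - Poly_Mapping.single p (int (nat (- m)))"
      by (simp add: single_uminus[symmetric])
    then show ?thesis using n[of "nat (- m)"] assms(3) by simp
  qed
qed

text \<open>The pairs generate the formal sums as a group, so statements compatible with addition
  and negation need a check on the \<open>gen (x, y)\<close> only.\<close>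

lemma free_ab_induct [consumes 1, case_names zero add neg gen]:
  assumes "\<Phi> \<in> free_ab M N" "P 0" "\<And>\<Phi> \<Psi>. P \<Phi> \<Longrightarrow> P \<Psi> \<Longrightarrow> P (\<Phi> + \<Psi>)" "\<And>\<Phi>. P \<Phi> \<Longrightarrow> P (- \<Phi>)"
    and "\<And>x y. x \<in> M \<Longrightarrow> y \<in> N \<Longrightarrow> P (gen (x, y))"
  shows "P \<Phi>"
proof -
  have "P (\<Sum>p\<in>A. Poly_Mapping.single p (Poly_Mapping.lookup \<Phi> p))" if "A \<subseteq> M \<times> N" for A
    using that
  proof (induction A rule: infinite_finite_induct)
    case (insert p A)
    have "P (Poly_Mapping.single p 1)"
      using assms(5) insert.prems by (auto simp: gen_def)
    then have "P (Poly_Mapping.single p (Poly_Mapping.lookup \<Phi> p))"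
      using assms(2-4) by (rule single_int_induct[rotated -1])
    then show ?case
      using insert assms(3) by simp
  qed (use assms(2) in auto)
  from this[of "Poly_Mapping.keys \<Phi>"] show ?thesis
    using poly_mapping_sum_single[of "Poly_Mapping.keys \<Phi>" \<Phi>] assms(1) by (simp add: free_ab_def)
qed

lemma free_ab_closed:
  shows free_ab_0: "0 \<in> free_ab M N"
    and free_ab_add: "\<Phi> \<in> free_ab M N \<Longrightarrow> \<Psi> \<in> free_ab M N \<Longrightarrow> \<Phi> + \<Psi> \<in> free_ab M N"
    and free_ab_uminus: "\<Phi> \<in> free_ab M N \<Longrightarrow> - \<Phi> \<in> free_ab M N"
    and free_ab_gen: "x \<in> M \<Longrightarrow> y \<in> N \<Longrightarrow> gen (x, y) \<in> free_ab M N"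
proof -
  show "\<Phi> \<in> free_ab M N \<Longrightarrow> \<Psi> \<in> free_ab M N \<Longrightarrow> \<Phi> + \<Psi> \<in> free_ab M N"
    using keys_add[of \<Phi> \<Psi>] unfolding free_ab_def by blast
  show "\<Phi> \<in> free_ab M N \<Longrightarrow> - \<Phi> \<in> free_ab M N"
    unfolding free_ab_def by (auto simp: in_keys_iff subset_iff)
qed (auto simp: free_ab_def gen_def)

lemma free_ab_diff: "\<Phi> \<in> free_ab M N \<Longrightarrow> \<Psi> \<in> free_ab M N \<Longrightarrow> \<Phi> - \<Psi> \<in> free_ab M N"
  using free_ab_add[of \<Phi> M N "- \<Psi>"] free_ab_uminus[of \<Psi> M N] by simp

lemma free_ab_sum: "(\<And>i. i \<in> A \<Longrightarrow> f i \<in> free_ab M N) \<Longrightarrow> sum f A \<in> free_ab M N"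
  by (induction A rule: infinite_finite_induct) (auto intro: free_ab_0 free_ab_add)

text \<open>\<^const>\<open>tensor_map\<close> is typed for endofunctions only.\<close>

definition pair_map :: "('m \<Rightarrow> 'k) \<Rightarrow> ('m \<times> 'n \<Rightarrow>\<^sub>0 int) \<Rightarrow> ('k \<times> 'n \<Rightarrow>\<^sub>0 int)" where
  "pair_map f \<Phi> = (\<Sum>p\<in>Poly_Mapping.keys \<Phi>. Poly_Mapping.single (f (fst p), snd p) (Poly_Mapping.lookup \<Phi> p))"

lemma tensor_map_eq_pair_map: "tensor_map = pair_map"
  by (intro ext) (simp add: tensor_map_def pair_map_def)

lemma pair_map_superset:
  assumes "finite A" "Poly_Mapping.keys \<Phi> \<subseteq> A"
  shows "pair_map f \<Phi> = (\<Sum>p\<in>A. Poly_Mapping.single (f (fst p), snd p) (Poly_Mapping.lookup \<Phi> p))"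
  unfolding pair_map_def
  by (rule sum.mono_neutral_left) (use assms in \<open>auto simp: in_keys_iff\<close>)

lemma pair_map_0 [simp]: "pair_map f 0 = 0"
  by (simp add: pair_map_def)

lemma pair_map_add: "pair_map f (\<Phi> + \<Psi>) = pair_map f \<Phi> + pair_map f \<Psi>"
proof -
  let ?A = "Poly_Mapping.keys \<Phi> \<union> Poly_Mapping.keys \<Psi>"
  have A: "finite ?A" "Poly_Mapping.keys \<Phi> \<subseteq> ?A" "Poly_Mapping.keys \<Psi> \<subseteq> ?A"
    "Poly_Mapping.keys (\<Phi> + \<Psi>) \<subseteq> ?A"
    using keys_add[of \<Phi> \<Psi>] by auto
  show ?thesis
    unfolding pair_map_superset[OF A(1,2)] pair_map_superset[OF A(1,3)] pair_map_superset[OF A(1,4)]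
    by (simp add: lookup_add single_add sum.distrib)
qed

lemma pair_map_uminus: "pair_map f (- \<Phi>) = - pair_map f \<Phi>"
  using pair_map_add[of f \<Phi> "- \<Phi>"] by (simp add: eq_neg_iff_add_eq_0 add.commute)

lemma pair_map_diff: "pair_map f (\<Phi> - \<Psi>) = pair_map f \<Phi> - pair_map f \<Psi>"
  using pair_map_add[of f \<Phi> "- \<Psi>"] pair_map_uminus[of f \<Psi>] by simp

lemma pair_map_sum: "pair_map f (sum g A) = (\<Sum>i\<in>A. pair_map f (g i))"
  by (induction A rule: infinite_finite_induct) (auto simp: pair_map_add)

lemma pair_map_gen [simp]: "pair_map f (gen (x, y)) = gen (f x, y)"
  by (simp add: pair_map_def gen_def)

lemma pair_map_in:
  "\<Phi> \<in> free_ab M N \<Longrightarrow> (\<And>x. x \<in> M \<Longrightarrow> f x \<in> M') \<Longrightarrow> pair_map f \<Phi> \<in> free_ab M' N"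
  by (induction rule: free_ab_induct)
    (auto simp: pair_map_add pair_map_uminus intro: free_ab_closed)

lemma pair_map_cong:
  "\<Phi> \<in> free_ab M N \<Longrightarrow> (\<And>x. x \<in> M \<Longrightarrow> f x = g x) \<Longrightarrow> pair_map f \<Phi> = pair_map g \<Phi>"
  by (induction rule: free_ab_induct) (auto simp: pair_map_add pair_map_uminus)

lemma pair_map_comp: "pair_map g (pair_map f \<Phi>) = pair_map (\<lambda>x. g (f x)) \<Phi>"
proof -
  have "\<Phi> \<in> free_ab UNIV UNIV"
    by (simp add: free_ab_def)
  then show ?thesis
    by (induction rule: free_ab_induct) (auto simp: pair_map_add pair_map_uminus)
qed

lemma pair_map_id: "pair_map (\<lambda>x. x) \<Phi> = \<Phi>"
  unfolding pair_map_def using poly_mapping_sum_single[of "Poly_Mapping.keys \<Phi>" \<Phi>] by simp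

lemma tensor_rel_diff:
  "\<Phi> \<in> tensor_rel S M act N lact \<Longrightarrow> \<Psi> \<in> tensor_rel S M act N lact \<Longrightarrow> \<Phi> - \<Psi> \<in> tensor_rel S M act N lact"
  using tensor_rel.add[OF _ tensor_rel.neg] by fastforce

lemma tensor_rel_sum:
  "(\<And>i. i \<in> A \<Longrightarrow> f i \<in> tensor_rel S M act N lact) \<Longrightarrow> sum f A \<in> tensor_rel S M act N lact"
  by (induction A rule: infinite_finite_induct) (auto intro: tensor_rel.zero tensor_rel.add)

lemma tensor_rel_trans:
  "\<Phi> - \<Psi> \<in> tensor_rel S M act N lact \<Longrightarrow> \<Psi> - \<Xi> \<in> tensor_rel S M act N lact \<Longrightarrow> \<Phi> - \<Xi> \<in> tensor_rel S M act N lact"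
  using tensor_rel.add by fastforce

lemma tensor_rel_sym:
  "\<Phi> - \<Psi> \<in> tensor_rel S M act N lact \<Longrightarrow> \<Psi> - \<Phi> \<in> tensor_rel S M act N lact"
  using tensor_rel.neg by fastforce

lemma tensor_rel_sum_diff:
  "(\<And>i. i \<in> A \<Longrightarrow> f i - g i \<in> tensor_rel S M act N lact) \<Longrightarrow> sum f A - sum g A \<in> tensor_rel S M act N lact"
  using tensor_rel_sum[of A "\<lambda>i. f i - g i" S M act N lact] by (simp add: sum_subtractf)

lemma tensor_rel_map:
  assumes "\<Phi> \<in> tensor_rel S M act N lact" "linear_map S M act M' act' f"
  shows "pair_map f \<Phi> \<in> tensor_rel S M' act' N lact"
  using assms(1)
proof induction
  case (addl x x' y)
  then show ?case
    by (simp add: pair_map_diff linear_add[OF assms(2)] tensor_rel.addl linear_in[OF assms(2)])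
next
  case (addr x y y')
  then show ?case
    by (simp add: pair_map_diff tensor_rel.addr linear_in[OF assms(2)])
next
  case (bal x y a)
  then show ?case
    by (simp add: pair_map_diff linear_act[OF assms(2)] tensor_rel.bal linear_in[OF assms(2)])
qed (auto simp: pair_map_add pair_map_uminus intro: tensor_rel.intros)

lemma gen_zero_left: "0 \<in> M \<Longrightarrow> y \<in> N \<Longrightarrow> gen (0, y) \<in> tensor_rel S M act N lact"
  using tensor_rel.neg[OF tensor_rel.addl[of 0 M 0 y N]] by simp

lemma gen_zero_right: "x \<in> M \<Longrightarrow> 0 \<in> N \<Longrightarrow> gen (x, 0) \<in> tensor_rel S M act N lact"
  using tensor_rel.neg[OF tensor_rel.addr[of x M 0 N 0]] by simp

lemma gen_sum_left:
  assumes M: "right_module S M act" and y: "y \<in> N"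
  shows "(\<And>i. i \<in> A \<Longrightarrow> x i \<in> M) \<Longrightarrow> gen (sum x A, y) - (\<Sum>i\<in>A. gen (x i, y)) \<in> tensor_rel S M act N lact"
proof (induction A rule: infinite_finite_induct)
  case (insert i A)
  then have "gen (x i + sum x A, y) - gen (x i, y) - gen (sum x A, y) \<in> tensor_rel S M act N lact"
    by (intro tensor_rel.addl module_sum[OF M] y) auto
  then show ?case
    using insert tensor_rel.add[of "gen (x i + sum x A, y) - gen (x i, y) - gen (sum x A, y)" S M act N lact
        "gen (sum x A, y) - (\<Sum>i\<in>A. gen (x i, y))"]
    by (simp add: algebra_simps)
qed (use gen_zero_left[OF module_0[OF M] y] in auto)

lemma gen_sum_right:
  assumes N: "left_module S N lact" and x: "x \<in> M"
  shows "(\<And>i. i \<in> A \<Longrightarrow> y i \<in> N) \<Longrightarrow> gen (x, sum y A) - (\<Sum>i\<in>A. gen (x, y i)) \<in> tensor_rel S M act N lact"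
proof (induction A rule: infinite_finite_induct)
  case (insert i A)
  then have "gen (x, y i + sum y A) - gen (x, y i) - gen (x, sum y A) \<in> tensor_rel S M act N lact"
    by (intro tensor_rel.addr left_sum[OF N] x) auto
  then show ?case
    using insert tensor_rel.add[of "gen (x, y i + sum y A) - gen (x, y i) - gen (x, sum y A)" S M act N lact
        "gen (x, sum y A) - (\<Sum>i\<in>A. gen (x, y i))"]
    by (simp add: algebra_simps)
qed (use gen_zero_right[OF x left_0[OF N]] in auto)

text \<open>On formal sums \<open>pair_map\<close> is not additive in the map; it becomes so modulo
  the bilinearity relations.\<close>

lemma pair_map_plus:
  assumes "\<Phi> \<in> free_ab M N" "\<And>x. x \<in> M \<Longrightarrow> f x \<in> M'" "\<And>x. x \<in> M \<Longrightarrow> g x \<in> M'"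
  shows "pair_map (\<lambda>x. f x + g x) \<Phi> - (pair_map f \<Phi> + pair_map g \<Phi>) \<in> tensor_rel S M' act N lact"
  using assms(1)
proof (induction rule: free_ab_induct)
  case (add \<Phi> \<Psi>)
  from tensor_rel.add[OF this] show ?case
    by (simp add: pair_map_add algebra_simps)
next
  case (neg \<Phi>)
  from tensor_rel.neg[OF this] show ?case
    by (simp add: pair_map_uminus algebra_simps)
next
  case (gen x y)
  then show ?case
    using tensor_rel.addl[OF assms(2,3)[OF gen(1)] gen(2)] by (simp add: algebra_simps)
qed (auto intro: tensor_rel.zero)

text \<open>The usual argument for homotopy retracts, carried out on representatives: push a cycle
  to \<open>D\<close>, bound it there, pull back, and correct by the homotopy. The identities that
  use additivity hold only up to \<open>tensor_rel\<close>.\<close>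

lemma tensor_acyclic_dominated:
  assumes C: "chain_complex S C d act" and D: "chain_complex S D e act'"
    and dom: "dominated S C d act D e act'" and acyc: "tensor_acyclic S D e act' N lact"
  shows "tensor_acyclic S C d act N lact"
  unfolding tensor_acyclic_def tensor_map_eq_pair_map
proof (intro allI ballI impI)
  fix k \<Phi>
  assume \<Phi>: "\<Phi> \<in> free_ab (C k) N" and d\<Phi>: "pair_map (d k) \<Phi> \<in> tensor_rel S (C (k - 1)) act N lact"
  obtain f g where f: "chain_map S C d act D e act' f" and g: "chain_map S D e act' C d act g"
    and "chain_homotopic S C d act C d act (\<lambda>k x. g k (f k x)) (\<lambda>k x. x)"
    using dom unfolding dominated_def by blast
  then obtain h where h: "\<And>k. linear_map S (C k) act (C (k + 1)) act (h k)"
    "\<And>k x. x \<in> C k \<Longrightarrow> g k (f k x) - x = d (k + 1) (h k x) + h (k - 1) (d k x)"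
    unfolding chain_homotopic_def by blast
  let ?R = "tensor_rel S (C k) act N lact"
  note MC = complex_module[OF C]
  have f\<Phi>: "pair_map (f k) \<Phi> \<in> free_ab (D k) N"
    by (rule pair_map_in[OF \<Phi> chain_map_in[OF f]])
  have "pair_map (e k) (pair_map (f k) \<Phi>) = pair_map (f (k - 1)) (pair_map (d k) \<Phi>)"
    unfolding pair_map_comp by (rule pair_map_cong[OF \<Phi>]) (rule chain_map_comm[OF f])
  then have "pair_map (e k) (pair_map (f k) \<Phi>) \<in> tensor_rel S (D (k - 1)) act' N lact"
    using tensor_rel_map[OF d\<Phi> chain_map_linear[OF f]] by simp
  then obtain \<Psi> where \<Psi>: "\<Psi> \<in> free_ab (D (k + 1)) N"
    and 1: "pair_map (f k) \<Phi> - pair_map (e (k + 1)) \<Psi> \<in> tensor_rel S (D k) act' N lact"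
    using acyc f\<Phi> unfolding tensor_acyclic_def tensor_map_eq_pair_map by blast
  have "pair_map (g k) (pair_map (e (k + 1)) \<Psi>) = pair_map (d (k + 1)) (pair_map (g (k + 1)) \<Psi>)"
    unfolding pair_map_comp by (rule pair_map_cong[OF \<Psi>]) (use chain_map_comm[OF g] in fastforce)
  then have 2: "pair_map (\<lambda>x. g k (f k x)) \<Phi> - pair_map (d (k + 1)) (pair_map (g (k + 1)) \<Psi>) \<in> ?R"
    using tensor_rel_map[OF 1 chain_map_linear[OF g]] by (simp add: pair_map_diff pair_map_comp)
  have hd: "linear_map S (C (k - 1)) act (C k) act (h (k - 1))"
    using h(1)[of "k - 1"] by simp
  have 3: "pair_map (\<lambda>x. h (k - 1) (d k x)) \<Phi> \<in> ?R"
    using tensor_rel_map[OF d\<Phi> hd] by (simp add: pair_map_comp)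
  have in1: "d (k + 1) (h k x) \<in> C k" "h (k - 1) (d k x) \<in> C k" if "x \<in> C k" for x
    using complex_d_Suc[OF C linear_in[OF h(1) that]] linear_in[OF hd complex_d[OF C that]] by auto
  \<comment> \<open>Together with \<open>5\<close> this splits \<open>1 + (d h + h d)\<close> into
    its summands on representatives; \<open>6\<close> identifies the unsplit map with
    \<open>g f\<close>.\<close>
  have 4: "pair_map (\<lambda>x. x + (d (k + 1) (h k x) + h (k - 1) (d k x))) \<Phi>
      - (pair_map (\<lambda>x. x) \<Phi> + pair_map (\<lambda>x. d (k + 1) (h k x) + h (k - 1) (d k x)) \<Phi>) \<in> ?R"
    by (rule pair_map_plus[OF \<Phi>]) (use in1 module_add[OF MC] in auto)
  have 5: "pair_map (\<lambda>x. d (k + 1) (h k x) + h (k - 1) (d k x)) \<Phi>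
      - (pair_map (\<lambda>x. d (k + 1) (h k x)) \<Phi> + pair_map (\<lambda>x. h (k - 1) (d k x)) \<Phi>) \<in> ?R"
    by (rule pair_map_plus[OF \<Phi>]) (use in1 in auto)
  have 6: "pair_map (\<lambda>x. x + (d (k + 1) (h k x) + h (k - 1) (d k x))) \<Phi> = pair_map (\<lambda>x. g k (f k x)) \<Phi>"
    by (rule pair_map_cong[OF \<Phi>]) (use h(2) in \<open>simp add: algebra_simps\<close>)
  let ?\<Psi> = "pair_map (g (k + 1)) \<Psi> - pair_map (h k) \<Phi>"
  have "(pair_map (\<lambda>x. g k (f k x)) \<Phi> - pair_map (d (k + 1)) (pair_map (g (k + 1)) \<Psi>))
     - (pair_map (\<lambda>x. x + (d (k + 1) (h k x) + h (k - 1) (d k x))) \<Phi>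
      - (pair_map (\<lambda>x. x) \<Phi> + pair_map (\<lambda>x. d (k + 1) (h k x) + h (k - 1) (d k x)) \<Phi>))
     - (pair_map (\<lambda>x. d (k + 1) (h k x) + h (k - 1) (d k x)) \<Phi>
      - (pair_map (\<lambda>x. d (k + 1) (h k x)) \<Phi> + pair_map (\<lambda>x. h (k - 1) (d k x)) \<Phi>))
     - pair_map (\<lambda>x. h (k - 1) (d k x)) \<Phi> \<in> ?R"
    by (intro tensor_rel_diff 2 3 4 5)
  then have "\<Phi> - pair_map (d (k + 1)) ?\<Psi> \<in> ?R"
    unfolding 6 pair_map_diff pair_map_id pair_map_comp by (simp add: algebra_simps)
  moreover have "?\<Psi> \<in> free_ab (C (k + 1)) N"
    by (rule free_ab_diff[OF pair_map_in[OF \<Psi> chain_map_in[OF g]] pair_map_in[OF \<Phi> linear_in[OF h(1)]]])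
  ultimately show "\<exists>\<Psi>\<in>free_ab (C (k + 1)) N. \<Phi> - pair_map (d (k + 1)) \<Psi> \<in> ?R"
    by blast
qed

subsection \<open>Matrices acting on columns\<close>

definition cols :: "'n set \<Rightarrow> 'i set \<Rightarrow> ('i \<Rightarrow> 'n::zero) set" where
  "cols N J = {z. (\<forall>j. z j \<in> N) \<and> (\<forall>j. j \<notin> J \<longrightarrow> z j = 0)}"

text \<open>The map \<open>e \<otimes> N\<close> after identifying \<open>M \<otimes> N\<close>, for
  free \<open>M\<close>, with columns over \<open>N\<close>. Only the values of \<open>e\<close> on
  unit vectors enter, and they multiply from the left.\<close>

definition mat :: "('a::ring_1 \<Rightarrow> 'n::ab_group_add \<Rightarrow> 'n) \<Rightarrow> 'i set \<Rightarrow> (('i \<Rightarrow> 'a) \<Rightarrow> 'l \<Rightarrow> 'a)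
    \<Rightarrow> ('i \<Rightarrow> 'n) \<Rightarrow> 'l \<Rightarrow> 'n" where
  "mat lact J e z = (\<lambda>i. \<Sum>j\<in>J. lact (e (unit_vec j) i) (z j))"

lemma cols_in: "z \<in> cols N J \<Longrightarrow> z j \<in> N"
  by (simp add: cols_def)

lemma cols_0: "left_module S N lact \<Longrightarrow> 0 \<in> cols N J"
  by (simp add: cols_def left_0)

lemma cols_add: "left_module S N lact \<Longrightarrow> z \<in> cols N J \<Longrightarrow> w \<in> cols N J \<Longrightarrow> z + w \<in> cols N J"
  by (simp add: cols_def left_add)

lemma cols_uminus: "left_module S N lact \<Longrightarrow> z \<in> cols N J \<Longrightarrow> - z \<in> cols N J"
  by (simp add: cols_def left_uminus)

lemma cols_diff: "left_module S N lact \<Longrightarrow> z \<in> cols N J \<Longrightarrow> w \<in> cols N J \<Longrightarrow> z - w \<in> cols N J"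
  using cols_add[of S N lact z J "- w"] cols_uminus[of S N lact w J] by simp

context
  fixes S :: "('a::ring_1) set" and N :: "('n::ab_group_add) set" and lact
  assumes S: "subring S" and N: "left_module S N lact"
begin

lemma mat_coeff:
  assumes "linear_map S (free_mod S J) free_act (free_mod S J') free_act e" "j \<in> J"
  shows "e (unit_vec j) i \<in> S" "i \<notin> J' \<Longrightarrow> e (unit_vec j) i = 0"
  using linear_in[OF assms(1) unit_vec_in[OF S assms(2)]] by (auto simp: free_mod_def)

lemma mat_in:
  assumes "linear_map S (free_mod S J) free_act (free_mod S J') free_act e" "z \<in> cols N J"
  shows "mat lact J e z \<in> cols N J'"
  using mat_coeff[OF assms(1)] cols_in[OF assms(2)] lact_0_left[OF N subring_0[OF S]]
  unfolding cols_def mat_def by (auto intro!: left_sum[OF N] left_act[OF N])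

lemma mat_add:
  assumes "linear_map S (free_mod S J) free_act (free_mod S J') free_act e" "z \<in> cols N J" "w \<in> cols N J"
  shows "mat lact J e (z + w) = mat lact J e z + mat lact J e w"
  using mat_coeff[OF assms(1)] cols_in[OF assms(2)] cols_in[OF assms(3)]
  by (simp add: mat_def fun_eq_iff lact_add[OF N] sum.distrib)

lemma mat_0:
  assumes "linear_map S (free_mod S J) free_act (free_mod S J') free_act e"
  shows "mat lact J e 0 = 0"
  using mat_coeff[OF assms(1)] by (simp add: mat_def fun_eq_iff lact_0[OF N])

lemma mat_uminus:
  assumes "linear_map S (free_mod S J) free_act (free_mod S J') free_act e" "z \<in> cols N J"
  shows "mat lact J e (- z) = - mat lact J e z"
  using mat_coeff[OF assms(1)] cols_in[OF assms(2)]
  by (simp add: mat_def fun_eq_iff lact_uminus[OF N] sum_negf)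

lemma mat_diff:
  assumes "linear_map S (free_mod S J) free_act (free_mod S J') free_act e" "z \<in> cols N J" "w \<in> cols N J"
  shows "mat lact J e (z - w) = mat lact J e z - mat lact J e w"
  using mat_add[OF assms(1,2) cols_uminus[OF N assms(3)]] mat_uminus[OF assms(1,3)] by simp

lemma mat_cong: "(\<And>j. j \<in> J \<Longrightarrow> e (unit_vec j) = e' (unit_vec j)) \<Longrightarrow> mat lact J e z = mat lact J e' z"
  unfolding mat_def by simp

lemma mat_id:
  assumes "finite J" "z \<in> cols N J"
  shows "mat lact J (\<lambda>x. x) z = z"
proof
  fix i
  have "mat lact J (\<lambda>x. x) z i = (\<Sum>j\<in>J. if j = i then z i else 0)"
    unfolding mat_def using cols_in[OF assms(2)]
    by (intro sum.cong) (auto simp: unit_vec_def lact_1[OF N] lact_0_left[OF N subring_0[OF S]])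
  then show "mat lact J (\<lambda>x. x) z i = z i"
    using assms by (simp add: cols_def)
qed

lemma mat_plus_maps:
  assumes "linear_map S (free_mod S J) free_act (free_mod S J') free_act e"
    "linear_map S (free_mod S J) free_act (free_mod S J') free_act e'" "z \<in> cols N J"
  shows "mat lact J (\<lambda>x. e x + e' x) z = mat lact J e z + mat lact J e' z"
  using mat_coeff[OF assms(1)] mat_coeff[OF assms(2)] cols_in[OF assms(3)]
  by (simp add: mat_def fun_eq_iff lact_add_left[OF N] sum.distrib)

lemma mat_neg_map:
  assumes "linear_map S (free_mod S J) free_act (free_mod S J') free_act e" "z \<in> cols N J"
  shows "mat lact J (\<lambda>x. - e x) z = - mat lact J e z"
  using mat_coeff[OF assms(1)] cols_in[OF assms(2)]
  by (simp add: mat_def fun_eq_iff lact_uminus_left[OF N S] sum_negf)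

lemma mat_minus_maps:
  assumes "linear_map S (free_mod S J) free_act (free_mod S J') free_act e"
    "linear_map S (free_mod S J) free_act (free_mod S J') free_act e'" "z \<in> cols N J"
  shows "mat lact J (\<lambda>x. e x - e' x) z = mat lact J e z - mat lact J e' z"
  using mat_plus_maps[OF assms(1) linear_neg[OF assms(2) free_mod_module[OF S]] assms(3)]
    mat_neg_map[OF assms(2,3)] by simp

lemma lact_linear_coeff:
  assumes "linear_map S (free_mod S J) free_act (free_mod S J') free_act e"
    and "finite J" "x \<in> free_mod S J" "y \<in> N"
  shows "lact (e x l) y = (\<Sum>j\<in>J. lact (e (unit_vec j) l) (lact (x j) y))"
proof -
  have x: "x j \<in> S" for j
    using assms(3) by (simp add: free_mod_def)
  have "lact (e x l) y = lact (\<Sum>j\<in>J. e (unit_vec j) l * x j) y"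
    using linear_on_free[OF assms(1) S assms(2,3)] by (simp add: sum_fun_apply free_act_def)
  also have "\<dots> = (\<Sum>j\<in>J. lact (e (unit_vec j) l * x j) y)"
    by (rule lact_sum_left[OF N S assms(4)]) (use mat_coeff[OF assms(1)] x subring_mult[OF S] in auto)
  also have "\<dots> = (\<Sum>j\<in>J. lact (e (unit_vec j) l) (lact (x j) y))"
    by (rule sum.cong) (use mat_coeff[OF assms(1)] x assms(4) in \<open>auto simp: lact_mult[OF N]\<close>)
  finally show ?thesis .
qed

lemma mat_comp:
  assumes e: "linear_map S (free_mod S J) free_act (free_mod S J') free_act e"
    and e': "linear_map S (free_mod S J') free_act (free_mod S J'') free_act e'"
    and fin: "finite J'" and z: "z \<in> cols N J"
  shows "mat lact J' e' (mat lact J e z) = mat lact J (\<lambda>x. e' (e x)) z"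
proof
  fix l
  have "mat lact J (\<lambda>x. e' (e x)) z l = (\<Sum>j\<in>J. \<Sum>i\<in>J'. lact (e' (unit_vec i) l) (lact (e (unit_vec j) i) (z j)))"
    unfolding mat_def
    by (intro sum.cong refl lact_linear_coeff[OF e' fin] cols_in[OF z] linear_in[OF e] unit_vec_in[OF S])
  also have "\<dots> = (\<Sum>i\<in>J'. \<Sum>j\<in>J. lact (e' (unit_vec i) l) (lact (e (unit_vec j) i) (z j)))"
    by (rule sum.swap)
  also have "\<dots> = (\<Sum>i\<in>J'. lact (e' (unit_vec i) l) (\<Sum>j\<in>J. lact (e (unit_vec j) i) (z j)))"
    by (intro sum.cong refl lact_sum[OF N, symmetric] mat_coeff(1)[OF e'] left_act[OF N] mat_coeff(1)[OF e] cols_in[OF z])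
  finally show "mat lact J' e' (mat lact J e z) l = mat lact J (\<lambda>x. e' (e x)) z l"
    by (simp add: mat_def)
qed

text \<open>Balancing moves the matrix entries of \<open>e\<close> across the tensor sign. The outer
  map \<open>u\<close> lets the sums be formed in a module that is merely a retract of the free
  one.\<close>

lemma gen_mat:
  assumes e: "linear_map S (free_mod S J) free_act (free_mod S J') free_act e"
    and u: "linear_map S (free_mod S J') free_act M act u" and M: "right_module S M act"
    and fin: "finite J'" and z: "z \<in> cols N J"
  shows "(\<Sum>j\<in>J. gen (u (e (unit_vec j)), z j)) - (\<Sum>l\<in>J'. gen (u (unit_vec l), mat lact J e z l))
    \<in> tensor_rel S M act N lact"
proof -
  let ?R = "tensor_rel S M act N lact"
  note eS = mat_coeff(1)[OF e] and zN = cols_in[OF z]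
  have uM: "u (unit_vec l) \<in> M" if "l \<in> J'" for l
    using linear_in[OF u unit_vec_in[OF S that]] .
  have 1: "(\<Sum>j\<in>J. gen (u (e (unit_vec j)), z j))
      - (\<Sum>j\<in>J. \<Sum>l\<in>J'. gen (u (unit_vec l), lact (e (unit_vec j) l) (z j))) \<in> ?R"
  proof (rule tensor_rel_sum_diff)
    fix j assume j: "j \<in> J"
    have "u (e (unit_vec j)) = (\<Sum>l\<in>J'. act (u (unit_vec l)) (e (unit_vec j) l))"
      by (rule linear_on_free[OF u S fin linear_in[OF e unit_vec_in[OF S j]]])
    then have "gen (u (e (unit_vec j)), z j) - (\<Sum>l\<in>J'. gen (act (u (unit_vec l)) (e (unit_vec j) l), z j)) \<in> ?R"
      using gen_sum_left[OF M zN, of J' "\<lambda>l. act (u (unit_vec l)) (e (unit_vec j) l)" j lact]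
        uM eS[OF j] module_act[OF M] by simp
    moreover have "(\<Sum>l\<in>J'. gen (act (u (unit_vec l)) (e (unit_vec j) l), z j))
        - (\<Sum>l\<in>J'. gen (u (unit_vec l), lact (e (unit_vec j) l) (z j))) \<in> ?R"
      by (intro tensor_rel_sum_diff tensor_rel.bal uM zN eS j)
    ultimately show "gen (u (e (unit_vec j)), z j)
        - (\<Sum>l\<in>J'. gen (u (unit_vec l), lact (e (unit_vec j) l) (z j))) \<in> ?R"
      by (rule tensor_rel_trans)
  qed
  have 2: "(\<Sum>l\<in>J'. gen (u (unit_vec l), mat lact J e z l))
      - (\<Sum>l\<in>J'. \<Sum>j\<in>J. gen (u (unit_vec l), lact (e (unit_vec j) l) (z j))) \<in> ?R"
    unfolding mat_def
    by (intro tensor_rel_sum_diff gen_sum_right[OF N] uM left_act[OF N] eS zN)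
  have "(\<Sum>l\<in>J'. gen (u (unit_vec l), mat lact J e z l))
      - (\<Sum>j\<in>J. \<Sum>l\<in>J'. gen (u (unit_vec l), lact (e (unit_vec j) l) (z j))) \<in> ?R"
    by (subst sum.swap) (rule 2)
  then show ?thesis
    using tensor_rel_trans[OF 1 tensor_rel_sym] by blast
qed

end

text \<open>The identification of \<open>M \<otimes> N\<close> with columns over \<open>N\<close> given by coordinates \<open>\<iota>\<close> on \<open>M\<close>.\<close>

definition tensor_col :: "('a::ring_1 \<Rightarrow> ('e \<Rightarrow> 'b::ring_1) \<Rightarrow> 'e \<Rightarrow> 'b) \<Rightarrow> ('m \<Rightarrow> 'i \<Rightarrow> 'a)
    \<Rightarrow> ('m \<times> ('e \<Rightarrow> 'b) \<Rightarrow>\<^sub>0 int) \<Rightarrow> 'i \<Rightarrow> 'e \<Rightarrow> 'b" where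
  "tensor_col lact \<iota> \<Phi> = (\<lambda>i t. \<Sum>p\<in>Poly_Mapping.keys \<Phi>.
     of_int (Poly_Mapping.lookup \<Phi> p) * lact (\<iota> (fst p) i) (snd p) t)"

lemma tensor_col_superset:
  assumes "finite A" "Poly_Mapping.keys \<Phi> \<subseteq> A"
  shows "tensor_col lact \<iota> \<Phi> = (\<lambda>i t. \<Sum>p\<in>A. of_int (Poly_Mapping.lookup \<Phi> p) * lact (\<iota> (fst p) i) (snd p) t)"
  unfolding tensor_col_def
  by (intro ext sum.mono_neutral_left) (use assms in \<open>auto simp: in_keys_iff\<close>)

lemma tensor_col_0 [simp]: "tensor_col lact \<iota> 0 = 0"
  by (simp add: tensor_col_def fun_eq_iff)

lemma tensor_col_add: "tensor_col lact \<iota> (\<Phi> + \<Psi>) = tensor_col lact \<iota> \<Phi> + tensor_col lact \<iota> \<Psi>"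
proof -
  let ?A = "Poly_Mapping.keys \<Phi> \<union> Poly_Mapping.keys \<Psi>"
  have A: "finite ?A" "Poly_Mapping.keys \<Phi> \<subseteq> ?A" "Poly_Mapping.keys \<Psi> \<subseteq> ?A"
    "Poly_Mapping.keys (\<Phi> + \<Psi>) \<subseteq> ?A"
    using keys_add[of \<Phi> \<Psi>] by auto
  show ?thesis
    unfolding tensor_col_superset[OF A(1,2)] tensor_col_superset[OF A(1,3)] tensor_col_superset[OF A(1,4)]
    by (simp add: fun_eq_iff lookup_add sum.distrib algebra_simps)
qed

lemma tensor_col_uminus: "tensor_col lact \<iota> (- \<Phi>) = - tensor_col lact \<iota> \<Phi>"
  using tensor_col_add[of lact \<iota> \<Phi> "- \<Phi>"] by (simp add: eq_neg_iff_add_eq_0 add.commute)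

lemma tensor_col_diff: "tensor_col lact \<iota> (\<Phi> - \<Psi>) = tensor_col lact \<iota> \<Phi> - tensor_col lact \<iota> \<Psi>"
  using tensor_col_add[of lact \<iota> \<Phi> "- \<Psi>"] by (simp add: tensor_col_uminus)

lemma tensor_col_sum: "tensor_col lact \<iota> (sum g A) = (\<Sum>i\<in>A. tensor_col lact \<iota> (g i))"
  by (induction A rule: infinite_finite_induct) (auto simp: tensor_col_add)

lemma tensor_col_gen [simp]: "tensor_col lact \<iota> (gen (x, y)) = (\<lambda>i. lact (\<iota> x i) y)"
  by (simp add: tensor_col_def gen_def)

context
  fixes S :: "('a::ring_1) set" and N :: "('e \<Rightarrow> 'b::ring_1) set" and lact
  assumes S: "subring S" and N: "left_module S N lact"
begin

lemma tensor_col_in: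
  assumes "linear_map S M act (free_mod S J) free_act \<iota>" "\<Phi> \<in> free_ab M N"
  shows "tensor_col lact \<iota> \<Phi> \<in> cols N J"
  using assms(2)
proof (induction rule: free_ab_induct)
  case zero
  show ?case by (subst tensor_col_0) (rule cols_0[OF N])
next
  case (add \<Phi> \<Psi>)
  then show ?case by (subst tensor_col_add) (rule cols_add[OF N])
next
  case (neg \<Phi>)
  then show ?case by (subst tensor_col_uminus) (rule cols_uminus[OF N])
next
  case (gen x y)
  have "\<iota> x j \<in> S" "j \<notin> J \<Longrightarrow> \<iota> x j = 0" for j
    using linear_in[OF assms(1) gen(1)] by (auto simp: free_mod_def)
  then show ?case
    using gen(2) lact_0_left[OF N subring_0[OF S]] by (simp add: cols_def left_act[OF N])
qed

text \<open>Needed for the column map to descend to the tensor product; each kind of relation is one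
  of the bimodule laws.\<close>

lemma tensor_col_rel:
  assumes \<iota>: "linear_map S M act (free_mod S J) free_act \<iota>" and "\<Phi> \<in> tensor_rel S M act N lact"
  shows "tensor_col lact \<iota> \<Phi> = 0"
  using assms(2)
proof induction
  have \<iota>S: "\<iota> x i \<in> S" if "x \<in> M" for x i
    using linear_in[OF \<iota> that] by (simp add: free_mod_def)
  {
    case (addl x x' y)
    then show ?case
      using \<iota>S by (simp add: tensor_col_diff fun_eq_iff linear_add[OF \<iota>] lact_add_left[OF N])
  next
    case (addr x y y')
    then show ?case
      using \<iota>S by (simp add: tensor_col_diff fun_eq_iff lact_add[OF N])
  next
    case (bal x y a)
    then show ?case
      using \<iota>S by (simp add: tensor_col_diff fun_eq_iff linear_act[OF \<iota>] free_act_def lact_mult[OF N])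
  }
qed (auto simp: tensor_col_add tensor_col_uminus)

lemma tensor_col_map:
  assumes \<iota>: "linear_map S M act (free_mod S J) free_act \<iota>"
    and e: "linear_map S (free_mod S J) free_act (free_mod S J') free_act e"
    and comm: "\<And>x. x \<in> M \<Longrightarrow> \<iota>' (f x) = e (\<iota> x)" and "finite J" and "\<Phi> \<in> free_ab M N"
  shows "tensor_col lact \<iota>' (pair_map f \<Phi>) = mat lact J e (tensor_col lact \<iota> \<Phi>)"
proof -
  have "tensor_col lact \<iota> \<Phi> \<in> cols N J \<and> tensor_col lact \<iota>' (pair_map f \<Phi>) = mat lact J e (tensor_col lact \<iota> \<Phi>)"
    using \<open>\<Phi> \<in> free_ab M N\<close>
  proof (induction rule: free_ab_induct)
    case zero
    show ?case
      unfolding tensor_col_0 pair_map_0 mat_0[OF S N e] using cols_0[OF N] by blast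
  next
    case (add \<Phi> \<Psi>)
    then show ?case
      using mat_add[OF S N e] cols_add[OF N] by (metis pair_map_add tensor_col_add)
  next
    case (neg \<Phi>)
    then show ?case
      using mat_uminus[OF S N e] cols_uminus[OF N] by (metis pair_map_uminus tensor_col_uminus)
  next
    case (gen x y)
    have "tensor_col lact \<iota> (gen (x, y)) \<in> cols N J"
      by (rule tensor_col_in[OF \<iota> free_ab_gen[OF gen]])
    moreover have "lact (e (\<iota> x) l) y = (\<Sum>j\<in>J. lact (e (unit_vec j) l) (lact (\<iota> x j) y))" for l
      by (rule lact_linear_coeff[OF S N e \<open>finite J\<close> linear_in[OF \<iota> gen(1)] gen(2)])
    ultimately show ?case
      by (simp add: comm[OF gen(1)] mat_def)
  qed
  then show ?thesis by blast
qed

text \<open>\<open>D\<close> is only a retract of the free complex, so \<open>D \<otimes> N\<close>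
  appears among the columns as the fixed points of \<open>i p\<close>. A cycle becomes a formal
  tensor through \<open>p\<close>, is bounded there, and returns through \<open>i\<close>.\<close>

lemma exact_of_tensor_acyclic:
  assumes D: "chain_complex S D d act" and fin: "\<And>k. finite (J k)"
    and F: "chain_complex S (\<lambda>k. free_mod S (J k)) e free_act"
    and i: "chain_map S D d act (\<lambda>k. free_mod S (J k)) e free_act i"
    and p: "chain_map S (\<lambda>k. free_mod S (J k)) e free_act D d act p"
    and pi: "\<And>k x. x \<in> D k \<Longrightarrow> p k (i k x) = x"
    and acyc: "tensor_acyclic S D d act N lact"
    and z: "z \<in> cols N (J k)" "mat lact (J k) (\<lambda>x. i k (p k x)) z = z" "mat lact (J k) (e k) z = 0"
  shows "\<exists>w\<in>cols N (J (k + 1)). mat lact (J (k + 1)) (\<lambda>x. i (k + 1) (p (k + 1) x)) w = w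
    \<and> mat lact (J (k + 1)) (e (k + 1)) w = z"
proof -
  note il = chain_map_linear[OF i] and pl = chain_map_linear[OF p] and MD = complex_module[OF D]
  have ip: "linear_map S (free_mod S (J k)) free_act (free_mod S (J k)) free_act (\<lambda>x. i k (p k x))" for k
    by (rule linear_comp[OF pl il])
  \<comment> \<open>Its column is \<open>i p\<close> applied to \<open>z\<close>, which is
    \<open>z\<close> again.\<close>
  define \<Phi> where "\<Phi> = (\<Sum>j\<in>J k. gen (p k (unit_vec j), z j))"
  have \<Phi>: "\<Phi> \<in> free_ab (D k) N"
    unfolding \<Phi>_def
    by (intro free_ab_sum free_ab_gen cols_in[OF z(1)] linear_in[OF pl] unit_vec_in[OF S])
  let ?R = "tensor_rel S (D (k - 1)) act N lact"
  have mz: "mat lact (J k) (e k) z l = 0" for l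
    using z(3) by (metis zero_fun_apply)
  have "pair_map (d k) \<Phi> = (\<Sum>j\<in>J k. gen (p (k - 1) (e k (unit_vec j)), z j))"
    unfolding \<Phi>_def pair_map_sum
    by (intro sum.cong) (auto simp: chain_map_comm[OF p unit_vec_in[OF S]])
  moreover have "(\<Sum>j\<in>J k. gen (p (k - 1) (e k (unit_vec j)), z j))
      - (\<Sum>l\<in>J (k - 1). gen (p (k - 1) (unit_vec l), mat lact (J k) (e k) z l)) \<in> ?R"
    by (rule gen_mat[OF S N complex_linear[OF F] pl MD fin z(1)])
  moreover have "(\<Sum>l\<in>J (k - 1). gen (p (k - 1) (unit_vec l), mat lact (J k) (e k) z l)) \<in> ?R"
    unfolding mz
    by (intro tensor_rel_sum gen_zero_right left_0[OF N] linear_in[OF pl] unit_vec_in[OF S])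
  ultimately have "pair_map (d k) \<Phi> \<in> ?R"
    using tensor_rel.add by fastforce
  then obtain \<Psi> where \<Psi>: "\<Psi> \<in> free_ab (D (k + 1)) N"
    "\<Phi> - pair_map (d (k + 1)) \<Psi> \<in> tensor_rel S (D k) act N lact"
    using acyc \<Phi> unfolding tensor_acyclic_def tensor_map_eq_pair_map by blast
  define w where "w = tensor_col lact (i (k + 1)) \<Psi>"
  have "tensor_col lact (i k) \<Phi> = z"
    using z(2) unfolding \<Phi>_def tensor_col_sum by (simp add: mat_def fun_eq_iff sum_fun_apply)
  moreover have "tensor_col lact (i k) (pair_map (d (k + 1)) \<Psi>) = mat lact (J (k + 1)) (e (k + 1)) w"
    unfolding w_def
    by (rule tensor_col_map[OF il complex_linear_Suc[OF F] _ fin \<Psi>(1)])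
      (use chain_map_comm[OF i, of _ "k + 1"] in simp)
  ultimately have "mat lact (J (k + 1)) (e (k + 1)) w = z"
    using tensor_col_rel[OF il \<Psi>(2)] by (simp add: tensor_col_diff)
  moreover have "mat lact (J (k + 1)) (\<lambda>x. i (k + 1) (p (k + 1) x)) w = w"
    unfolding w_def using tensor_col_map[OF il ip _ fin \<Psi>(1), of "i (k + 1)" "\<lambda>x. x"] pi
    by (simp add: pair_map_id)
  moreover have "w \<in> cols N (J (k + 1))"
    unfolding w_def by (rule tensor_col_in[OF il \<Psi>(1)])
  ultimately show ?thesis by blast
qed

text \<open>A converse for free modules: exactness bounds the coordinate column of a cycle, and a
  formal tensor is congruent to the one rebuilt from its column.\<close>

lemma tensor_acyclic_of_exact:
  assumes fin: "\<And>k. finite (J k)"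
    and F: "chain_complex S (\<lambda>k. free_mod S (J k)) e free_act"
    and exact: "\<And>k z. z \<in> cols N (J k) \<Longrightarrow> mat lact (J k) (e k) z = 0
      \<Longrightarrow> \<exists>w\<in>cols N (J (k + 1)). mat lact (J (k + 1)) (e (k + 1)) w = z"
  shows "tensor_acyclic S (\<lambda>k. free_mod S (J k)) e free_act N lact"
  unfolding tensor_acyclic_def tensor_map_eq_pair_map
proof (intro allI ballI impI)
  fix k \<Phi>
  let ?F = "\<lambda>k. free_mod S (J k)"
  let ?R = "\<lambda>k. tensor_rel S (?F k) free_act N lact"
  assume \<Phi>: "\<Phi> \<in> free_ab (?F k) N" and d\<Phi>: "pair_map (e k) \<Phi> \<in> ?R (k - 1)"
  note FM = free_mod_module[OF S]
  define \<mu> where "\<mu> = tensor_col lact (\<lambda>x::'c \<Rightarrow> 'a. x)"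
  have \<mu>in: "\<mu> \<Phi> \<in> cols N (J k)"
    unfolding \<mu>_def by (rule tensor_col_in[OF linear_id \<Phi>])
  have "mat lact (J k) (e k) (\<mu> \<Phi>) = \<mu> (pair_map (e k) \<Phi>)"
    unfolding \<mu>_def by (rule tensor_col_map[OF linear_id[of S "?F k" free_act] complex_linear[OF F] _ fin \<Phi>, symmetric]) simp
  also have "\<dots> = 0"
    unfolding \<mu>_def by (rule tensor_col_rel[OF linear_id d\<Phi>])
  finally obtain w where w: "w \<in> cols N (J (k + 1))" "mat lact (J (k + 1)) (e (k + 1)) w = \<mu> \<Phi>"
    using exact[OF \<mu>in] by blast
  define \<Psi> where "\<Psi> = (\<Sum>j\<in>J (k + 1). gen (unit_vec j :: 'c \<Rightarrow> 'a, w j))"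
  have \<Psi>: "\<Psi> \<in> free_ab (?F (k + 1)) N"
    unfolding \<Psi>_def by (intro free_ab_sum free_ab_gen cols_in[OF w(1)] unit_vec_in[OF S])
  have 1: "pair_map (e (k + 1)) \<Psi> - (\<Sum>l\<in>J k. gen (unit_vec l, \<mu> \<Phi> l)) \<in> ?R k"
    using gen_mat[OF S N complex_linear_Suc[OF F] linear_id FM fin w(1)]
    unfolding \<Psi>_def pair_map_sum w(2) by simp
  have eq_add: "(x - a) + (y - b) - (z - a - b) = x + y - z"
    and eq_neg: "- ((x - a) + (z - (z - a - b))) = - x - b"
    for x y z a b :: "('c \<Rightarrow> 'a) \<times> ('e \<Rightarrow> 'b) \<Rightarrow>\<^sub>0 int"
    by (simp_all add: algebra_simps)
  \<comment> \<open>Rebuilding from the column changes \<open>\<Phi>\<close> only by relations.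
    Membership of the column in \<open>cols\<close> is carried along because the relations may be
    applied only to elements of \<open>N\<close>.\<close>
  have 2: "\<Phi> - (\<Sum>l\<in>J k. gen (unit_vec l, \<mu> \<Phi> l)) \<in> ?R k \<and> \<mu> \<Phi> \<in> cols N (J k)"
    using \<Phi>
  proof (induction rule: free_ab_induct)
    case zero
    have \<mu>0: "\<mu> 0 = 0"
      unfolding \<mu>_def by (rule tensor_col_0)
    then have \<mu>l: "\<mu> 0 l = 0" for l
      by (metis zero_fun_apply)
    have "(\<Sum>l\<in>J k. gen (unit_vec l, \<mu> 0 l)) \<in> ?R k"
      unfolding \<mu>l by (intro tensor_rel_sum gen_zero_right left_0[OF N] unit_vec_in[OF S])
    from tensor_rel_diff[OF tensor_rel.zero this] show ?case
      using \<mu>0 cols_0[OF N] by metis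
  next
    case (add \<Phi> \<Psi>)
    have "(\<Sum>l\<in>J k. gen (unit_vec l, \<mu> \<Phi> l + \<mu> \<Psi> l) - gen (unit_vec l, \<mu> \<Phi> l) - gen (unit_vec l, \<mu> \<Psi> l)) \<in> ?R k"
      by (intro tensor_rel_sum tensor_rel.addr unit_vec_in[OF S]) (use add cols_in in auto)
    then have "(\<Sum>l\<in>J k. gen (unit_vec l, \<mu> \<Phi> l + \<mu> \<Psi> l)) - (\<Sum>l\<in>J k. gen (unit_vec l, \<mu> \<Phi> l))
        - (\<Sum>l\<in>J k. gen (unit_vec l, \<mu> \<Psi> l)) \<in> ?R k"
      by (simp only: sum_subtractf)
    from tensor_rel_diff[OF tensor_rel.add[OF conjunct1[OF add(1)] conjunct1[OF add(2)]] this]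
    have "\<Phi> + \<Psi> - (\<Sum>l\<in>J k. gen (unit_vec l, \<mu> \<Phi> l + \<mu> \<Psi> l)) \<in> ?R k"
      unfolding eq_add .
    moreover have \<mu>a: "\<mu> (\<Phi> + \<Psi>) = \<mu> \<Phi> + \<mu> \<Psi>"
      unfolding \<mu>_def by (rule tensor_col_add)
    have "\<mu> (\<Phi> + \<Psi>) l = \<mu> \<Phi> l + \<mu> \<Psi> l" for l
      by (subst \<mu>a) (rule plus_fun_apply)
    ultimately have "\<Phi> + \<Psi> - (\<Sum>l\<in>J k. gen (unit_vec l, \<mu> (\<Phi> + \<Psi>) l)) \<in> ?R k"
      by (simp only:)
    moreover have "\<mu> (\<Phi> + \<Psi>) \<in> cols N (J k)"
      by (subst \<mu>a) (rule cols_add[OF N conjunct2[OF add(1)] conjunct2[OF add(2)]])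
    ultimately show ?case
      by (rule conjI)
  next
    case (neg \<Phi>)
    \<comment> \<open>Negation in the second argument is not a relation by itself; it comes from
      \<open>addr\<close> applied to an element and its negative, together with the triviality of
      \<open>gen (x, 0)\<close>.\<close>
    have "(\<Sum>l\<in>J k. gen (unit_vec l, \<mu> \<Phi> l + - \<mu> \<Phi> l) - gen (unit_vec l, \<mu> \<Phi> l) - gen (unit_vec l, - \<mu> \<Phi> l)) \<in> ?R k"
      by (intro tensor_rel_sum tensor_rel.addr unit_vec_in[OF S] left_uminus[OF N] cols_in[OF conjunct2[OF neg]])
    then have "(\<Sum>l\<in>J k. gen (unit_vec l, 0)) - (\<Sum>l\<in>J k. gen (unit_vec l, \<mu> \<Phi> l))
        - (\<Sum>l\<in>J k. gen (unit_vec l, - \<mu> \<Phi> l)) \<in> ?R k"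
      by (simp only: sum_subtractf add.right_inverse)
    moreover have "(\<Sum>l\<in>J k. gen (unit_vec l, 0)) \<in> ?R k"
      by (intro tensor_rel_sum gen_zero_right left_0[OF N] unit_vec_in[OF S])
    ultimately have "(\<Sum>l\<in>J k. gen (unit_vec l, 0)) - ((\<Sum>l\<in>J k. gen (unit_vec l, 0))
        - (\<Sum>l\<in>J k. gen (unit_vec l, \<mu> \<Phi> l)) - (\<Sum>l\<in>J k. gen (unit_vec l, - \<mu> \<Phi> l))) \<in> ?R k"
      by (rule tensor_rel_diff[rotated])
    from tensor_rel.neg[OF tensor_rel.add[OF conjunct1[OF neg] this]]
    have "- \<Phi> - (\<Sum>l\<in>J k. gen (unit_vec l, - \<mu> \<Phi> l)) \<in> ?R k"
      unfolding eq_neg .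
    moreover have \<mu>u: "\<mu> (- \<Phi>) = - \<mu> \<Phi>"
      unfolding \<mu>_def by (rule tensor_col_uminus)
    have "\<mu> (- \<Phi>) l = - \<mu> \<Phi> l" for l
      by (subst \<mu>u) (rule uminus_apply)
    ultimately have "- \<Phi> - (\<Sum>l\<in>J k. gen (unit_vec l, \<mu> (- \<Phi>) l)) \<in> ?R k"
      by (simp only:)
    moreover have "\<mu> (- \<Phi>) \<in> cols N (J k)"
      by (subst \<mu>u) (rule cols_uminus[OF N conjunct2[OF neg]])
    ultimately show ?case
      by (rule conjI)
  next
    case (gen x y)
    have x: "x j \<in> S" "j \<notin> J k \<Longrightarrow> x j = 0" for j
      using gen(1) by (auto simp: free_mod_def)
    have eq: "(\<Sum>j\<in>J k. free_act (unit_vec j) (x j)) = x"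
      by (rule sum_unit_vec[OF fin x(2)])
    have "gen (\<Sum>j\<in>J k. free_act (unit_vec j) (x j), y) - (\<Sum>j\<in>J k. gen (free_act (unit_vec j) (x j), y)) \<in> ?R k"
      by (rule gen_sum_left[OF FM gen(2)]) (intro module_act[OF FM] unit_vec_in[OF S] x)
    then have "gen (x, y) - (\<Sum>j\<in>J k. gen (free_act (unit_vec j) (x j), y)) \<in> ?R k"
      unfolding eq .
    moreover have "(\<Sum>j\<in>J k. gen (free_act (unit_vec j) (x j), y)) - (\<Sum>j\<in>J k. gen (unit_vec j, lact (x j) y)) \<in> ?R k"
      by (intro tensor_rel_sum_diff tensor_rel.bal unit_vec_in[OF S] x gen(2))
    ultimately have "gen (x, y) - (\<Sum>j\<in>J k. gen (unit_vec j, lact (x j) y)) \<in> ?R k"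
      by (rule tensor_rel_trans)
    moreover have "\<mu> (gen (x, y)) \<in> cols N (J k)"
      unfolding \<mu>_def by (rule tensor_col_in[OF linear_id free_ab_gen[OF gen]])
    ultimately show ?case
      by (simp add: \<mu>_def)
  qed
  have "\<Phi> - pair_map (e (k + 1)) \<Psi> \<in> ?R k"
    by (rule tensor_rel_trans[OF conjunct1[OF 2] tensor_rel_sym[OF 1]])
  then show "\<exists>\<Psi>\<in>free_ab (?F (k + 1)) N. \<Phi> - pair_map (e (k + 1)) \<Psi> \<in> ?R k"
    using \<Psi> by blast
qed

end


section \<open>Laurent polynomials and Novikov series\<close>

type_synonym expo = "nat \<Rightarrow>\<^sub>0 int"

text \<open>The left action carries the matrices of differentials, the right action the linearity of
  homotopies: series form a bimodule over the Laurent polynomials.\<close>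

definition series_rmult :: "('r::ring_1) series \<Rightarrow> 'r laurent \<Rightarrow> 'r series" where
  "series_rmult f p = (\<lambda>e. \<Sum>k\<in>Poly_Mapping.keys p. f (e - k) * Poly_Mapping.lookup p k)"

lemma poly_mapping_single_induct [case_names single add]:
  fixes p :: "'k \<Rightarrow>\<^sub>0 'b::comm_monoid_add"
  assumes "\<And>k c. P (Poly_Mapping.single k c)" "\<And>p q. P p \<Longrightarrow> P q \<Longrightarrow> P (p + q)"
  shows "P p"
proof -
  have "P (\<Sum>k\<in>A. Poly_Mapping.single k (Poly_Mapping.lookup p k))" for A
    by (induction A rule: infinite_finite_induct) (use assms assms(1)[of undefined 0] in auto)
  from this[of "Poly_Mapping.keys p"] show ?thesis
    using poly_mapping_sum_single[of "Poly_Mapping.keys p" p] by simp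
qed

lemma series_lmult_superset:
  "finite A \<Longrightarrow> Poly_Mapping.keys p \<subseteq> A \<Longrightarrow> series_lmult p f = (\<lambda>e. \<Sum>k\<in>A. Poly_Mapping.lookup p k * f (e - k))"
  unfolding series_lmult_def by (intro ext sum.mono_neutral_left) (auto simp: in_keys_iff)

lemma series_rmult_superset:
  "finite A \<Longrightarrow> Poly_Mapping.keys p \<subseteq> A \<Longrightarrow> series_rmult f p = (\<lambda>e. \<Sum>k\<in>A. f (e - k) * Poly_Mapping.lookup p k)"
  unfolding series_rmult_def by (intro ext sum.mono_neutral_left) (auto simp: in_keys_iff)

lemma series_lmult_add_left: "series_lmult (p + q) f = series_lmult p f + series_lmult q f"
proof -
  let ?A = "Poly_Mapping.keys p \<union> Poly_Mapping.keys q"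
  have A: "finite ?A" "Poly_Mapping.keys p \<subseteq> ?A" "Poly_Mapping.keys q \<subseteq> ?A" "Poly_Mapping.keys (p + q) \<subseteq> ?A"
    using keys_add[of p q] by auto
  show ?thesis
    unfolding series_lmult_superset[OF A(1,2)] series_lmult_superset[OF A(1,3)] series_lmult_superset[OF A(1,4)]
    by (simp add: fun_eq_iff lookup_add sum.distrib algebra_simps)
qed

lemma series_rmult_add_right: "series_rmult f (p + q) = series_rmult f p + series_rmult f q"
proof -
  let ?A = "Poly_Mapping.keys p \<union> Poly_Mapping.keys q"
  have A: "finite ?A" "Poly_Mapping.keys p \<subseteq> ?A" "Poly_Mapping.keys q \<subseteq> ?A" "Poly_Mapping.keys (p + q) \<subseteq> ?A"
    using keys_add[of p q] by auto
  show ?thesis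
    unfolding series_rmult_superset[OF A(1,2)] series_rmult_superset[OF A(1,3)] series_rmult_superset[OF A(1,4)]
    by (simp add: fun_eq_iff lookup_add sum.distrib algebra_simps)
qed

lemma series_lmult_add: "series_lmult p (f + g) = series_lmult p f + series_lmult p g"
  by (simp add: series_lmult_def fun_eq_iff sum.distrib algebra_simps)

lemma series_rmult_add: "series_rmult (f + g) p = series_rmult f p + series_rmult g p"
  by (simp add: series_rmult_def fun_eq_iff sum.distrib algebra_simps)

lemma series_lmult_single: "series_lmult (Poly_Mapping.single k c) f = (\<lambda>e. c * f (e - k))"
  by (subst series_lmult_superset[of "{k}"]) auto

lemma series_rmult_single: "series_rmult f (Poly_Mapping.single k c) = (\<lambda>e. f (e - k) * c)"
  by (subst series_rmult_superset[of "{k}"]) auto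

text \<open>Biadditivity reduces the identity to monomials, where it is associativity in
  \<open>'r\<close>; the coefficients need not commute. The neighbouring laws are proved in the same
  way.\<close>

lemma series_lmult_mult: "series_lmult (p * q) f = series_lmult p (series_lmult q f)"
proof (induction p rule: poly_mapping_single_induct)
  case (single k c)
  show ?case
  proof (induction q rule: poly_mapping_single_induct)
    case (single l d)
    show ?case
      by (simp add: mult_single series_lmult_single fun_eq_iff algebra_simps)
  next
    case (add p q)
    then show ?case
      by (simp only: distrib_left series_lmult_add_left series_lmult_add)
  qed
next
  case (add p q)
  then show ?case
    by (simp only: distrib_right series_lmult_add_left)
qed

lemma series_rmult_mult: "series_rmult f (p * q) = series_rmult (series_rmult f p) q"
proof (induction p rule: poly_mapping_single_induct)
  case (single k c)
  show ?case
  proof (induction q rule: poly_mapping_single_induct)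
    case (single l d)
    show ?case
      by (simp add: mult_single series_rmult_single fun_eq_iff algebra_simps)
  next
    case (add p q)
    then show ?case
      by (simp only: distrib_left series_rmult_add_right)
  qed
next
  case (add p q)
  then show ?case
    by (simp only: distrib_right series_rmult_add_right series_rmult_add)
qed

text \<open>This makes left multiplication by a matrix linear for the right action.\<close>

lemma series_lmult_rmult: "series_lmult p (series_rmult f q) = series_rmult (series_lmult p f) q"
proof (induction p rule: poly_mapping_single_induct)
  case (single k c)
  show ?case
  proof (induction q rule: poly_mapping_single_induct)
    case (single l d)
    show ?case
      by (simp add: series_lmult_single series_rmult_single fun_eq_iff algebra_simps diff_diff_eq)
  next
    case (add p q)
    then show ?case
      by (simp only: series_rmult_add_right series_lmult_add)
  qed
next
  case (add p q)
  then show ?case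
    by (simp only: series_lmult_add_left series_rmult_add)
qed

lemma plus_eq_lookup: "Poly_Mapping.lookup p + Poly_Mapping.lookup q = Poly_Mapping.lookup (p + q)"
  by (simp add: fun_eq_iff lookup_add)

lemma lookup_mult_lmult: "Poly_Mapping.lookup (p * q) = series_lmult p (Poly_Mapping.lookup q)"
proof (induction p rule: poly_mapping_single_induct)
  case (single k c)
  show ?case
  proof (induction q rule: poly_mapping_single_induct)
    case (single l d)
    show ?case
      by (auto simp: mult_single series_lmult_single fun_eq_iff lookup_single when_def)
  next
    case (add p q)
    then show ?case
      by (simp only: distrib_left series_lmult_add plus_eq_lookup[symmetric])
  qed
next
  case (add p q)
  then show ?case
    by (simp only: distrib_right series_lmult_add_left plus_eq_lookup[symmetric])
qed

lemma lookup_mult_rmult: "Poly_Mapping.lookup (p * q) = series_rmult (Poly_Mapping.lookup p) q"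
proof (induction p rule: poly_mapping_single_induct)
  case (single k c)
  show ?case
  proof (induction q rule: poly_mapping_single_induct)
    case (single l d)
    show ?case
      by (auto simp: mult_single series_rmult_single fun_eq_iff lookup_single when_def)
  next
    case (add p q)
    then show ?case
      by (simp only: distrib_left series_rmult_add_right plus_eq_lookup[symmetric])
  qed
next
  case (add p q)
  then show ?case
    by (simp only: distrib_right series_rmult_add plus_eq_lookup[symmetric])
qed

lemma series_lmult_1: "series_lmult 1 f = f"
  using series_lmult_single[of 0 1 f] by simp

lemma series_rmult_1: "series_rmult f 1 = f"
  using series_rmult_single[of f 0 1] by simp

text \<open>Variables commute with all coefficients although \<open>'r\<close> may be
  noncommutative, so multiplication by \<open>x\<close> is a linear endomorphism of every right
  module.\<close>

lemma single_central: "Poly_Mapping.single k 1 * p = p * Poly_Mapping.single k 1"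
  for p :: "('r::ring_1) laurent"
  by (induction p rule: poly_mapping_single_induct) (auto simp: mult_single add.commute algebra_simps)

lemma expo_keys_add: "Poly_Mapping.keys e \<subseteq> A \<Longrightarrow> Poly_Mapping.keys k \<subseteq> A \<Longrightarrow> Poly_Mapping.keys (e + k) \<subseteq> A"
  for e k :: expo
  using keys_add[of e k] by blast

lemma expo_keys_diff: "Poly_Mapping.keys e \<subseteq> A \<Longrightarrow> Poly_Mapping.keys k \<subseteq> A \<Longrightarrow> Poly_Mapping.keys (e - k) \<subseteq> A"
  for e k :: expo
  using expo_keys_add[of e A "- k"] by simp

lemma laurent_ring_iff: "p \<in> laurent_ring V \<longleftrightarrow> (\<forall>e. Poly_Mapping.lookup p e \<noteq> 0 \<longrightarrow> Poly_Mapping.keys e \<subseteq> V)"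
  unfolding laurent_ring_def by (auto simp: in_keys_iff)

lemma laurent_ring_subring: "subring (laurent_ring V)"
proof -
  have "a * b \<in> laurent_ring V" if "a \<in> laurent_ring V" "b \<in> laurent_ring V" for a b :: "'a laurent"
    unfolding laurent_ring_def
  proof (intro CollectI ballI)
    fix e assume "e \<in> Poly_Mapping.keys (a * b)"
    then obtain k l where "e = k + l" "k \<in> Poly_Mapping.keys a" "l \<in> Poly_Mapping.keys b"
      using keys_mult[of a b] by auto
    then show "Poly_Mapping.keys e \<subseteq> V"
      using that expo_keys_add[of k V l] by (auto simp: laurent_ring_def)
  qed
  moreover have "a + b \<in> laurent_ring V" if "a \<in> laurent_ring V" "b \<in> laurent_ring V" for a b :: "'a laurent"
    using that keys_add[of a b] unfolding laurent_ring_def by blast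
  moreover have "0 \<in> laurent_ring V" "1 \<in> laurent_ring V"
    by (auto simp: laurent_ring_iff lookup_one when_def)
  moreover have "- a \<in> laurent_ring V" if "a \<in> laurent_ring V" for a :: "'a laurent"
    using that by (simp add: laurent_ring_iff)
  ultimately show ?thesis
    unfolding subring_def by simp
qed

lemma laurent_ring_mono: "V \<subseteq> W \<Longrightarrow> laurent_ring V \<subseteq> laurent_ring W"
  unfolding laurent_ring_def by blast

lemma single_in_laurent_ring: "Poly_Mapping.keys e \<subseteq> V \<Longrightarrow> Poly_Mapping.single e c \<in> laurent_ring V"
  by (auto simp: laurent_ring_iff lookup_single when_def)

lemma laurent_ring_induct [consumes 1, case_names single add]:
  assumes "p \<in> laurent_ring V" "\<And>k c. Poly_Mapping.keys k \<subseteq> V \<Longrightarrow> P (Poly_Mapping.single k c)"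
    "\<And>p q. p \<in> laurent_ring V \<Longrightarrow> q \<in> laurent_ring V \<Longrightarrow> P p \<Longrightarrow> P q \<Longrightarrow> P (p + q)"
  shows "P p"
proof -
  have "(\<Sum>k\<in>A. Poly_Mapping.single k (Poly_Mapping.lookup p k)) \<in> laurent_ring V
      \<and> P (\<Sum>k\<in>A. Poly_Mapping.single k (Poly_Mapping.lookup p k))" if "A \<subseteq> Poly_Mapping.keys p" for A
    using that
  proof (induction A rule: infinite_finite_induct)
    case (insert k A)
    then have k: "Poly_Mapping.keys k \<subseteq> V"
      using assms(1) by (auto simp: laurent_ring_def)
    let ?s = "Poly_Mapping.single k (Poly_Mapping.lookup p k)"
    let ?r = "\<Sum>k\<in>A. Poly_Mapping.single k (Poly_Mapping.lookup p k)"
    have "?r \<in> laurent_ring V" "P ?r"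
      using insert by auto
    moreover have "?s \<in> laurent_ring V" "P ?s"
      using single_in_laurent_ring[OF k] assms(2)[OF k] by auto
    ultimately have "?s + ?r \<in> laurent_ring V \<and> P (?s + ?r)"
      using assms(3) subring_add[OF laurent_ring_subring] by blast
    then show ?case
      using insert(1,2) by simp
  qed (use assms(2)[of 0 0] subring_0[OF laurent_ring_subring] in auto)
  then show ?thesis
    using poly_mapping_sum_single[of "Poly_Mapping.keys p" p] by force
qed

text \<open>The coefficient, as a Laurent polynomial in the variables of \<open>W\<close>, of the monomial \<open>e\<close>
  in the other variables.\<close>

definition coef :: "nat set \<Rightarrow> expo \<Rightarrow> ('r::ring_1) series \<Rightarrow> 'r laurent" where
  "coef W e f = Abs_poly_mapping (\<lambda>k. if Poly_Mapping.keys k \<subseteq> W then f (e + k) else 0)"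

text \<open>The finiteness hypothesis makes the cut-off function a legitimate argument of
  \<open>Abs_poly_mapping\<close>. It holds for Laurent polynomials and, with \<open>W = V\<close>,
  for Novikov series.\<close>

lemma lookup_coef:
  assumes "finite {k. f k \<noteq> 0 \<and> Poly_Mapping.keys (k - e) \<subseteq> W}"
  shows "Poly_Mapping.lookup (coef W e f) k = (if Poly_Mapping.keys k \<subseteq> W then f (e + k) else 0)"
proof -
  have "{k. (if Poly_Mapping.keys k \<subseteq> W then f (e + k) else 0) \<noteq> 0}
      \<subseteq> (\<lambda>k. k - e) ` {k. f k \<noteq> 0 \<and> Poly_Mapping.keys (k - e) \<subseteq> W}"
  proof
    fix k assume "k \<in> {k. (if Poly_Mapping.keys k \<subseteq> W then f (e + k) else 0) \<noteq> 0}"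
    then have "e + k \<in> {k. f k \<noteq> 0 \<and> Poly_Mapping.keys (k - e) \<subseteq> W}"
      by (simp split: if_splits)
    then show "k \<in> (\<lambda>k. k - e) ` {k. f k \<noteq> 0 \<and> Poly_Mapping.keys (k - e) \<subseteq> W}"
      by (rule rev_image_eqI) simp
  qed
  then have "finite {k. (if Poly_Mapping.keys k \<subseteq> W then f (e + k) else 0) \<noteq> 0}"
    using assms finite_surj by blast
  then show ?thesis
    unfolding coef_def by simp
qed

lemma finite_lookup_support: "finite {k. Poly_Mapping.lookup a k \<noteq> 0 \<and> P k}"
  by (rule finite_subset[OF _ finite_lookup[of a]]) auto

lemmas lookup_coef_lookup = lookup_coef[OF finite_lookup_support]

text \<open>The monomials in the variables outside \<open>W\<close> are a basis over the smaller
  ring; the coordinates sort terms by their exponents outside \<open>W\<close>.\<close>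

lemma dual_basis_laurent_ring:
  assumes "W \<subseteq> U"
  shows "dual_basis (laurent_ring W) (laurent_ring U :: ('r::ring_1) laurent set) (*) {e. Poly_Mapping.keys e \<subseteq> U - W}
    (\<lambda>e. Poly_Mapping.single e 1) (\<lambda>e a. coef W e (Poly_Mapping.lookup a))"
  unfolding dual_basis_def
proof (intro conjI ballI)
  fix e :: expo assume e: "e \<in> {e. Poly_Mapping.keys e \<subseteq> U - W}"
  show "Poly_Mapping.single e 1 \<in> (laurent_ring U :: 'r laurent set)"
    using e by (auto intro: single_in_laurent_ring)
  show "linear_map (laurent_ring W) (laurent_ring U) (*) (laurent_ring W) (*) (\<lambda>a :: 'r laurent. coef W e (Poly_Mapping.lookup a))"
  proof (rule linear_mapI)
    fix a :: "'r laurent"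
    show "coef W e (Poly_Mapping.lookup a) \<in> laurent_ring W"
      by (auto simp: laurent_ring_iff lookup_coef_lookup)
  next
    fix a b :: "'r laurent"
    show "coef W e (Poly_Mapping.lookup (a + b)) = coef W e (Poly_Mapping.lookup a) + coef W e (Poly_Mapping.lookup b)"
      by (rule poly_mapping_eqI) (simp add: lookup_coef_lookup lookup_add)
  next
    fix a b :: "'r laurent" assume "b \<in> laurent_ring W"
    then show "coef W e (Poly_Mapping.lookup (a * b)) = coef W e (Poly_Mapping.lookup a) * b"
    proof (induction b rule: laurent_ring_induct)
      case (single l c)
      have "Poly_Mapping.keys (k - l) \<subseteq> W \<longleftrightarrow> Poly_Mapping.keys k \<subseteq> W" for k
        using expo_keys_diff[of k W l] expo_keys_add[of "k - l" W l] single by auto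
      then show ?case
        by (intro poly_mapping_eqI, unfold lookup_coef_lookup, unfold lookup_mult_rmult,
            unfold series_rmult_single, unfold lookup_coef_lookup)
          (simp add: add_diff_eq)
    next
      case (add p q)
      have "coef W e (Poly_Mapping.lookup (a * (p + q))) = coef W e (Poly_Mapping.lookup (a * p)) + coef W e (Poly_Mapping.lookup (a * q))"
        by (rule poly_mapping_eqI) (simp add: lookup_coef_lookup lookup_add distrib_left)
      then show ?case
        using add by (simp add: distrib_left)
    qed
  qed
next
  fix a :: "'r laurent" assume a: "a \<in> laurent_ring U"
  \<comment> \<open>The restriction of an exponent to the variables in \<open>A\<close>. An exponent
    supported on \<open>U\<close> splits uniquely into its parts on \<open>U - W\<close> and on
    \<open>W\<close>, which is what \<open>split\<close> records.\<close>
  define part :: "nat set \<Rightarrow> expo \<Rightarrow> expo" where "part A e = Abs_poly_mapping (\<lambda>i. if i \<in> A then Poly_Mapping.lookup e i else 0)" for A e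
  have part: "Poly_Mapping.lookup (part A e) i = (if i \<in> A then Poly_Mapping.lookup e i else 0)" for A e i
  proof -
    have "finite {i. (if i \<in> A then Poly_Mapping.lookup e i else 0) \<noteq> 0}"
      by (rule finite_subset[OF _ finite_lookup[of e]]) auto
    then show ?thesis by (simp add: part_def)
  qed
  have split: "e = k" "part W e' = l" "part (U - W) e' = k"
    if "Poly_Mapping.keys k \<subseteq> U - W" "Poly_Mapping.keys l \<subseteq> W" "e' = k + l" "Poly_Mapping.keys e \<subseteq> U - W"
      "Poly_Mapping.keys (e' - e) \<subseteq> W" for e e' k l
  proof -
    have k: "Poly_Mapping.lookup k i = 0" if "i \<notin> U - W" for i
      using \<open>Poly_Mapping.keys k \<subseteq> U - W\<close> that by (auto simp: in_keys_iff subset_iff)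
    have l: "Poly_Mapping.lookup l i = 0" if "i \<notin> W" for i
      using \<open>Poly_Mapping.keys l \<subseteq> W\<close> that by (auto simp: in_keys_iff subset_iff)
    have e: "Poly_Mapping.lookup e i = 0" if "i \<notin> U - W" for i
      using \<open>Poly_Mapping.keys e \<subseteq> U - W\<close> that by (auto simp: in_keys_iff subset_iff)
    have e': "Poly_Mapping.lookup e' i = Poly_Mapping.lookup e i" if "i \<notin> W" for i
      using \<open>Poly_Mapping.keys (e' - e) \<subseteq> W\<close> that by (auto simp: in_keys_iff subset_iff lookup_minus)
    show "e = k"
      by (rule poly_mapping_eqI) (metis DiffE e e' k l add.right_neutral lookup_add that(3))
    show "part W e' = l" "part (U - W) e' = k"
      by (rule poly_mapping_eqI; use k l that(3) in \<open>auto simp: part lookup_add\<close>)+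
  qed
  let ?B = "{e. Poly_Mapping.keys e \<subseteq> U - W}"
  let ?A = "{e \<in> ?B. coef W e (Poly_Mapping.lookup a) \<noteq> 0}"
  have partkeys: "Poly_Mapping.keys (part A e) \<subseteq> A" for A e
    by (auto simp: in_keys_iff part split: if_splits)
  have "?A \<subseteq> part (U - W) ` Poly_Mapping.keys a"
  proof
    fix e assume e: "e \<in> ?A"
    then obtain k where "Poly_Mapping.lookup (coef W e (Poly_Mapping.lookup a)) k \<noteq> 0"
      using poly_mapping_eqI[of "coef W e (Poly_Mapping.lookup a)" 0] by auto
    then have k: "Poly_Mapping.keys k \<subseteq> W" "e + k \<in> Poly_Mapping.keys a"
      by (auto simp: lookup_coef_lookup in_keys_iff split: if_splits)
    then have "part (U - W) (e + k) = e"
      using split(3)[of e k "e + k" e] e by simp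
    then show "e \<in> part (U - W) ` Poly_Mapping.keys a"
      using k(2) by force
  qed
  then show fin: "finite ?A"
    using finite_keys finite_surj by blast
  show "a = (\<Sum>e\<in>?A. Poly_Mapping.single e 1 * coef W e (Poly_Mapping.lookup a))"
  proof (rule poly_mapping_eqI)
    fix k
    have eq: "Poly_Mapping.lookup (Poly_Mapping.single e 1 * coef W e (Poly_Mapping.lookup a)) k
      = (if Poly_Mapping.keys (k - e) \<subseteq> W then Poly_Mapping.lookup a k else 0)" for e
      by (simp add: lookup_mult_lmult series_lmult_single lookup_coef_lookup)
    show "Poly_Mapping.lookup a k = Poly_Mapping.lookup (\<Sum>e\<in>?A. Poly_Mapping.single e 1 * coef W e (Poly_Mapping.lookup a)) k"
    proof (cases "Poly_Mapping.lookup a k = 0")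
      case True
      show ?thesis
        unfolding lookup_sum eq True by simp
    next
      case False
      then have "Poly_Mapping.keys k \<subseteq> U"
        using a by (auto simp: laurent_ring_iff)
      then have k: "k = part (U - W) k + part W k"
        using assms by (intro poly_mapping_eqI) (auto simp: lookup_add part in_keys_iff subset_iff)
      let ?e = "part (U - W) k"
      have e: "Poly_Mapping.keys (k - e) \<subseteq> W \<longleftrightarrow> e = ?e" if "e \<in> ?B" for e
        using split(1)[OF partkeys partkeys k, of e] that partkeys[of W k] k
        by (metis add_diff_cancel_left' mem_Collect_eq)
      have "Poly_Mapping.lookup (coef W ?e (Poly_Mapping.lookup a)) (part W k) \<noteq> 0"
        using False k partkeys by (simp add: lookup_coef_lookup)
      then have eA: "?e \<in> ?A"
        using partkeys[of "U - W" k] by auto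
      have "(\<Sum>e\<in>?A. if Poly_Mapping.keys (k - e) \<subseteq> W then Poly_Mapping.lookup a k else 0)
          = (\<Sum>e\<in>?A. if e = ?e then Poly_Mapping.lookup a k else 0)"
        using e by (intro sum.cong) auto
      then show ?thesis
        unfolding lookup_sum eq using eA fin by simp
    qed
  qed
qed

lemma dual_basis_restrict_laurent:
  fixes P :: "('m::ab_group_add) set"
  assumes "dual_basis (laurent_ring U) P act (B :: 'i set) b c" "right_module (laurent_ring U) P act" "W \<subseteq> U"
  shows "\<exists>(B::('i \<times> expo) set) b c. dual_basis (laurent_ring W) P act B b c"
  using dual_basis_restrict_scalars[OF assms(1) laurent_ring_subring assms(2)
      dual_basis_laurent_ring[OF assms(3)] laurent_ring_subring laurent_ring_mono[OF assms(3)]]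
  by blast

subsection \<open>Adjoining one variable\<close>

text \<open>Here \<open>L\<close> is \<open>K[x, x\<^sup>-\<^sup>1]\<close> with \<open>x = x\<^sub>v\<close> for \<open>\<epsilon> = 1\<close> and \<open>x\<close> the inverse of \<open>x\<^sub>v\<close> for \<open>\<epsilon> = -1\<close>, so that
  both Novikov rings are treated as \<open>K((x))\<close>.\<close>

locale one_variable =
  fixes V :: "nat set" and v :: nat and \<epsilon> :: int
  assumes v: "v \<notin> V" and \<epsilon>: "\<epsilon> = 1 \<or> \<epsilon> = -1"
begin

definition deg :: "expo \<Rightarrow> int" where
  "deg e = \<epsilon> * Poly_Mapping.lookup e v"

definition xe :: "int \<Rightarrow> expo" where
  "xe t = Poly_Mapping.single v (\<epsilon> * t)"

abbreviation K :: "('r::ring_1) laurent set" where "K \<equiv> laurent_ring V"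
abbreviation L :: "('r::ring_1) laurent set" where "L \<equiv> laurent_ring (insert v V)"

definition N :: "('r::ring_1) series set" where
  "N = {f. (\<forall>e. f e \<noteq> 0 \<longrightarrow> Poly_Mapping.keys e \<subseteq> insert v V)
      \<and> (\<exists>m. \<forall>e. f e \<noteq> 0 \<longrightarrow> m \<le> deg e) \<and> (\<forall>t. finite {e. f e \<noteq> 0 \<and> deg e = t})}"

lemma KL: "K \<subseteq> L"
  by (rule laurent_ring_mono) auto

lemma deg_add: "deg (e + k) = deg e + deg k"
  by (simp add: deg_def lookup_add algebra_simps)

lemma deg_diff: "deg (e - k) = deg e - deg k"
  by (simp add: deg_def lookup_minus algebra_simps)

lemma deg_xe [simp]: "deg (xe t) = t"
  using \<epsilon> by (auto simp: deg_def xe_def)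

lemma deg_K: "Poly_Mapping.keys e \<subseteq> V \<Longrightarrow> deg e = 0"
  using v by (auto simp: deg_def in_keys_iff subset_iff)

lemma keys_xe: "Poly_Mapping.keys (xe t) \<subseteq> insert v V"
  by (simp add: xe_def)

lemma xe_add: "xe (s + t) = xe s + xe t"
  by (simp add: xe_def single_add[symmetric] algebra_simps)

lemma keys_minus_xe:
  assumes "Poly_Mapping.keys e \<subseteq> insert v V"
  shows "Poly_Mapping.keys (e - xe t) \<subseteq> V \<longleftrightarrow> deg e = t"
proof
  assume "Poly_Mapping.keys (e - xe t) \<subseteq> V"
  then show "deg e = t"
    using deg_K[of "e - xe t"] by (simp add: deg_diff)
next
  assume "deg e = t"
  then have "Poly_Mapping.lookup (e - xe t) v = 0"
    using \<epsilon> by (auto simp: lookup_minus xe_def deg_def)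
  then show "Poly_Mapping.keys (e - xe t) \<subseteq> V"
    using expo_keys_diff[OF assms keys_xe, of t] by (auto simp: in_keys_iff)
qed

lemma N_supp: "f \<in> N \<Longrightarrow> f e \<noteq> 0 \<Longrightarrow> Poly_Mapping.keys e \<subseteq> insert v V"
  and N_bound: "f \<in> N \<Longrightarrow> \<exists>m. \<forall>e. f e \<noteq> 0 \<longrightarrow> m \<le> deg e"
  and N_finite: "f \<in> N \<Longrightarrow> finite {e. f e \<noteq> 0 \<and> deg e = t}"
  unfolding N_def by blast+

lemma N_0: "0 \<in> N"
  by (simp add: N_def)

lemma N_add:
  assumes "f \<in> N" "g \<in> N"
  shows "f + g \<in> N"
  unfolding N_def
proof (intro CollectI conjI allI impI)
  have *: "f e \<noteq> 0 \<or> g e \<noteq> 0" if "(f + g) e \<noteq> 0" for e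
    using that by auto
  show "Poly_Mapping.keys e \<subseteq> insert v V" if "(f + g) e \<noteq> 0" for e
    using *[OF that] N_supp assms by blast
  obtain m n where "\<forall>e. f e \<noteq> 0 \<longrightarrow> m \<le> deg e" "\<forall>e. g e \<noteq> 0 \<longrightarrow> n \<le> deg e"
    using N_bound assms by meson
  then have "\<forall>e. (f + g) e \<noteq> 0 \<longrightarrow> min m n \<le> deg e"
    using * by (meson min.coboundedI1 min.coboundedI2)
  then show "\<exists>m. \<forall>e. (f + g) e \<noteq> 0 \<longrightarrow> m \<le> deg e" by blast
  show "finite {e. (f + g) e \<noteq> 0 \<and> deg e = t}" for t
    by (rule finite_subset[OF _ finite_UnI[OF N_finite[OF assms(1), of t] N_finite[OF assms(2), of t]]])
      (use * in blast)
qed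

text \<open>Membership in \<open>N\<close> depends on the support only, so this covers
  multiplication by a monomial from either side and, with \<open>k = 0\<close>, negation.\<close>

lemma N_shift:
  assumes f: "f \<in> N" and k: "Poly_Mapping.keys k \<subseteq> insert v V" and g: "\<And>e. g e \<noteq> 0 \<Longrightarrow> f (e - k) \<noteq> 0"
  shows "g \<in> N"
  unfolding N_def
proof (intro CollectI conjI allI impI)
  show "Poly_Mapping.keys e \<subseteq> insert v V" if "g e \<noteq> 0" for e
    using expo_keys_add[OF N_supp[OF f g[OF that]] k] by simp
  obtain m where m: "\<And>e. f e \<noteq> 0 \<Longrightarrow> m \<le> deg e"
    using N_bound[OF f] by blast
  have "m + deg k \<le> deg e" if "g e \<noteq> 0" for e
    using m[OF g[OF that]] by (simp add: deg_diff)
  then show "\<exists>m. \<forall>e. g e \<noteq> 0 \<longrightarrow> m \<le> deg e" by blast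
  fix t
  have "{e. g e \<noteq> 0 \<and> deg e = t} \<subseteq> (\<lambda>e. e + k) ` {e. f e \<noteq> 0 \<and> deg e = t - deg k}"
  proof
    fix e assume "e \<in> {e. g e \<noteq> 0 \<and> deg e = t}"
    then have "e - k \<in> {e. f e \<noteq> 0 \<and> deg e = t - deg k}"
      using g by (simp add: deg_diff)
    then show "e \<in> (\<lambda>e. e + k) ` {e. f e \<noteq> 0 \<and> deg e = t - deg k}"
      by (metis (no_types, lifting) diff_add_cancel image_eqI)
  qed
  then show "finite {e. g e \<noteq> 0 \<and> deg e = t}"
    using N_finite[OF f] finite_surj by blast
qed

lemma N_uminus: "f \<in> N \<Longrightarrow> - f \<in> N"
  by (rule N_shift[of f 0]) auto

lemma N_lmult:
  assumes "f \<in> N" "p \<in> L"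
  shows "series_lmult p f \<in> N"
  using assms(2)
proof (induction p rule: laurent_ring_induct)
  case (single k c)
  then show ?case
    by (intro N_shift[OF assms(1), of k]) (auto simp: series_lmult_single)
next
  case (add p q)
  show ?case
    unfolding series_lmult_add_left by (rule N_add[OF add(3,4)])
qed

lemma N_rmult:
  assumes "f \<in> N" "p \<in> L"
  shows "series_rmult f p \<in> N"
  using assms(2)
proof (induction p rule: laurent_ring_induct)
  case (single k c)
  then show ?case
    by (intro N_shift[OF assms(1), of k]) (auto simp: series_rmult_single)
next
  case (add p q)
  show ?case
    unfolding series_rmult_add_right by (rule N_add[OF add(3,4)])
qed

lemma N_left_module: "left_module L N series_lmult"
  unfolding left_module_def
  by (intro conjI ballI N_0 N_add N_uminus N_lmult series_lmult_add series_lmult_add_left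
      series_lmult_mult series_lmult_1)

lemma N_right_module: "right_module L N series_rmult"
  unfolding right_module_def
  by (intro conjI ballI N_0 N_add N_uminus N_rmult series_rmult_add series_rmult_add_right
      series_rmult_mult series_rmult_1)

lemma lookup_in_N: "a \<in> L \<Longrightarrow> Poly_Mapping.lookup a \<in> N"
  unfolding N_def
proof (intro CollectI conjI allI impI)
  assume a: "a \<in> L"
  then show "Poly_Mapping.keys e \<subseteq> insert v V" if "Poly_Mapping.lookup a e \<noteq> 0" for e
    using that by (simp add: laurent_ring_iff)
  show "finite {e. Poly_Mapping.lookup a e \<noteq> 0 \<and> deg e = t}" for t
    by (rule finite_lookup_support)
  have "Min (insert 0 (deg ` Poly_Mapping.keys a)) \<le> deg e" if "Poly_Mapping.lookup a e \<noteq> 0" for e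
    by (rule Min_le) (use that in \<open>auto simp: in_keys_iff\<close>)
  then show "\<exists>m. \<forall>e. Poly_Mapping.lookup a e \<noteq> 0 \<longrightarrow> m \<le> deg e" by blast
qed

section \<open>Truncation to Laurent polynomials, and windows of bounded degree\<close>

definition trunc :: "int \<Rightarrow> ('r::ring_1) series \<Rightarrow> 'r laurent" where
  "trunc m f = Abs_poly_mapping (\<lambda>e. if deg e < m then f e else 0)"

text \<open>Only finitely many degrees lie between the lower bound of \<open>f\<close> and
  \<open>m\<close>, and each contributes finitely many terms, so the cut-off series is a Laurent
  polynomial.\<close>

lemma lookup_trunc:
  assumes "f \<in> N"
  shows "Poly_Mapping.lookup (trunc m f) e = (if deg e < m then f e else 0)"
proof -
  obtain l where l: "\<And>e. f e \<noteq> 0 \<Longrightarrow> l \<le> deg e"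
    using N_bound[OF assms] by blast
  have "{e. (if deg e < m then f e else 0) \<noteq> 0} \<subseteq> (\<Union>t\<in>{l..<m}. {e. f e \<noteq> 0 \<and> deg e = t})"
    using l by auto
  moreover have "finite (\<Union>t\<in>{l..<m}. {e. f e \<noteq> 0 \<and> deg e = t})"
    using N_finite[OF assms] by blast
  ultimately have "finite {e. (if deg e < m then f e else 0) \<noteq> 0}"
    by (rule finite_subset)
  then show ?thesis
    unfolding trunc_def by simp
qed

lemma trunc_in_L: "f \<in> N \<Longrightarrow> trunc m f \<in> L"
  using N_supp by (auto simp: laurent_ring_iff lookup_trunc split: if_splits)

lemma trunc_add: "f \<in> N \<Longrightarrow> g \<in> N \<Longrightarrow> trunc m (f + g) = trunc m f + trunc m g"
  by (rule poly_mapping_eqI) (simp add: lookup_trunc N_add lookup_add)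

lemma trunc_0: "trunc m 0 = 0"
  by (rule poly_mapping_eqI) (simp add: lookup_trunc N_0)

lemma trunc_sum: "(\<And>i. i \<in> A \<Longrightarrow> f i \<in> N) \<Longrightarrow> trunc m (sum f A) = (\<Sum>i\<in>A. trunc m (f i))"
proof (induction A rule: infinite_finite_induct)
  case (insert i A)
  have IH: "trunc m (sum f A) = (\<Sum>i\<in>A. trunc m (f i))"
    by (rule insert(3)) (rule insert(4), simp)
  show ?case
    unfolding sum.insert[OF insert(1,2)] IH[symmetric]
    by (rule trunc_add) (rule insert(4), simp, rule left_sum[OF N_left_module], rule insert(4), simp)
qed (simp_all only: sum.infinite sum.empty trunc_0 not_False_eq_True)

text \<open>Elements of \<open>K\<close> have degree 0, so multiplying by them moves no term across
  the threshold. For \<open>L\<close> this fails, and \<open>trunc_commutator\<close> measures by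
  how much.\<close>

lemma trunc_rmult:
  assumes "f \<in> N" "k \<in> K"
  shows "trunc m (series_rmult f k) = trunc m f * k"
  using assms(2)
proof (induction k rule: laurent_ring_induct)
  case (single k c)
  then have sN: "series_rmult f (Poly_Mapping.single k c) \<in> N"
    using KL single_in_laurent_ring[OF single, of c] by (intro N_rmult[OF assms(1)]) auto
  show ?case
  proof (rule poly_mapping_eqI)
    fix e
    show "Poly_Mapping.lookup (trunc m (series_rmult f (Poly_Mapping.single k c))) e
      = Poly_Mapping.lookup (trunc m f * Poly_Mapping.single k c) e"
      unfolding lookup_trunc[OF sN] lookup_mult_rmult
      unfolding series_rmult_single lookup_trunc[OF assms(1)]
      using deg_K[OF single] by (simp add: deg_diff)
  qed
next
  case (add p q)
  have "trunc m (series_rmult f (p + q)) = trunc m (series_rmult f p) + trunc m (series_rmult f q)"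
    unfolding series_rmult_add_right
    by (intro trunc_add N_rmult assms(1)) (use add(1,2) KL in auto)
  then show ?case
    using add(3,4) by (simp add: distrib_left)
qed

text \<open>The interval of degrees is symmetric, so the window is the same for both signs of
  \<open>\<epsilon>\<close>.\<close>

definition window :: "int \<Rightarrow> ('r::ring_1) laurent set" where
  "window m = {a \<in> L. \<forall>e\<in>Poly_Mapping.keys a. \<bar>deg e\<bar> \<le> m}"

lemma window_closed:
  shows window_0: "0 \<in> window m"
    and window_add: "a \<in> window m \<Longrightarrow> b \<in> window m \<Longrightarrow> a + b \<in> window m"
    and window_uminus: "a \<in> window m \<Longrightarrow> - a \<in> window m"
proof -
  show "0 \<in> window m"
    using subring_0[OF laurent_ring_subring] by (simp add: window_def)
  show "a \<in> window m \<Longrightarrow> b \<in> window m \<Longrightarrow> a + b \<in> window m"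
    using subring_add[OF laurent_ring_subring, of a "insert v V" b] keys_add[of a b]
    unfolding window_def by blast
  show "a \<in> window m \<Longrightarrow> - a \<in> window m"
    using subring_uminus[OF laurent_ring_subring, of a "insert v V"]
    unfolding window_def by (simp add: in_keys_iff)
qed

lemma window_sum: "(\<And>i. i \<in> A \<Longrightarrow> f i \<in> window m) \<Longrightarrow> sum f A \<in> window m"
  by (induction A rule: infinite_finite_induct) (auto intro: window_0 window_add)

lemma window_mult:
  assumes "a \<in> window m" "b \<in> window n"
  shows "a * b \<in> window (m + n)"
  unfolding window_def
proof (intro CollectI conjI ballI)
  show "a * b \<in> L"
    using assms subring_mult[OF laurent_ring_subring] by (auto simp: window_def)
  fix e assume "e \<in> Poly_Mapping.keys (a * b)"
  then obtain k l where "e = k + l" "k \<in> Poly_Mapping.keys a" "l \<in> Poly_Mapping.keys b"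
    using keys_mult[of a b] by auto
  moreover have "\<bar>deg k\<bar> \<le> m" "\<bar>deg l\<bar> \<le> n"
    using assms calculation by (auto simp: window_def)
  ultimately show "\<bar>deg e\<bar> \<le> m + n"
    by (simp add: deg_add)
qed

lemma window_mono: "m \<le> n \<Longrightarrow> window m \<subseteq> window n"
  unfolding window_def by force

lemma K_window: "K \<subseteq> window 0"
  using KL deg_K by (auto simp: window_def laurent_ring_def)

lemma window_exists: "a \<in> L \<Longrightarrow> \<exists>m\<ge>0. a \<in> window m"
proof -
  assume a: "a \<in> L"
  have "\<bar>deg e\<bar> \<le> Max (insert 0 ((\<lambda>e. \<bar>deg e\<bar>) ` Poly_Mapping.keys a))" if "e \<in> Poly_Mapping.keys a" for e
    by (rule Max_ge) (use that in auto)
  then show ?thesis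
    using a by (intro exI[of _ "Max (insert 0 ((\<lambda>e. \<bar>deg e\<bar>) ` Poly_Mapping.keys a))"]) (auto simp: window_def)
qed

text \<open>The coefficient at \<open>e\<close> survives only if subtracting some exponent
  \<open>k\<close> of \<open>a\<close> carries \<open>deg e\<close> across the threshold
  \<open>l\<close>. As \<open>\<bar>deg k\<bar> \<le> m\<close>, this happens only within distance
  \<open>m\<close> of \<open>l\<close>.\<close>

lemma trunc_commutator:
  assumes f: "f \<in> N" and a: "a \<in> window m"
  shows "trunc l (series_lmult a f) - a * trunc l f \<in> window (m + \<bar>l\<bar>)"
proof -
  have m: "\<bar>deg e\<bar> \<le> m" if "e \<in> Poly_Mapping.keys a" for e
    using a that by (auto simp: window_def)
  have aL: "a \<in> L"
    using a by (simp add: window_def)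
  have lN: "series_lmult a f \<in> N"
    by (rule N_lmult[OF f aL])
  have "Poly_Mapping.lookup (trunc l (series_lmult a f) - a * trunc l f) e
      = (\<Sum>k\<in>Poly_Mapping.keys a. Poly_Mapping.lookup a k * ((if deg e < l then f (e - k) else 0) - (if deg (e - k) < l then f (e - k) else 0)))" for e
    unfolding lookup_minus lookup_trunc[OF lN] lookup_mult_lmult
    unfolding series_lmult_def lookup_trunc[OF f]
    by (cases "deg e < l") (simp_all add: sum_subtractf[symmetric] right_diff_distrib sum_negf)
  note eq = this
  have ex: "\<exists>k\<in>Poly_Mapping.keys a. (deg e < l) \<noteq> (deg e - deg k < l)"
    if "Poly_Mapping.lookup (trunc l (series_lmult a f) - a * trunc l f) e \<noteq> 0" for e
  proof (rule ccontr)
    assume "\<not> ?thesis"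
    then have "Poly_Mapping.lookup (trunc l (series_lmult a f) - a * trunc l f) e = 0"
      unfolding eq by (intro sum.neutral) (auto simp: deg_diff)
    then show False
      using that by simp
  qed
  have "\<bar>deg e\<bar> \<le> m + \<bar>l\<bar>" if e: "e \<in> Poly_Mapping.keys (trunc l (series_lmult a f) - a * trunc l f)" for e
  proof -
    obtain k where "k \<in> Poly_Mapping.keys a" "(deg e < l) \<noteq> (deg e - deg k < l)"
      using ex[OF e[unfolded in_keys_iff]] by blast
    then show ?thesis
      using m[of k] by linarith
  qed
  moreover have "trunc l (series_lmult a f) - a * trunc l f \<in> L"
    by (intro subring_diff[OF laurent_ring_subring] subring_mult[OF laurent_ring_subring] trunc_in_L lN f aL)
  ultimately show ?thesis
    by (simp add: window_def)
qed

lemma single_in_window: "e \<in> xe ` {-m..m} \<Longrightarrow> Poly_Mapping.single e c \<in> window m"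
  using keys_xe subring_0[OF laurent_ring_subring, of "insert v V"]
  by (auto simp: window_def intro!: single_in_laurent_ring)

text \<open>An exponent involving \<open>v\<close> alone is some \<open>xe t\<close>, and for
  \<open>t\<close> outside the window no term of \<open>a\<close> has degree
  \<open>t\<close>.\<close>

lemma coef_window:
  assumes e: "Poly_Mapping.keys e \<subseteq> insert v V - V" "e \<notin> xe ` {-m..m}" and a: "a \<in> window m"
  shows "coef V e (Poly_Mapping.lookup a) = 0"
proof -
  have "Poly_Mapping.lookup e i = Poly_Mapping.lookup (xe (deg e)) i" for i
    using e(1) \<epsilon> v by (cases "i = v") (auto simp: xe_def deg_def lookup_single when_def in_keys_iff subset_iff)
  then have "e = xe (deg e)"
    by (rule poly_mapping_eqI)
  then have e': "deg e \<notin> {-m..m}"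
    using e(2) by blast
  have "Poly_Mapping.lookup a (e + k) = 0" if "Poly_Mapping.keys k \<subseteq> V" for k
  proof (rule ccontr)
    assume "Poly_Mapping.lookup a (e + k) \<noteq> 0"
    then have "e + k \<in> Poly_Mapping.keys a"
      by (rule in_keys_iff[THEN iffD2])
    then have "\<bar>deg (e + k)\<bar> \<le> m"
      using a by (simp add: window_def)
    then show False
      using e' deg_K[OF that] by (simp add: deg_add abs_le_iff)
  qed
  then show ?thesis
    by (intro poly_mapping_eqI) (simp add: lookup_coef_lookup)
qed

subsection \<open>Coefficients\<close>

definition co :: "int \<Rightarrow> ('r::ring_1) series \<Rightarrow> 'r laurent" where
  "co t f = coef V (xe t) f"

definition X :: "int \<Rightarrow> ('r::ring_1) laurent" where
  "X t = Poly_Mapping.single (xe t) 1"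

lemma lookup_co:
  assumes "f \<in> N"
  shows "Poly_Mapping.lookup (co t f) k = (if Poly_Mapping.keys k \<subseteq> V then f (xe t + k) else 0)"
proof -
  have "{k. f k \<noteq> 0 \<and> Poly_Mapping.keys (k - xe t) \<subseteq> V} \<subseteq> {k. f k \<noteq> 0 \<and> deg k = t}"
    using keys_minus_xe[OF N_supp[OF assms]] by auto
  then show ?thesis
    unfolding co_def by (intro lookup_coef finite_subset[OF _ N_finite[OF assms]])
qed

lemma co_in_K: "f \<in> N \<Longrightarrow> co t f \<in> K"
  by (auto simp: laurent_ring_iff lookup_co)

lemma co_add: "f \<in> N \<Longrightarrow> g \<in> N \<Longrightarrow> co t (f + g) = co t f + co t g"
  by (rule poly_mapping_eqI) (simp add: lookup_co N_add lookup_add)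

lemma co_0: "co t 0 = 0"
  by (rule poly_mapping_eqI) (simp add: lookup_co N_0)

lemma co_sum: "(\<And>i. i \<in> A \<Longrightarrow> f i \<in> N) \<Longrightarrow> co t (sum f A) = (\<Sum>i\<in>A. co t (f i))"
proof (induction A rule: infinite_finite_induct)
  case (insert i A)
  have IH: "co t (sum f A) = (\<Sum>i\<in>A. co t (f i))"
    by (rule insert(3)) (rule insert(4), simp)
  show ?case
    unfolding sum.insert[OF insert(1,2)] IH[symmetric]
    by (rule co_add) (rule insert(4), simp, rule left_sum[OF N_left_module], rule insert(4), simp)
qed (simp_all only: sum.infinite sum.empty co_0 not_False_eq_True)

lemma co_lmult:
  assumes "f \<in> N" "k \<in> K"
  shows "co t (series_lmult k f) = k * co t f"
  using assms(2)
proof (induction k rule: laurent_ring_induct)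
  case (single l c)
  then have sN: "series_lmult (Poly_Mapping.single l c) f \<in> N"
    using KL single_in_laurent_ring[OF single, of c] by (intro N_lmult[OF assms(1)]) auto
  have "Poly_Mapping.keys (k - l) \<subseteq> V \<longleftrightarrow> Poly_Mapping.keys k \<subseteq> V" for k
    using expo_keys_diff[of k V l] expo_keys_add[of "k - l" V l] single by auto
  then show ?case
    by (intro poly_mapping_eqI, unfold lookup_co[OF sN], unfold lookup_mult_lmult,
        unfold series_lmult_single, unfold lookup_co[OF assms(1)])
      (simp add: add_diff_eq)
next
  case (add p q)
  have "co t (series_lmult (p + q) f) = co t (series_lmult p f) + co t (series_lmult q f)"
    unfolding series_lmult_add_left
    by (intro co_add N_lmult assms(1)) (use add(1,2) KL in auto)
  then show ?case
    using add(3,4) by (simp add: distrib_right)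
qed

lemma X_in_L: "X t \<in> L"
  unfolding X_def by (rule single_in_laurent_ring[OF keys_xe])

lemma X_mult: "X (s + t) = X s * X t"
  by (simp add: X_def mult_single xe_add)

lemma X_0: "X 0 = 1"
  by (simp add: X_def xe_def)

lemma X_central: "X t * a = a * X t"
  unfolding X_def by (rule single_central)

lemma co_X:
  assumes "f \<in> N"
  shows "co t (series_lmult (X s) f) = co (t - s) f"
proof -
  have eq: "xe t + k - xe s = xe (t - s) + k" for k
    using xe_add[of "t - s" s] by (simp add: algebra_simps)
  show ?thesis
    by (intro poly_mapping_eqI, unfold lookup_co[OF assms] lookup_co[OF N_lmult[OF assms X_in_L]],
        unfold X_def series_lmult_single mult_1_left eq) (rule refl)
qed

lemma co_K:
  assumes "k \<in> K"
  shows "co t (Poly_Mapping.lookup k) = (if t = 0 then k else 0)"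
proof (rule poly_mapping_eqI)
  fix e
  have kN: "Poly_Mapping.lookup k \<in> N"
    using assms KL lookup_in_N by blast
  have "Poly_Mapping.lookup k (xe t + e) = 0" if "t \<noteq> 0" "Poly_Mapping.keys e \<subseteq> V"
    using assms that deg_K[of "xe t + e"] deg_K[of e] by (auto simp: laurent_ring_iff deg_add)
  moreover have "Poly_Mapping.keys e \<subseteq> V" if "Poly_Mapping.lookup k e \<noteq> 0"
    using assms that by (simp add: laurent_ring_iff)
  ultimately show "Poly_Mapping.lookup (co t (Poly_Mapping.lookup k)) e = Poly_Mapping.lookup (if t = 0 then k else 0) e"
    by (auto simp: lookup_co[OF kN] xe_def)
qed

lemma co_eqI:
  assumes f: "f \<in> N" and g: "g \<in> N" and co: "\<And>t. co t f = co t g"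
  shows "f = g"
proof
  fix e
  have "h e = 0" if "h \<in> N" "\<not> Poly_Mapping.keys e \<subseteq> insert v V" for h
    using N_supp[OF that(1)] that(2) by blast
  moreover have "f e = g e" if "Poly_Mapping.keys e \<subseteq> insert v V"
  proof -
    have "Poly_Mapping.keys (e - xe (deg e)) \<subseteq> V"
      using keys_minus_xe[OF that] by simp
    then show ?thesis
      using co[of "deg e"] lookup_co[OF f, of "deg e" "e - xe (deg e)"] lookup_co[OF g, of "deg e" "e - xe (deg e)"]
      by (simp add: algebra_simps)
  qed
  ultimately show "f e = g e"
    using f g by metis
qed

text \<open>With \<open>co_eqI\<close> and \<open>co_lower\<close> this identifies series with the
  sequences over \<open>K\<close> that vanish far to the left. Each degree contributes finitely many
  terms because \<open>c t\<close> is a Laurent polynomial.\<close>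

lemma series_with_co:
  assumes c: "\<And>t. c t \<in> K" "\<And>t. t < t0 \<Longrightarrow> c t = 0"
  shows "\<exists>f\<in>N. \<forall>t. co t f = c t"
proof -
  define f where "f e = (if Poly_Mapping.keys e \<subseteq> insert v V then Poly_Mapping.lookup (c (deg e)) (e - xe (deg e)) else 0)" for e
  have f: "f \<in> N"
    unfolding N_def
  proof (intro CollectI conjI allI impI)
    show "Poly_Mapping.keys e \<subseteq> insert v V" if "f e \<noteq> 0" for e
      using that by (simp add: f_def split: if_splits)
    have "t0 \<le> deg e" if "f e \<noteq> 0" for e
      using that c(2)[of "deg e"] by (force simp: f_def split: if_splits)
    then show "\<exists>m. \<forall>e. f e \<noteq> 0 \<longrightarrow> m \<le> deg e" by blast
    fix t
    have "{e. f e \<noteq> 0 \<and> deg e = t} \<subseteq> (\<lambda>k. xe t + k) ` Poly_Mapping.keys (c t)"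
    proof
      fix e assume "e \<in> {e. f e \<noteq> 0 \<and> deg e = t}"
      then have "e - xe t \<in> Poly_Mapping.keys (c t)"
        by (auto simp: f_def in_keys_iff split: if_splits)
      then show "e \<in> (\<lambda>k. xe t + k) ` Poly_Mapping.keys (c t)"
        by (metis add.commute diff_add_cancel image_eqI)
    qed
    then show "finite {e. f e \<noteq> 0 \<and> deg e = t}"
      using finite_keys finite_surj by blast
  qed
  have "co t f = c t" for t
  proof (rule poly_mapping_eqI)
    fix k
    have "Poly_Mapping.lookup (c t) k = 0" if "\<not> Poly_Mapping.keys k \<subseteq> V"
      using c(1)[of t] that by (auto simp: laurent_ring_iff)
    moreover have "Poly_Mapping.keys (xe t + k) \<subseteq> insert v V" if "Poly_Mapping.keys k \<subseteq> V"
      using that by (intro expo_keys_add keys_xe) auto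
    moreover have "deg (xe t + k) = t" if "Poly_Mapping.keys k \<subseteq> V"
      using deg_K[OF that] by (simp add: deg_add)
    ultimately show "Poly_Mapping.lookup (co t f) k = Poly_Mapping.lookup (c t) k"
      by (simp add: lookup_co[OF f] f_def)
  qed
  then show ?thesis
    using f by blast
qed

lemma co_lower: "f \<in> N \<Longrightarrow> \<exists>t0. \<forall>t<t0. co t f = 0"
proof -
  assume f: "f \<in> N"
  then obtain m where m: "\<And>e. f e \<noteq> 0 \<Longrightarrow> m \<le> deg e"
    using N_bound by blast
  have "co t f = 0" if "t < m" for t
  proof (rule poly_mapping_eqI)
    fix k
    have "f (xe t + k) = 0" if "Poly_Mapping.keys k \<subseteq> V"
      using m[of "xe t + k"] deg_K[OF that] \<open>t < m\<close> by (force simp: deg_add)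
    then show "Poly_Mapping.lookup (co t f) k = Poly_Mapping.lookup 0 k"
      by (simp add: lookup_co[OF f])
  qed
  then show ?thesis by blast
qed

lemma laurent_expand:
  assumes "a \<in> L" "\<And>t. t \<notin> T \<Longrightarrow> co t (Poly_Mapping.lookup a) = 0" "finite T"
  shows "a = (\<Sum>t\<in>T. co t (Poly_Mapping.lookup a) * X t)"
proof -
  have aN: "Poly_Mapping.lookup a \<in> N"
    by (rule lookup_in_N[OF assms(1)])
  let ?c = "\<lambda>t. co t (Poly_Mapping.lookup a)"
  have cK: "?c t \<in> K" for t
    by (rule co_in_K[OF aN])
  then have cL: "?c t \<in> L" for t
    using KL by blast
  have sN: "Poly_Mapping.lookup (?c t * X t) \<in> N" for t
    by (intro lookup_in_N subring_mult[OF laurent_ring_subring] cL X_in_L)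
  have "co s (Poly_Mapping.lookup (?c t * X t)) = (if t = s then ?c s else 0)" for s t
    unfolding X_central[symmetric] lookup_mult_lmult
    using co_X[OF lookup_in_N[OF cL], of s t t] co_K[OF cK[of t], of "s - t"] by auto
  then have 1: "co s (\<Sum>t\<in>T. Poly_Mapping.lookup (?c t * X t)) = ?c s" for s
    using assms(2)[of s] assms(3) by (subst co_sum) (auto simp: sN)
  have 2: "Poly_Mapping.lookup (\<Sum>t\<in>T. ?c t * X t) = (\<Sum>t\<in>T. Poly_Mapping.lookup (?c t * X t))"
    by (rule ext) (simp add: lookup_sum sum_fun_apply)
  have "Poly_Mapping.lookup a = Poly_Mapping.lookup (\<Sum>t\<in>T. ?c t * X t)"
    unfolding 2 by (rule co_eqI[OF aN left_sum[OF N_left_module sN] 1[symmetric]])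
  then show ?thesis
    by (rule lookup_inject[THEN iffD1])
qed

lemma co_finite: "a \<in> L \<Longrightarrow> \<exists>m. \<forall>t. m < \<bar>t\<bar> \<longrightarrow> co t (Poly_Mapping.lookup a) = 0"
proof -
  assume a: "a \<in> L"
  obtain m where m: "a \<in> window m"
    using window_exists[OF a] by blast
  have "co t (Poly_Mapping.lookup a) = 0" if "m < \<bar>t\<bar>" for t
  proof (rule poly_mapping_eqI)
    fix k
    have "xe t + k \<notin> Poly_Mapping.keys a" if "Poly_Mapping.keys k \<subseteq> V"
      using m deg_K[OF that] \<open>m < \<bar>t\<bar>\<close> by (force simp: window_def deg_add)
    then show "Poly_Mapping.lookup (co t (Poly_Mapping.lookup a)) k = Poly_Mapping.lookup 0 k"
      by (simp add: lookup_co[OF lookup_in_N[OF a]] in_keys_iff)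
  qed
  then show ?thesis by blast
qed

end


section \<open>From Novikov acyclicity to finite domination over the smaller ring\<close>

text \<open>Puts the perfect complex into matrix form: \<open>D\<close> is a strict retract, as a
  chain complex, of a finite free complex, and \<open>i p\<close> is the idempotent called
  \<open>q\<close> in the overview.\<close>

lemma fin_dominated_coordinates:
  fixes C :: "int \<Rightarrow> ('m::ab_group_add) set" and S :: "('a::ring_1) set"
  assumes S: "subring S" and "fin_dominated S C d act"
  obtains D :: "int \<Rightarrow> (nat \<Rightarrow> 'a) set" and d' act' and J :: "int \<Rightarrow> nat set" and lo hi e i p
  where "chain_complex S D d' act'" "homotopy_equiv S C d act D d' act'"
    "\<forall>k. finite (J k)" "\<forall>k. k \<notin> {lo..hi} \<longrightarrow> J k = {}" "lo \<le> hi"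
    "chain_complex S (\<lambda>k. free_mod S (J k)) e free_act"
    "chain_map S D d' act' (\<lambda>k. free_mod S (J k)) e free_act i"
    "chain_map S (\<lambda>k. free_mod S (J k)) e free_act D d' act' p"
    "\<forall>k. \<forall>x\<in>D k. p k (i k x) = x"
proof -
  obtain D :: "int \<Rightarrow> (nat \<Rightarrow> 'a) set" and d' act' where D: "chain_complex S D d' act'" "bounded_complex D"
    "\<And>k. fin_generated S (D k) act'" "\<And>k. projective_module S (D k) act'"
    "homotopy_equiv S C d act D d' act'"
    using assms(2) unfolding fin_dominated_def by blast
  obtain n where n: "\<And>k. n < \<bar>k\<bar> \<Longrightarrow> D k = {0}"
    using D(2) unfolding bounded_complex_def by blast
  let ?I = "{-\<bar>n\<bar>..\<bar>n\<bar>}"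
  \<comment> \<open>Outside the range \<open>D k\<close> is zero and the empty dual basis is chosen,
    so that the free complex is bounded too.\<close>
  have "\<exists>(B :: (nat \<Rightarrow> 'a) set) b c. finite B \<and> dual_basis S (D k) act' B b c \<and> (k \<notin> ?I \<longrightarrow> B = {})" for k
  proof (cases "k \<in> ?I")
    case True
    then show ?thesis
      using dual_basis_fin_generated[OF D(3,4) S, of k] by blast
  next
    case False
    then have "D k = {0}"
      using n[of k] by auto
    then show ?thesis
      by (intro exI[of _ "{}"]) (auto simp: dual_basis_def)
  qed
  then obtain B :: "int \<Rightarrow> (nat \<Rightarrow> 'a) set" and b c
    where B: "\<And>k. finite (B k)" "\<And>k. dual_basis S (D k) act' (B k) (b k) (c k)" "\<And>k. k \<notin> ?I \<Longrightarrow> B k = {}"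
    by metis
  show ?thesis
  proof (rule coordinatize[OF D(1) S B(1,3,2)])
    fix J :: "int \<Rightarrow> nat set" and e i p
    assume J: "\<And>k. finite (J k)"
      "\<And>k l. k \<noteq> l \<Longrightarrow> J k \<inter> J l = {}" "\<And>k. k \<notin> ?I \<Longrightarrow> J k = {}"
      "chain_complex S (\<lambda>k. free_mod S (J k)) e free_act"
      "chain_map S D d' act' (\<lambda>k. free_mod S (J k)) e free_act i"
      "chain_map S (\<lambda>k. free_mod S (J k)) e free_act D d' act' p"
      "\<And>k x. x \<in> D k \<Longrightarrow> p k (i k x) = x"
    show ?thesis
      by (rule that[OF D(1,5) _ _ _ J(4-6)]) (use J(1,3,7) in auto)
  qed
qed

definition col_act :: "('i \<Rightarrow> ('r::ring_1) series) \<Rightarrow> 'r laurent \<Rightarrow> 'i \<Rightarrow> 'r series" where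
  "col_act z a = (\<lambda>j. series_rmult (z j) a)"

definition col_of :: "('i \<Rightarrow> ('r::ring_1) laurent) \<Rightarrow> 'i \<Rightarrow> 'r series" where
  "col_of \<phi> = (\<lambda>j. Poly_Mapping.lookup (\<phi> j))"

context one_variable
begin

lemma cols_module: "right_module L (cols N J :: ('i \<Rightarrow> ('r::ring_1) series) set) col_act"
  unfolding right_module_def
proof (intro conjI ballI)
  show "z + w \<in> cols N J" if "z \<in> cols N J" "w \<in> cols N J" for z w :: "'i \<Rightarrow> 'r series"
    by (rule cols_add[OF N_left_module that])
  show "col_act z a \<in> cols N J" if "z \<in> cols N J" "a \<in> L" for z :: "'i \<Rightarrow> 'r series" and a
    unfolding cols_def col_act_def
  proof (intro CollectI conjI allI impI)
    show "series_rmult (z j) a \<in> N" for j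
      by (rule N_rmult[OF cols_in[OF that(1)] that(2)])
    show "series_rmult (z j) a = 0" if "j \<notin> J" for j
    proof -
      have "z j = 0"
        using \<open>z \<in> cols N J\<close> that by (simp add: cols_def)
      then show ?thesis
        using act_0[OF N_right_module \<open>a \<in> L\<close>] by simp
    qed
  qed
qed (simp_all only: cols_0[OF N_left_module] cols_uminus[OF N_left_module] col_act_def
    plus_fun_apply series_rmult_add series_rmult_add_right series_rmult_mult series_rmult_1, simp_all only: plus_fun_def)

lemma col_of_in:
  assumes "\<phi> \<in> free_mod L J"
  shows "col_of \<phi> \<in> cols N J"
proof -
  have "Poly_Mapping.lookup (\<phi> j) = 0" if "j \<notin> J" for j
  proof -
    have "\<phi> j = 0"
      using assms that by (auto simp: free_mod_def)
    then show ?thesis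
      by (simp add: fun_eq_iff)
  qed
  moreover have "Poly_Mapping.lookup (\<phi> j) \<in> N" for j
    by (rule lookup_in_N) (use assms in \<open>simp add: free_mod_def\<close>)
  ultimately show ?thesis
    unfolding col_of_def cols_def by blast
qed

lemma col_of_linear:
  "linear_map L (free_mod L J) free_act (cols N J) col_act (col_of :: ('i \<Rightarrow> ('r::ring_1) laurent) \<Rightarrow> 'i \<Rightarrow> 'r series)"
proof (rule linear_mapI)
  show "col_of \<phi> \<in> cols N J" if "\<phi> \<in> free_mod L J" for \<phi> :: "'i \<Rightarrow> 'r laurent"
    by (rule col_of_in[OF that])
  show "col_of (\<phi> + \<psi>) = col_of \<phi> + col_of \<psi>" for \<phi> \<psi> :: "'i \<Rightarrow> 'r laurent"
    by (intro ext) (simp add: col_of_def lookup_add)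
  show "col_of (free_act \<phi> a) = col_act (col_of \<phi>) a" for \<phi> :: "'i \<Rightarrow> 'r laurent" and a
    by (simp only: col_of_def col_act_def free_act_def lookup_mult_rmult)
qed

lemma mat_col_of:
  assumes e: "linear_map L (free_mod L J) free_act (free_mod L J') free_act e" and "finite J"
    and \<phi>: "\<phi> \<in> free_mod L J"
  shows "mat series_lmult J e (col_of \<phi>) = col_of (e \<phi>)"
proof (intro ext)
  fix l t
  have "e \<phi> l = (\<Sum>j\<in>J. e (unit_vec j) l * \<phi> j)"
    using linear_on_free[OF e laurent_ring_subring assms(2) \<phi>] by (simp add: sum_fun_apply free_act_def)
  then show "mat series_lmult J e (col_of \<phi>) l t = col_of (e \<phi>) l t"
    by (simp add: mat_def col_of_def sum_fun_apply lookup_sum lookup_mult_lmult)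
qed

lemma mat_col_act:
  assumes e: "linear_map L (free_mod L J) free_act (free_mod L J') free_act e" and z: "z \<in> cols N J" and a: "a \<in> L"
  shows "mat series_lmult J e (col_act z a) = col_act (mat series_lmult J e z) a"
proof
  fix l
  have "col_act (mat series_lmult J e z) a l = (\<Sum>j\<in>J. series_rmult (series_lmult (e (unit_vec j) l) (z j)) a)"
    unfolding col_act_def mat_def
    by (rule act_sum[OF N_right_module a])
      (intro N_lmult cols_in[OF z] mat_coeff[OF laurent_ring_subring N_left_module e])
  then show "mat series_lmult J e (col_act z a) l = col_act (mat series_lmult J e z) a l"
    unfolding mat_def by (simp only: col_act_def series_lmult_rmult)
qed

text \<open>Projectivity yields a \<open>K\<close>-linear null homotopy of the inclusion of \<open>D\<close> into the
  acyclic complex \<open>D \<otimes>\<^sub>L K((x))\<close>; no multiplication on \<open>K((x))\<close> is needed for this.\<close>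

lemma series_null_homotopy:
  fixes D :: "int \<Rightarrow> ('m::ab_group_add) set" and J :: "int \<Rightarrow> 'i set"
    and e :: "int \<Rightarrow> ('i \<Rightarrow> ('r::ring_1) laurent) \<Rightarrow> 'i \<Rightarrow> 'r laurent"
  assumes D: "chain_complex L D d act" and fin: "\<And>k. finite (J k)"
    and lo: "\<And>k. k < lo \<Longrightarrow> J k = {}"
    and F: "chain_complex L (\<lambda>k. free_mod L (J k)) e free_act"
    and i: "chain_map L D d act (\<lambda>k. free_mod L (J k)) e free_act i"
    and p: "chain_map L (\<lambda>k. free_mod L (J k)) e free_act D d act p"
    and pi: "\<And>k x. x \<in> D k \<Longrightarrow> p k (i k x) = x"
    and acyc: "tensor_acyclic L D d act N series_lmult"
  obtains s where "\<And>k. linear_map K (free_mod L (J k)) free_act (cols N (J (k + 1))) col_act (s k)"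
    "\<And>k \<phi>. \<phi> \<in> free_mod L (J k) \<Longrightarrow> mat series_lmult (J (k + 1)) (e (k + 1)) (s k \<phi>) + s (k - 1) (e k \<phi>)
       = col_of (i k (p k \<phi>))"
proof -
  note S = laurent_ring_subring and NL = N_left_module
  note il = chain_map_linear[OF i] and pl = chain_map_linear[OF p] and eL = complex_linear[OF F]
  let ?m = "\<lambda>k. mat series_lmult (J k)"
  define q where "q k \<phi> = i k (p k \<phi>)" for k \<phi>
  have q: "chain_map L (\<lambda>k. free_mod L (J k)) e free_act (\<lambda>k. free_mod L (J k)) e free_act q"
    unfolding q_def[abs_def] by (rule chain_map_comp[OF p i])
  note ql = chain_map_linear[OF q]
  have qq: "q k (q k \<phi>) = q k \<phi>" if "\<phi> \<in> free_mod L (J k)" for k \<phi>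
    using pi[OF linear_in[OF pl that]] by (simp add: q_def)
  \<comment> \<open>The copy of \<open>D \<otimes> N\<close> inside the columns. Acyclicity is known
    for this part only, hence the null homotopy must be constructed with values in \<open>Y\<close>
    and not in all columns.\<close>
  define Y where "Y k = {z \<in> cols N (J k). ?m k (q k) z = z}" for k
  have me: "?m k (e k) z \<in> cols N (J (k - 1))" if "z \<in> cols N (J k)" for k z
    by (rule mat_in[OF S NL eL that])
  have mqe: "?m (k - 1) (q (k - 1)) (?m k (e k) z) = ?m k (e k) (?m k (q k) z)" if "z \<in> cols N (J k)" for k z
    unfolding mat_comp[OF S NL eL ql fin that] mat_comp[OF S NL ql eL fin that]
    by (rule mat_cong[OF S NL]) (rule chain_map_comm[OF q unit_vec_in[OF S], symmetric])
  have mee: "?m (k - 1) (e (k - 1)) (?m k (e k) z) = 0" if "z \<in> cols N (J k)" for k z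
  proof -
    have "?m k (\<lambda>x. e (k - 1) (e k x)) z = ?m k (\<lambda>x. 0) z"
      by (rule mat_cong[OF S NL]) (rule complex_dd[OF F unit_vec_in[OF S]])
    also have "\<dots> = 0"
      by (intro ext) (simp add: mat_def sum_fun_apply series_lmult_def)
    finally show ?thesis
      unfolding mat_comp[OF S NL eL eL fin that] .
  qed
  have MY: "right_module K (Y k) col_act" for k
  proof -
    note MC = right_module_mono[OF cols_module KL, of "J k"]
    have 1: "0 \<in> Y k"
      unfolding Y_def using module_0[OF MC] mat_0[OF S NL ql] by blast
    have 2: "z + w \<in> Y k" if "z \<in> Y k" "w \<in> Y k" for z w
      using that module_add[OF MC, of z w] mat_add[OF S NL ql, of z k w] unfolding Y_def by simp
    have 3: "- z \<in> Y k" if "z \<in> Y k" for z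
      using that module_uminus[OF MC, of z] mat_uminus[OF S NL ql, of z k] unfolding Y_def by simp
    have 4: "col_act z a \<in> Y k" if "z \<in> Y k" "a \<in> K" for z a
      using that module_act[OF MC, of z a] mat_col_act[OF ql, of z k a] KL unfolding Y_def by auto
    have "Y k \<subseteq> cols N (J k)"
      unfolding Y_def by blast
    then show ?thesis
      using 1 2 3 4 MC unfolding right_module_def by (meson subsetD)
  qed
  have Y: "chain_complex K Y (\<lambda>k. ?m k (e k)) col_act"
    unfolding chain_complex_def
  proof (intro conjI allI ballI)
    show "right_module K (Y k) col_act" for k by (rule MY)
    show "linear_map K (Y k) col_act (Y (k - 1)) col_act (?m k (e k))" for k
    proof (rule linear_mapI)
      fix z assume "z \<in> Y k"
      then have z: "z \<in> cols N (J k)" "?m k (q k) z = z"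
        by (auto simp: Y_def)
      show "?m k (e k) z \<in> Y (k - 1)"
        unfolding Y_def using me[OF z(1)] mqe[OF z(1)] z(2) by simp
      show "?m k (e k) (z + w) = ?m k (e k) z + ?m k (e k) w" if "w \<in> Y k" for w
        using that by (intro mat_add[OF S NL eL z(1)]) (simp add: Y_def)
      show "?m k (e k) (col_act z a) = col_act (?m k (e k) z) a" if "a \<in> K" for a
        using that KL by (intro mat_col_act[OF eL z(1)]) blast
    qed
    show "?m (k - 1) (e (k - 1)) (?m k (e k) z) = 0" if "z \<in> Y k" for k z
      using that by (intro mee) (simp add: Y_def)
  qed
  have exY: "\<exists>w\<in>Y (k + 1). ?m (k + 1) (e (k + 1)) w = z" if z: "z \<in> Y k" "?m k (e k) z = 0" for k z
    using exact_of_tensor_acyclic[OF S NL D fin F i p pi acyc, of z k] z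
    unfolding Y_def q_def by blast
  have FK: "chain_complex K (\<lambda>k. free_mod L (J k)) e free_act"
    by (rule chain_complex_mono[OF F KL])
  have loF: "free_mod L (J k) = {0 :: 'i \<Rightarrow> 'r laurent}" if "k < lo" for k
    unfolding lo[OF that] by (rule free_mod_empty[OF subring_0[OF S]])
  \<comment> \<open>Over \<open>K\<close> these modules are free on unit vectors times powers of the
    variable, in general of infinite rank, which is where infinite dual bases come in.\<close>
  have db: "\<exists>(B::('i \<times> expo) set) b c. dual_basis K (free_mod L (J k) :: ('i \<Rightarrow> 'r laurent) set) free_act B b c" for k
    by (rule dual_basis_restrict_laurent[OF dual_basis_free[OF S] free_mod_module[OF S]]) auto
  have cm: "chain_map K (\<lambda>k. free_mod L (J k)) e free_act Y (\<lambda>k. ?m k (e k)) col_act (\<lambda>k \<phi>. col_of (q k \<phi>))"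
  proof (rule chain_mapI)
    fix k
    have "linear_map L (free_mod L (J k)) free_act (cols N (J k)) col_act (\<lambda>\<phi>. col_of (q k \<phi>))"
      by (rule linear_comp[OF ql col_of_linear])
    then have "linear_map K (free_mod L (J k)) free_act (cols N (J k)) col_act (\<lambda>\<phi>. col_of (q k \<phi>))"
      using KL by (rule linear_map_mono)
    then show "linear_map K (free_mod L (J k)) free_act (Y k) col_act (\<lambda>\<phi>. col_of (q k \<phi>))"
    proof (rule linear_map_codomain)
      fix \<phi> :: "'i \<Rightarrow> 'r laurent" assume \<phi>: "\<phi> \<in> free_mod L (J k)"
      show "col_of (q k \<phi>) \<in> Y k"
        unfolding Y_def
        using col_of_in[OF linear_in[OF ql \<phi>]] mat_col_of[OF ql fin linear_in[OF ql \<phi>]] qq[OF \<phi>] by simp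
    qed
    fix \<phi> :: "'i \<Rightarrow> 'r laurent" assume \<phi>: "\<phi> \<in> free_mod L (J k)"
    show "?m k (e k) (col_of (q k \<phi>)) = col_of (q (k - 1) (e k \<phi>))"
      using mat_col_of[OF eL fin linear_in[OF ql \<phi>]] chain_map_comm[OF q \<phi>] by simp
  qed
  obtain s where s: "\<And>k. linear_map K (free_mod L (J k)) free_act (Y (k + 1)) col_act (s k)"
    "\<And>k \<phi>. \<phi> \<in> free_mod L (J k) \<Longrightarrow> col_of (q k \<phi>) = ?m (k + 1) (e (k + 1)) (s k \<phi>) + s (k - 1) (e k \<phi>)"
    using null_homotopy[OF S FK Y loF db exY cm] by blast
  show ?thesis
  proof (rule that[of s])
    show "linear_map K (free_mod L (J k)) free_act (cols N (J (k + 1))) col_act (s k)" for k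
      by (rule linear_map_codomain[OF s(1)]) (use linear_in[OF s(1)] in \<open>auto simp: Y_def\<close>)
    show "?m (k + 1) (e (k + 1)) (s k \<phi>) + s (k - 1) (e k \<phi>) = col_of (i k (p k \<phi>))"
      if "\<phi> \<in> free_mod L (J k)" for k \<phi>
      using s(2)[OF that] unfolding q_def by (rule sym)
  qed
qed

lemma finite_window: "finite A \<Longrightarrow> A \<subseteq> L \<Longrightarrow> \<exists>m\<ge>0. A \<subseteq> window m"
proof (induction A rule: finite_induct)
  case (insert a A)
  then obtain m where m: "m \<ge> 0" "A \<subseteq> window m"
    by blast
  obtain n where n: "n \<ge> 0" "a \<in> window n"
    using window_exists insert.prems by blast
  have "insert a A \<subseteq> window (max m n)"
    using m n window_mono[of m "max m n"] window_mono[of n "max m n"] by auto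
  then show ?case
    using m(1) by (intro exI[of _ "max m n"]) auto
qed (auto intro: exI[of _ 0])

end

lemma N_pos: "one_variable.N V v 1 = novikov_pos V v" if "v \<notin> V"
proof -
  interpret one_variable V v 1
    using that by unfold_locales auto
  show ?thesis
    unfolding N_def novikov_pos_def deg_def by simp
qed

lemma N_neg: "one_variable.N V v (-1) = novikov_neg V v" if "v \<notin> V"
proof -
  interpret one_variable V v "-1"
    using that by unfold_locales auto
  have 1: "(\<exists>m. \<forall>e. f e \<noteq> 0 \<longrightarrow> m \<le> deg e) = (\<exists>m. \<forall>e. f e \<noteq> 0 \<longrightarrow> Poly_Mapping.lookup e v \<le> m)"
    for f :: "'a series"
  proof
    assume "\<exists>m. \<forall>e. f e \<noteq> 0 \<longrightarrow> m \<le> deg e"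
    then obtain m where "\<forall>e. f e \<noteq> 0 \<longrightarrow> m \<le> deg e" ..
    then show "\<exists>m. \<forall>e. f e \<noteq> 0 \<longrightarrow> Poly_Mapping.lookup e v \<le> m"
      by (intro exI[of _ "- m"]) (auto simp: deg_def)
  next
    assume "\<exists>m. \<forall>e. f e \<noteq> 0 \<longrightarrow> Poly_Mapping.lookup e v \<le> m"
    then obtain m where "\<forall>e. f e \<noteq> 0 \<longrightarrow> Poly_Mapping.lookup e v \<le> m" ..
    then show "\<exists>m. \<forall>e. f e \<noteq> 0 \<longrightarrow> m \<le> deg e"
      by (intro exI[of _ "- m"]) (auto simp: deg_def)
  qed
  have 2: "(\<forall>t. finite {e. f e \<noteq> 0 \<and> deg e = t}) = (\<forall>t. finite {e. f e \<noteq> 0 \<and> Poly_Mapping.lookup e v = t})"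
    for f :: "'a series"
  proof -
    have "{e. f e \<noteq> 0 \<and> deg e = t} = {e. f e \<noteq> 0 \<and> Poly_Mapping.lookup e v = - t}" for t
      by (auto simp: deg_def)
    then have "finite {e. f e \<noteq> 0 \<and> deg e = t} = finite {e. f e \<noteq> 0 \<and> Poly_Mapping.lookup e v = - t}" for t
      by simp
    moreover have "(\<forall>t. P (- t)) = (\<forall>t. P t)" for P :: "int \<Rightarrow> bool"
      by (metis minus_minus)
    ultimately show ?thesis
      by simp
  qed
  show ?thesis
    unfolding N_def novikov_neg_def 1 2 by simp
qed

lemma retract_dominated:
  assumes "chain_map S C d act D e act' i" "chain_map S D e act' C d act p"
    and "\<And>k x. x \<in> C k \<Longrightarrow> p k (i k x) = x" and C: "chain_complex S C d act"
  shows "dominated S C d act D e act'"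
  unfolding dominated_def
proof (intro exI conjI)
  show "chain_homotopic S C d act C d act (\<lambda>k x. p k (i k x)) (\<lambda>k x. x)"
    by (rule chain_homotopic_cong[OF chain_homotopic_refl[OF C]]) (use assms(3) in auto)
qed (use assms in auto)

theorem fin_dominated_of_novikov_acyclic:
  fixes C :: "int \<Rightarrow> ('m::ab_group_add) set" and act :: "'m \<Rightarrow> ('r::ring_1) laurent \<Rightarrow> 'm"
  assumes v: "v \<notin> V" and C: "chain_complex (laurent_ring (insert v V)) C d act"
    and fd: "fin_dominated (laurent_ring (insert v V)) C d act"
    and pos: "tensor_acyclic (laurent_ring (insert v V)) C d act (novikov_pos V v) series_lmult"
    and neg: "tensor_acyclic (laurent_ring (insert v V)) C d act (novikov_neg V v) series_lmult"
  shows "fin_dominated (laurent_ring V) C d act"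
proof -
  interpret P: one_variable V v 1 using v by unfold_locales auto
  interpret Q: one_variable V v "-1" using v by unfold_locales auto
  let ?K = "laurent_ring V :: 'r laurent set" and ?L = "laurent_ring (insert v V) :: 'r laurent set"
  have SL: "subring ?L" and SK: "subring ?K" by (rule laurent_ring_subring)+
  have KL: "?K \<subseteq> ?L" by (rule P.KL)
  obtain D :: "int \<Rightarrow> (nat \<Rightarrow> 'r laurent) set" and d' act' and J :: "int \<Rightarrow> nat set" and lo hi e i p
    where D: "chain_complex ?L D d' act'" and CD: "homotopy_equiv ?L C d act D d' act'"
      and fin': "\<forall>k. finite (J k)" and bd': "\<forall>k. k \<notin> {lo..hi} \<longrightarrow> J k = {}"
      and lohi: "lo \<le> hi"
      and F: "chain_complex ?L (\<lambda>k. free_mod ?L (J k)) e free_act"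
      and i: "chain_map ?L D d' act' (\<lambda>k. free_mod ?L (J k)) e free_act i"
      and p: "chain_map ?L (\<lambda>k. free_mod ?L (J k)) e free_act D d' act' p"
      and pi': "\<forall>k. \<forall>x\<in>D k. p k (i k x) = x"
    by (rule fin_dominated_coordinates[OF SL fd])
  have fin: "\<And>k. finite (J k)" and bd: "\<And>k. k \<notin> {lo..hi} \<Longrightarrow> J k = {}"
    and pi: "\<And>k x. x \<in> D k \<Longrightarrow> p k (i k x) = x"
    using fin' bd' pi' by auto
  let ?F = "\<lambda>k. free_mod ?L (J k)"
  note eL = complex_linear[OF F] and il = chain_map_linear[OF i] and pl = chain_map_linear[OF p]
  note FM = free_mod_module[OF SL]
  have DC: "dominated ?L D d' act' C d act"
    by (rule homotopy_equiv_dominated[OF homotopy_equiv_sym[OF CD]])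
  have acP: "tensor_acyclic ?L D d' act' P.N series_lmult"
    using tensor_acyclic_dominated[OF D C DC pos] N_pos[OF v] by metis
  have acQ: "tensor_acyclic ?L D d' act' Q.N series_lmult"
    using tensor_acyclic_dominated[OF D C DC neg] N_neg[OF v] by metis
  have lo: "J k = {}" if "k < lo" for k
    using bd[of k] that by auto
  have eL': "linear_map ?L (?F (k + 1)) free_act (?F k) free_act (e (k + 1))" for k
    by (rule complex_linear_Suc[OF F])
  obtain s where s: "\<And>k. linear_map ?K (?F k) free_act (cols P.N (J (k + 1))) col_act (s k)"
    "\<And>k \<phi>. \<phi> \<in> ?F k \<Longrightarrow> mat series_lmult (J (k + 1)) (e (k + 1)) (s k \<phi>) + s (k - 1) (e k \<phi>)
       = col_of (i k (p k \<phi>))"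
    using P.series_null_homotopy[OF D fin lo F i p pi acP] by blast
  obtain s' where s': "\<And>k. linear_map ?K (?F k) free_act (cols Q.N (J (k + 1))) col_act (s' k)"
    "\<And>k \<phi>. \<phi> \<in> ?F k \<Longrightarrow> mat series_lmult (J (k + 1)) (e (k + 1)) (s' k \<phi>) + s' (k - 1) (e k \<phi>)
       = col_of (i k (p k \<phi>))"
    using Q.series_null_homotopy[OF D fin lo F i p pi acQ] by blast
  have sN: "s k \<phi> j \<in> P.N" "s' k \<phi> j \<in> Q.N" if "\<phi> \<in> ?F k" for k \<phi> j
    using cols_in[OF linear_in[OF s(1) that]] cols_in[OF linear_in[OF s'(1) that]] by auto
  have s0: "s k \<phi> j = 0" "s' k \<phi> j = 0" if "\<phi> \<in> ?F k" "j \<notin> J (k + 1)" for k \<phi> j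
    using linear_in[OF s(1) that(1)] linear_in[OF s'(1) that(1)] that(2) by (auto simp: cols_def)

  \<comment> \<open>\<open>P.trunc 0\<close> keeps the degrees below 0 of the first series. In
    \<open>Q\<close> degrees are counted with the opposite sign, so \<open>Q.trunc 1\<close> keeps
    the degrees at least 0 of the second. Every degree is kept exactly once, as
    \<open>trunc_split\<close> confirms.\<close>
  define h where "h k \<phi> = (\<lambda>j. P.trunc 0 (s k \<phi> j) + Q.trunc 1 (s' k \<phi> j))" for k \<phi>
  have h: "linear_map ?K (?F k) free_act (?F (k + 1)) free_act (h k)" for k
  proof (rule linear_mapI)
    fix \<phi> assume \<phi>: "\<phi> \<in> ?F k"
    show "h k \<phi> \<in> ?F (k + 1)"
      unfolding free_mod_iff[OF fin] h_def
      using s0[OF \<phi>]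
      by (auto simp: P.trunc_0 Q.trunc_0 intro!: subring_add[OF SL] P.trunc_in_L Q.trunc_in_L sN[OF \<phi>])
    show "h k (\<phi> + \<psi>) = h k \<phi> + h k \<psi>" if \<psi>: "\<psi> \<in> ?F k" for \<psi>
    proof
      fix j
      have eqs: "s k (\<phi> + \<psi>) j = s k \<phi> j + s k \<psi> j" "s' k (\<phi> + \<psi>) j = s' k \<phi> j + s' k \<psi> j"
        by (simp_all only: linear_add[OF s(1) \<phi> \<psi>] linear_add[OF s'(1) \<phi> \<psi>] plus_fun_apply)
      have "h k (\<phi> + \<psi>) j = h k \<phi> j + h k \<psi> j"
        unfolding h_def eqs P.trunc_add[OF sN(1)[OF \<phi>] sN(1)[OF \<psi>]] Q.trunc_add[OF sN(2)[OF \<phi>] sN(2)[OF \<psi>]]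
        by (simp only: ac_simps)
      then show "h k (\<phi> + \<psi>) j = (h k \<phi> + h k \<psi>) j"
        by simp
    qed
    show "h k (free_act \<phi> a) = free_act (h k \<phi>) a" if a: "a \<in> ?K" for a
    proof
      fix j
      show "h k (free_act \<phi> a) j = free_act (h k \<phi>) a j"
        unfolding h_def linear_act[OF s(1) \<phi> a] linear_act[OF s'(1) \<phi> a] col_act_def
          P.trunc_rmult[OF sN(1)[OF \<phi>] a] Q.trunc_rmult[OF sN(2)[OF \<phi>] a]
        by (simp add: free_act_def distrib_right)
    qed
  qed

  have trunc_split: "P.trunc 0 (Poly_Mapping.lookup a) + Q.trunc 1 (Poly_Mapping.lookup a) = a" if "a \<in> ?L" for a
    by (rule poly_mapping_eqI)
      (simp add: lookup_add P.lookup_trunc[OF P.lookup_in_N[OF that]] Q.lookup_trunc[OF Q.lookup_in_N[OF that]]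
        P.deg_def Q.deg_def)
  have QPwindow: "Q.window m = P.window m" for m
    by (simp add: P.window_def Q.window_def P.deg_def Q.deg_def)
  let ?c = "\<lambda>k j l. e k (unit_vec j) l"
  have cL: "?c k j l \<in> ?L" if "j \<in> J k" for k j l
    using linear_in[OF eL unit_vec_in[OF SL that]] by (simp add: free_mod_iff[OF fin])
  \<comment> \<open>One bound for all matrix entries of the differential; there are only finitely
    many nonzero ones.\<close>
  obtain m where m: "m \<ge> 0" "\<And>k j l. j \<in> J k \<Longrightarrow> ?c k j l \<in> P.window m"
  proof -
    let ?A = "(\<lambda>(k, j, l). ?c k j l) ` (SIGMA k:{lo..hi}. J k \<times> J (k - 1))"
    have "finite ?A" "?A \<subseteq> ?L"
      using fin cL by auto
    then obtain m where m: "m \<ge> 0" "?A \<subseteq> P.window m"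
      using P.finite_window by blast
    show ?thesis
    proof (rule that[OF m(1)])
      fix k j l assume j: "j \<in> J k"
      then have k: "k \<in> {lo..hi}"
        using bd by blast
      show "?c k j l \<in> P.window m"
      proof (cases "l \<in> J (k - 1)")
        case True
        then have "?c k j l \<in> ?A"
          using j k by force
        then show ?thesis
          using m(2) by blast
      next
        case False
        then have "?c k j l = 0"
          using linear_in[OF eL unit_vec_in[OF SL j]] by (simp add: free_mod_iff[OF fin])
        then show ?thesis
          by (simp add: P.window_0)
      qed
    qed
  qed
  \<comment> \<open>If truncation commuted with \<open>e\<close>, the two homotopy identities would
    add up to \<open>q = e h + h e\<close> and \<open>E\<close> would vanish. What remains are
    commutators of truncation with the matrix of \<open>e\<close>.\<close>
  define E where "E k \<phi> = i k (p k \<phi>) - e (k + 1) (h k \<phi>) - h (k - 1) (e k \<phi>)" for k \<phi>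
  \<comment> \<open>The bound is \<open>m\<close> from the entries of \<open>e\<close> plus the
    larger of the thresholds 0 and 1.\<close>
  have E_window: "E k \<phi> l \<in> P.window (m + 1)" if \<phi>: "\<phi> \<in> ?F k" for k \<phi> l
  proof -
    note e\<phi> = complex_d[OF F \<phi>]
    have qL: "i k (p k \<phi>) l \<in> ?L"
      using linear_in[OF il linear_in[OF pl \<phi>]] by (simp add: free_mod_iff[OF fin])
    have hs: "h k \<phi> \<in> ?F (k + 1)"
      by (rule linear_in[OF h \<phi>])
    have eh: "e (k + 1) (h k \<phi>) l = (\<Sum>j\<in>J (k + 1). ?c (k + 1) j l * P.trunc 0 (s k \<phi> j))
        + (\<Sum>j\<in>J (k + 1). ?c (k + 1) j l * Q.trunc 1 (s' k \<phi> j))"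
      using linear_on_free[OF eL' SL fin hs]
      by (simp add: sum_fun_apply free_act_def h_def distrib_left sum.distrib)
    let ?fP = "\<lambda>j. series_lmult (?c (k + 1) j l) (s k \<phi> j)"
    let ?fQ = "\<lambda>j. series_lmult (?c (k + 1) j l) (s' k \<phi> j)"
    have lP: "series_lmult (?c (k + 1) j l) (s k \<phi> j) \<in> P.N" if "j \<in> J (k + 1)" for j
      by (rule P.N_lmult[OF sN(1)[OF \<phi>] cL[OF that]])
    have lQ: "series_lmult (?c (k + 1) j l) (s' k \<phi> j) \<in> Q.N" if "j \<in> J (k + 1)" for j
      by (rule Q.N_lmult[OF sN(2)[OF \<phi>] cL[OF that]])
    have sP: "s (k - 1) (e k \<phi>) l \<in> P.N" and sQ: "s' (k - 1) (e k \<phi>) l \<in> Q.N"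
      by (rule sN[OF e\<phi>])+
    have "(\<Sum>j\<in>J (k + 1). series_lmult (?c (k + 1) j l) (s k \<phi> j)) + s (k - 1) (e k \<phi>) l = Poly_Mapping.lookup (i k (p k \<phi>) l)"
      using fun_cong[OF s(2)[OF \<phi>], of l] unfolding mat_def col_of_def plus_fun_apply .
    then have tP: "(\<Sum>j\<in>J (k + 1). P.trunc 0 (series_lmult (?c (k + 1) j l) (s k \<phi> j))) + P.trunc 0 (s (k - 1) (e k \<phi>) l)
        = P.trunc 0 (Poly_Mapping.lookup (i k (p k \<phi>) l))"
      using P.trunc_sum[of "J (k + 1)" ?fP 0, OF lP]
        P.trunc_add[OF left_sum[OF P.N_left_module, of "J (k + 1)" ?fP, OF lP] sP, of 0] by simp
    have "(\<Sum>j\<in>J (k + 1). series_lmult (?c (k + 1) j l) (s' k \<phi> j)) + s' (k - 1) (e k \<phi>) l = Poly_Mapping.lookup (i k (p k \<phi>) l)"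
      using fun_cong[OF s'(2)[OF \<phi>], of l] unfolding mat_def col_of_def plus_fun_apply .
    then have tQ: "(\<Sum>j\<in>J (k + 1). Q.trunc 1 (series_lmult (?c (k + 1) j l) (s' k \<phi> j))) + Q.trunc 1 (s' (k - 1) (e k \<phi>) l)
        = Q.trunc 1 (Poly_Mapping.lookup (i k (p k \<phi>) l))"
      using Q.trunc_sum[of "J (k + 1)" ?fQ 1, OF lQ]
        Q.trunc_add[OF left_sum[OF Q.N_left_module, of "J (k + 1)" ?fQ, OF lQ] sQ, of 1] by simp
    have "E k \<phi> l = i k (p k \<phi>) l - e (k + 1) (h k \<phi>) l - (P.trunc 0 (s (k - 1) (e k \<phi>) l) + Q.trunc 1 (s' (k - 1) (e k \<phi>) l))"
      by (simp add: E_def h_def)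
    also have "\<dots> = (\<Sum>j\<in>J (k + 1). P.trunc 0 (series_lmult (?c (k + 1) j l) (s k \<phi> j)) - ?c (k + 1) j l * P.trunc 0 (s k \<phi> j))
        + (\<Sum>j\<in>J (k + 1). Q.trunc 1 (series_lmult (?c (k + 1) j l) (s' k \<phi> j)) - ?c (k + 1) j l * Q.trunc 1 (s' k \<phi> j))"
    proof -
      \<comment> \<open>The truncated homotopy identities eliminate the terms of \<open>h e\<close>,
        and \<open>trunc_split\<close> joins the two truncations of \<open>q\<close>, so only
        differences of the form truncated product minus product of truncations are left.\<close>
      have "a - (b + b') - (x + x') = (c - b) + (c' - b')"
        if "c + x = t" "c' + x' = t'" "t + t' = a" for a b b' c c' x x' t t' :: "'r laurent"
        using that by (auto simp: algebra_simps)
      from this[OF tP tQ trunc_split[OF qL]] show ?thesis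
        unfolding eh sum_subtractf .
    qed
    also have "\<dots> \<in> P.window (m + 1)"
    proof (intro P.window_add P.window_sum)
      fix j assume j: "j \<in> J (k + 1)"
      show "P.trunc 0 (series_lmult (?c (k + 1) j l) (s k \<phi> j)) - ?c (k + 1) j l * P.trunc 0 (s k \<phi> j) \<in> P.window (m + 1)"
        using P.trunc_commutator[OF sN(1)[OF \<phi>, of j] m(2)[OF j, of l], of 0] P.window_mono[of m "m + 1"] by auto
      show "Q.trunc 1 (series_lmult (?c (k + 1) j l) (s' k \<phi> j)) - ?c (k + 1) j l * Q.trunc 1 (s' k \<phi> j) \<in> P.window (m + 1)"
        using Q.trunc_commutator[OF sN(2)[OF \<phi>, of j], of "?c (k + 1) j l" m 1] m(2)[OF j, of l] by (simp add: QPwindow)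
    qed
    finally show ?thesis .
  qed

  txt \<open>The differential raises degrees in \<open>x\<close> by at most \<open>m\<close>, so the bound grows by \<open>m\<close> with each
    step down from the top dimension \<open>hi\<close>.\<close>
  define M where "M k = m * max 0 (hi - k) + (m + 1)" for k
  define W where "W k = {\<psi> \<in> ?F k. \<forall>j. \<psi> j \<in> P.window (M k)}" for k
  have WF: "W k \<subseteq> ?F k" for k
    by (auto simp: W_def)
  have Fhi: "\<psi> = 0" if "\<psi> \<in> ?F k" "k > hi" for \<psi> k
    using that bd[of k] free_mod_empty[OF subring_0[OF SL], where 'b = nat] by auto
  have e0: "e k 0 = 0" for k
    by (rule linear_0[OF eL module_0[OF FM]])
  have W0: "0 \<in> W k" for k
    by (simp add: W_def P.window_0 module_0[OF FM])
  have MW: "right_module ?K (W k) free_act" for k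
  proof -
    have FK: "right_module ?K (?F k) free_act"
      by (rule right_module_mono[OF FM KL])
    have "\<psi> + \<psi>' \<in> W k" if "\<psi> \<in> W k" "\<psi>' \<in> W k" for \<psi> \<psi>'
      using that by (auto simp: W_def intro!: module_add[OF FM] P.window_add)
    moreover have "- \<psi> \<in> W k" if "\<psi> \<in> W k" for \<psi>
      using that by (auto simp: W_def intro!: module_uminus[OF FM] P.window_uminus)
    moreover have "free_act \<psi> a \<in> W k" if "\<psi> \<in> W k" "a \<in> ?K" for \<psi> a
    proof -
      have "\<psi> j * a \<in> P.window (M k)" for j
        using P.window_mult[of "\<psi> j" "M k" a 0] that subsetD[OF P.K_window, of a] by (simp add: W_def)
      then show ?thesis
        using that module_act[OF FM, of \<psi> "J k" a] KL by (auto simp: W_def free_act_def)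
    qed
    ultimately show ?thesis
      using W0 FK WF[of k] unfolding right_module_def by (meson subsetD)
  qed
  have eW: "e k \<psi> \<in> W (k - 1)" if \<psi>: "\<psi> \<in> W k" for k \<psi>
  proof (cases "k > hi")
    case True
    then have "\<psi> = 0"
      using Fhi[of \<psi> k] WF \<psi> by blast
    then show ?thesis
      using e0 W0 by simp
  next
    case False
    have M1: "M (k - 1) = m + M k"
      using False by (simp add: M_def max_def algebra_simps)
    have \<psi>F: "\<psi> \<in> ?F k"
      using \<psi> WF by blast
    have "e k \<psi> l = (\<Sum>j\<in>J k. ?c k j l * \<psi> j)" for l
      using linear_on_free[OF eL SL fin \<psi>F] by (simp add: sum_fun_apply free_act_def)
    moreover have "?c k j l * \<psi> j \<in> P.window (m + M k)" if "j \<in> J k" for j l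
      by (rule P.window_mult[OF m(2)[OF that]]) (use \<psi> in \<open>simp add: W_def\<close>)
    ultimately have "e k \<psi> l \<in> P.window (M (k - 1))" for l
      unfolding M1 by (simp add: P.window_sum)
    then show ?thesis
      using complex_d[OF F \<psi>F] by (simp add: W_def)
  qed
  have Wc: "chain_complex ?K W e free_act"
    unfolding chain_complex_def
  proof (intro conjI allI ballI)
    fix k
    show "right_module ?K (W k) free_act" by (rule MW)
    show "linear_map ?K (W k) free_act (W (k - 1)) free_act (e k)"
      by (rule linear_map_codomain[OF linear_map_domain[OF linear_map_mono[OF eL KL] WF] eW])
    show "e (k - 1) (e k \<psi>) = 0" if "\<psi> \<in> W k" for \<psi>
      using complex_dd[OF F] WF that by blast
  qed
  \<comment> \<open>\<open>W k\<close> is finite free over \<open>K\<close>: unit vectors times the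
    powers of \<open>x\<close> within the bound \<open>M k\<close>.\<close>
  let ?B = "\<lambda>k. J k \<times> P.xe ` {- M k..M k}"
  let ?b = "\<lambda>(j, e). free_act (unit_vec j) (Poly_Mapping.single e (1::'r))"
  let ?co = "\<lambda>(j :: nat, e) \<psi>. coef V e (Poly_Mapping.lookup (\<psi> j :: 'r laurent))"
  have dbW: "dual_basis ?K (W k) free_act (?B k) ?b ?co" for k
  proof (rule dual_basis_submodule[OF dual_basis_restrict_scalars[OF dual_basis_free[OF SL] SL FM
          dual_basis_laurent_ring[OF subset_insertI] SK KL] WF])
    have xek: "Poly_Mapping.keys (P.xe t) \<subseteq> insert v V - V" for t
      using v by (auto simp: P.xe_def split: if_splits)
    then show "?B k \<subseteq> J k \<times> {e. Poly_Mapping.keys e \<subseteq> insert v V - V}"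
      by blast
    fix z assume z: "z \<in> ?B k"
    then obtain j e where je: "z = (j, e)" "j \<in> J k" "e \<in> P.xe ` {- M k..M k}"
      by blast
    have sw: "Poly_Mapping.single e (1::'r) \<in> P.window (M k)"
      by (rule P.single_in_window[OF je(3)])
    then have "free_act (unit_vec j) (Poly_Mapping.single e (1::'r)) \<in> ?F k"
      by (intro module_act[OF FM] unit_vec_in[OF SL] je(2)) (simp add: P.window_def)
    moreover have "free_act (unit_vec j) (Poly_Mapping.single e (1::'r)) l \<in> P.window (M k)" for l
      using sw by (simp add: free_act_def unit_vec_def P.window_0)
    ultimately show "?b z \<in> W k"
      by (simp add: je(1) W_def)
  next
    fix z \<psi> assume z: "z \<in> J k \<times> {e. Poly_Mapping.keys e \<subseteq> insert v V - V} - ?B k" and \<psi>: "\<psi> \<in> W k"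
    then obtain j e where je: "z = (j, e)" "Poly_Mapping.keys e \<subseteq> insert v V - V" "e \<notin> P.xe ` {- M k..M k}"
      by blast
    show "?co z \<psi> = 0"
      unfolding je(1) prod.case by (rule P.coef_window[OF je(2,3)]) (use \<psi> in \<open>simp add: W_def\<close>)
  qed

  have E: "linear_map ?K (?F k) free_act (W k) free_act (E k)" for k
  proof (rule linear_map_codomain)
    have hd: "linear_map ?K (?F (k - 1)) free_act (?F k) free_act (h (k - 1))"
      using h[of "k - 1"] by simp
    show "linear_map ?K (?F k) free_act (?F k) free_act (E k)"
      unfolding E_def[abs_def]
      by (intro linear_minus linear_comp[OF linear_map_mono[OF pl KL] linear_map_mono[OF il KL]]
          linear_comp[OF h linear_map_mono[OF eL' KL]] linear_comp[OF linear_map_mono[OF eL KL] hd]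
          right_module_mono[OF FM KL])
    then show "E k \<phi> \<in> W k" if "\<phi> \<in> ?F k" for \<phi>
      using linear_in[OF _ that] E_window[OF that] P.window_mono[of "m + 1" "M k"] m(1)
      by (fastforce simp: W_def M_def)
  qed
  have q: "chain_map ?L ?F e free_act ?F e free_act (\<lambda>k x. i k (p k x))"
    by (rule chain_map_comp[OF p i])
  have Ecm: "chain_map ?K ?F e free_act W e free_act E"
  proof (rule chain_mapI[OF E])
    fix k \<phi> assume \<phi>: "\<phi> \<in> ?F k"
    have q\<phi>: "i k (p k \<phi>) \<in> ?F k"
      by (rule chain_map_in[OF q \<phi>])
    have eh: "e (k + 1) (h k \<phi>) \<in> ?F k"
      by (rule complex_d_Suc[OF F linear_in[OF h \<phi>]])
    have e\<phi>: "e k \<phi> \<in> ?F (k - 1)"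
      by (rule complex_d[OF F \<phi>])
    have he: "h (k - 1) (e k \<phi>) \<in> ?F k"
      using linear_in[OF h e\<phi>] by simp
    have "e k (E k \<phi>) = e k (i k (p k \<phi>)) - e k (e (k + 1) (h k \<phi>)) - e k (h (k - 1) (e k \<phi>))"
      unfolding E_def
      using linear_diff[OF eL FM module_diff[OF FM q\<phi> eh] he] linear_diff[OF eL FM q\<phi> eh] by simp
    also have "\<dots> = i (k - 1) (p (k - 1) (e k \<phi>)) - e k (h (k - 1) (e k \<phi>))"
      using chain_map_comm[OF q \<phi>] complex_dd_Suc[OF F linear_in[OF h \<phi>]] by simp
    also have "\<dots> = E (k - 1) (e k \<phi>)"
      using complex_dd[OF F \<phi>] linear_0[OF h module_0[OF FM], of "k - 1 - 1"] by (simp add: E_def)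
    finally show "e k (E k \<phi>) = E (k - 1) (e k \<phi>)" .
  qed
  \<comment> \<open>\<open>D\<close> maps to \<open>W\<close> by \<open>E i\<close> and back by
    \<open>p\<close>. Since \<open>E\<close> differs from \<open>i p\<close> by the homotopy
    \<open>h\<close>, the composite is homotopic to the identity of \<open>D\<close> through
    \<open>p h i\<close>.\<close>
  have DW: "dominated ?K D d' act' W e free_act"
    unfolding dominated_def
  proof (intro exI conjI)
    show "chain_map ?K D d' act' W e free_act (\<lambda>k x. E k (i k x))"
      by (rule chain_map_comp[OF chain_map_mono[OF i KL] Ecm])
    show "chain_map ?K W e free_act D d' act' p"
    proof (rule chain_mapI)
      show "linear_map ?K (W k) free_act (D k) act' (p k)" for k
        by (rule linear_map_domain[OF linear_map_mono[OF pl KL] WF])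
      show "d' k (p k \<psi>) = p (k - 1) (e k \<psi>)" if "\<psi> \<in> W k" for k \<psi>
        using chain_map_comm[OF p] WF that by blast
    qed
    show "chain_homotopic ?K D d' act' D d' act' (\<lambda>k x. p k (E k (i k x))) (\<lambda>k x. x)"
      unfolding chain_homotopic_def
    proof (intro exI[of _ "\<lambda>k x. - p (k + 1) (h k (i k x))"] conjI allI ballI)
      fix k
      note MD = complex_module[OF D]
      show "linear_map ?K (D k) act' (D (k + 1)) act' (\<lambda>x. - p (k + 1) (h k (i k x)))"
        by (rule linear_neg[OF linear_comp[OF linear_comp[OF linear_map_mono[OF il KL] h] linear_map_mono[OF pl KL]]
              right_module_mono[OF MD KL]])
      fix x assume x: "x \<in> D k"
      have ix: "i k x \<in> ?F k"
        by (rule chain_map_in[OF i x])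
      have hix: "h k (i k x) \<in> ?F (k + 1)"
        by (rule linear_in[OF h ix])
      have eix: "e k (i k x) \<in> ?F (k - 1)"
        by (rule complex_d[OF F ix])
      have 1: "i k (p k (i k x)) \<in> ?F k" "e (k + 1) (h k (i k x)) \<in> ?F k" "h (k - 1) (e k (i k x)) \<in> ?F k"
        using chain_map_in[OF q ix] complex_d_Suc[OF F hix] linear_in[OF h eix] by auto
      have "p k (E k (i k x)) = p k (i k (p k (i k x))) - p k (e (k + 1) (h k (i k x))) - p k (h (k - 1) (e k (i k x)))"
        unfolding E_def
        using linear_diff[OF pl FM module_diff[OF FM 1(1,2)] 1(3)] linear_diff[OF pl FM 1(1,2)] by simp
      also have "\<dots> = x - d' (k + 1) (p (k + 1) (h k (i k x))) - p k (h (k - 1) (i (k - 1) (d' k x)))"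
        using pi[OF x] chain_map_comm[OF p hix] chain_map_comm[OF i x] by simp
      finally show "p k (E k (i k x)) - x = d' (k + 1) (- p (k + 1) (h k (i k x))) + - p (k - 1 + 1) (h (k - 1) (i (k - 1) (d' k x)))"
        using linear_uminus[OF complex_linear[OF D] MD linear_in[OF pl hix]] by simp
    qed
  qed
  have finB: "finite (?B k)" for k
    using fin by blast
  have bdB: "?B k = {}" if "k \<notin> {lo..hi}" for k
    using bd[of k] that by auto
  have CK: "chain_complex ?K C d act" and DK: "chain_complex ?K D d' act'"
    using chain_complex_mono[OF _ KL] C D by blast+
  show ?thesis
  proof (rule coordinatize[OF Wc SK finB bdB dbW])
    fix J' :: "int \<Rightarrow> nat set" and e' i' p'
    assume J': "\<And>k. finite (J' k)" "\<And>k l. k \<noteq> l \<Longrightarrow> J' k \<inter> J' l = {}"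
      "\<And>k. k \<notin> {lo..hi} \<Longrightarrow> J' k = {}"
      "chain_complex ?K (\<lambda>k. free_mod ?K (J' k)) e' free_act"
      "chain_map ?K W e free_act (\<lambda>k. free_mod ?K (J' k)) e' free_act i'"
      "chain_map ?K (\<lambda>k. free_mod ?K (J' k)) e' free_act W e free_act p'"
      "\<And>k x. x \<in> W k \<Longrightarrow> p' k (i' k x) = x"
    have WJ: "dominated ?K W e free_act (\<lambda>k. free_mod ?K (J' k)) e' free_act"
      by (rule retract_dominated[OF J'(5,6) _ Wc]) (rule J'(7))
    have "dominated ?K C d act (\<lambda>k. free_mod ?K (J' k)) e' free_act"
      by (rule dominated_trans[OF dominated_trans[OF dominated_mono[OF homotopy_equiv_dominated[OF CD] KL] DW CK DK] WJ CK Wc])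
    from fin_dominated_of_dominated[OF SK CK J'(1,2,3) lohi J'(4) this] show ?thesis
      by blast
  qed
qed


section \<open>From finite domination over the smaller ring to the larger one\<close>

text \<open>Extension of scalars for a \<open>K\<close>-linear \<open>u\<close> on a free module;
  for a target that is already an \<open>L\<close>-module this is the adjoint map. Only the values
  of \<open>u\<close> on unit vectors are read, and those vectors lie in the smaller free
  module.\<close>

definition lext :: "'i set \<Rightarrow> ('m::ab_group_add \<Rightarrow> 'a::ring_1 \<Rightarrow> 'm) \<Rightarrow> (('i \<Rightarrow> 'a) \<Rightarrow> 'm) \<Rightarrow> ('i \<Rightarrow> 'a) \<Rightarrow> 'm" where
  "lext J act u \<phi> = (\<Sum>j\<in>J. act (u (unit_vec j)) (\<phi> j))"

lemma lext_linear:
  assumes "subring S" "right_module S M act" "\<And>j. j \<in> J \<Longrightarrow> u (unit_vec j) \<in> M"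
  shows "linear_map S (free_mod S J) free_act M act (lext J act u)"
  unfolding lext_def
  by (intro linear_sum_maps[OF assms(2)] linear_comp[OF linear_proj] linear_act_const assms)

lemma lext_eq:
  assumes "linear_map S (free_mod S J) free_act M act u" "subring S" "finite J" "\<phi> \<in> free_mod S J"
  shows "lext J act u \<phi> = u \<phi>"
  unfolding lext_def by (rule linear_on_free[OF assms, symmetric])

context one_variable
begin

lemma FKL: "free_mod K J \<subseteq> free_mod L J"
  unfolding free_mod_def using KL by blast

lemma linear_X:
  assumes M: "right_module L M act"
  shows "linear_map L M act M act (\<lambda>x. act x (X t))"
proof (rule linear_mapI)
  show "act (act x a) (X t) = act (act x (X t)) a" if "x \<in> M" "a \<in> L" for x a
    using act_mult[OF M that X_in_L, of t] act_mult[OF M that(1) X_in_L that(2), of t] X_central[of t a] by simp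
qed (intro module_act[OF M] act_add[OF M] X_in_L; assumption)+

lemma lext_linear_free:
  assumes "linear_map K (free_mod K J) free_act M act u" "right_module L M act"
  shows "linear_map L (free_mod L J) free_act M act (lext J act u)"
  by (rule lext_linear[OF laurent_ring_subring assms(2)])
    (rule linear_in[OF assms(1) unit_vec_in[OF laurent_ring_subring]])

lemma lext_linear_free2:
  assumes "linear_map K (free_mod K J) free_act (free_mod K J') free_act u"
  shows "linear_map L (free_mod L J) free_act (free_mod L J') free_act (lext J free_act u)"
  by (rule lext_linear[OF laurent_ring_subring free_mod_module[OF laurent_ring_subring]])
    (use linear_in[OF assms unit_vec_in[OF laurent_ring_subring]] FKL in blast)

lemma lext_unit_vec:
  assumes "linear_map K (free_mod K J) free_act M act u" "finite J" "j \<in> J"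
  shows "lext J act u (unit_vec j) = u (unit_vec j)"
  by (rule lext_eq[OF assms(1) laurent_ring_subring assms(2) unit_vec_in[OF laurent_ring_subring assms(3)]])

text \<open>Both sides are \<open>L\<close>-linear and agree on unit vectors, since the inner value
  there lies over \<open>K\<close>, where \<open>lext\<close> changes nothing.\<close>

lemma lext_comp:
  assumes u: "linear_map K (free_mod K J) free_act (free_mod K J') free_act u"
    and w: "linear_map K (free_mod K J') free_act M act w" and M: "right_module L M act"
    and fin: "finite J" "finite J'" and \<phi>: "\<phi> \<in> free_mod L J"
  shows "lext J' act w (lext J free_act u \<phi>) = lext J act (\<lambda>x. w (u x)) \<phi>"
proof (rule linear_free_eqI[OF linear_comp[OF lext_linear_free2[OF u] lext_linear_free[OF w M]]
      lext_linear_free[OF linear_comp[OF u w] M] laurent_ring_subring fin(1) \<phi>])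
  fix j assume j: "j \<in> J"
  note S = laurent_ring_subring
  show "lext J' act w (lext J free_act u (unit_vec j)) = lext J act (\<lambda>x. w (u x)) (unit_vec j)"
    unfolding lext_unit_vec[OF u fin(1) j] lext_unit_vec[OF linear_comp[OF u w] fin(1) j]
    by (rule lext_eq[OF w S fin(2) linear_in[OF u unit_vec_in[OF S j]]])
qed

lemma lext_comp2:
  assumes u: "linear_map K (free_mod K J) free_act (free_mod K J') free_act u"
    and w: "linear_map K (free_mod K J') free_act (free_mod K J'') free_act w"
    and fin: "finite J" "finite J'" and \<phi>: "\<phi> \<in> free_mod L J"
  shows "lext J' free_act w (lext J free_act u \<phi>) = lext J free_act (\<lambda>x. w (u x)) \<phi>"
  by (rule lext_comp[OF u linear_map_codomain[OF w] free_mod_module[OF laurent_ring_subring] fin \<phi>])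
    (use linear_in[OF w] FKL in blast)

lemma lext_cong: "(\<And>j. j \<in> J \<Longrightarrow> u (unit_vec j) = w (unit_vec j)) \<Longrightarrow> lext J act u \<phi> = lext J act w \<phi>"
  unfolding lext_def by simp

section \<open>Coefficient sequences of columns over \<open>K((x))\<close>\<close>

definition cf :: "int \<Rightarrow> ('i \<Rightarrow> ('r::ring_1) series) \<Rightarrow> 'i \<Rightarrow> 'r laurent" where
  "cf t z = (\<lambda>j. co t (z j))"

lemma cf_in:
  assumes "finite J" "z \<in> cols N J"
  shows "cf t z \<in> free_mod K J"
proof -
  have "co t (z j) = 0" if "j \<notin> J" for j
  proof -
    have "z j = 0" using assms(2) that by (simp add: cols_def)
    then show ?thesis using co_0 by metis
  qed
  then show ?thesis
    using co_in_K[OF cols_in[OF assms(2)]] by (simp add: free_mod_iff[OF assms(1)] cf_def)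
qed

lemma cf_add: "z \<in> cols N J \<Longrightarrow> w \<in> cols N J \<Longrightarrow> cf t (z + w) = cf t z + cf t w"
proof
  fix j
  assume z: "z \<in> cols N J" and w: "w \<in> cols N J"
  have eq: "(z + w) j = z j + w j"
    by (rule plus_fun_apply)
  show "cf t (z + w) j = (cf t z + cf t w) j"
    unfolding plus_fun_apply[of "cf t z" "cf t w" j] unfolding cf_def eq
    by (rule co_add[OF cols_in[OF z] cols_in[OF w]])
qed

lemma cf_0: "cf t (0 :: 'i \<Rightarrow> ('r::ring_1) series) = 0"
proof
  fix j :: 'i
  have "co t (0 :: 'r series) = 0" by (rule co_0)
  then show "cf t 0 j = (0 :: 'i \<Rightarrow> 'r laurent) j"
    unfolding cf_def zero_fun_apply[of j] by metis
qed

lemma cf_diff: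
  assumes "z \<in> cols N J" "w \<in> cols N J"
  shows "cf t (z - w) = cf t z - cf t w"
  using cf_add[OF cols_diff[OF N_left_module assms] assms(2), of t] by (simp add: algebra_simps)

lemma cf_eqI:
  assumes "z \<in> cols N J" "w \<in> cols N J" "\<And>t. cf t z = cf t w"
  shows "z = w"
proof
  fix j
  show "z j = w j"
    by (rule co_eqI[OF cols_in[OF assms(1)] cols_in[OF assms(2)]]) (use assms(3) in \<open>simp add: cf_def fun_eq_iff\<close>)
qed

lemma cf_lower:
  assumes "finite J" "z \<in> cols N J"
  shows "\<exists>t0. \<forall>t<t0. cf t z = 0"
proof -
  obtain t0 where t0: "\<And>j t. t < t0 j \<Longrightarrow> co t (z j) = 0"
    using co_lower[OF cols_in[OF assms(2)]] by metis
  have "cf t z = 0" if "t < Min (insert 0 (t0 ` J))" for t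
  proof
    fix j
    show "cf t z j = 0 j"
    proof (cases "j \<in> J")
      case True
      then have "t < t0 j"
        using that assms(1) by simp
      then show ?thesis
        using t0 by (simp add: cf_def)
    next
      case False
      then show ?thesis
        using cf_in[OF assms, of t] by (simp add: free_mod_iff[OF assms(1)])
    qed
  qed
  then show ?thesis by blast
qed

lemma cols_with_cf:
  fixes c :: "int \<Rightarrow> 'i \<Rightarrow> ('r::ring_1) laurent"
  assumes J: "finite J" and c: "\<And>t. c t \<in> free_mod K J" "\<And>t. t < t0 \<Longrightarrow> c t = 0"
  shows "\<exists>z\<in>cols N J. \<forall>t. cf t z = c t"
proof -
  have "\<exists>f\<in>N. \<forall>t. co t f = c t j" for j
    by (rule series_with_co[of _ t0]) (use c J in \<open>auto simp: free_mod_iff\<close>)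
  then obtain f where f: "\<And>j. f j \<in> N" "\<And>j t. co t (f j) = c t j"
    by metis
  define z where "z j = (if j \<in> J then f j else 0)" for j
  have "z \<in> cols N J"
    using f(1) by (simp add: cols_def z_def N_0)
  moreover have "cf t z = c t" for t
  proof
    fix j
    have "co t (0 :: 'r series) = 0" by (rule co_0)
    moreover have "c t j = 0" if "j \<notin> J"
      using c(1)[of t] that by (simp add: free_mod_iff[OF J])
    ultimately show "cf t z j = c t j"
      using f(2) by (cases "j \<in> J") (simp_all only: cf_def z_def if_True if_False not_False_eq_True)
  qed
  ultimately show ?thesis by blast
qed

text \<open>Extended maps have matrix entries in \<open>K\<close>, of degree 0, so they act on every
  coefficient separately, whereas \<open>cf_X\<close> shifts the sequence. Together the two lemmas
  turn equations over \<open>K((x))\<close> into recursions over \<open>K\<close>.\<close>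

lemma cf_mat:
  assumes u: "linear_map K (free_mod K J) free_act (free_mod K J') free_act u" and J: "finite J" and z: "z \<in> cols N J"
  shows "cf t (mat series_lmult J (lext J free_act u) z) = u (cf t z)"
proof
  fix l
  note S = laurent_ring_subring
  have uK: "u (unit_vec j) l \<in> K" if "j \<in> J" for j
    using linear_in[OF u unit_vec_in[OF S that]] by (simp add: free_mod_def)
  have m: "mat series_lmult J (lext J free_act u) z l = (\<Sum>j\<in>J. series_lmult (u (unit_vec j) l) (z j))"
    unfolding mat_def by (rule sum.cong[OF refl]) (simp only: lext_unit_vec[OF u J])
  have "co t (\<Sum>j\<in>J. series_lmult (u (unit_vec j) l) (z j)) = (\<Sum>j\<in>J. co t (series_lmult (u (unit_vec j) l) (z j)))"
    by (rule co_sum) (use uK KL cols_in[OF z] in \<open>auto intro!: N_lmult\<close>)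
  also have "\<dots> = (\<Sum>j\<in>J. u (unit_vec j) l * co t (z j))"
    by (intro sum.cong[OF refl] co_lmult cols_in[OF z] uK)
  also have "\<dots> = u (cf t z) l"
    using linear_on_free[OF u S J cf_in[OF J z]] by (simp add: sum_fun_apply free_act_def cf_def)
  finally show "cf t (mat series_lmult J (lext J free_act u) z) l = u (cf t z) l"
    unfolding cf_def m .
qed

lemma mat_X:
  assumes "finite J" "z \<in> cols N J"
  shows "mat series_lmult J (\<lambda>\<phi>. free_act \<phi> (X s)) z = (\<lambda>j. series_lmult (X s) (z j))"
proof
  fix l
  have z0: "z l = 0" if "l \<notin> J"
    using that assms(2) by (simp add: cols_def)
  have "mat series_lmult J (\<lambda>\<phi>. free_act \<phi> (X s)) z l = (\<Sum>j\<in>J. if j = l then series_lmult (X s) (z l) else 0)"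
    unfolding mat_def
    by (rule sum.cong) (auto simp: free_act_def unit_vec_def lact_0_left[OF N_left_module subring_0[OF laurent_ring_subring] cols_in[OF assms(2)]])
  also have "\<dots> = series_lmult (X s) (z l)"
    using assms(1) z0 by (simp add: lact_0[OF N_left_module X_in_L])
  finally show "mat series_lmult J (\<lambda>\<phi>. free_act \<phi> (X s)) z l = series_lmult (X s) (z l)" .
qed

lemma cf_X:
  assumes "finite J" "z \<in> cols N J"
  shows "cf t (mat series_lmult J (\<lambda>\<phi>. free_act \<phi> (X s)) z) = cf (t - s) z"
  unfolding mat_X[OF assms] cf_def by (intro ext co_X cols_in[OF assms(2)])

lemma free_expand:
  assumes J: "finite J" and \<phi>: "\<phi> \<in> free_mod L J"
  shows "\<exists>m. (\<forall>t. m < \<bar>t\<bar> \<longrightarrow> cf t (col_of \<phi>) = 0) \<and> \<phi> = (\<Sum>t\<in>{-m..m}. free_act (cf t (col_of \<phi>)) (X t))"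
proof -
  have \<phi>L: "\<phi> j \<in> L" for j
    using \<phi> by (simp add: free_mod_def)
  obtain m where m: "\<And>j t. m j < \<bar>t\<bar> \<Longrightarrow> co t (Poly_Mapping.lookup (\<phi> j)) = 0"
    using co_finite[OF \<phi>L] by metis
  let ?m = "Max (insert 0 (m ` J))"
  have 0: "co t (Poly_Mapping.lookup (\<phi> j)) = 0" if "?m < \<bar>t\<bar>" for j t
  proof (cases "j \<in> J")
    case True
    then have "m j \<le> ?m" using J by simp
    then show ?thesis using m[of j t] that by simp
  next
    case False
    then show ?thesis
      using cf_in[OF J col_of_in[OF \<phi>], of t] by (simp add: free_mod_iff[OF J] cf_def col_of_def)
  qed
  show ?thesis
  proof (intro exI[of _ ?m] conjI allI impI)
    show "cf t (col_of \<phi>) = 0" if "?m < \<bar>t\<bar>" for t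
      using 0[OF that] by (simp add: cf_def col_of_def fun_eq_iff)
    show "\<phi> = (\<Sum>t\<in>{-?m..?m}. free_act (cf t (col_of \<phi>)) (X t))"
    proof
      fix j
      have "\<phi> j = (\<Sum>t\<in>{-?m..?m}. co t (Poly_Mapping.lookup (\<phi> j)) * X t)"
        by (rule laurent_expand[OF \<phi>L]) (use 0 in auto)
      then show "\<phi> j = (\<Sum>t\<in>{-?m..?m}. free_act (cf t (col_of \<phi>)) (X t)) j"
        by (simp add: sum_fun_apply free_act_def cf_def col_of_def)
    qed
  qed
qed

end

section \<open>Free modules on a disjoint sum of index sets\<close>

lemma comp_Inl_in: "z \<in> free_mod S (A <+> B) \<Longrightarrow> z \<circ> Inl \<in> free_mod S A"
  and comp_Inr_in: "z \<in> free_mod S (A <+> B) \<Longrightarrow> z \<circ> Inr \<in> free_mod S B"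
proof -
  assume z: "z \<in> free_mod S (A <+> B)"
  have "finite (Inl -` {i. z i \<noteq> 0})" "finite (Inr -` {i. z i \<noteq> 0})"
    by (rule finite_vimageI; use z in \<open>simp add: free_mod_def\<close>)+
  then show "z \<circ> Inl \<in> free_mod S A" "z \<circ> Inr \<in> free_mod S B"
    using z by (auto simp: free_mod_def vimage_def)
qed

lemma linear_comp_Inl: "linear_map S (free_mod S (A <+> B)) free_act (free_mod S A) free_act (\<lambda>z. z \<circ> Inl)"
  by (rule linear_mapI) (auto simp: comp_Inl_in free_act_def fun_eq_iff)

lemma linear_comp_Inr: "linear_map S (free_mod S (A <+> B)) free_act (free_mod S B) free_act (\<lambda>z. z \<circ> Inr)"
  by (rule linear_mapI) (auto simp: comp_Inr_in free_act_def fun_eq_iff)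

lemma case_sum_in:
  assumes "finite A" "finite B" "a \<in> free_mod S A" "b \<in> free_mod S B"
  shows "case_sum a b \<in> free_mod S (A <+> B)"
proof -
  have "finite (A <+> B)" using assms by (rule_tac finite_Plus)
  then show ?thesis
    using assms by (auto simp: free_mod_iff split: sum.split)
qed

lemma linear_case_sum:
  assumes "finite A" "finite B" "linear_map S M act (free_mod S A) free_act f" "linear_map S M act (free_mod S B) free_act g"
  shows "linear_map S M act (free_mod S (A <+> B)) free_act (\<lambda>x. case_sum (f x) (g x))"
proof (rule linear_mapI)
  show "case_sum (f x) (g x) \<in> free_mod S (A <+> B)" if "x \<in> M" for x
    by (rule case_sum_in[OF assms(1,2) linear_in[OF assms(3) that] linear_in[OF assms(4) that]])
  show "case_sum (f (x + y)) (g (x + y)) = case_sum (f x) (g x) + case_sum (f y) (g y)" if "x \<in> M" "y \<in> M" for x y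
    using linear_add[OF assms(3) that] linear_add[OF assms(4) that] by (auto simp: fun_eq_iff split: sum.split)
  show "case_sum (f (act x a)) (g (act x a)) = free_act (case_sum (f x) (g x)) a" if "x \<in> M" "a \<in> S" for x a
    using linear_act[OF assms(3) that] linear_act[OF assms(4) that]
    by (auto simp: fun_eq_iff free_act_def split: sum.split)
qed


subsection \<open>The mapping torus\<close>

lemma lext_post:
  assumes g: "linear_map S M act M' act' g" and M: "right_module S M act" and "subring S"
    and u: "\<And>j. j \<in> J \<Longrightarrow> u (unit_vec j) \<in> M" and \<phi>: "\<phi> \<in> free_mod S J"
  shows "g (lext J act u \<phi>) = lext J act' (\<lambda>x. g (u x)) \<phi>"
proof -
  have \<phi>S: "\<phi> j \<in> S" for j
    using \<phi> by (simp add: free_mod_def)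
  have "g (lext J act u \<phi>) = (\<Sum>j\<in>J. g (act (u (unit_vec j)) (\<phi> j)))"
    unfolding lext_def by (rule linear_sum[OF g M]) (intro module_act[OF M] u \<phi>S)
  then show ?thesis
    unfolding lext_def using linear_act[OF g u \<phi>S] by simp
qed

lemma lext_plus:
  assumes M: "right_module S M act" and u: "\<And>j. j \<in> J \<Longrightarrow> u (unit_vec j) \<in> M"
    and w: "\<And>j. j \<in> J \<Longrightarrow> w (unit_vec j) \<in> M" and \<phi>: "\<phi> \<in> free_mod S J"
  shows "lext J act u \<phi> + lext J act w \<phi> = lext J act (\<lambda>x. u x + w x) \<phi>"
proof -
  have "\<phi> j \<in> S" for j
    using \<phi> by (simp add: free_mod_def)
  then show ?thesis
    unfolding lext_def using act_add[OF M u w] by (simp add: sum.distrib)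
qed

lemma lext_zero:
  assumes "right_module S M act" "\<And>j. j \<in> J \<Longrightarrow> u (unit_vec j) = 0" "\<phi> \<in> free_mod S J"
  shows "lext J act u \<phi> = 0"
  unfolding lext_def using assms(2,3) act_0[OF assms(1)] by (simp add: free_mod_def)

text \<open>In the application \<open>q = i p\<close>, \<open>\<alpha> = i f\<close> and
  \<open>\<beta> = g p\<close>, where \<open>f\<close> and \<open>g\<close> are mutually inverse
  homotopy equivalences between \<open>C\<close> and a retract \<open>D\<close> of \<open>F\<close>.
  The last assumption records that \<open>\<alpha> \<beta>\<close> and \<open>q\<close> agree on
  homology, which is the form used by the exactness arguments. \<open>C\<close> carries an
  \<open>L\<close>-action, while all comparison maps are only \<open>K\<close>-linear.\<close>

locale mapping_torus = one_variable V v \<epsilon> for V v \<epsilon> +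
  fixes C :: "int \<Rightarrow> ('m::ab_group_add) set" and d :: "int \<Rightarrow> 'm \<Rightarrow> 'm"
    and act :: "'m \<Rightarrow> ('r::ring_1) laurent \<Rightarrow> 'm"
    and J :: "int \<Rightarrow> nat set" and e q :: "int \<Rightarrow> (nat \<Rightarrow> 'r laurent) \<Rightarrow> nat \<Rightarrow> 'r laurent"
    and \<alpha> :: "int \<Rightarrow> 'm \<Rightarrow> nat \<Rightarrow> 'r laurent" and \<beta> :: "int \<Rightarrow> (nat \<Rightarrow> 'r laurent) \<Rightarrow> 'm"
    and \<eta> :: "int \<Rightarrow> 'm \<Rightarrow> 'm"
  assumes C: "chain_complex L C d act" and fin: "\<And>k. finite (J k)"
    and F: "chain_complex K (\<lambda>k. free_mod K (J k)) e free_act"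
    and q: "chain_map K (\<lambda>k. free_mod K (J k)) e free_act (\<lambda>k. free_mod K (J k)) e free_act q"
    and qq: "\<And>k x. x \<in> free_mod K (J k) \<Longrightarrow> q k (q k x) = q k x"
    and \<alpha>: "chain_map K C d act (\<lambda>k. free_mod K (J k)) e free_act \<alpha>"
    and \<beta>: "chain_map K (\<lambda>k. free_mod K (J k)) e free_act C d act \<beta>"
    and q\<alpha>: "\<And>k c. c \<in> C k \<Longrightarrow> q k (\<alpha> k c) = \<alpha> k c"
    and \<beta>q: "\<And>k x. x \<in> free_mod K (J k) \<Longrightarrow> \<beta> k (q k x) = \<beta> k x"
    and \<eta>: "\<And>k. linear_map K (C k) act (C (k + 1)) act (\<eta> k)"
    and d\<eta>: "\<And>k c. c \<in> C k \<Longrightarrow> d (k + 1) (\<eta> k c) + \<eta> (k - 1) (d k c) = c - \<beta> k (\<alpha> k c)"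
    and \<alpha>\<beta>: "\<And>k x. x \<in> free_mod K (J k) \<Longrightarrow> e k x = 0
      \<Longrightarrow> \<exists>w\<in>free_mod K (J (k + 1)). \<alpha> k (\<beta> k x) - q k x = e (k + 1) w"
begin

abbreviation FK :: "int \<Rightarrow> (nat \<Rightarrow> 'r laurent) set" where "FK k \<equiv> free_mod K (J k)"
abbreviation FL :: "int \<Rightarrow> (nat \<Rightarrow> 'r laurent) set" where "FL k \<equiv> free_mod L (J k)"

lemmas S = laurent_ring_subring
lemmas MC = complex_module[OF C]
lemmas MF = free_mod_module[OF laurent_ring_subring]
lemmas eK = complex_linear[OF F]
lemmas \<alpha>K = chain_map_linear[OF \<alpha>]
lemmas \<beta>K = chain_map_linear[OF \<beta>]
lemmas qK = chain_map_linear[OF q]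

lemma eK_Suc: "linear_map K (FK (k + 1)) free_act (FK k) free_act (e (k + 1))"
  by (rule complex_linear_Suc[OF F])

lemma mult_X_chain_map: "chain_map L C d act C d act (\<lambda>k c. act c (X t))"
  by (rule chain_mapI[OF linear_X[OF MC]]) (rule linear_act[OF complex_linear[OF C] _ X_in_L])

text \<open>\<open>conj_X 1\<close> is multiplication by \<open>x\<close> transported to \<open>F\<close>, and \<open>conj_X (-1)\<close> is its homotopy inverse.\<close>

definition conj_X :: "int \<Rightarrow> int \<Rightarrow> (nat \<Rightarrow> 'r laurent) \<Rightarrow> nat \<Rightarrow> 'r laurent" where
  "conj_X t k x = \<alpha> k (act (\<beta> k x) (X t))"

lemma conj_X: "chain_map K FK e free_act FK e free_act (conj_X t)"
  unfolding conj_X_def[abs_def]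
  by (rule chain_map_comp[OF chain_map_comp[OF \<beta> chain_map_mono[OF mult_X_chain_map KL]] \<alpha>])

lemmas UK = chain_map_linear[OF conj_X]

lemma act_X_in: "c \<in> C k \<Longrightarrow> act c (X t) \<in> C k"
  by (rule module_act[OF MC _ X_in_L])

lemma q_conj_X: "x \<in> FK k \<Longrightarrow> q k (conj_X t k x) = conj_X t k x"
  unfolding conj_X_def by (intro q\<alpha> act_X_in linear_in[OF \<beta>K])

lemma conj_X_q: "x \<in> FK k \<Longrightarrow> conj_X t k (q k x) = conj_X t k x"
  unfolding conj_X_def by (simp add: \<beta>q)

definition bdK :: "int \<Rightarrow> (nat \<Rightarrow> 'r laurent) set" where
  "bdK k = e (k + 1) ` FK (k + 1)"

lemma bdK_closed:
  shows bdK_0: "0 \<in> bdK k"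
    and bdK_add: "x \<in> bdK k \<Longrightarrow> y \<in> bdK k \<Longrightarrow> x + y \<in> bdK k"
    and bdK_diff: "x \<in> bdK k \<Longrightarrow> y \<in> bdK k \<Longrightarrow> x - y \<in> bdK k"
proof -
  show "0 \<in> bdK k"
    unfolding bdK_def using linear_0[OF eK_Suc module_0[OF MF]] module_0[OF MF] by (metis image_eqI)
  show "x \<in> bdK k \<Longrightarrow> y \<in> bdK k \<Longrightarrow> x + y \<in> bdK k"
  proof -
    assume "x \<in> bdK k" "y \<in> bdK k"
    then obtain a b where ab: "a \<in> FK (k + 1)" "x = e (k + 1) a" "b \<in> FK (k + 1)" "y = e (k + 1) b"
      unfolding bdK_def by blast
    show ?thesis
      unfolding bdK_def ab(2,4) linear_add[OF eK_Suc ab(1,3), symmetric]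
      by (rule imageI[OF module_add[OF MF ab(1,3)]])
  qed
  show "x \<in> bdK k \<Longrightarrow> y \<in> bdK k \<Longrightarrow> x - y \<in> bdK k"
  proof -
    assume "x \<in> bdK k" "y \<in> bdK k"
    then obtain a b where ab: "a \<in> FK (k + 1)" "x = e (k + 1) a" "b \<in> FK (k + 1)" "y = e (k + 1) b"
      unfolding bdK_def by blast
    show ?thesis
      unfolding bdK_def ab(2,4) linear_diff[OF eK_Suc MF ab(1,3), symmetric]
      by (rule imageI[OF module_diff[OF MF ab(1,3)]])
  qed
qed

lemma bdK_map:
  assumes "chain_map K FK e free_act FK e free_act u" "x \<in> bdK k"
  shows "u k x \<in> bdK k"
proof -
  obtain a where a: "a \<in> FK (k + 1)" "x = e (k + 1) a"
    using assms(2) unfolding bdK_def by blast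
  have "u k x = e (k + 1) (u (k + 1) a)"
    using chain_map_comm[OF assms(1) a(1)] a(2) by simp
  then show ?thesis
    unfolding bdK_def using chain_map_in[OF assms(1) a(1)] by blast
qed

text \<open>Between the two multiplications sits \<open>\<beta> \<alpha>\<close>, homotopic to the
  identity. Multiplication by \<open>X t\<close> is a chain map of \<open>C\<close>, so on a cycle
  the homotopy contributes a boundary, and \<open>X s * X t = 1\<close> leaves
  \<open>\<alpha> \<beta>\<close>, which is \<open>q\<close> on homology.\<close>

lemma conj_X_inverse:
  assumes x: "x \<in> FK k" "e k x = 0" and st: "s + t = 0"
  shows "conj_X t k (conj_X s k x) - q k x \<in> bdK k"
proof -
  let ?c = "act (\<beta> k x) (X s)"
  have bx: "\<beta> k x \<in> C k" by (rule linear_in[OF \<beta>K x(1)])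
  have c: "?c \<in> C k" by (rule act_X_in[OF bx])
  have \<eta>c: "\<eta> k ?c \<in> C (k + 1)" by (rule linear_in[OF \<eta> c])
  have "d k ?c = act (\<beta> (k - 1) (e k x)) (X s)"
    using chain_map_comm[OF mult_X_chain_map bx] chain_map_comm[OF \<beta> x(1)] by simp
  also have "\<dots> = 0"
    unfolding x(2) linear_0[OF \<beta>K module_0[OF MF]] by (rule act_0[OF MC X_in_L])
  finally have "\<beta> k (\<alpha> k ?c) = ?c - d (k + 1) (\<eta> k ?c)"
    using d\<eta>[OF c] linear_0[OF \<eta> module_0[OF MC], of "k - 1"] by (simp add: algebra_simps)
  then have "act (\<beta> k (\<alpha> k ?c)) (X t) = act ?c (X t) - act (d (k + 1) (\<eta> k ?c)) (X t)"
    using act_diff[OF MC c complex_d_Suc[OF C \<eta>c] X_in_L] by simp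
  also have "act ?c (X t) = \<beta> k x"
  proof -
    have "X s * X t = (1 :: 'r laurent)"
      by (simp add: X_mult[symmetric] st X_0)
    then show ?thesis
      using act_mult[OF MC bx X_in_L X_in_L, of s t] act_1[OF MC bx] by simp
  qed
  also have "act (d (k + 1) (\<eta> k ?c)) (X t) = d (k + 1) (act (\<eta> k ?c) (X t))"
    by (rule linear_act[OF complex_linear[OF C] \<eta>c X_in_L, symmetric])
  finally have 1: "conj_X t k (conj_X s k x) = \<alpha> k (\<beta> k x - d (k + 1) (act (\<eta> k ?c) (X t)))"
    unfolding conj_X_def by simp
  have y: "act (\<eta> k ?c) (X t) \<in> C (k + 1)"
    by (rule act_X_in[OF \<eta>c])
  have 2: "\<alpha> k (\<beta> k x - d (k + 1) (act (\<eta> k ?c) (X t))) = \<alpha> k (\<beta> k x) - e (k + 1) (\<alpha> (k + 1) (act (\<eta> k ?c) (X t)))"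
    using linear_diff[OF \<alpha>K right_module_mono[OF MC KL] bx complex_d_Suc[OF C y]] chain_map_comm[OF \<alpha> y] by simp
  have "\<alpha> k (\<beta> k x) - q k x \<in> bdK k"
    using \<alpha>\<beta>[OF x] unfolding bdK_def by blast
  moreover have "e (k + 1) (\<alpha> (k + 1) (act (\<eta> k ?c) (X t))) \<in> bdK k"
    unfolding bdK_def using chain_map_in[OF \<alpha> y] by blast
  ultimately have "(\<alpha> k (\<beta> k x) - q k x) - e (k + 1) (\<alpha> (k + 1) (act (\<eta> k ?c) (X t))) \<in> bdK k"
    by (rule bdK_diff)
  then show ?thesis
    unfolding 1 2 by (simp add: algebra_simps)
qed

text \<open>The coefficients of \<open>xq - U + (1 - q)\<close> applied to a sequence.  On sequences that vanish far to the
  left this map is injective and surjective on homology, since the inverse of \<open>U\<close> propagates from one coefficient to the next.\<close>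

definition \<phi>K :: "int \<Rightarrow> (int \<Rightarrow> nat \<Rightarrow> 'r laurent) \<Rightarrow> int \<Rightarrow> nat \<Rightarrow> 'r laurent" where
  "\<phi>K k b t = q k (b (t - 1)) - conj_X 1 k (b t) + (b t - q k (b t))"

text \<open>Applying \<open>q\<close> to the hypothesis says that \<open>conj_X 1\<close> of
  \<open>b t\<close> is homologous to \<open>q (b (t - 1))\<close>. The homotopy inverse
  \<open>conj_X (-1)\<close> therefore carries the vanishing of \<open>q (b (t - 1))\<close> in
  homology on to \<open>q (b t)\<close>, starting where \<open>b\<close> is zero. The complementary
  part of the hypothesis is \<open>b t - q (b t)\<close> itself.\<close>

lemma \<phi>K_injective:
  assumes b: "\<And>t. b t \<in> FK k" "\<And>t. e k (b t) = 0" "\<And>t. t < t0 \<Longrightarrow> b t = 0"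
    and a: "\<And>t. \<phi>K k b t \<in> bdK k"
  shows "b t \<in> bdK k"
proof -
  have qb: "q k (b t) \<in> FK k" for t
    by (rule linear_in[OF qK b(1)])
  have Ub: "conj_X 1 k (b t) \<in> FK k" for t
    by (rule linear_in[OF UK b(1)])
  have qx: "q k (\<phi>K k b t) = q k (b (t - 1)) - conj_X 1 k (b t)" for t
  proof -
    have "q k (\<phi>K k b t) = q k (q k (b (t - 1))) - q k (conj_X 1 k (b t)) + (q k (b t) - q k (q k (b t)))"
      unfolding \<phi>K_def
      using linear_add[OF qK module_diff[OF MF qb Ub] module_diff[OF MF b(1) qb]]
        linear_diff[OF qK MF qb Ub] linear_diff[OF qK MF b(1) qb] by simp
    then show ?thesis
      using qq[OF b(1)] q_conj_X[OF b(1)] by simp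
  qed
  have qa: "q k (b (t - 1)) - conj_X 1 k (b t) \<in> bdK k" for t
    using bdK_map[OF q a] unfolding qx .
  have step: "q k (b t) \<in> bdK k" if "q k (b (t - 1)) \<in> bdK k" for t
  proof -
    have "q k (b (t - 1)) - (q k (b (t - 1)) - conj_X 1 k (b t)) \<in> bdK k"
      by (rule bdK_diff[OF that qa])
    then have "conj_X 1 k (b t) \<in> bdK k" by simp
    then have "conj_X (-1) k (conj_X 1 k (b t)) \<in> bdK k"
      by (rule bdK_map[OF conj_X])
    from bdK_diff[OF this conj_X_inverse[OF b(1,2), of 1 "-1" t]] show ?thesis by simp
  qed
  have small: "q k (b t) \<in> bdK k" if "t < t0" for t
    using b(3)[OF that] linear_0[OF qK module_0[OF MF]] bdK_0 by metis
  have "q k (b (t0 - 1 + int n)) \<in> bdK k" for n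
  proof (induction n)
    case 0
    then show ?case using small[of "t0 - 1"] by simp
  next
    case (Suc n)
    then show ?case using step[of "t0 - 1 + int (Suc n)"] by (simp add: algebra_simps)
  qed
  from this[of "nat (t - (t0 - 1))"] have "q k (b t) \<in> bdK k"
    using small[of t] by (cases "t < t0") auto
  moreover have "\<phi>K k b t - q k (\<phi>K k b t) \<in> bdK k"
    by (rule bdK_diff[OF a bdK_map[OF q a]])
  then have "b t - q k (b t) \<in> bdK k"
    unfolding qx by (simp add: \<phi>K_def)
  ultimately have "q k (b t) + (b t - q k (b t)) \<in> bdK k"
    by (rule bdK_add)
  then show ?thesis by simp
qed

text \<open>The equation is solved from left to right: its complementary part prescribes
  \<open>b t - q (b t) = z t - q (z t)\<close>, and its part in the image of \<open>q\<close> is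
  solved up to boundaries by applying \<open>conj_X (-1)\<close> to
  \<open>q (b (t - 1)) - q (z t)\<close>.\<close>

lemma \<phi>K_surjective:
  assumes z: "\<And>t. z t \<in> FK k" "\<And>t. e k (z t) = 0" "\<And>t. t < t0 \<Longrightarrow> z t = 0"
  shows "\<exists>b. (\<forall>t. b t \<in> FK k \<and> e k (b t) = 0 \<and> z t - \<phi>K k b t \<in> bdK k) \<and> (\<forall>t<t0. b t = 0)"
proof -
  \<comment> \<open>\<open>g n\<close> is to be \<open>b (t0 - 1 + n)\<close>; the initial 0 is the
    value just left of the range where \<open>z\<close> may be nonzero.\<close>
  define g where "g = rec_nat 0 (\<lambda>n x. (z (t0 + int n) - q k (z (t0 + int n)))
    + conj_X (-1) k (q k x - q k (z (t0 + int n))))"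
  have g0: "g 0 = 0" and gSuc: "g (Suc n) = (z (t0 + int n) - q k (z (t0 + int n)))
      + conj_X (-1) k (q k (g n) - q k (z (t0 + int n)))" for n
    by (simp_all add: g_def)
  define b where "b t = g (nat (t - t0 + 1))" for t
  have ecl: "e k (x - y) = 0" "e k (x + y) = 0" "e k (q k x) = 0" "e k (conj_X s k x) = 0"
    if "x \<in> FK k" "e k x = 0" "y \<in> FK k" "e k y = 0" for x y s
    using that linear_diff[OF eK MF that(1,3)] linear_add[OF eK that(1,3)] chain_map_comm[OF q that(1)]
      chain_map_comm[OF conj_X that(1)] linear_0[OF qK module_0[OF MF]] linear_0[OF UK module_0[OF MF]] by simp_all
  have mem: "q k x \<in> FK k" "conj_X s k x \<in> FK k" if "x \<in> FK k" for x s
    using linear_in[OF qK that] linear_in[OF UK that] by auto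
  have g: "g n \<in> FK k \<and> e k (g n) = 0" for n
  proof (induction n)
    case 0
    show ?case
      unfolding g0 by (rule conjI[OF module_0[OF MF] linear_0[OF eK module_0[OF MF]]])
  next
    case (Suc n)
    note zn = z(1)[of "t0 + int n"] z(2)[of "t0 + int n"]
    have 1: "q k (g n) - q k (z (t0 + int n)) \<in> FK k" "e k (q k (g n) - q k (z (t0 + int n))) = 0"
      using Suc zn by (auto intro!: module_diff[OF MF] mem ecl)
    have 2: "z (t0 + int n) - q k (z (t0 + int n)) \<in> FK k" "e k (z (t0 + int n) - q k (z (t0 + int n))) = 0"
      using zn by (auto intro!: module_diff[OF MF] mem ecl)
    have 3: "conj_X (-1) k (q k (g n) - q k (z (t0 + int n))) \<in> FK k"
       "e k (conj_X (-1) k (q k (g n) - q k (z (t0 + int n)))) = 0"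
      using mem(2)[OF 1(1)] ecl(4)[OF 1 1] by auto
    show ?case
      unfolding gSuc by (rule conjI[OF module_add[OF MF 2(1) 3(1)] ecl(2)[OF 2 3]])
  qed
  have b: "b t \<in> FK k" "e k (b t) = 0" for t
    using g by (auto simp: b_def)
  have b0: "b t = 0" if "t < t0" for t
    using that by (simp add: b_def g0)
  have "z t - \<phi>K k b t \<in> bdK k" for t
  proof (cases "t < t0")
    case True
    have "\<phi>K k b t = 0"
      unfolding \<phi>K_def using b0[OF True] b0[of "t - 1"] True linear_0[OF qK module_0[OF MF]] linear_0[OF UK module_0[OF MF]]
      by simp
    then show ?thesis
      using z(3)[OF True] bdK_0 by simp
  next
    case False
    define y where "y = q k (b (t - 1)) - q k (z t)"
    have n: "nat (t - t0 + 1) = Suc (nat (t - t0))" "t0 + int (nat (t - t0)) = t"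
      using False by auto
    have b1: "b (t - 1) = g (nat (t - t0))"
      by (simp add: b_def)
    have bt: "b t = (z t - q k (z t)) + conj_X (-1) k y"
      unfolding b_def n(1) gSuc n(2) y_def b1 by simp
    have y: "y \<in> FK k" "e k y = 0"
      unfolding y_def
      by (rule module_diff[OF MF mem(1)[OF b(1)] mem(1)[OF z(1)]],
          rule ecl(1)[OF mem(1)[OF b(1)] ecl(3)[OF b b] mem(1)[OF z(1)] ecl(3)[OF z(1,2) z(1,2)]])
    have qy: "q k y = y"
      unfolding y_def using linear_diff[OF qK MF mem(1)[OF b(1)] mem(1)[OF z(1)]] qq b(1) z(1) by simp
    have zq: "z t - q k (z t) \<in> FK k"
      by (rule module_diff[OF MF z(1) mem(1)[OF z(1)]])
    have qb: "q k (b t) = conj_X (-1) k y"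
      unfolding bt using linear_add[OF qK zq mem(2)[OF y(1)]] linear_diff[OF qK MF z(1) mem(1)[OF z(1)]]
        qq[OF z(1)] q_conj_X[OF y(1)] by simp
    have Ub: "conj_X 1 k (b t) = conj_X 1 k (conj_X (-1) k y)"
      using conj_X_q[OF b(1), of 1 t] qb by simp
    have "conj_X 1 k (conj_X (-1) k y) - y \<in> bdK k"
      using conj_X_inverse[OF y, of "-1" 1] qy by simp
    moreover have "z t - \<phi>K k b t = conj_X 1 k (conj_X (-1) k y) - y"
      unfolding \<phi>K_def Ub qb by (subst bt) (simp add: y_def)
    ultimately show ?thesis by simp
  qed
  then show ?thesis
    using b b0 by blast
qed

subsection \<open>The torus over Laurent polynomials and over series\<close>

definition et where "et k = lext (J k) free_act (e k)"
definition qt where "qt k = lext (J k) free_act (q k)"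
definition Ut where "Ut k = lext (J k) free_act (conj_X 1 k)"
definition \<phi> where "\<phi> k z = free_act (qt k z) (X 1) - Ut k z + (z - qt k z)"
definition bt where "bt k = lext (J k) act (\<beta> k)"
text \<open>The chain homotopy between \<open>\<beta>\<close> followed by multiplication by
  \<open>x\<close>, and \<open>conj_X 1\<close> followed by \<open>\<beta>\<close>. Its extension
  \<open>gt\<close> makes \<open>bt \<phi>\<close> null homotopic.\<close>

definition \<gamma> where "\<gamma> k x = \<eta> k (act (\<beta> k x) (X 1))"
definition gt where "gt k = lext (J k) act (\<gamma> k)"

lemma etL: "linear_map L (FL k) free_act (FL (k - 1)) free_act (et k)"
  unfolding et_def by (rule lext_linear_free2[OF eK])

lemma etL_Suc: "linear_map L (FL (k + 1)) free_act (FL k) free_act (et (k + 1))"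
  using etL[of "k + 1"] by simp

lemma qtL: "linear_map L (FL k) free_act (FL k) free_act (qt k)"
  unfolding qt_def by (rule lext_linear_free2[OF qK])

lemma UtL: "linear_map L (FL k) free_act (FL k) free_act (Ut k)"
  unfolding Ut_def by (rule lext_linear_free2[OF UK])

lemma \<phi>L: "linear_map L (FL k) free_act (FL k) free_act (\<phi> k)"
  unfolding \<phi>_def[abs_def]
  by (intro linear_plus linear_minus linear_comp[OF qtL linear_X[OF MF]] UtL qtL linear_id MF)

lemma btL: "linear_map L (FL k) free_act (C k) act (bt k)"
  unfolding bt_def by (rule lext_linear_free[OF \<beta>K MC])

lemma \<gamma>K: "linear_map K (FK k) free_act (C (k + 1)) act (\<gamma> k)"
  unfolding \<gamma>_def[abs_def]
  by (rule linear_comp[OF linear_comp[OF \<beta>K linear_map_mono[OF linear_X[OF MC] KL]] \<eta>])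

lemma gtL: "linear_map L (FL k) free_act (C (k + 1)) act (gt k)"
  unfolding gt_def by (rule lext_linear_free[OF \<gamma>K MC])

lemma et_et: "z \<in> FL k \<Longrightarrow> et (k - 1) (et k z) = 0"
proof -
  assume z: "z \<in> FL k"
  show ?thesis
    unfolding et_def lext_comp2[OF eK eK fin fin z]
    by (rule lext_zero[OF MF _ z]) (rule complex_dd[OF F unit_vec_in[OF S]])
qed

lemma et_qt: "z \<in> FL k \<Longrightarrow> et k (qt k z) = qt (k - 1) (et k z)"
  unfolding et_def qt_def lext_comp2[OF eK qK fin fin] lext_comp2[OF qK eK fin fin]
  by (rule lext_cong) (rule chain_map_comm[OF q unit_vec_in[OF S]])

lemma et_Ut: "z \<in> FL k \<Longrightarrow> et k (Ut k z) = Ut (k - 1) (et k z)"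
  unfolding et_def Ut_def lext_comp2[OF eK UK fin fin] lext_comp2[OF UK eK fin fin]
  by (rule lext_cong) (rule chain_map_comm[OF conj_X unit_vec_in[OF S]])

lemma qt_qt: "z \<in> FL k \<Longrightarrow> qt k (qt k z) = qt k z"
  unfolding qt_def lext_comp2[OF qK qK fin fin] by (rule lext_cong) (rule qq[OF unit_vec_in[OF S]])

lemma Ut_qt: "z \<in> FL k \<Longrightarrow> Ut k (qt k z) = Ut k z"
  unfolding qt_def Ut_def lext_comp2[OF qK UK fin fin] by (rule lext_cong) (rule conj_X_q[OF unit_vec_in[OF S]])

lemma et_\<phi>:
  assumes z: "z \<in> FL k"
  shows "et k (\<phi> k z) = \<phi> (k - 1) (et k z)"
proof -
  have qz: "qt k z \<in> FL k" and Uz: "Ut k z \<in> FL k"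
    using linear_in[OF qtL z] linear_in[OF UtL z] by auto
  have Xq: "free_act (qt k z) (X 1) \<in> FL k"
    by (rule module_act[OF MF qz X_in_L])
  have "et k (\<phi> k z) = et k (free_act (qt k z) (X 1)) - et k (Ut k z) + (et k z - et k (qt k z))"
    unfolding \<phi>_def
    using linear_add[OF etL module_diff[OF MF Xq Uz] module_diff[OF MF z qz]]
      linear_diff[OF etL MF Xq Uz] linear_diff[OF etL MF z qz] by simp
  then show ?thesis
    unfolding \<phi>_def using et_qt[OF z] et_Ut[OF z] linear_act[OF etL qz X_in_L] by simp
qed

lemma d_bt: "z \<in> FL k \<Longrightarrow> d k (bt k z) = bt (k - 1) (et k z)"
proof -
  assume z: "z \<in> FL k"
  have "d k (bt k z) = lext (J k) act (\<lambda>x. d k (\<beta> k x)) z"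
    unfolding bt_def
    by (rule lext_post[OF complex_linear[OF C] MC S _ z]) (rule linear_in[OF \<beta>K unit_vec_in[OF S]])
  also have "\<dots> = lext (J k) act (\<lambda>x. \<beta> (k - 1) (e k x)) z"
    by (rule lext_cong) (rule chain_map_comm[OF \<beta> unit_vec_in[OF S]])
  also have "\<dots> = bt (k - 1) (et k z)"
    unfolding bt_def et_def by (rule lext_comp[OF eK \<beta>K MC fin fin z, symmetric])
  finally show ?thesis .
qed

lemma bt_qt: "z \<in> FL k \<Longrightarrow> bt k (qt k z) = bt k z"
  unfolding bt_def qt_def lext_comp[OF qK \<beta>K MC fin fin]
  by (rule lext_cong) (rule \<beta>q[OF unit_vec_in[OF S]])

text \<open>The terms with \<open>1 - q\<close> cancel because \<open>\<beta> q = \<beta>\<close>.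
  What is left is \<open>1 - \<beta> \<alpha>\<close> applied after \<open>\<beta>\<close> and
  multiplication by \<open>x\<close>, and \<open>\<eta>\<close> contracts it.\<close>

lemma bt_\<phi>:
  assumes z: "z \<in> FL k"
  shows "bt k (\<phi> k z) = d (k + 1) (gt k z) + gt (k - 1) (et k z)"
proof -
  have qz: "qt k z \<in> FL k" and Uz: "Ut k z \<in> FL k"
    using linear_in[OF qtL z] linear_in[OF UtL z] by auto
  have Xq: "free_act (qt k z) (X 1) \<in> FL k"
    by (rule module_act[OF MF qz X_in_L])
  let ?x = "\<lambda>x. act (\<beta> k x) (X 1)"
  have xC: "?x (unit_vec j) \<in> C k" if "j \<in> J k" for j
    by (intro act_X_in linear_in[OF \<beta>K unit_vec_in[OF S that]])
  have gK: "linear_map K (FK (k - 1)) free_act (C k) act (\<gamma> (k - 1))"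
    using \<gamma>K[of "k - 1"] by simp
  have dg: "d (k + 1) (gt k z) = lext (J k) act (\<lambda>x. d (k + 1) (\<gamma> k x)) z"
    unfolding gt_def
    by (rule lext_post[OF complex_linear_Suc[OF C] MC S _ z]) (rule linear_in[OF \<gamma>K unit_vec_in[OF S]])
  have ge: "gt (k - 1) (et k z) = lext (J k) act (\<lambda>x. \<gamma> (k - 1) (e k x)) z"
    unfolding gt_def et_def by (rule lext_comp[OF eK gK MC fin fin z])
  have Ub: "bt k (Ut k z) = lext (J k) act (\<lambda>x. \<beta> k (conj_X 1 k x)) z"
    unfolding bt_def Ut_def by (rule lext_comp[OF UK \<beta>K MC fin fin z])
  have "bt k (\<phi> k z) = bt k (free_act (qt k z) (X 1)) - bt k (Ut k z) + (bt k z - bt k (qt k z))"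
    unfolding \<phi>_def
    using linear_add[OF btL module_diff[OF MF Xq Uz] module_diff[OF MF z qz]]
      linear_diff[OF btL MF Xq Uz] linear_diff[OF btL MF z qz] by simp
  also have "\<dots> = act (bt k z) (X 1) - bt k (Ut k z)"
    using linear_act[OF btL qz X_in_L] bt_qt[OF z] by simp
  also have "act (bt k z) (X 1) = lext (J k) act ?x z"
    unfolding bt_def by (rule lext_post[OF linear_X[OF MC] MC S _ z]) (rule linear_in[OF \<beta>K unit_vec_in[OF S]])
  finally have 1: "bt k (\<phi> k z) + bt k (Ut k z) = lext (J k) act ?x z"
    by simp
  have mem: "d (k + 1) (\<gamma> k (unit_vec j)) \<in> C k" "\<gamma> (k - 1) (e k (unit_vec j)) \<in> C k"
    "\<beta> k (conj_X 1 k (unit_vec j)) \<in> C k" if "j \<in> J k" for j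
    using complex_d_Suc[OF C linear_in[OF \<gamma>K unit_vec_in[OF S that]]]
      linear_in[OF gK linear_in[OF eK unit_vec_in[OF S that]]]
      linear_in[OF \<beta>K linear_in[OF UK unit_vec_in[OF S that]]] by auto
  have "d (k + 1) (gt k z) + gt (k - 1) (et k z) + bt k (Ut k z)
     = lext (J k) act (\<lambda>x. d (k + 1) (\<gamma> k x) + \<gamma> (k - 1) (e k x) + \<beta> k (conj_X 1 k x)) z"
  proof -
    have "lext (J k) act (\<lambda>x. d (k + 1) (\<gamma> k x)) z + lext (J k) act (\<lambda>x. \<gamma> (k - 1) (e k x)) z
        = lext (J k) act (\<lambda>x. d (k + 1) (\<gamma> k x) + \<gamma> (k - 1) (e k x)) z"
      by (rule lext_plus[OF MC[of k] _ _ z]) (rule mem; assumption)+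
    moreover have "lext (J k) act (\<lambda>x. d (k + 1) (\<gamma> k x) + \<gamma> (k - 1) (e k x)) z
        + lext (J k) act (\<lambda>x. \<beta> k (conj_X 1 k x)) z
        = lext (J k) act (\<lambda>x. d (k + 1) (\<gamma> k x) + \<gamma> (k - 1) (e k x) + \<beta> k (conj_X 1 k x)) z"
      by (rule lext_plus[OF MC[of k] _ _ z]) (intro module_add[OF MC[of k]] mem; assumption)+
    ultimately show ?thesis
      unfolding dg ge Ub by simp
  qed
  also have "\<dots> = lext (J k) act ?x z"
  proof (rule lext_cong)
    fix j assume j: "j \<in> J k"
    have uK: "unit_vec j \<in> FK k" by (rule unit_vec_in[OF S j])
    have "d k (?x (unit_vec j)) = act (\<beta> (k - 1) (e k (unit_vec j))) (X 1)"
      using chain_map_comm[OF mult_X_chain_map linear_in[OF \<beta>K uK]] chain_map_comm[OF \<beta> uK] by simp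
    then show "d (k + 1) (\<gamma> k (unit_vec j)) + \<gamma> (k - 1) (e k (unit_vec j)) + \<beta> k (conj_X 1 k (unit_vec j)) = ?x (unit_vec j)"
      using d\<eta>[OF xC[OF j]] by (simp add: \<gamma>_def conj_X_def algebra_simps)
  qed
  finally show ?thesis
    using 1 by (metis add_right_cancel)
qed

lemma cf_lext:
  assumes "linear_map K (FK k) free_act (FK l) free_act u" "z \<in> FL k"
  shows "cf t (col_of (lext (J k) free_act u z)) = u (cf t (col_of z))"
  using cf_mat[OF assms(1) fin col_of_in[OF assms(2)]] mat_col_of[OF lext_linear_free2[OF assms(1)] fin assms(2)]
  by simp

lemma cf_\<phi>:
  assumes z: "z \<in> cols N (J k)"
  shows "cf t (mat series_lmult (J k) (\<phi> k) z) = \<phi>K k (\<lambda>t. cf t z) t"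
proof -
  let ?m = "mat series_lmult (J k)"
  note NL = N_left_module
  have Xq: "linear_map L (FL k) free_act (FL k) free_act (\<lambda>z. free_act (qt k z) (X 1))"
    by (rule linear_comp[OF qtL linear_X[OF MF]])
  have mq: "?m (qt k) z \<in> cols N (J k)" and mU: "?m (Ut k) z \<in> cols N (J k)"
    and mX: "?m (\<lambda>z. free_act (qt k z) (X 1)) z \<in> cols N (J k)"
    using mat_in[OF S NL qtL z] mat_in[OF S NL UtL z] mat_in[OF S NL Xq z] by auto
  have "?m (\<phi> k) z = ?m (\<lambda>z. free_act (qt k z) (X 1) - Ut k z) z + ?m (\<lambda>z. z - qt k z) z"
    unfolding \<phi>_def[abs_def]
    by (rule mat_plus_maps[OF S NL linear_minus[OF Xq UtL MF] linear_minus[OF linear_id qtL MF] z])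
  also have "\<dots> = (?m (\<lambda>z. free_act (qt k z) (X 1)) z - ?m (Ut k) z) + (z - ?m (qt k) z)"
    using mat_minus_maps[OF S NL Xq UtL z] mat_minus_maps[OF S NL linear_id qtL z] mat_id[OF S NL fin z] by simp
  finally have eq: "?m (\<phi> k) z = (?m (\<lambda>z. free_act (qt k z) (X 1)) z - ?m (Ut k) z) + (z - ?m (qt k) z)" .
  have 1: "cf t (?m (\<lambda>z. free_act (qt k z) (X 1)) z) = cf (t - 1) (?m (qt k) z)"
    using cf_X[OF fin mq, of t 1] mat_comp[OF S NL qtL linear_X[OF MF] fin z] by simp
  have 2: "cf s (?m (qt k) z) = q k (cf s z)" for s
    unfolding qt_def by (rule cf_mat[OF qK fin z])
  have 3: "cf t (?m (Ut k) z) = conj_X 1 k (cf t z)"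
    unfolding Ut_def by (rule cf_mat[OF UK fin z])
  have "cf t (?m (\<phi> k) z) = (cf t (?m (\<lambda>z. free_act (qt k z) (X 1)) z) - cf t (?m (Ut k) z)) + (cf t z - cf t (?m (qt k) z))"
    unfolding eq cf_add[OF cols_diff[OF NL mX mU] cols_diff[OF NL z mq]] cf_diff[OF mX mU] cf_diff[OF z mq] ..
  then show ?thesis
    unfolding 1 2 3 \<phi>K_def .
qed

lemma cf_\<phi>_L: "z \<in> FL k \<Longrightarrow> cf t (col_of (\<phi> k z)) = \<phi>K k (\<lambda>t. cf t (col_of z)) t"
  using cf_\<phi>[OF col_of_in, of z k t] mat_col_of[OF \<phi>L fin, of z k] by simp

text \<open>Coefficients of Laurent polynomials vanish far to the left, so
  \<open>\<phi>K_injective\<close> applies to each of them; as only finitely many are nonzero, the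
  bounding vectors add up to Laurent polynomials.\<close>

lemma \<phi>_injective_L:
  assumes b: "b \<in> FL k" "et k b = 0" and a: "a \<in> FL (k + 1)" "\<phi> k b = et (k + 1) a"
  shows "\<exists>w\<in>FL (k + 1). et (k + 1) w = b"
proof -
  define b' where "b' t = cf t (col_of b)" for t
  obtain m where m: "\<And>t. m < \<bar>t\<bar> \<Longrightarrow> b' t = 0" "b = (\<Sum>t\<in>{-m..m}. free_act (b' t) (X t))"
    using free_expand[OF fin b(1)] unfolding b'_def by blast
  have col0: "col_of (0 :: nat \<Rightarrow> 'r laurent) = 0"
    by (rule linear_0[OF col_of_linear module_0[OF MF]])
  have "b' t \<in> bdK k" for t
  proof (rule \<phi>K_injective)
    show "b' t \<in> FK k" for t
      unfolding b'_def by (rule cf_in[OF fin col_of_in[OF b(1)]])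
    show "e k (b' t) = 0" for t
      unfolding b'_def cf_lext[OF eK b(1), symmetric] et_def[symmetric] b(2) col0 by (rule cf_0)
    show "b' t = 0" if "t < - \<bar>m\<bar>" for t
      using that by (intro m(1)) linarith
    show "\<phi>K k b' t \<in> bdK k" for t
    proof -
      have "\<phi>K k b' t = e (k + 1) (cf t (col_of a))"
        using cf_\<phi>_L[OF b(1), of t] cf_lext[OF eK_Suc a(1), of t] a(2) unfolding et_def[symmetric] b'_def[abs_def] by simp
      then show ?thesis
        unfolding bdK_def using cf_in[OF fin col_of_in[OF a(1)]] by blast
    qed
  qed
  then have "\<forall>t. \<exists>w\<in>FK (k + 1). b' t = e (k + 1) w"
    unfolding bdK_def by blast
  then obtain w where w: "\<And>t. w t \<in> FK (k + 1)" "\<And>t. b' t = e (k + 1) (w t)"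
    by metis
  have wL: "w t \<in> FL (k + 1)" for t
    using w(1) FKL by blast
  let ?w = "\<Sum>t\<in>{-m..m}. free_act (w t) (X t)"
  have wX: "free_act (w t) (X t) \<in> FL (k + 1)" for t
    by (rule module_act[OF MF wL X_in_L])
  have "et (k + 1) ?w = (\<Sum>t\<in>{-m..m}. et (k + 1) (free_act (w t) (X t)))"
    by (rule linear_sum[OF etL MF wX])
  also have "\<dots> = (\<Sum>t\<in>{-m..m}. free_act (b' t) (X t))"
  proof (rule sum.cong[OF refl])
    fix t
    have "et (k + 1) (w t) = b' t"
      unfolding et_def w(2) by (rule lext_eq[OF eK S fin w(1)])
    then show "et (k + 1) (free_act (w t) (X t)) = free_act (b' t) (X t)"
      using linear_act[OF etL wL X_in_L] by simp
  qed
  finally have "et (k + 1) ?w = b"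
    using m(2) by simp
  moreover have "?w \<in> FL (k + 1)"
    by (rule module_sum[OF MF wX])
  ultimately show ?thesis
    by blast
qed

lemma \<phi>_injective_N:
  assumes z: "z \<in> cols N (J k)" "mat series_lmult (J k) (et k) z = 0"
    and a: "a \<in> cols N (J (k + 1))" "mat series_lmult (J k) (\<phi> k) z = mat series_lmult (J (k + 1)) (et (k + 1)) a"
  shows "\<exists>w\<in>cols N (J (k + 1)). mat series_lmult (J (k + 1)) (et (k + 1)) w = z"
proof -
  define b' where "b' t = cf t z" for t
  obtain t0 where t0: "\<And>t. t < t0 \<Longrightarrow> b' t = 0"
    using cf_lower[OF fin z(1)] unfolding b'_def by blast
  have "b' t \<in> bdK k" for t
  proof (rule \<phi>K_injective)
    show "b' t \<in> FK k" for t
      unfolding b'_def by (rule cf_in[OF fin z(1)])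
    show "e k (b' t) = 0" for t
      unfolding b'_def cf_mat[OF eK fin z(1), symmetric] et_def[symmetric] z(2) by (rule cf_0)
    show "\<phi>K k b' t \<in> bdK k" for t
    proof -
      have "\<phi>K k b' t = e (k + 1) (cf t a)"
        using cf_\<phi>[OF z(1), of t] cf_mat[OF eK_Suc fin a(1), of t] a(2) unfolding et_def[symmetric] b'_def[abs_def] by simp
      then show ?thesis
        unfolding bdK_def using cf_in[OF fin a(1)] by blast
    qed
  qed (rule t0)
  then have bd: "b' t \<in> bdK k" for t .
  \<comment> \<open>Below \<open>t0\<close> the bounding vector is chosen to be 0; arbitrary choices
    would not assemble to a series.\<close>
  have "\<forall>t. \<exists>w\<in>FK (k + 1). b' t = e (k + 1) w \<and> (t < t0 \<longrightarrow> w = 0)"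
  proof
    fix t
    show "\<exists>w\<in>FK (k + 1). b' t = e (k + 1) w \<and> (t < t0 \<longrightarrow> w = 0)"
    proof (cases "t < t0")
      case True
      then show ?thesis
        using t0 linear_0[OF eK_Suc module_0[OF MF]] module_0[OF MF] by (intro bexI[of _ 0]) auto
    next
      case False
      then show ?thesis
        using bd[of t] unfolding bdK_def by blast
    qed
  qed
  then obtain w where w: "\<And>t. w t \<in> FK (k + 1)" "\<And>t. b' t = e (k + 1) (w t)" "\<And>t. t < t0 \<Longrightarrow> w t = 0"
    by metis
  obtain y where y: "y \<in> cols N (J (k + 1))" "\<And>t. cf t y = w t"
    using cols_with_cf[of "J (k + 1)" w t0, OF fin w(1,3)] by blast
  have "mat series_lmult (J (k + 1)) (et (k + 1)) y = z"
  proof (rule cf_eqI[OF mat_in[OF S N_left_module etL_Suc y(1)] z(1)])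
    show "cf t (mat series_lmult (J (k + 1)) (et (k + 1)) y) = cf t z" for t
      unfolding et_def cf_mat[OF eK fin y(1)] y(2) using w(2) by (simp add: b'_def)
  qed
  then show ?thesis
    using y(1) by blast
qed

text \<open>Here series are indispensable: the solution from \<open>\<phi>K_surjective\<close>
  continues to the right indefinitely. Over \<open>L\<close> the map \<open>\<phi>\<close> is
  injective on homology but in general not onto, and its cokernel there gives the homology of
  \<open>C\<close>.\<close>

lemma \<phi>_surjective_N:
  assumes z: "z \<in> cols N (J k)" "mat series_lmult (J k) (et k) z = 0"
  shows "\<exists>a\<in>cols N (J (k + 1)). \<exists>b\<in>cols N (J k). mat series_lmult (J k) (et k) b = 0
     \<and> z = mat series_lmult (J (k + 1)) (et (k + 1)) a + mat series_lmult (J k) (\<phi> k) b"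
proof -
  note NL = N_left_module
  obtain t0 where t0: "\<And>t. t < t0 \<Longrightarrow> cf t z = 0"
    using cf_lower[OF fin z(1)] by blast
  have "e k (cf t z) = 0" for t
    unfolding cf_mat[OF eK fin z(1), symmetric] et_def[symmetric] z(2) by (rule cf_0)
  then have "\<exists>b. (\<forall>t. b t \<in> FK k \<and> e k (b t) = 0 \<and> cf t z - \<phi>K k b t \<in> bdK k) \<and> (\<forall>t<t0. b t = 0)"
    by (intro \<phi>K_surjective[where z = "\<lambda>t. cf t z"] cf_in[OF fin z(1)] t0)
  then obtain b where b: "\<And>t. b t \<in> FK k" "\<And>t. e k (b t) = 0" "\<And>t. cf t z - \<phi>K k b t \<in> bdK k" "\<And>t. t < t0 \<Longrightarrow> b t = 0"
    by blast
  obtain y where y: "y \<in> cols N (J k)" "\<And>t. cf t y = b t"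
    using cols_with_cf[of "J k" b t0, OF fin b(1,4)] by blast
  have \<phi>0: "\<phi>K k b t = 0" if "t < t0" for t
    using b(4)[OF that] b(4)[of "t - 1"] that linear_0[OF qK module_0[OF MF]] linear_0[OF UK module_0[OF MF]]
    by (simp add: \<phi>K_def)
  have "\<forall>t. \<exists>w\<in>FK (k + 1). cf t z - \<phi>K k b t = e (k + 1) w \<and> (t < t0 \<longrightarrow> w = 0)"
  proof
    fix t
    show "\<exists>w\<in>FK (k + 1). cf t z - \<phi>K k b t = e (k + 1) w \<and> (t < t0 \<longrightarrow> w = 0)"
    proof (cases "t < t0")
      case True
      then show ?thesis
        using t0 \<phi>0 linear_0[OF eK_Suc module_0[OF MF]] module_0[OF MF] by (intro bexI[of _ 0]) auto
    next
      case False
      then show ?thesis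
        using b(3)[of t] unfolding bdK_def by blast
    qed
  qed
  then obtain w where w: "\<And>t. w t \<in> FK (k + 1)" "\<And>t. cf t z - \<phi>K k b t = e (k + 1) (w t)" "\<And>t. t < t0 \<Longrightarrow> w t = 0"
    by metis
  obtain a where a: "a \<in> cols N (J (k + 1))" "\<And>t. cf t a = w t"
    using cols_with_cf[of "J (k + 1)" w t0, OF fin w(1,3)] by blast
  have ma: "mat series_lmult (J (k + 1)) (et (k + 1)) a \<in> cols N (J k)"
    by (rule mat_in[OF S NL etL_Suc a(1)])
  have my: "mat series_lmult (J k) (\<phi> k) y \<in> cols N (J k)"
    by (rule mat_in[OF S NL \<phi>L y(1)])
  have "z = mat series_lmult (J (k + 1)) (et (k + 1)) a + mat series_lmult (J k) (\<phi> k) y"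
  proof (rule cf_eqI[OF z(1) cols_add[OF NL ma my]])
    fix t
    have "cf t (mat series_lmult (J (k + 1)) (et (k + 1)) a) = e (k + 1) (w t)"
      unfolding et_def cf_mat[OF eK fin a(1)] a(2) ..
    moreover have "cf t (mat series_lmult (J k) (\<phi> k) y) = \<phi>K k b t"
      unfolding cf_\<phi>[OF y(1)] y(2) ..
    ultimately show "cf t z = cf t (mat series_lmult (J (k + 1)) (et (k + 1)) a + mat series_lmult (J k) (\<phi> k) y)"
      unfolding cf_add[OF ma my] using w(2)[of t] by (simp add: algebra_simps)
  qed
  moreover have "mat series_lmult (J k) (et k) y = 0"
  proof (rule cf_eqI[OF mat_in[OF S NL etL y(1)] cols_0[OF NL]])
    show "cf t (mat series_lmult (J k) (et k) y) = cf t 0" for t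
      unfolding et_def cf_mat[OF eK fin y(1)] y(2) b(2) by (rule cf_0[symmetric])
  qed
  ultimately show ?thesis
    using a(1) y(1) by blast
qed

end


lemma fg_free_free_mod:
  fixes J :: "nat set"
  assumes S: "subring S" and J: "finite J"
  shows "fg_free S (free_mod S J) free_act"
proof -
  let ?u = "unit_vec :: nat \<Rightarrow> nat \<Rightarrow> 'a"
  have inj: "inj_on ?u J"
    by (metis inj_onI unit_vec_other unit_vec_same zero_neq_one)
  have coeff: "(\<Sum>b\<in>?u ` J. free_act b (c b)) i = (if i \<in> J then c (?u i) else 0)" for c i
    unfolding sum.reindex[OF inj] comp_def
    using fun_cong[OF sum_unit_vec[OF J, of "\<lambda>i. if i \<in> J then c (?u i) else 0"], of i]
    by (simp add: sum_fun_apply)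
  show ?thesis
    unfolding fg_free_def
  proof (intro exI[of _ "?u ` J"] conjI ballI allI impI)
    show "?u ` J \<subseteq> free_mod S J"
      by (rule image_subsetI) (rule unit_vec_in[OF S])
    fix x assume x: "x \<in> free_mod S J"
    have "x = (\<Sum>b\<in>?u ` J. free_act b (x (inv_into J ?u b)))"
      using x J by (intro ext) (simp add: coeff inv_into_f_f[OF inj] free_mod_iff)
    then show "\<exists>c. (\<forall>b\<in>?u ` J. c b \<in> S) \<and> x = (\<Sum>b\<in>?u ` J. free_act b (c b))"
      using x J by (intro exI[of _ "\<lambda>b. x (inv_into J ?u b)"]) (simp add: free_mod_iff)
  next
    fix c b
    assume c: "(\<forall>b\<in>?u ` J. c b \<in> S) \<and> (\<Sum>b\<in>?u ` J. free_act b (c b)) = 0" and "b \<in> ?u ` J"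
    then obtain j where j: "j \<in> J" "b = ?u j" by blast
    have "(\<Sum>b\<in>?u ` J. free_act b (c b)) j = 0"
      using c by simp
    then show "c b = 0"
      using coeff[of c j] j by simp
  qed (use J in auto)
qed

section \<open>The torus as a finite free model of \<open>C\<close>\<close>

context mapping_torus
begin

text \<open>Cycles modulo \<open>Bd\<close> form the cokernel of \<open>\<phi>\<close> on the
  homology of \<open>F\<close> extended to \<open>L\<close>, which is to be compared with the
  homology of \<open>C\<close>.\<close>

definition Bd :: "int \<Rightarrow> (nat \<Rightarrow> 'r laurent) set" where
  "Bd k = {et (k + 1) a + \<phi> k b | a b. a \<in> FL (k + 1) \<and> b \<in> FL k \<and> et k b = 0}"

lemma BdI: "a \<in> FL (k + 1) \<Longrightarrow> b \<in> FL k \<Longrightarrow> et k b = 0 \<Longrightarrow> x = et (k + 1) a + \<phi> k b \<Longrightarrow> x \<in> Bd k"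
  unfolding Bd_def by blast

lemma Bd_et: "a \<in> FL (k + 1) \<Longrightarrow> et (k + 1) a \<in> Bd k"
  by (erule BdI[OF _ module_0[OF MF] linear_0[OF etL module_0[OF MF]]])
    (simp only: linear_0[OF \<phi>L module_0[OF MF]] add_0_right)

lemma Bd_\<phi>: "b \<in> FL k \<Longrightarrow> et k b = 0 \<Longrightarrow> \<phi> k b \<in> Bd k"
  by (erule (1) BdI[OF module_0[OF MF]])
    (simp only: linear_0[OF etL_Suc module_0[OF MF]] add_0_left)

lemma Bd_0: "0 \<in> Bd k"
proof -
  have "et (k + 1) 0 \<in> Bd k"
    by (rule Bd_et[OF module_0[OF MF]])
  then show ?thesis
    unfolding linear_0[OF etL_Suc module_0[OF MF]] .
qed

lemma Bd_add:
  assumes "x \<in> Bd k" "y \<in> Bd k"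
  shows "x + y \<in> Bd k"
proof -
  obtain a b a' b' where ab: "a \<in> FL (k + 1)" "b \<in> FL k" "et k b = 0" "x = et (k + 1) a + \<phi> k b"
    "a' \<in> FL (k + 1)" "b' \<in> FL k" "et k b' = 0" "y = et (k + 1) a' + \<phi> k b'"
    using assms unfolding Bd_def by blast
  have "x + y = et (k + 1) (a + a') + \<phi> k (b + b')"
    using linear_add[OF etL_Suc ab(1,5)] linear_add[OF \<phi>L ab(2,6)] ab(4,8) by simp
  moreover have "et k (b + b') = 0"
    using linear_add[OF etL ab(2,6)] ab(3,7) by simp
  ultimately show ?thesis
    unfolding Bd_def using module_add[OF MF ab(1,5)] module_add[OF MF ab(2,6)] by blast
qed

lemma Bd_act:
  assumes "x \<in> Bd k" "s \<in> L"
  shows "free_act x s \<in> Bd k"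
proof -
  obtain a b where ab: "a \<in> FL (k + 1)" "b \<in> FL k" "et k b = 0" "x = et (k + 1) a + \<phi> k b"
    using assms unfolding Bd_def by blast
  have "free_act x s = et (k + 1) (free_act a s) + \<phi> k (free_act b s)"
    unfolding ab(4)
    using act_add[OF MF linear_in[OF etL_Suc ab(1)] linear_in[OF \<phi>L ab(2)] assms(2)]
      linear_act[OF etL_Suc ab(1) assms(2)] linear_act[OF \<phi>L ab(2) assms(2)] by simp
  moreover have "et k (free_act b s) = 0"
    using linear_act[OF etL ab(2) assms(2)] ab(3) act_0[OF MF assms(2)] by simp
  ultimately show ?thesis
    unfolding Bd_def using module_act[OF MF ab(1) assms(2)] module_act[OF MF ab(2) assms(2)] by blast
qed

lemma Bd_uminus: "x \<in> Bd k \<Longrightarrow> - x \<in> Bd k"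
proof -
  assume x: "x \<in> Bd k"
  have "free_act x (- 1) \<in> Bd k"
    by (rule Bd_act[OF x]) (intro subring_uminus[OF S] subring_1[OF S])
  moreover have "free_act x (- 1) = - x"
    by (simp add: free_act_def fun_eq_iff)
  ultimately show ?thesis by simp
qed

lemma Bd_trans: "x - y \<in> Bd k \<Longrightarrow> y - z \<in> Bd k \<Longrightarrow> x - z \<in> Bd k"
  using Bd_add[of "x - y" k "y - z"] by simp

lemma Bd_sum: "(\<And>i. i \<in> A \<Longrightarrow> f i \<in> Bd k) \<Longrightarrow> sum f A \<in> Bd k"
  by (induction A rule: infinite_finite_induct) (auto intro: Bd_0 Bd_add)

lemma et_K: "x \<in> FK k \<Longrightarrow> et k x = e k x" and qt_K: "x \<in> FK k \<Longrightarrow> qt k x = q k x"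
  and Ut_K: "x \<in> FK k \<Longrightarrow> Ut k x = conj_X 1 k x" and bt_K: "x \<in> FK k \<Longrightarrow> bt k x = \<beta> k x"
  unfolding et_def qt_def Ut_def bt_def
  by (simp_all only: lext_eq[OF eK S fin] lext_eq[OF qK S fin] lext_eq[OF UK S fin] lext_eq[OF \<beta>K S fin])

lemma bdK_Bd: "x \<in> bdK k \<Longrightarrow> x \<in> Bd k"
proof -
  assume "x \<in> bdK k"
  then obtain w where w: "w \<in> FK (k + 1)" "x = e (k + 1) w"
    unfolding bdK_def by blast
  have "w \<in> FL (k + 1)"
    using w(1) FKL by blast
  from Bd_et[OF this] show ?thesis
    using et_K[OF w(1)] w(2) by simp
qed

lemma cycle_q:
  assumes "f \<in> FK k" "e k f = 0"
  shows "q k f \<in> FK k" "e k (q k f) = 0" "conj_X t k f \<in> FK k" "e k (conj_X t k f) = 0"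
  using linear_in[OF qK assms(1)] linear_in[OF UK assms(1)] chain_map_comm[OF q assms(1)]
    chain_map_comm[OF conj_X assms(1)] assms(2) linear_0[OF qK module_0[OF MF]] linear_0[OF UK module_0[OF MF]]
  by simp_all

lemma shift_Bd:
  assumes f: "f \<in> FK k" "e k f = 0"
  shows "free_act (q k f) (X 1) - q k (conj_X 1 k f) \<in> Bd k"
proof -
  note qf = cycle_q(1,2)[OF f]
  have qfL: "q k f \<in> FL k" using qf(1) FKL by blast
  have "\<phi> k (q k f) = free_act (q k f) (X 1) - conj_X 1 k f"
    unfolding \<phi>_def qt_K[OF qf(1)] Ut_K[OF qf(1)] qq[OF f(1)] conj_X_q[OF f(1)] by simp
  moreover have "\<phi> k (q k f) \<in> Bd k"
    by (rule Bd_\<phi>[OF qfL]) (use et_K[OF qf(1)] qf(2) in simp)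
  ultimately show ?thesis
    using q_conj_X[OF f(1), of 1] by simp
qed

text \<open>Modulo \<open>Bd\<close>, multiplication by \<open>x\<close> acts as \<open>U\<close>, so every power of \<open>x\<close> can be absorbed.\<close>

lemma absorb_X:
  assumes "f \<in> FK k" "e k f = 0"
  shows "\<exists>g\<in>FK k. e k g = 0 \<and> free_act (q k f) (X t) - q k g \<in> Bd k"
  using assms
proof (induction t arbitrary: f rule: int_induct[where k = 0])
  case base
  have "free_act (q k f) (X 0) = q k f"
    by (simp add: X_0 free_act_def)
  then have "free_act (q k f) (X 0) - q k f \<in> Bd k"
    using Bd_0 by simp
  then show ?case
    using base by blast
next
  case (step1 t)
  note Uf = cycle_q(3,4)[OF step1.prems, of 1]
  have qfL: "q k f \<in> FL k" "q k (conj_X 1 k f) \<in> FL k"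
    using cycle_q(1)[OF step1.prems] cycle_q(1)[OF Uf] FKL by blast+
  obtain g where g: "g \<in> FK k" "e k g = 0" "free_act (q k (conj_X 1 k f)) (X t) - q k g \<in> Bd k"
    using step1.IH[OF Uf] by blast
  have "free_act (free_act (q k f) (X 1) - q k (conj_X 1 k f)) (X t) \<in> Bd k"
    by (rule Bd_act[OF shift_Bd[OF step1.prems] X_in_L])
  moreover have "free_act (free_act (q k f) (X 1) - q k (conj_X 1 k f)) (X t)
      = free_act (q k f) (X (t + 1)) - free_act (q k (conj_X 1 k f)) (X t)"
    unfolding add.commute[of t 1] X_mult by (simp add: free_act_def fun_eq_iff algebra_simps)
  ultimately have "free_act (q k f) (X (t + 1)) - free_act (q k (conj_X 1 k f)) (X t) \<in> Bd k"
    by simp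
  from Bd_trans[OF this g(3)] show ?case
    using g(1,2) by blast
next
  case (step2 t)
  \<comment> \<open>Going down, write \<open>V\<close> for \<open>conj_X (-1)\<close>. Then
    \<open>q f\<close> is homologous to \<open>conj_X 1\<close> of \<open>V f\<close>, which
    \<open>shift_Bd\<close> makes congruent to \<open>q (V f)\<close> times \<open>X 1\<close>.
    Multiplying by \<open>X (t - 1)\<close> trades \<open>f\<close> for \<open>V f\<close> and
    raises the exponent to \<open>t\<close>.\<close>
  note Vf = cycle_q(3,4)[OF step2.prems, of "-1"]
  obtain g where g: "g \<in> FK k" "e k g = 0" "free_act (q k (conj_X (-1) k f)) (X t) - q k g \<in> Bd k"
    using step2.IH[OF Vf] by blast
  have UVf: "q k (conj_X 1 k (conj_X (-1) k f)) = conj_X 1 k (conj_X (-1) k f)"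
    by (rule q_conj_X[OF Vf(1)])
  have "- (conj_X 1 k (conj_X (-1) k f) - q k f) \<in> Bd k"
    by (rule Bd_uminus[OF bdK_Bd[OF conj_X_inverse[OF step2.prems]]]) simp
  moreover have "- (free_act (q k (conj_X (-1) k f)) (X 1) - conj_X 1 k (conj_X (-1) k f)) \<in> Bd k"
    using Bd_uminus[OF shift_Bd[OF Vf]] unfolding UVf .
  ultimately have "q k f - free_act (q k (conj_X (-1) k f)) (X 1) \<in> Bd k"
    using Bd_trans[of "q k f" "conj_X 1 k (conj_X (-1) k f)" k "free_act (q k (conj_X (-1) k f)) (X 1)"] by simp
  then have "free_act (q k f - free_act (q k (conj_X (-1) k f)) (X 1)) (X (t - 1)) \<in> Bd k"
    by (rule Bd_act[OF _ X_in_L])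
  moreover have "free_act (q k f - free_act (q k (conj_X (-1) k f)) (X 1)) (X (t - 1))
      = free_act (q k f) (X (t - 1)) - free_act (q k (conj_X (-1) k f)) (X t)"
  proof -
    have "X t = X 1 * (X (t - 1) :: 'r laurent)"
      unfolding X_mult[symmetric] by simp
    then show ?thesis
      by (simp add: free_act_def fun_eq_iff algebra_simps)
  qed
  ultimately have "free_act (q k f) (X (t - 1)) - free_act (q k (conj_X (-1) k f)) (X t) \<in> Bd k"
    by simp
  from Bd_trans[OF this g(3)] show ?case
    using g(1,2) by blast
qed

text \<open>Injectivity of the comparison from the cokernel of \<open>\<phi>\<close> to the homology
  of \<open>C\<close>. Modulo \<open>Bd\<close> the cycle \<open>a\<close> becomes
  \<open>q f\<close> with \<open>f\<close> a cycle over \<open>K\<close>; then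
  \<open>\<beta> f\<close> is a boundary in \<open>C\<close>, so
  \<open>\<alpha> (\<beta> f)\<close>, which is homologous to \<open>q f\<close>, is a boundary over
  \<open>K\<close>.\<close>

lemma Bd_of_boundary:
  assumes a: "a \<in> FL k" "et k a = 0" and c: "c \<in> C (k + 1)" "bt k a = d (k + 1) c"
  shows "a \<in> Bd k"
proof -
  have qa: "qt k a \<in> FL k"
    by (rule linear_in[OF qtL a(1)])
  \<comment> \<open>On the image of \<open>1 - q\<close> the map \<open>\<phi>\<close> is the
    identity, so this part of \<open>a\<close> lies in \<open>Bd\<close>.\<close>
  have 1: "a - qt k a \<in> Bd k"
  proof -
    have m: "a - qt k a \<in> FL k"
      by (rule module_diff[OF MF a(1) qa])
    have "qt k (a - qt k a) = 0"
      using linear_diff[OF qtL MF a(1) qa] qt_qt[OF a(1)] by simp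
    moreover have "Ut k (a - qt k a) = 0"
      using linear_diff[OF UtL MF a(1) qa] Ut_qt[OF a(1)] by simp
    moreover have "free_act 0 (X 1) = (0 :: nat \<Rightarrow> 'r laurent)"
      by (rule act_0[OF MF X_in_L])
    ultimately have "\<phi> k (a - qt k a) = a - qt k a"
      unfolding \<phi>_def by simp
    moreover have "et k (a - qt k a) = 0"
      using linear_diff[OF etL MF a(1) qa] et_qt[OF a(1)] a(2) linear_0[OF qtL module_0[OF MF]] by simp
    ultimately show ?thesis
      using Bd_\<phi>[OF m] by simp
  qed
  let ?b = "\<lambda>t. cf t (col_of a)"
  obtain m where m: "a = (\<Sum>t\<in>{-m..m}. free_act (?b t) (X t))"
    using free_expand[OF fin a(1)] by blast
  have bK: "?b t \<in> FK k" for t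
    by (rule cf_in[OF fin col_of_in[OF a(1)]])
  then have bL: "?b t \<in> FL k" for t
    using FKL by blast
  have col0: "col_of (0 :: nat \<Rightarrow> 'r laurent) = 0"
    by (rule linear_0[OF col_of_linear module_0[OF MF]])
  have be: "e k (?b t) = 0" for t
    unfolding cf_lext[OF eK a(1), symmetric] et_def[symmetric] a(2) col0 by (rule cf_0)
  have "\<forall>t. \<exists>g. g \<in> FK k \<and> e k g = 0 \<and> free_act (q k (?b t)) (X t) - q k g \<in> Bd k"
    using absorb_X[OF bK be] by blast
  then obtain g where g: "\<And>t. g t \<in> FK k" "\<And>t. e k (g t) = 0"
    "\<And>t. free_act (q k (?b t)) (X t) - q k (g t) \<in> Bd k"
    by metis
  \<comment> \<open>All powers of \<open>x\<close> have been absorbed, so the coefficients collapse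
    into a single vector over \<open>K\<close>.\<close>
  define f where "f = (\<Sum>t\<in>{-m..m}. g t)"
  have f: "f \<in> FK k" "e k f = 0"
    unfolding f_def using module_sum[OF MF g(1)] linear_sum[OF eK MF g(1)] g(2) by auto
  have fL: "f \<in> FL k" using f(1) FKL by blast
  have "qt k a = (\<Sum>t\<in>{-m..m}. qt k (free_act (?b t) (X t)))"
    by (subst m) (rule linear_sum[OF qtL MF module_act[OF MF bL X_in_L]])
  also have "\<dots> = (\<Sum>t\<in>{-m..m}. free_act (q k (?b t)) (X t))"
    by (rule sum.cong[OF refl]) (simp only: linear_act[OF qtL bL X_in_L] qt_K[OF bK])
  finally have "qt k a - q k f = (\<Sum>t\<in>{-m..m}. free_act (q k (?b t)) (X t) - q k (g t))"
    unfolding f_def linear_sum[OF qK MF g(1)] sum_subtractf by simp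
  moreover have "(\<Sum>t\<in>{-m..m}. free_act (q k (?b t)) (X t) - q k (g t)) \<in> Bd k"
    by (rule Bd_sum[OF g(3)])
  ultimately have "qt k a - q k f \<in> Bd k"
    by simp
  from Bd_trans[OF 1 this] have 2: "a - q k f \<in> Bd k" .
  then obtain a' b' where ab: "a' \<in> FL (k + 1)" "b' \<in> FL k" "et k b' = 0" "a - q k f = et (k + 1) a' + \<phi> k b'"
    unfolding Bd_def by blast
  have qfK: "q k f \<in> FK k" by (rule cycle_q(1)[OF f])
  then have qfL: "q k f \<in> FL k" using FKL by blast
  have btqf: "bt k (q k f) = \<beta> k f"
    using bt_K[OF qfK] \<beta>q[OF f(1)] by simp
  have bta: "bt (k + 1) a' \<in> C (k + 1)" by (rule linear_in[OF btL ab(1)])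
  have gtb: "gt k b' \<in> C (k + 1)" by (rule linear_in[OF gtL ab(2)])
  have gt0: "gt (k - 1) 0 = 0" by (rule linear_0[OF gtL module_0[OF MF]])
  have "bt k a - \<beta> k f = bt k (et (k + 1) a') + bt k (\<phi> k b')"
    using linear_diff[OF btL MF a(1) qfL] ab(4) btqf
      linear_add[OF btL linear_in[OF etL_Suc ab(1)] linear_in[OF \<phi>L ab(2)]] by simp
  also have "\<dots> = d (k + 1) (bt (k + 1) a') + d (k + 1) (gt k b')"
    using d_bt[OF ab(1)] bt_\<phi>[OF ab(2)] ab(3) gt0 by simp
  also have "\<dots> = d (k + 1) (bt (k + 1) a' + gt k b')"
    by (rule linear_add[OF complex_linear[OF C] bta gtb, symmetric])
  finally have "\<beta> k f = d (k + 1) c - d (k + 1) (bt (k + 1) a' + gt k b')"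
    using c(2) by (simp add: algebra_simps)
  also have "\<dots> = d (k + 1) (c - (bt (k + 1) a' + gt k b'))"
    by (rule linear_diff[OF complex_linear[OF C] MC c(1) module_add[OF MC bta gtb], symmetric])
  finally have \<beta>f: "\<beta> k f = d (k + 1) (c - (bt (k + 1) a' + gt k b'))" .
  have cC: "c - (bt (k + 1) a' + gt k b') \<in> C (k + 1)"
    by (rule module_diff[OF MC c(1) module_add[OF MC bta gtb]])
  have "\<alpha> k (\<beta> k f) \<in> bdK k"
    unfolding \<beta>f bdK_def using chain_map_comm[OF \<alpha> cC] chain_map_in[OF \<alpha> cC] by (metis add_diff_cancel_right' imageI)
  moreover have "\<alpha> k (\<beta> k f) - q k f \<in> bdK k"
    using \<alpha>\<beta>[OF f] unfolding bdK_def by blast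
  ultimately have "\<alpha> k (\<beta> k f) - (\<alpha> k (\<beta> k f) - q k f) \<in> bdK k"
    by (rule bdK_diff)
  then have "q k f \<in> Bd k"
    by (intro bdK_Bd) simp
  from Bd_add[OF 2 this] show ?thesis by simp
qed

text \<open>The mapping cone of \<open>\<phi>\<close>. Its index sets are disjoint sums, so it is
  again a complex of standard free modules. In \<open>\<psi>\<close> the null homotopy
  \<open>gt\<close> of \<open>bt \<phi>\<close> extends \<open>bt\<close> over the cone.\<close>

definition T :: "int \<Rightarrow> (nat + nat \<Rightarrow> 'r laurent) set" where
  "T k = free_mod L (J k <+> J (k - 1))"

definition dT :: "int \<Rightarrow> (nat + nat \<Rightarrow> 'r laurent) \<Rightarrow> nat + nat \<Rightarrow> 'r laurent" where
  "dT k z = case_sum (et k (z \<circ> Inl) + \<phi> (k - 1) (z \<circ> Inr)) (- et (k - 1) (z \<circ> Inr))"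

definition \<psi> :: "int \<Rightarrow> (nat + nat \<Rightarrow> 'r laurent) \<Rightarrow> 'm" where
  "\<psi> k z = bt k (z \<circ> Inl) + gt (k - 1) (z \<circ> Inr)"

lemma T_Inl: "z \<in> T k \<Longrightarrow> z \<circ> Inl \<in> FL k"
  unfolding T_def by (rule comp_Inl_in)

lemma T_Inr: "z \<in> T k \<Longrightarrow> z \<circ> Inr \<in> FL (k - 1)"
  unfolding T_def by (rule comp_Inr_in)

lemma T_case_sum: "a \<in> FL k \<Longrightarrow> b \<in> FL (k - 1) \<Longrightarrow> case_sum a b \<in> T k"
  unfolding T_def by (rule case_sum_in[OF fin fin])

lemma case_sum_comp [simp]: "case_sum a b \<circ> Inl = a" "case_sum a b \<circ> Inr = b"
  by auto

lemma gtL': "linear_map L (FL (k - 1)) free_act (C k) act (gt (k - 1))"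
  using gtL[of "k - 1"] by simp

lemma fin_T: "finite (J k <+> J (k - 1))"
  using fin by (rule finite_Plus) (rule fin)

lemma T_module: "right_module L (T k) free_act"
  unfolding T_def by (rule MF)

lemma dT_linear: "linear_map L (T k) free_act (T (k - 1)) free_act (dT k)"
  unfolding T_def dT_def[abs_def]
  by (intro linear_case_sum fin linear_plus linear_neg linear_comp[OF linear_comp_Inl etL]
      linear_comp[OF linear_comp_Inr \<phi>L] linear_comp[OF linear_comp_Inr etL] MF)

lemma dT_dT:
  assumes "z \<in> T k"
  shows "dT (k - 1) (dT k z) = 0"
proof -
  let ?a = "z \<circ> Inl" and ?b = "z \<circ> Inr"
  note a = T_Inl[OF assms] and b = T_Inr[OF assms]
  have ea: "et k ?a \<in> FL (k - 1)" by (rule linear_in[OF etL a])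
  have \<phi>b: "\<phi> (k - 1) ?b \<in> FL (k - 1)" by (rule linear_in[OF \<phi>L b])
  have eb: "et (k - 1) ?b \<in> FL (k - 1 - 1)" by (rule linear_in[OF etL b])
  have 1: "et (k - 1) (et k ?a + \<phi> (k - 1) ?b) + \<phi> (k - 1 - 1) (- et (k - 1) ?b) = 0"
    using linear_add[OF etL ea \<phi>b] et_et[OF a] et_\<phi>[OF b] linear_uminus[OF \<phi>L MF eb] by simp
  have 2: "- et (k - 1 - 1) (- et (k - 1) ?b) = 0"
    using linear_uminus[OF etL MF eb] et_et[OF b] by simp
  have "dT (k - 1) (dT k z) = case_sum (et (k - 1) (et k ?a + \<phi> (k - 1) ?b) + \<phi> (k - 1 - 1) (- et (k - 1) ?b))
      (- et (k - 1 - 1) (- et (k - 1) ?b))"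
    unfolding dT_def case_sum_comp ..
  also have "\<dots> = case_sum 0 0"
    unfolding 1 2 ..
  also have "\<dots> = 0"
    by (rule ext) (simp split: sum.split)
  finally show ?thesis .
qed

lemma T_complex: "chain_complex L T dT free_act"
  unfolding chain_complex_def using T_module dT_linear dT_dT by blast

lemma \<psi>_chain_map: "chain_map L T dT free_act C d act \<psi>"
proof (rule chain_mapI)
  fix k
  show "linear_map L (T k) free_act (C k) act (\<psi> k)"
    unfolding T_def \<psi>_def[abs_def]
    by (intro linear_plus linear_comp[OF linear_comp_Inl btL] linear_comp[OF linear_comp_Inr gtL'] MC)
  fix z assume z: "z \<in> T k"
  let ?a = "z \<circ> Inl" and ?b = "z \<circ> Inr"
  note a = T_Inl[OF z] and b = T_Inr[OF z]
  have ba: "bt k ?a \<in> C k" by (rule linear_in[OF btL a])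
  have gb: "gt (k - 1) ?b \<in> C k" by (rule linear_in[OF gtL' b])
  have ea: "et k ?a \<in> FL (k - 1)" by (rule linear_in[OF etL a])
  have \<phi>b: "\<phi> (k - 1) ?b \<in> FL (k - 1)" by (rule linear_in[OF \<phi>L b])
  have eb: "et (k - 1) ?b \<in> FL (k - 1 - 1)" by (rule linear_in[OF etL b])
  have "d k (\<psi> k z) = bt (k - 1) (et k ?a) + d k (gt (k - 1) ?b)"
    unfolding \<psi>_def using linear_add[OF complex_linear[OF C] ba gb] d_bt[OF a] by simp
  moreover have "\<psi> (k - 1) (dT k z) = bt (k - 1) (et k ?a + \<phi> (k - 1) ?b) + gt (k - 1 - 1) (- et (k - 1) ?b)"
    unfolding \<psi>_def dT_def case_sum_comp ..
  moreover have "bt (k - 1) (et k ?a + \<phi> (k - 1) ?b) = bt (k - 1) (et k ?a) + (d k (gt (k - 1) ?b) + gt (k - 1 - 1) (et (k - 1) ?b))"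
    using linear_add[OF btL ea \<phi>b] bt_\<phi>[OF b] by simp
  moreover have "gt (k - 1 - 1) (- et (k - 1) ?b) = - gt (k - 1 - 1) (et (k - 1) ?b)"
    by (rule linear_uminus[OF gtL MF eb])
  ultimately show "d k (\<psi> k z) = \<psi> (k - 1) (dT k z)"
    by simp
qed

lemma case_sum_eq_0: "case_sum a b = 0 \<longleftrightarrow> a = 0 \<and> b = 0"
proof
  assume eq: "case_sum a b = 0"
  have "a i = 0" for i
    using fun_cong[OF eq, of "Inl i"] by simp
  moreover have "b i = 0" for i
    using fun_cong[OF eq, of "Inr i"] by simp
  ultimately show "a = 0 \<and> b = 0"
    by (simp add: fun_eq_iff)
next
  assume "a = 0 \<and> b = 0"
  then show "case_sum a b = 0"
    by (intro ext) (simp split: sum.split)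
qed

text \<open>Injectivity of \<open>\<phi>\<close> on homology removes the second component of
  \<open>z\<close>, \<open>Bd_of_boundary\<close> removes the first, and the cycle of
  \<open>C\<close> that remains is hit up to a boundary because \<open>\<beta> \<alpha>\<close> is
  homotopic to the identity.\<close>

lemma cone_exact:
  assumes c: "c \<in> C k" and z: "z \<in> T (k - 1)" "dT (k - 1) z = 0" and cz: "d k c + \<psi> (k - 1) z = 0"
  shows "\<exists>c'\<in>C (k + 1). \<exists>z'\<in>T k. d (k + 1) c' + \<psi> k z' = c \<and> - dT k z' = z"
proof -
  let ?a = "z \<circ> Inl" and ?b = "z \<circ> Inr"
  note a = T_Inl[OF z(1)] and b = T_Inr[OF z(1)]
  have zs: "case_sum ?a ?b = z"
    by (intro ext) (simp split: sum.split)
  have ea: "et (k - 1) ?a + \<phi> (k - 1 - 1) ?b = 0" and eb: "et (k - 1 - 1) ?b = 0"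
    using z(2) unfolding dT_def case_sum_eq_0 by simp_all
  have "\<phi> (k - 1 - 1) ?b = - et (k - 1) ?a"
    by (rule minus_unique[OF ea, symmetric])
  also have "\<dots> = et (k - 1) (- ?a)"
    by (rule linear_uminus[OF etL MF a, symmetric])
  finally have "\<phi> (k - 1 - 1) ?b = et (k - 1 - 1 + 1) (- ?a)"
    by (simp only: diff_add_cancel)
  then obtain b1 where b1: "b1 \<in> FL (k - 1)" "et (k - 1) b1 = ?b"
    using \<phi>_injective_L[OF b eb, of "- ?a"] module_uminus[OF MF a] by auto
  define a1 where "a1 = ?a + \<phi> (k - 1) b1"
  have \<phi>b1: "\<phi> (k - 1) b1 \<in> FL (k - 1)" by (rule linear_in[OF \<phi>L b1(1)])
  have a1: "a1 \<in> FL (k - 1)"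
    unfolding a1_def by (rule module_add[OF MF a \<phi>b1])
  have ea1: "et (k - 1) a1 = 0"
    unfolding a1_def using linear_add[OF etL a \<phi>b1] et_\<phi>[OF b1(1)] b1(2) ea by simp
  have gb1: "gt (k - 1) b1 \<in> C k" by (rule linear_in[OF gtL' b1(1)])
  have "bt (k - 1) a1 = bt (k - 1) ?a + (d k (gt (k - 1) b1) + gt (k - 1 - 1) ?b)"
    unfolding a1_def using linear_add[OF btL a \<phi>b1] bt_\<phi>[OF b1(1)] b1(2) by simp
  also have "\<dots> = \<psi> (k - 1) z + d k (gt (k - 1) b1)"
    by (simp add: \<psi>_def)
  also have "\<dots> = d k (gt (k - 1) b1) - d k c"
    using cz by (simp add: eq_neg_iff_add_eq_0 add.commute algebra_simps)
  also have "\<dots> = d k (gt (k - 1) b1 - c)"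
    by (rule linear_diff[OF complex_linear[OF C] MC gb1 c, symmetric])
  finally have "a1 \<in> Bd (k - 1)"
    using Bd_of_boundary[OF a1 ea1, of "gt (k - 1) b1 - c"] module_diff[OF MC gb1 c] by simp
  then obtain a2 b2 where ab2: "a2 \<in> FL k" "b2 \<in> FL (k - 1)" "et (k - 1) b2 = 0" "a1 = et k a2 + \<phi> (k - 1) b2"
    unfolding Bd_def by auto
  have b21: "b2 - b1 \<in> FL (k - 1)" by (rule module_diff[OF MF ab2(2) b1(1)])
  define z0 where "z0 = case_sum a2 (b2 - b1)"
  have z0: "z0 \<in> T k"
    unfolding z0_def by (rule T_case_sum[OF ab2(1) b21])
  have dz0: "dT k z0 = z"
  proof -
    have "et k a2 + \<phi> (k - 1) (b2 - b1) = ?a"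
    proof -
      have "et k a2 + (\<phi> (k - 1) b2 - \<phi> (k - 1) b1) = a1 - \<phi> (k - 1) b1"
        unfolding ab2(4) by (rule add_diff_eq)
      then show ?thesis
        unfolding linear_diff[OF \<phi>L MF ab2(2) b1(1)] a1_def add_diff_cancel_right' .
    qed
    moreover have "- et (k - 1) (b2 - b1) = ?b"
      using linear_diff[OF etL MF ab2(2) b1(1)] ab2(3) b1(2) by simp
    ultimately show ?thesis
      unfolding dT_def z0_def case_sum_comp using zs by simp
  qed
  note \<psi>L = chain_map_linear[OF \<psi>_chain_map]
  have \<psi>z0: "\<psi> k z0 \<in> C k" by (rule linear_in[OF \<psi>L z0])
  \<comment> \<open>Adding \<open>\<psi> k z0\<close> turns \<open>c\<close> into a cycle, and
    \<open>\<eta>\<close> then gives \<open>c1 = \<beta> (\<alpha> c1) + d (\<eta> c1)\<close>; the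
    first summand is the image of \<open>z1\<close>.\<close>
  define c1 where "c1 = c + \<psi> k z0"
  have c1: "c1 \<in> C k"
    unfolding c1_def by (rule module_add[OF MC c \<psi>z0])
  have dc1: "d k c1 = 0"
    unfolding c1_def using linear_add[OF complex_linear[OF C] c \<psi>z0] chain_map_comm[OF \<psi>_chain_map z0] dz0 cz by simp
  have \<alpha>c: "\<alpha> k c1 \<in> FK k" by (rule linear_in[OF \<alpha>K c1])
  then have \<alpha>cL: "\<alpha> k c1 \<in> FL k" using FKL by blast
  define z1 where "z1 = case_sum (\<alpha> k c1) (0 :: nat \<Rightarrow> 'r laurent)"
  have z1: "z1 \<in> T k"
    unfolding z1_def by (rule T_case_sum[OF \<alpha>cL module_0[OF MF]])
  have "et k (\<alpha> k c1) = 0"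
    using et_K[OF \<alpha>c] chain_map_comm[OF \<alpha> c1] dc1 linear_0[OF \<alpha>K module_0[OF MC]] by simp
  then have dz1: "dT k z1 = 0"
    unfolding dT_def z1_def case_sum_comp case_sum_eq_0
    using linear_0[OF \<phi>L module_0[OF MF]] linear_0[OF etL module_0[OF MF]] by simp
  have \<psi>z1: "\<psi> k z1 = \<beta> k (\<alpha> k c1)"
    unfolding \<psi>_def z1_def case_sum_comp using bt_K[OF \<alpha>c] linear_0[OF gtL' module_0[OF MF]] by simp
  have "d (k + 1) (\<eta> k c1) + \<psi> k (z1 - z0) = c"
    using linear_diff[OF \<psi>L T_module z1 z0] \<psi>z1 d\<eta>[OF c1] dc1 linear_0[OF \<eta> module_0[OF MC], of "k - 1"]
    by (simp add: c1_def)
  moreover have "- dT k (z1 - z0) = z"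
    using linear_diff[OF dT_linear T_module z1 z0] dz1 dz0 by simp
  ultimately show ?thesis
    using linear_in[OF \<eta> c1] module_diff[OF T_module z1 z0] by blast
qed

text \<open>Evaluating \<open>dT\<close> on the two kinds of unit vectors exhibits its block matrix,
  which then acts on columns of series exactly as on polynomials.\<close>

lemma mat_dT:
  assumes z: "z \<in> cols N (J k <+> J (k - 1))"
  shows "mat series_lmult (J k <+> J (k - 1)) (dT k) z
    = case_sum (mat series_lmult (J k) (et k) (z \<circ> Inl) + mat series_lmult (J (k - 1)) (\<phi> (k - 1)) (z \<circ> Inr))
        (- mat series_lmult (J (k - 1)) (et (k - 1)) (z \<circ> Inr))"
proof
  fix i :: "nat + nat"
  have uI: "unit_vec (Inl j) \<circ> Inl = (unit_vec j :: nat \<Rightarrow> 'r laurent)" "unit_vec (Inl j) \<circ> Inr = (0 :: nat \<Rightarrow> 'r laurent)"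
    "unit_vec (Inr j) \<circ> Inr = (unit_vec j :: nat \<Rightarrow> 'r laurent)" "unit_vec (Inr j) \<circ> Inl = (0 :: nat \<Rightarrow> 'r laurent)" for j :: nat
    by (auto simp: unit_vec_def fun_eq_iff)
  have 0: "et l 0 = 0" "\<phi> l 0 = 0" for l
    using linear_0[OF etL module_0[OF MF]] linear_0[OF \<phi>L module_0[OF MF]] by auto
  have dI: "dT k (unit_vec (Inl j)) = case_sum (et k (unit_vec j)) 0"
    "dT k (unit_vec (Inr j)) = case_sum (\<phi> (k - 1) (unit_vec j)) (- et (k - 1) (unit_vec j))" for j
    unfolding dT_def uI 0 by simp_all
  have zN: "z i \<in> N" for i
    by (rule cols_in[OF z])
  have l0: "series_lmult 0 f = 0" for f :: "'r series"
    by (simp add: series_lmult_def fun_eq_iff)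
  have ln: "series_lmult (- p) f = - series_lmult p f" for p :: "'r laurent" and f
    using series_lmult_add_left[of p "- p" f] l0[of f] by (simp add: eq_neg_iff_add_eq_0 add.commute)
  have "mat series_lmult (J k <+> J (k - 1)) (dT k) z i
      = (\<Sum>j\<in>J k. series_lmult (case_sum (et k (unit_vec j)) 0 i) (z (Inl j)))
       + (\<Sum>j\<in>J (k - 1). series_lmult (case_sum (\<phi> (k - 1) (unit_vec j)) (- et (k - 1) (unit_vec j)) i) (z (Inr j)))"
    unfolding mat_def by (subst sum.Plus[OF fin fin]) (simp only: comp_def dI)
  also have "\<dots> = case_sum (mat series_lmult (J k) (et k) (z \<circ> Inl) + mat series_lmult (J (k - 1)) (\<phi> (k - 1)) (z \<circ> Inr))
        (- mat series_lmult (J (k - 1)) (et (k - 1)) (z \<circ> Inr)) i"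
  proof (cases i)
    case (Inl l)
    show ?thesis
      unfolding Inl sum.case mat_def comp_def plus_fun_apply[where x = l] by (rule refl)
  next
    case (Inr l)
    have "(\<Sum>j\<in>J k. series_lmult ((0 :: nat \<Rightarrow> 'r laurent) l) (z (Inl j))) = 0"
      by (rule sum.neutral, rule ballI, subst zero_fun_apply, rule l0)
    moreover have "(\<Sum>j\<in>J (k - 1). series_lmult ((- et (k - 1) (unit_vec j)) l) (z (Inr j)))
        = - (\<Sum>j\<in>J (k - 1). series_lmult (et (k - 1) (unit_vec j) l) (z (Inr j)))"
      unfolding sum_negf[symmetric] by (rule sum.cong[OF refl]) (subst uminus_apply, rule ln)
    ultimately show ?thesis
      unfolding Inr sum.case uminus_apply[where x = l] mat_def comp_def by simp
  qed
  finally show "mat series_lmult (J k <+> J (k - 1)) (dT k) z i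
     = case_sum (mat series_lmult (J k) (et k) (z \<circ> Inl) + mat series_lmult (J (k - 1)) (\<phi> (k - 1)) (z \<circ> Inr))
        (- mat series_lmult (J (k - 1)) (et (k - 1)) (z \<circ> Inr)) i" .
qed

text \<open>Over the series \<open>\<phi>\<close> is both injective and surjective on homology, so
  its cone is exact by the usual chase: \<open>b1\<close> clears the second component,
  \<open>a2\<close> and \<open>b2\<close> clear the first.\<close>

lemma T_tensor_acyclic: "tensor_acyclic L T dT free_act N series_lmult"
proof -
  note NL = N_left_module
  let ?m = "\<lambda>k. mat series_lmult (J k)"
  have exact: "\<exists>w\<in>cols N (J (k + 1) <+> J (k + 1 - 1)). mat series_lmult (J (k + 1) <+> J (k + 1 - 1)) (dT (k + 1)) w = z"
    if z: "z \<in> cols N (J k <+> J (k - 1))" and dz: "mat series_lmult (J k <+> J (k - 1)) (dT k) z = 0" for k z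
  proof -
    let ?a = "z \<circ> Inl" and ?b = "z \<circ> Inr"
    have zs: "case_sum ?a ?b = z"
      by (intro ext) (simp split: sum.split)
    have a: "?a \<in> cols N (J k)" and b: "?b \<in> cols N (J (k - 1))"
      using z unfolding cols_def by auto
    have ea: "?m k (et k) ?a + ?m (k - 1) (\<phi> (k - 1)) ?b = 0"
      and eb: "?m (k - 1) (et (k - 1)) ?b = 0"
    proof -
      have "?m k (et k) ?a + ?m (k - 1) (\<phi> (k - 1)) ?b = 0 \<and> - ?m (k - 1) (et (k - 1)) ?b = 0"
        using dz unfolding mat_dT[OF z] case_sum_eq_0 .
      then show "?m k (et k) ?a + ?m (k - 1) (\<phi> (k - 1)) ?b = 0" "?m (k - 1) (et (k - 1)) ?b = 0"
        by (blast, metis neg_equal_0_iff_equal)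
    qed
    have "?m (k - 1) (\<phi> (k - 1)) ?b = - ?m k (et k) ?a"
      by (rule minus_unique[OF ea, symmetric])
    also have "\<dots> = ?m k (et k) (- ?a)"
      by (rule mat_uminus[OF S NL etL a, symmetric])
    finally have "\<exists>w\<in>cols N (J (k - 1 + 1)). ?m (k - 1 + 1) (et (k - 1 + 1)) w = ?b"
      by (intro \<phi>_injective_N[OF b eb, of "- ?a"]) (simp_all only: diff_add_cancel cols_uminus[OF NL a])
    then obtain b1 where b1: "b1 \<in> cols N (J k)" "?m k (et k) b1 = ?b"
      unfolding diff_add_cancel by blast
    define a1 where "a1 = ?a + ?m k (\<phi> k) b1"
    have \<phi>b1: "?m k (\<phi> k) b1 \<in> cols N (J k)"
      by (rule mat_in[OF S NL \<phi>L b1(1)])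
    have a1: "a1 \<in> cols N (J k)"
      unfolding a1_def by (rule cols_add[OF NL a \<phi>b1])
    have "?m k (et k) (?m k (\<phi> k) b1) = ?m (k - 1) (\<phi> (k - 1)) (?m k (et k) b1)"
      unfolding mat_comp[OF S NL \<phi>L etL fin b1(1)] mat_comp[OF S NL etL \<phi>L fin b1(1)]
      by (rule mat_cong[OF S NL]) (rule et_\<phi>[OF unit_vec_in[OF S]])
    then have "?m k (et k) (?m k (\<phi> k) b1) = ?m (k - 1) (\<phi> (k - 1)) ?b"
      unfolding b1(2) .
    then have ea1: "?m k (et k) a1 = 0"
      unfolding a1_def mat_add[OF S NL etL a \<phi>b1] by (simp only: ea)
    obtain a2 b2 where ab2: "a2 \<in> cols N (J (k + 1))" "b2 \<in> cols N (J k)" "?m k (et k) b2 = 0"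
      "a1 = ?m (k + 1) (et (k + 1)) a2 + ?m k (\<phi> k) b2"
      using \<phi>_surjective_N[OF a1 ea1] by blast
    have b21: "b2 - b1 \<in> cols N (J k)"
      by (rule cols_diff[OF NL ab2(2) b1(1)])
    define w where "w = case_sum a2 (b2 - b1)"
    have wc: "w \<circ> Inl = a2" "w \<circ> Inr = b2 - b1"
      unfolding w_def by (rule case_sum_comp)+
    have w: "w \<in> cols N (J (k + 1) <+> J (k + 1 - 1))"
      using ab2(1) b21 unfolding w_def cols_def by (auto split: sum.split)
    have 1: "?m (k + 1) (et (k + 1)) a2 + ?m k (\<phi> k) (b2 - b1) = ?a"
    proof -
      have "?m (k + 1) (et (k + 1)) a2 + (?m k (\<phi> k) b2 - ?m k (\<phi> k) b1) = a1 - ?m k (\<phi> k) b1"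
        unfolding ab2(4) by (rule add_diff_eq)
      then show ?thesis
        unfolding mat_diff[OF S NL \<phi>L ab2(2) b1(1)] a1_def add_diff_cancel_right' .
    qed
    have 2: "- ?m k (et k) (b2 - b1) = ?b"
      unfolding mat_diff[OF S NL etL ab2(2) b1(1)] ab2(3) b1(2) by (simp only: diff_0 minus_minus)
    have "mat series_lmult (J (k + 1) <+> J (k + 1 - 1)) (dT (k + 1)) w = z"
      unfolding mat_dT[OF w] unfolding wc add_diff_cancel_right' 1 2 by (rule zs)
    then show ?thesis
      using w by blast
  qed
  have "tensor_acyclic L (\<lambda>k. free_mod L (J k <+> J (k - 1))) dT free_act N series_lmult"
    by (rule tensor_acyclic_of_exact[OF S NL fin_T T_complex[unfolded T_def[abs_def]] exact])
  then show ?thesis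
    unfolding T_def[abs_def] .
qed

lemma homotopy_equiv_T:
  assumes "\<And>k. \<exists>(B::'i set) b c. dual_basis L (C k) act B b c"
    and "\<And>k. k < lo \<Longrightarrow> C k = {0}" "\<And>k. k < lo \<Longrightarrow> J k = {}"
  shows "homotopy_equiv L C d act T dT free_act"
proof (rule homotopy_equiv_of_exact_cone[OF S C T_complex assms(2) _ assms(1) _ \<psi>_chain_map cone_exact])
  show "T k = {0}" if "k < lo" for k
  proof -
    have "J k = {}" "J (k - 1) = {}"
      using assms(3)[of k] assms(3)[of "k - 1"] that by auto
    then have "J k <+> J (k - 1) = {}"
      by auto
    then show ?thesis
      unfolding T_def by (simp only: free_mod_empty[OF subring_0[OF S]])
  qed
  show "\<exists>(B::(nat + nat) set) b c. dual_basis L (T k) free_act B b c" for k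
    unfolding T_def using dual_basis_free[OF S] by blast
qed

text \<open>The unit vectors of \<open>T\<close> are an honest basis, so \<open>coordinatize\<close>
  gives an isomorphism with a standard free complex and not merely a retract. Free modules being
  projective, the same complex witnesses both conclusions.\<close>

lemma homotopy_finite_C:
  assumes CT: "homotopy_equiv L C d act T dT free_act" and bd: "\<And>k. k \<notin> {lo..hi} \<Longrightarrow> J k = {}"
  shows "homotopy_finite L C d act" and "fin_dominated L C d act"
proof -
  let ?I = "{lo..hi + 1}"
  have bdB: "J k <+> J (k - 1) = {}" if "k \<notin> ?I" for k
    using bd[of k] bd[of "k - 1"] that by auto
  have db: "dual_basis L (T k) free_act (J k <+> J (k - 1)) unit_vec (\<lambda>j x. x j)" for k
    unfolding T_def by (rule dual_basis_free[OF S])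
  have "homotopy_finite L C d act \<and> fin_dominated L C d act"
  proof (rule coordinatize[OF T_complex S fin_T bdB db])
    fix J' :: "int \<Rightarrow> nat set" and e' i' p'
    assume J': "\<And>k. finite (J' k)" "\<And>k l. k \<noteq> l \<Longrightarrow> J' k \<inter> J' l = {}"
      "\<And>k. k \<notin> ?I \<Longrightarrow> J' k = {}"
      "chain_complex L (\<lambda>k. free_mod L (J' k)) e' free_act"
      "chain_map L T dT free_act (\<lambda>k. free_mod L (J' k)) e' free_act i'"
      "chain_map L (\<lambda>k. free_mod L (J' k)) e' free_act T dT free_act p'"
      "\<And>k x. x \<in> T k \<Longrightarrow> p' k (i' k x) = x"
      "(\<And>k u v. u \<in> J k <+> J (k - 1) \<Longrightarrow> v \<in> J k <+> J (k - 1)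
          \<Longrightarrow> unit_vec v u = (if u = v then 1 else (0 :: 'r laurent)))
        \<Longrightarrow> (\<And>k y. y \<in> free_mod L (J' k) \<Longrightarrow> i' k (p' k y) = y)"
    have ip: "i' k (p' k y) = y" if "y \<in> free_mod L (J' k)" for k y
      by (rule J'(8)[OF _ that]) (simp add: unit_vec_def)
    have "homotopy_equiv L T dT free_act (\<lambda>k. free_mod L (J' k)) e' free_act"
      unfolding homotopy_equiv_def
    proof (intro exI conjI)
      show "chain_homotopic L T dT free_act T dT free_act (\<lambda>k x. p' k (i' k x)) (\<lambda>k x. x)"
        by (rule chain_homotopic_cong[OF chain_homotopic_refl[OF T_complex]]) (use J'(7) in auto)
      show "chain_homotopic L (\<lambda>k. free_mod L (J' k)) e' free_act (\<lambda>k. free_mod L (J' k)) e' free_act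
          (\<lambda>k x. i' k (p' k x)) (\<lambda>k x. x)"
        by (rule chain_homotopic_cong[OF chain_homotopic_refl[OF J'(4)]]) (use ip in auto)
    qed (rule J')+
    then have "homotopy_equiv L C d act (\<lambda>k. free_mod L (J' k)) e' free_act"
      by (rule homotopy_equiv_trans[OF CT _ C T_complex J'(4)])
    moreover have "bounded_complex (\<lambda>k. free_mod L (J' k) :: (nat \<Rightarrow> 'r laurent) set)"
      unfolding bounded_complex_def
    proof (intro exI allI impI)
      fix k assume "\<bar>lo\<bar> + \<bar>hi\<bar> + 1 < \<bar>k\<bar>"
      then have "J' k = {}"
        by (intro J'(3)) auto
      then show "free_mod L (J' k) = {0 :: nat \<Rightarrow> 'r laurent}"
        by (simp only: free_mod_empty[OF subring_0[OF S]])
    qed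
    moreover have "fg_free L (free_mod L (J' k) :: (nat \<Rightarrow> 'r laurent) set) free_act" for k
      by (rule fg_free_free_mod[OF S J'(1)])
    moreover have "fin_generated L (free_mod L (J' k) :: (nat \<Rightarrow> 'r laurent) set) free_act"
      "projective_module L (free_mod L (J' k) :: (nat \<Rightarrow> 'r laurent) set) free_act" for k
      by (rule retract_of_free[OF S J'(1) free_mod_module[OF S] order_refl linear_id], rule refl)+
    ultimately show ?thesis
      unfolding homotopy_finite_def fin_dominated_def using J'(4) free_mod_module[OF S] by blast
  qed
  then show "homotopy_finite L C d act" "fin_dominated L C d act" by blast+
qed

end

section \<open>The ascent by one variable\<close>

theorem finite_and_acyclic_of_fin_dominated:
  fixes C :: "int \<Rightarrow> ('m::ab_group_add) set" and act :: "'m \<Rightarrow> ('r::ring_1) laurent \<Rightarrow> 'm"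
  assumes v: "v \<notin> V" and C: "chain_complex (laurent_ring (insert v V)) C d act"
    and db: "\<And>k. \<exists>(B::'i set) b c. dual_basis (laurent_ring (insert v V)) (C k) act B b c"
    and bb: "bounded_below C" and fd: "fin_dominated (laurent_ring V) C d act"
  shows "homotopy_finite (laurent_ring (insert v V)) C d act"
    and "fin_dominated (laurent_ring (insert v V)) C d act"
    and "tensor_acyclic (laurent_ring (insert v V)) C d act (novikov_pos V v) series_lmult"
    and "tensor_acyclic (laurent_ring (insert v V)) C d act (novikov_neg V v) series_lmult"
proof -
  let ?K = "laurent_ring V :: 'r laurent set" and ?L = "laurent_ring (insert v V) :: 'r laurent set"
  have SL: "subring ?L" and SK: "subring ?K" by (rule laurent_ring_subring)+
  have KL: "?K \<subseteq> ?L" by (rule laurent_ring_mono) auto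
  have CK: "chain_complex ?K C d act"
    by (rule chain_complex_mono[OF C KL])
  note MC = complex_module[OF CK]
  obtain D :: "int \<Rightarrow> (nat \<Rightarrow> 'r laurent) set" and d' act' and J :: "int \<Rightarrow> nat set" and lo hi e i p
    where D: "chain_complex ?K D d' act'" and CD: "homotopy_equiv ?K C d act D d' act'"
      and fin': "\<forall>k. finite (J k)" and bd': "\<forall>k. k \<notin> {lo..hi} \<longrightarrow> J k = {}" and "lo \<le> hi"
      and F: "chain_complex ?K (\<lambda>k. free_mod ?K (J k)) e free_act"
      and i: "chain_map ?K D d' act' (\<lambda>k. free_mod ?K (J k)) e free_act i"
      and p: "chain_map ?K (\<lambda>k. free_mod ?K (J k)) e free_act D d' act' p"
      and pi: "\<forall>k. \<forall>x\<in>D k. p k (i k x) = x"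
    by (rule fin_dominated_coordinates[OF SK fd])
  obtain f g where f: "chain_map ?K C d act D d' act' f" and g: "chain_map ?K D d' act' C d act g"
    and gf: "chain_homotopic ?K C d act C d act (\<lambda>k x. g k (f k x)) (\<lambda>k x. x)"
    and fg: "chain_homotopic ?K D d' act' D d' act' (\<lambda>k x. f k (g k x)) (\<lambda>k x. x)"
    using CD unfolding homotopy_equiv_def by blast
  obtain h where h: "\<And>k. linear_map ?K (C k) act (C (k + 1)) act (h k)"
    "\<And>k x. x \<in> C k \<Longrightarrow> g k (f k x) - x = d (k + 1) (h k x) + h (k - 1) (d k x)"
    using gf unfolding chain_homotopic_def by blast
  obtain h' where h': "\<And>k. linear_map ?K (D k) act' (D (k + 1)) act' (h' k)"
    "\<And>k x. x \<in> D k \<Longrightarrow> f k (g k x) - x = d' (k + 1) (h' k x) + h' (k - 1) (d' k x)"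
    using fg unfolding chain_homotopic_def by blast
  \<comment> \<open>The idempotent of the free complex with image \<open>D\<close>, and the
    equivalence between \<open>C\<close> and \<open>D\<close> rewritten in terms of that free
    complex.\<close>
  let ?q = "\<lambda>k x. i k (p k x)" and ?\<alpha> = "\<lambda>k x. i k (f k x)" and ?\<beta> = "\<lambda>k x. g k (p k x)"
  have torus: "mapping_torus_axioms V v C d act J e ?q ?\<alpha> ?\<beta> (\<lambda>k x. - h k x)"
  proof (unfold mapping_torus_axioms_def, intro conjI allI impI)
    show "chain_complex ?L C d act" by (rule C)
    show "finite (J k)" for k using fin' by blast
    show "chain_complex ?K (\<lambda>k. free_mod ?K (J k)) e free_act" by (rule F)
    show "chain_map ?K (\<lambda>k. free_mod ?K (J k)) e free_act (\<lambda>k. free_mod ?K (J k)) e free_act ?q"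
      by (rule chain_map_comp[OF p i])
    show "?q k (?q k x) = ?q k x" if "x \<in> free_mod ?K (J k)" for k x
      using pi chain_map_in[OF p that] by simp
    show "chain_map ?K C d act (\<lambda>k. free_mod ?K (J k)) e free_act ?\<alpha>"
      by (rule chain_map_comp[OF f i])
    show "chain_map ?K (\<lambda>k. free_mod ?K (J k)) e free_act C d act ?\<beta>"
      by (rule chain_map_comp[OF p g])
    show "?q k (?\<alpha> k c) = ?\<alpha> k c" if "c \<in> C k" for k c
      using pi chain_map_in[OF f that] by simp
    show "?\<beta> k (?q k x) = ?\<beta> k x" if "x \<in> free_mod ?K (J k)" for k x
      using pi chain_map_in[OF p that] by simp
    show "linear_map ?K (C k) act (C (k + 1)) act (\<lambda>x. - h k x)" for k
      by (rule linear_neg[OF h(1) MC])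
    show "d (k + 1) (- h k c) + - h (k - 1) (d k c) = c - ?\<beta> k (?\<alpha> k c)" if c: "c \<in> C k" for k c
    proof -
      have "d (k + 1) (- h k c) = - d (k + 1) (h k c)"
        by (rule linear_uminus[OF complex_linear[OF CK] MC linear_in[OF h(1) c]])
      moreover have "p k (i k (f k c)) = f k c"
        using pi chain_map_in[OF f c] by blast
      ultimately show ?thesis
        using h(2)[OF c] by (simp add: algebra_simps)
    qed
    show "\<exists>w\<in>free_mod ?K (J (k + 1)). ?\<alpha> k (?\<beta> k x) - ?q k x = e (k + 1) w"
      if x: "x \<in> free_mod ?K (J k)" and ex: "e k x = 0" for k x
    proof -
      note MD = complex_module[OF D]
      have px: "p k x \<in> D k" by (rule chain_map_in[OF p x])
      have hp: "h' k (p k x) \<in> D (k + 1)" by (rule linear_in[OF h'(1) px])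
      \<comment> \<open>On cycles the term \<open>h' d'\<close> drops out, so \<open>f g\<close>
        differs from the identity by a boundary of \<open>D\<close>, which \<open>i\<close> carries
        to the free complex.\<close>
      have "d' k (p k x) = 0"
        using chain_map_comm[OF p x] ex linear_0[OF chain_map_linear[OF p] module_0[OF free_mod_module[OF SK]]] by simp
      then have "f k (g k (p k x)) - p k x = d' (k + 1) (h' k (p k x))"
        using h'(2)[OF px] linear_0[OF h'(1) module_0[OF MD], of "k - 1"] by simp
      moreover have "i k (f k (g k (p k x)) - p k x) = ?\<alpha> k (?\<beta> k x) - ?q k x"
        by (rule linear_diff[OF chain_map_linear[OF i] MD chain_map_in[OF f chain_map_in[OF g px]] px])
      moreover have "e (k + 1) (i (k + 1) (h' k (p k x))) = i k (d' (k + 1) (h' k (p k x)))"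
        using chain_map_comm[OF i hp] by simp
      ultimately show ?thesis
        using chain_map_in[OF i hp] by metis
    qed
  qed
  have bd: "J k = {}" if "k \<notin> {lo..hi}" for k
    using bd' that by blast
  obtain n where n: "\<And>k. k < n \<Longrightarrow> C k = {0}"
    using bb unfolding bounded_below_def by blast
  have low: "C k = {0}" "J k = {}" if "k < min n lo" for k
    using n[of k] bd[of k] that by auto
  \<comment> \<open>The data in \<open>torus\<close> do not mention the sign, so they feed two tori:
    one for \<open>x\<close> and, with sign -1, one for its inverse.\<close>
  interpret P: one_variable V v 1 using v by unfold_locales auto
  interpret Q: one_variable V v "-1" using v by unfold_locales auto
  interpret TP: mapping_torus V v 1 C d act J e ?q ?\<alpha> ?\<beta> "\<lambda>k x. - h k x"
    by (rule mapping_torus.intro[OF P.one_variable_axioms torus])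
  interpret TQ: mapping_torus V v "-1" C d act J e ?q ?\<alpha> ?\<beta> "\<lambda>k x. - h k x"
    by (rule mapping_torus.intro[OF Q.one_variable_axioms torus])
  note equivP = TP.homotopy_equiv_T[OF db low] and equivQ = TQ.homotopy_equiv_T[OF db low]
  show "homotopy_finite ?L C d act"
    by (rule TP.homotopy_finite_C(1)[OF equivP bd])
  show "fin_dominated ?L C d act"
    by (rule TP.homotopy_finite_C(2)[OF equivP bd])
  show "tensor_acyclic ?L C d act (novikov_pos V v) series_lmult"
    using tensor_acyclic_dominated[OF C TP.T_complex homotopy_equiv_dominated[OF equivP] TP.T_tensor_acyclic]
    unfolding N_pos[OF v] .
  show "tensor_acyclic ?L C d act (novikov_neg V v) series_lmult"
    using tensor_acyclic_dominated[OF C TQ.T_complex homotopy_equiv_dominated[OF equivQ] TQ.T_tensor_acyclic]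
    unfolding N_neg[OF v] .
qed

section \<open>Climbing and descending through the variables\<close>

theorem theorem1p3:
  fixes n :: nat
    and C :: "int \<Rightarrow> ('m::ab_group_add) set"
    and d :: "int \<Rightarrow> 'm \<Rightarrow> 'm"
    and act :: "'m \<Rightarrow> ('r::ring_1) laurent \<Rightarrow> 'm"
  assumes "n \<ge> 1"
    and "chain_complex (laurent_ring {1..n}) C d act"
    and "\<forall>k. projective_module (laurent_ring {1..n}) (C k) act"
    and "bounded_below C"
  shows "(fin_dominated (laurent_ring {}) C d act \<longleftrightarrow>
            fin_dominated (laurent_ring {}) C d act
          \<and> (\<forall>\<sigma>. bij_betw \<sigma> {1..n} {1..n} \<longrightarrow>
               (\<forall>j\<in>{1..n}. homotopy_finite (laurent_ring (\<sigma> ` {1..j})) C d act)))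
       \<and> (fin_dominated (laurent_ring {}) C d act \<longleftrightarrow>
            fin_dominated (laurent_ring {1..n}) C d act
          \<and> (\<forall>\<sigma>. bij_betw \<sigma> {1..n} {1..n} \<longrightarrow>
               (\<forall>j\<in>{1..n}.
                  tensor_acyclic (laurent_ring (\<sigma> ` {1..j})) C d act
                     (novikov_pos (\<sigma> ` {1..j - 1}) (\<sigma> j)) series_lmult
                \<and> tensor_acyclic (laurent_ring (\<sigma> ` {1..j})) C d act
                     (novikov_neg (\<sigma> ` {1..j - 1}) (\<sigma> j)) series_lmult)))
       \<and> (fin_dominated (laurent_ring {}) C d act \<longleftrightarrow>
            fin_dominated (laurent_ring {1..n}) C d act
          \<and> (\<exists>\<sigma>. bij_betw \<sigma> {1..n} {1..n} \<and>
               (\<forall>j\<in>{1..n}.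
                  tensor_acyclic (laurent_ring (\<sigma> ` {1..j})) C d act
                     (novikov_pos (\<sigma> ` {1..j - 1}) (\<sigma> j)) series_lmult
                \<and> tensor_acyclic (laurent_ring (\<sigma> ` {1..j})) C d act
                     (novikov_neg (\<sigma> ` {1..j - 1}) (\<sigma> j)) series_lmult)))"
proof -
  let ?L = "\<lambda>V. laurent_ring V :: 'r laurent set"
  let ?S = "\<lambda>\<sigma> j. \<sigma> ` {1..j :: nat} :: nat set"
  let ?acyclic = "\<lambda>\<sigma> j. tensor_acyclic (?L (?S \<sigma> j)) C d act (novikov_pos (?S \<sigma> (j - 1)) (\<sigma> j)) series_lmult
      \<and> tensor_acyclic (?L (?S \<sigma> j)) C d act (novikov_neg (?S \<sigma> (j - 1)) (\<sigma> j)) series_lmult"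
  note CL = assms(2)
  have sub: "?S \<sigma> j \<subseteq> {1..n}" if "bij_betw \<sigma> {1..n} {1..n}" "j \<le> n" for \<sigma> j
  proof -
    have "?S \<sigma> j \<subseteq> \<sigma> ` {1..n}"
      using that(2) by (intro image_mono) auto
    then show ?thesis
      using bij_betw_imp_surj_on[OF that(1)] by simp
  qed
  have new: "\<sigma> j \<notin> ?S \<sigma> (j - 1)" and insert: "?S \<sigma> j = insert (\<sigma> j) (?S \<sigma> (j - 1))"
    if "bij_betw \<sigma> {1..n} {1..n}" "j \<in> {1..n}" for \<sigma> j
  proof -
    show "\<sigma> j \<notin> ?S \<sigma> (j - 1)"
    proof
      assume "\<sigma> j \<in> ?S \<sigma> (j - 1)"
      then obtain i where i: "i \<in> {1..j - 1}" "\<sigma> j = \<sigma> i"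
        by auto
      then have "i \<in> {1..n}" "i \<noteq> j"
        using that(2) by auto
      then show False
        using inj_onD[OF bij_betw_imp_inj_on[OF that(1)] i(2) that(2)] by simp
    qed
    have "{1..j} = insert j {1..j - 1}"
      using that(2) by auto
    then show "?S \<sigma> j = insert (\<sigma> j) (?S \<sigma> (j - 1))"
      by simp
  qed
  have CW: "chain_complex (?L W) C d act" if "W \<subseteq> {1..n}" for W
    by (rule chain_complex_mono[OF CL laurent_ring_mono[OF that]])
  \<comment> \<open>\<open>C\<close> is assumed projective over the full ring, and the smaller rings
    inherit this because the full ring is free over them. Restricting from \<open>{1..n}\<close>
    directly to \<open>W\<close> keeps the index type the same at every step.\<close>
  have db: "\<exists>(B::('m \<times> expo) set) b c. dual_basis (?L W) (C k) act B b c" if W: "W \<subseteq> {1..n}" for W k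
  proof -
    obtain B :: "'m set" and b c where "dual_basis (?L {1..n}) (C k) act B b c"
      using dual_basis_projective[OF assms(3)[rule_format] laurent_ring_subring] by blast
    from dual_basis_restrict_laurent[OF this complex_module[OF CL] W] show ?thesis .
  qed
  \<comment> \<open>The only finiteness needed at \<open>j - 1\<close> is finite domination, which
    is also among the conclusions at \<open>j\<close>; hence the step can be iterated along any
    renumbering.\<close>
  have up: "homotopy_finite (?L (?S \<sigma> j)) C d act" "fin_dominated (?L (?S \<sigma> j)) C d act" "?acyclic \<sigma> j"
    if \<sigma>: "bij_betw \<sigma> {1..n} {1..n}" and j: "j \<in> {1..n}" and fd: "fin_dominated (?L (?S \<sigma> (j - 1))) C d act" for \<sigma> j
  proof -
    have W: "insert (\<sigma> j) (?S \<sigma> (j - 1)) \<subseteq> {1..n}"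
      using sub[OF \<sigma>, of j] j unfolding insert[OF \<sigma> j] by simp
    note * = finite_and_acyclic_of_fin_dominated[OF new[OF \<sigma> j] CW[OF W] db[OF W] assms(4) fd]
    show "homotopy_finite (?L (?S \<sigma> j)) C d act" "fin_dominated (?L (?S \<sigma> j)) C d act" "?acyclic \<sigma> j"
      unfolding insert[OF \<sigma> j] by (rule *(1), rule *(2), rule conjI[OF *(3) *(4)])
  qed
  have all: "fin_dominated (?L (?S \<sigma> j)) C d act"
    if \<sigma>: "bij_betw \<sigma> {1..n} {1..n}" and a: "fin_dominated (?L {}) C d act" and "j \<le> n" for \<sigma> j
    using \<open>j \<le> n\<close>
  proof (induction j)
    case 0
    then show ?case using a by simp
  next
    case (Suc j)
    then have "fin_dominated (?L (?S \<sigma> (Suc j - 1))) C d act" "Suc j \<in> {1..n}"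
      by simp_all
    then show ?case
      using up(2)[OF \<sigma>] by blast
  qed
  \<comment> \<open>The induction runs on the number \<open>i\<close> of variables already removed;
    acyclicity at \<open>j = n - i\<close> pays for the removal of
    \<open>\<sigma> j\<close>.\<close>
  have down: "fin_dominated (?L {}) C d act"
    if \<sigma>: "bij_betw \<sigma> {1..n} {1..n}" and fd: "fin_dominated (?L {1..n}) C d act"
      and acyclic: "\<forall>j\<in>{1..n}. ?acyclic \<sigma> j" for \<sigma>
  proof -
    have "fin_dominated (?L (?S \<sigma> (n - i))) C d act" if "i \<le> n" for i
      using that
    proof (induction i)
      case 0
      then show ?case using fd bij_betw_imp_surj_on[OF \<sigma>] by simp
    next
      case (Suc i)
      define j where "j = n - i"
      have j: "j \<in> {1..n}" and ji: "n - Suc i = j - 1"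
        using Suc.prems by (auto simp: j_def)
      have W: "insert (\<sigma> j) (?S \<sigma> (j - 1)) \<subseteq> {1..n}"
        using sub[OF \<sigma>, of j] j unfolding insert[OF \<sigma> j] by simp
      have "fin_dominated (?L (?S \<sigma> j)) C d act"
        using Suc by (simp add: j_def)
      moreover have "?acyclic \<sigma> j"
        using acyclic j by blast
      ultimately show ?case
        unfolding ji insert[OF \<sigma> j]
        by (intro fin_dominated_of_novikov_acyclic[OF new[OF \<sigma> j] CW[OF W]]) blast+
    qed
    from this[of n] show ?thesis by simp
  qed
  have ab: "homotopy_finite (?L (?S \<sigma> j)) C d act" and ac: "?acyclic \<sigma> j"
    if a: "fin_dominated (?L {}) C d act" and \<sigma>: "bij_betw \<sigma> {1..n} {1..n}" and j: "j \<in> {1..n}" for \<sigma> j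
  proof -
    have "j - 1 \<le> n"
      using j by auto
    note * = up[OF \<sigma> j all[OF \<sigma> a this]]
    show "homotopy_finite (?L (?S \<sigma> j)) C d act" "?acyclic \<sigma> j"
      by (rule *(1), rule *(3))
  qed
  \<comment> \<open>The identity renumbering leads from \<open>{}\<close> up to
    \<open>{1..n}\<close>, specialises (c), and is the witness for (d).\<close>
  have id: "bij_betw (\<lambda>i. i) {1..n} {1..n}"
    by (rule bij_betwI') auto
  have an: "fin_dominated (?L {1..n}) C d act" if "fin_dominated (?L {}) C d act"
    using all[OF id that order_refl] by simp
  show ?thesis
    by (intro conjI iffI) (use an ab ac down id in \<open>blast+\<close>)
qed

end
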